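(* Let $\{1,\dots,M\}=I\cup J$ with $I\cap J=\emptyset$, let $n_0,\dots,n_M$ be positive integers, and let $(z_\alpha,m_\alpha)_{\alpha=0}^M$ be a solution of the Whitham hierarchy associated with the system of string equations $$z_i^{n_i}=z_0^{n_0},\quad \frac{1}{n_i}\frac{m_i}{z_i^{n_i-1}}=\frac1{n_0}\frac{m_0}{z_0^{n_0-1}}\quad(i\in I),\qquad -\frac{n_0}{n_j}\frac{m_j}{z_j^{n_j-1}}=z_0^{n_0},\quad \frac1{n_0}z_j^{n_j}=\frac1{n_0}\frac{m_0}{z_0^{n_0-1}}\quad (j\in J),$$ in the sense specified in the context. Then the $\tau$-function of this solution is given by $$2\log\tau=\sum_{\alpha=0}^M\frac1{2\pi i}\oint_{\Gamma_\alpha}\Big(\sum_{n\ge1}z_\alpha^n t_{\alpha n}\Big)m_\alpha\,\mathrm{d}z_\alpha-\sum_{j\in J}\frac{1}{4\pi i\,n_j}\oint_{\Gamma_j}z_jm_j^2\,\mathrm{d}z_j+\sum_{i=1}^M t_{i0}v_{i1}$$ $$=\sum_{(\alpha,n)\ne(0,0),\ n\ge0}t_{\alpha n}v_{\alpha\, n+1}-\sum_{j\in J}\frac1{n_j}\sum_{n\ge1}n\,t_{jn}v_{j\,n+1}-\sum_{j\in J}\frac{t_{j0}^2}{2n_j}.$$ That is, the two right-hand sides coincide, and the function $F=\log\tau$ so defined satisfies $$\mathrm{d}F=\sum_{(\alpha,n)\ne(0,0)}v_{\alpha\,n+1}\,\mathrm{d}t_{\alpha n}.$$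
   Context: Indices and times. Greek indices run over $\{0,\dots,M\}$, Latin indices labelling punctures over $\{1,\dots,M\}$ (in $2\pi i$, $4\pi i$ the $i$ is the imaginary unit). Punctures: $q_0:=\infty$ and $q_1,\dots,q_M$ in the complex $p$-plane. Independent times: $t_{0n}$ ($n\ge1$) and $t_{in}$ ($n\ge0$), with $t_{00}:=-\sum_{i=1}^Mt_{i0}$ and $x:=t_{01}$. Only finitely many times are different from zero: there are arbitrary positive integers $N_\alpha$ such that $t_{\alpha n}=0$ for $n>N_\alpha$, and the independent variables $\boldsymbol{t}$ are the $t_{0n}$ ($1\le n\le N_0$) and $t_{in}$ ($0\le n\le N_i$). Expansions. $z_0=p+\sum_{n\ge1}d_{0n}p^{-n}$ at $p=\infty$; $z_i=\frac{d_i}{p-q_i}+\sum_{n\ge0}d_{in}(p-q_i)^n$ at $p=q_i$; $m_\alpha=\sum_{n\ge1}n\,t_{\alpha n}z_\alpha^{n-1}+t_{\alpha0}z_\alpha^{-1}+\sum_{n\ge2}v_{\alpha n}z_\alpha^{-n}$; here $q_i,d_i,d_{\alpha n},v_{\alpha n}$ are functions of $\boldsymbol{t}$. This defines $v_{\alpha n}$ for $n\ge2$. Projectors. $(\cdot)_{(0,+)}$ projects Laurent series at $\infty$ onto the span of $\{p^n\}_{n\ge0}$, and $(\cdot)_{(i,+)}$ projects Laurent series at $q_i$ onto the span of $\{(p-q_i)^{-n}\}_{n\ge1}$. Whitham hierarchy. Set $\Omega_{\mu n}:=(z_\mu^n)_{(\mu,+)}$ for $n\ge1$ and $\Omega_{i0}:=-\log_i(p-q_i)$,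 where $\log_i$ is a branch of the logarithm defined with a cut joining $\infty$ to $q_i$ (non-intersecting cuts). A solution of the Whitham hierarchy satisfies $\mathrm{d}z_\alpha\wedge \mathrm{d}m_\alpha=\mathrm{d}\big(\sum_{\mu,n}\Omega_{\mu n}\mathrm{d}t_{\mu n}\big)$ for all $\alpha$ ($\mathrm{d}$ with respect to $(p,\boldsymbol{t})$). Hence there are functions $S_\alpha$ with $\mathrm{d}S_\alpha=m_\alpha \mathrm{d}z_\alpha+\sum_{\mu,n}\Omega_{\mu n}\mathrm{d}t_{\mu n}$, with expansions $$S_\alpha=\sum_{n\ge1}z_\alpha^nt_{\alpha n}+t_{\alpha0}\log z_\alpha-v_\alpha(\boldsymbol{t})-\sum_{n\ge1}\frac{v_{\alpha\,n+1}}{n}\frac1{z_\alpha^n},\quad z_\alpha\to\infty,\qquad v_0\equiv0.$$ Solutions associated with the string equations. These are the solutions $(z_\alpha,m_\alpha)$ of the string equations in the claim which admit the expansions $z_0=p+\sum_{n\ge1}d_{0n}p^{-n}$ at $p=\infty$, $z_i=\frac{d_i}{p-q_i}+\sum_{n\ge0}d_{in}(p-q_i)^n$ at $p=q_i$, and $m_\alpha=\sum_{n\ge1}n\,t_{\alpha n}z_\alpha^{n-1}+t_{\alpha0}z_\alpha^{-1}+\sum_{n\ge2}v_{\alpha n}z_\alpha^{-n}$ as $z_\alpha\to\infty$, and for which $E_1:=z_0^{n_0}$ and $E_2:=m_0/z_0^{n_0-1}$ are rational functions of $p$ with finite poles at $q_1,\dots,q_M$ only (thus $z_i^{n_i}=E_1$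 for $i\in I$ and $z_j^{n_j}=E_2$ for $j\in J$). String equations are equalities of functions of $(p,\boldsymbol{t})$, after analytic continuation in $p$ where needed. For such solutions the additive constants in the functions $S_\alpha$ are fixed by $$S_\alpha=\sum_\beta R_\beta+\frac1{n_0}\sum_{j\in J}(E_1E_2)_{(j,+)}\ \ (\alpha\in\{0\}\cup I),\qquad S_\alpha=\sum_\beta R_\beta-\frac1{n_0}(E_1E_2)_{(0,+)}-\frac1{n_0}\sum_{i\in I}(E_1E_2)_{(i,+)}\ \ (\alpha\in J),$$ where $R_0:=\sum_{n\ge1}(z_0^n)_{(0,+)}t_{0n}$ and $R_i:=\sum_{n\ge1}(z_i^n)_{(i,+)}t_{in}-t_{i0}\log_i(p-q_i)$. The functions $v_{i1}$. $v_{i1}:=v_i-\sum_{j<i}\log_{ji}(-1)\,t_{j0}$, where $v_i$ is the coefficient in the expansion of $S_i$ and $\log_{ji}(-1):=\log_j(q_i-q_j)-\log_i(q_j-q_i)$. Contours. There are positively oriented closed curves $\Gamma_\mu$ in the $z_\mu$-planes such that $z_\mu(p)$ maps the right-exterior of a circle $\gamma_\mu:=z_\mu^{-1}(\Gamma_\mu)$ conformally onto the exterior of $\Gamma_\mu$: for $\mu=0$ this is the outside of $\gamma_0$ (containing $\infty$), for $\mu=i$ it is the disc bounded by $\gamma_i$ containing $q_i$; $\gamma_0$ encircles all the $\gamma_i$. For each $\alpha$, $S_\alpha$ and $m_\alpha$ are analytic in the exterior of $\Gamma_\alpha$, with the behaviour at $z_\alpha=\infty$ given by $S_\alpha=\sum_{n\ge1}z_\alpha^nt_{\alpha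 n}+t_{\alpha0}\log z_\alpha-v_\alpha-\sum_{n\ge1}\frac{v_{\alpha\,n+1}}{n}z_\alpha^{-n}$ and $m_\alpha=\sum_{n\ge1}n\,t_{\alpha n}z_\alpha^{n-1}+t_{\alpha0}z_\alpha^{-1}+\sum_{n\ge2}v_{\alpha n}z_\alpha^{-n}$. Thus $\frac1{2\pi i}\oint_{\Gamma_\alpha}z_\alpha^{k}\,\mathrm{d}z_\alpha=\delta_{k,-1}$. $\tau$-function. The (dispersionless) $\tau$-function of a solution is a function $\tau(\boldsymbol{t})$ whose logarithm (free energy) $F=\log\tau$ satisfies $\mathrm{d}F=\sum_{(\alpha,n)\neq(0,0)}v_{\alpha\,n+1}\mathrm{d}t_{\alpha n}$, i.e. $\partial F/\partial t_{\alpha n}=v_{\alpha\,n+1}$ for all independent times. *)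

theory Defs
  imports "HOL-Complex_Analysis.Complex_Analysis"
begin

section \<open>Times\<close>

text \<open>
  A point of the space of times is a function on pairs \<open>(\<alpha>, n)\<close> that vanishes off the
  finite set of independent times; this is \<open>\<complex>\<close> to a finite power, with its usual topology.
  The dependent time with index \<open>(0, 0)\<close> is only available through \<open>time\<close>.
\<close>

type_synonym times = "nat \<times> nat \<Rightarrow> complex"

definition time_indices :: "nat \<Rightarrow> (nat \<Rightarrow> nat) \<Rightarrow> (nat \<times> nat) set" where
  "time_indices M N = {(\<alpha>, n). \<alpha> \<le> M \<and> n \<le> N \<alpha>} - {(0, 0)}"

definition time_space :: "nat \<Rightarrow> (nat \<Rightarrow> nat) \<Rightarrow> times set" where
  "time_space M N = {t. \<forall>A. A \<notin> time_indices M N \<longrightarrow> t A = 0}"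

definition time :: "nat \<Rightarrow> times \<Rightarrow> nat \<Rightarrow> nat \<Rightarrow> complex" where
  "time M t \<alpha> n = (if (\<alpha>, n) = (0, 0) then - (\<Sum>i=1..M. t (i, 0)) else t (\<alpha>, n))"

definition tderiv :: "nat \<times> nat \<Rightarrow> (times \<Rightarrow> complex) \<Rightarrow> times \<Rightarrow> complex" where
  "tderiv A f t = deriv (\<lambda>s. f (t(A := s))) (t A)"

text \<open>
  Holomorphy in several variables, on relatively open sets: continuity together with
  complex differentiability in each variable separately (Osgood's lemma).
\<close>

definition holomorphic_in_times :: "(nat \<times> nat) set \<Rightarrow> times set \<Rightarrow> (times \<Rightarrow> complex) \<Rightarrow> bool" where
  "holomorphic_in_times Ind X f \<longleftrightarrow> continuous_on X f \<and>
     (\<forall>t\<in>X. \<forall>A\<in>Ind. (\<lambda>s. f (t(A := s))) field_differentiable at (t A))"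

definition jointly_holomorphic ::
    "(nat \<times> nat) set \<Rightarrow> (times \<times> complex) set \<Rightarrow> (times \<Rightarrow> complex \<Rightarrow> complex) \<Rightarrow> bool" where
  "jointly_holomorphic Ind X f \<longleftrightarrow> continuous_on X (\<lambda>(t, p). f t p) \<and>
     (\<forall>(t, p)\<in>X. f t field_differentiable at p \<and>
        (\<forall>A\<in>Ind. (\<lambda>s. f (t(A := s)) p) field_differentiable at (t A)))"

section \<open>Projectors and the Whitham hierarchy\<close>

text \<open>
  \<open>fls_prpart\<close> collects the coefficients of the negative powers. At infinity the
  Laurent series is taken in the local coordinate \<open>1/p\<close>, and the constant term belongs to
  the projection.
\<close>

definition principal_part :: "complex \<Rightarrow> (complex \<Rightarrow> complex) \<Rightarrow> complex \<Rightarrow> complex" where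
  "principal_part a f p = poly (fls_prpart (laurent_expansion f a)) (1 / (p - a))"

definition polynomial_part :: "(complex \<Rightarrow> complex) \<Rightarrow> complex \<Rightarrow> complex" where
  "polynomial_part f p =
     (let L = laurent_expansion (\<lambda>w. f (1 / w)) 0 in poly (fls_prpart L) p + fls_nth L 0)"

definition plus_part ::
    "(nat \<Rightarrow> times \<Rightarrow> complex) \<Rightarrow> nat \<Rightarrow> times \<Rightarrow> (complex \<Rightarrow> complex) \<Rightarrow> complex \<Rightarrow> complex" where
  "plus_part q \<mu> t f = (if \<mu> = 0 then polynomial_part f else principal_part (q \<mu> t) f)"

text \<open>
  Throughout, \<open>q i t\<close> is the \<open>i\<close>-th finite puncture, \<open>z \<alpha> t p\<close> and \<open>m \<alpha> t p\<close> are the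
  functions of the hierarchy, and \<open>lg i t (p - q i t)\<close> is the chosen branch of
  \<open>log (p - q i t)\<close>, off its cut \<open>K i t\<close> in the \<open>p\<close>-plane.
\<close>

definition Omega ::
    "(nat \<Rightarrow> times \<Rightarrow> complex) \<Rightarrow> (nat \<Rightarrow> times \<Rightarrow> complex \<Rightarrow> complex) \<Rightarrow>
     (nat \<Rightarrow> times \<Rightarrow> complex \<Rightarrow> complex) \<Rightarrow> nat \<times> nat \<Rightarrow> times \<Rightarrow> complex \<Rightarrow> complex" where
  "Omega q z lg A t p = (case A of (\<mu>, n) \<Rightarrow>
     if n = 0 then - lg \<mu> t (p - q \<mu> t) else plus_part q \<mu> t (\<lambda>x. z \<mu> t x ^ n) p)"

definition R_part ::
    "nat \<Rightarrow> (nat \<Rightarrow> nat) \<Rightarrow> (nat \<Rightarrow> times \<Rightarrow> complex) \<Rightarrow>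
     (nat \<Rightarrow> times \<Rightarrow> complex \<Rightarrow> complex) \<Rightarrow> (nat \<Rightarrow> times \<Rightarrow> complex \<Rightarrow> complex) \<Rightarrow>
     nat \<Rightarrow> times \<Rightarrow> complex \<Rightarrow> complex" where
  "R_part M N q z lg \<beta> t p =
     (\<Sum>n=1..N \<beta>. plus_part q \<beta> t (\<lambda>x. z \<beta> t x ^ n) p * time M t \<beta> n)
       - (if \<beta> = 0 then 0 else time M t \<beta> 0 * lg \<beta> t (p - q \<beta> t))"

definition puncture :: "(nat \<Rightarrow> times \<Rightarrow> complex) \<Rightarrow> nat \<Rightarrow> times \<Rightarrow> complex filter" where
  "puncture q \<alpha> t = (if \<alpha> = 0 then at_infinity else at (q \<alpha> t))"

text \<open>A simple arc from \<open>a\<close> to infinity.\<close>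

definition cut_to_infinity :: "complex \<Rightarrow> complex set \<Rightarrow> bool" where
  "cut_to_infinity a C \<longleftrightarrow> (\<exists>g :: real \<Rightarrow> complex. continuous_on {0..} g \<and> inj_on g {0..} \<and>
     g 0 = a \<and> filterlim g at_infinity at_top \<and> C = g ` {0..})"

text \<open>
  The term \<open>t\<^sub>\<alpha>\<^sub>0 log z\<^sub>\<alpha>\<close> of the expansion of \<open>S\<^sub>\<alpha>\<close>, for \<open>p\<close> close to the puncture.
  At \<open>q\<^sub>i\<close> the branch of \<open>log z\<^sub>i\<close> is the one with the cut of \<open>log\<^sub>i\<close>, determined by the
  branch \<open>ld i t\<close> of the logarithm of the leading coefficient \<open>d i t\<close>. At infinity
  \<open>t\<^sub>0\<^sub>0 = - (\<Sum>i. t\<^sub>i\<^sub>0)\<close>, and the term is read as \<open>- (\<Sum>i. t\<^sub>i\<^sub>0 log z\<^sub>0)\<close> with, in the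
  \<open>i\<close>-th summand, the branch with the cut of \<open>log\<^sub>i\<close> that is asymptotic to \<open>log\<^sub>i (p - q\<^sub>i)\<close>:
  \<open>S\<^sub>0\<close> jumps by a multiple of \<open>t\<^sub>i\<^sub>0\<close> across the \<open>i\<close>-th cut, so for \<open>M > 1\<close> no common
  branch exists. The arguments of \<open>Ln\<close> tend to 1 at the puncture.
\<close>

definition time_log_z ::
    "nat \<Rightarrow> (nat \<Rightarrow> times \<Rightarrow> complex) \<Rightarrow> (nat \<Rightarrow> times \<Rightarrow> complex \<Rightarrow> complex) \<Rightarrow>
     (nat \<Rightarrow> times \<Rightarrow> complex \<Rightarrow> complex) \<Rightarrow> (nat \<Rightarrow> times \<Rightarrow> complex) \<Rightarrow>
     (nat \<Rightarrow> times \<Rightarrow> complex) \<Rightarrow> nat \<Rightarrow> times \<Rightarrow> complex \<Rightarrow> complex" where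
  "time_log_z M q z lg d ld \<alpha> t p =
     (if \<alpha> = 0
      then - (\<Sum>i=1..M. time M t i 0 * (lg i t (p - q i t) + Ln (z 0 t p / (p - q i t))))
      else time M t \<alpha> 0 *
        (ld \<alpha> t - lg \<alpha> t (p - q \<alpha> t) + Ln (z \<alpha> t p * (p - q \<alpha> t) / d \<alpha> t)))"

definition gamma_set ::
    "(nat \<Rightarrow> times \<Rightarrow> complex \<Rightarrow> complex) \<Rightarrow> (nat \<Rightarrow> times \<Rightarrow> complex set) \<Rightarrow>
     (nat \<Rightarrow> times \<Rightarrow> real \<Rightarrow> complex) \<Rightarrow> nat \<Rightarrow> times \<Rightarrow> complex set" where
  "gamma_set z U \<Gamma> \<alpha> t = {p \<in> U \<alpha> t. z \<alpha> t p \<in> path_image (\<Gamma> \<alpha> t)}"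

text \<open>The right-exterior of \<open>\<gamma>\<^sub>\<alpha>\<close>, without the puncture itself.\<close>

definition right_exterior ::
    "(nat \<Rightarrow> times \<Rightarrow> complex) \<Rightarrow> (nat \<Rightarrow> times \<Rightarrow> complex \<Rightarrow> complex) \<Rightarrow>
     (nat \<Rightarrow> times \<Rightarrow> complex set) \<Rightarrow> (nat \<Rightarrow> times \<Rightarrow> real \<Rightarrow> complex) \<Rightarrow>
     nat \<Rightarrow> times \<Rightarrow> complex set" where
  "right_exterior q z U \<Gamma> \<alpha> t =
     (if \<alpha> = 0 then outside (gamma_set z U \<Gamma> 0 t)
      else inside (gamma_set z U \<Gamma> \<alpha> t) - {q \<alpha> t})"

text \<open>
  \<open>U \<alpha> t\<close> is a punctured neighbourhood of the closed right-exterior of \<open>\<gamma>\<^sub>\<alpha>\<close>, on which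
  \<open>z\<^sub>\<alpha>\<close> is a conformal coordinate. The values of \<open>v \<alpha> n\<close> matter for \<open>n \<ge> 2\<close> only, and
  \<open>vc \<alpha>\<close> is the constant \<open>v\<^sub>\<alpha>\<close> in the expansion of \<open>S\<^sub>\<alpha>\<close>.
\<close>

locale whitham_solution =
  fixes M :: nat
    and N :: "nat \<Rightarrow> nat"
    and T :: "times set"
    and q :: "nat \<Rightarrow> times \<Rightarrow> complex"
    and z m :: "nat \<Rightarrow> times \<Rightarrow> complex \<Rightarrow> complex"
    and d :: "nat \<Rightarrow> times \<Rightarrow> complex"
    and dc v :: "nat \<Rightarrow> nat \<Rightarrow> times \<Rightarrow> complex"
    and lg :: "nat \<Rightarrow> times \<Rightarrow> complex \<Rightarrow> complex"
    and K :: "nat \<Rightarrow> times \<Rightarrow> complex set"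
    and U :: "nat \<Rightarrow> times \<Rightarrow> complex set"
    and \<Gamma> :: "nat \<Rightarrow> times \<Rightarrow> real \<Rightarrow> complex"
    and ld vc :: "nat \<Rightarrow> times \<Rightarrow> complex"
    and S :: "nat \<Rightarrow> times \<Rightarrow> complex \<Rightarrow> complex"
  assumes N_pos: "\<And>\<alpha>. \<alpha> \<le> M \<Longrightarrow> 0 < N \<alpha>"
    and T_open: "openin (top_of_set (time_space M N)) T"
    and q_holo: "\<And>i. i \<in> {1..M} \<Longrightarrow> holomorphic_in_times (time_indices M N) T (q i)"
    \<comment> \<open>cuts and branches of the logarithm; they may move continuously with the times\<close>
    and cut: "\<And>i t. i \<in> {1..M} \<Longrightarrow> t \<in> T \<Longrightarrow> cut_to_infinity (q i t) (K i t)"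
    and cuts_disjoint: "\<And>i j t. i \<in> {1..M} \<Longrightarrow> j \<in> {1..M} \<Longrightarrow> i \<noteq> j \<Longrightarrow> t \<in> T \<Longrightarrow> K i t \<inter> K j t = {}"
    and cut_open: "\<And>i. i \<in> {1..M} \<Longrightarrow>
      openin (top_of_set (time_space M N \<times> UNIV)) {(t, p). t \<in> T \<and> p \<notin> K i t}"
    and lg_cont: "\<And>i. i \<in> {1..M} \<Longrightarrow>
      continuous_on {(t, p). t \<in> T \<and> p \<notin> K i t} (\<lambda>(t, p). lg i t (p - q i t))"
    and lg_exp: "\<And>i t p. i \<in> {1..M} \<Longrightarrow> t \<in> T \<Longrightarrow> p \<notin> K i t \<Longrightarrow> exp (lg i t (p - q i t)) = p - q i t"
    \<comment> \<open>domains and contours\<close>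
    and U_open: "\<And>\<alpha>. \<alpha> \<le> M \<Longrightarrow>
      openin (top_of_set (time_space M N \<times> UNIV)) {(t, p). t \<in> T \<and> p \<in> U \<alpha> t}"
    and z_holo: "\<And>\<alpha>. \<alpha> \<le> M \<Longrightarrow>
      jointly_holomorphic (time_indices M N) {(t, p). t \<in> T \<and> p \<in> U \<alpha> t} (z \<alpha>)"
    and m_holo: "\<And>\<alpha>. \<alpha> \<le> M \<Longrightarrow>
      jointly_holomorphic (time_indices M N) {(t, p). t \<in> T \<and> p \<in> U \<alpha> t} (m \<alpha>)"
    and z_inj: "\<And>\<alpha> t. \<alpha> \<le> M \<Longrightarrow> t \<in> T \<Longrightarrow> inj_on (z \<alpha> t) (U \<alpha> t)"
    and z_nonzero: "\<And>\<alpha> t p. \<alpha> \<le> M \<Longrightarrow> t \<in> T \<Longrightarrow> p \<in> U \<alpha> t \<Longrightarrow> z \<alpha> t p \<noteq> 0"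
    and Gamma_curve: "\<And>\<alpha> t. \<alpha> \<le> M \<Longrightarrow> t \<in> T \<Longrightarrow>
      simple_path (\<Gamma> \<alpha> t) \<and> valid_path (\<Gamma> \<alpha> t) \<and> pathfinish (\<Gamma> \<alpha> t) = pathstart (\<Gamma> \<alpha> t)"
    and Gamma_winding: "\<And>\<alpha> t. \<alpha> \<le> M \<Longrightarrow> t \<in> T \<Longrightarrow>
      0 \<in> inside (path_image (\<Gamma> \<alpha> t)) \<and> winding_number (\<Gamma> \<alpha> t) 0 = 1"
    and Gamma_image: "\<And>\<alpha> t. \<alpha> \<le> M \<Longrightarrow> t \<in> T \<Longrightarrow> path_image (\<Gamma> \<alpha> t) \<subseteq> z \<alpha> t ` U \<alpha> t"
    and exterior_subset: "\<And>\<alpha> t. \<alpha> \<le> M \<Longrightarrow> t \<in> T \<Longrightarrow> right_exterior q z U \<Gamma> \<alpha> t \<subseteq> U \<alpha> t"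
    and exterior_image: "\<And>\<alpha> t. \<alpha> \<le> M \<Longrightarrow> t \<in> T \<Longrightarrow>
      z \<alpha> t ` right_exterior q z U \<Gamma> \<alpha> t = outside (path_image (\<Gamma> \<alpha> t))"
    and q_inside: "\<And>i t. i \<in> {1..M} \<Longrightarrow> t \<in> T \<Longrightarrow> q i t \<in> inside (gamma_set z U \<Gamma> i t)"
    and gamma_nested: "\<And>i t. i \<in> {1..M} \<Longrightarrow> t \<in> T \<Longrightarrow>
      gamma_set z U \<Gamma> i t \<subseteq> inside (gamma_set z U \<Gamma> 0 t)"
    \<comment> \<open>expansions\<close>
    and z0_expansion: "\<And>t. t \<in> T \<Longrightarrow> eventually (\<lambda>p.
      (\<lambda>n. dc 0 (n + 1) t / p ^ (n + 1)) sums (z 0 t p - p)) at_infinity"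
    and zi_expansion: "\<And>i t. i \<in> {1..M} \<Longrightarrow> t \<in> T \<Longrightarrow> eventually (\<lambda>p.
      (\<lambda>n. dc i n t * (p - q i t) ^ n) sums (z i t p - d i t / (p - q i t))) (at (q i t))"
    and m_expansion: "\<And>\<alpha> t. \<alpha> \<le> M \<Longrightarrow> t \<in> T \<Longrightarrow> eventually (\<lambda>p.
      (\<lambda>n. v \<alpha> (n + 2) t / z \<alpha> t p ^ (n + 2)) sums
        (m \<alpha> t p - (\<Sum>n=1..N \<alpha>. of_nat n * time M t \<alpha> n * z \<alpha> t p ^ (n - 1))
           - time M t \<alpha> 0 / z \<alpha> t p)) (puncture q \<alpha> t)"
    \<comment> \<open>the components of \<open>dz\<^sub>\<alpha> \<and> dm\<^sub>\<alpha> = d (\<Sum>A. \<Omega>\<^sub>A dt\<^sub>A)\<close> along \<open>dp \<and> dt\<^sub>A\<close> and \<open>dt\<^sub>A \<and> dt\<^sub>B\<close>\<close>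
    and whitham_p: "\<And>\<alpha> t p A. \<alpha> \<le> M \<Longrightarrow> t \<in> T \<Longrightarrow> p \<in> U \<alpha> t - (\<Union>i\<in>{1..M}. K i t) \<Longrightarrow>
      A \<in> time_indices M N \<Longrightarrow>
      deriv (z \<alpha> t) p * tderiv A (\<lambda>s. m \<alpha> s p) t - tderiv A (\<lambda>s. z \<alpha> s p) t * deriv (m \<alpha> t) p
        = deriv (Omega q z lg A t) p"
    and whitham_t: "\<And>\<alpha> t p A B. \<alpha> \<le> M \<Longrightarrow> t \<in> T \<Longrightarrow> p \<in> U \<alpha> t - (\<Union>i\<in>{1..M}. K i t) \<Longrightarrow>
      A \<in> time_indices M N \<Longrightarrow> B \<in> time_indices M N \<Longrightarrow>
      tderiv A (\<lambda>s. z \<alpha> s p) t * tderiv B (\<lambda>s. m \<alpha> s p) t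
          - tderiv B (\<lambda>s. z \<alpha> s p) t * tderiv A (\<lambda>s. m \<alpha> s p) t
        = tderiv A (\<lambda>s. Omega q z lg B s p) t - tderiv B (\<lambda>s. Omega q z lg A s p) t"
    \<comment> \<open>the functions \<open>S\<^sub>\<alpha>\<close>: \<open>dS\<^sub>\<alpha> = m\<^sub>\<alpha> dz\<^sub>\<alpha> + (\<Sum>A. \<Omega>\<^sub>A dt\<^sub>A)\<close>, and their expansions\<close>
    and S_p: "\<And>\<alpha> t p. \<alpha> \<le> M \<Longrightarrow> t \<in> T \<Longrightarrow> p \<in> U \<alpha> t - (\<Union>i\<in>{1..M}. K i t) \<Longrightarrow>
      (S \<alpha> t has_field_derivative m \<alpha> t p * deriv (z \<alpha> t) p) (at p)"
    and S_t: "\<And>\<alpha> t p A. \<alpha> \<le> M \<Longrightarrow> t \<in> T \<Longrightarrow> p \<in> U \<alpha> t - (\<Union>i\<in>{1..M}. K i t) \<Longrightarrow>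
      A \<in> time_indices M N \<Longrightarrow>
      ((\<lambda>s. S \<alpha> (t(A := s)) p) has_field_derivative
        m \<alpha> t p * tderiv A (\<lambda>s. z \<alpha> s p) t + Omega q z lg A t p) (at (t A))"
    and ld_cont: "\<And>i. i \<in> {1..M} \<Longrightarrow> continuous_on T (ld i)"
    and ld_exp: "\<And>i t. i \<in> {1..M} \<Longrightarrow> t \<in> T \<Longrightarrow> exp (ld i t) = d i t"
    and S_expansion: "\<And>\<alpha> t. \<alpha> \<le> M \<Longrightarrow> t \<in> T \<Longrightarrow> eventually (\<lambda>p.
      p \<notin> (\<Union>i\<in>{1..M}. K i t) \<longrightarrow>
      (\<lambda>n. v \<alpha> (n + 2) t / of_nat (n + 1) / z \<alpha> t p ^ (n + 1)) sums
        ((\<Sum>n=1..N \<alpha>. z \<alpha> t p ^ n * time M t \<alpha> n) + time_log_z M q z lg d ld \<alpha> t p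
           - vc \<alpha> t - S \<alpha> t p)) (puncture q \<alpha> t)"
    and vc_0: "\<And>t. t \<in> T \<Longrightarrow> vc 0 t = 0"

section \<open>Solutions associated with the string equations\<close>

definition rational_with_poles_in :: "complex set \<Rightarrow> (complex \<Rightarrow> complex) \<Rightarrow> bool" where
  "rational_with_poles_in X f \<longleftrightarrow> (\<exists>P Q. Q \<noteq> 0 \<and> (\<forall>p. poly Q p = 0 \<longrightarrow> p \<in> X) \<and>
     (\<forall>p. p \<notin> X \<longrightarrow> f p = poly P p / poly Q p))"

text \<open>
  The rational functions \<open>E1 t\<close> and \<open>E2 t\<close> are the analytic continuations in \<open>p\<close> of
  \<open>z\<^sub>0 ^ n\<^sub>0\<close> and \<open>m\<^sub>0 / z\<^sub>0 ^ (n\<^sub>0 - 1)\<close>, by which the string equations, relating germs at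
  different punctures, are understood.
\<close>

locale string_solution =
  whitham_solution M N T q z m d dc v lg K U \<Gamma> ld vc S
  for M :: nat
    and N :: "nat \<Rightarrow> nat"
    and T :: "times set"
    and q :: "nat \<Rightarrow> times \<Rightarrow> complex"
    and z m :: "nat \<Rightarrow> times \<Rightarrow> complex \<Rightarrow> complex"
    and d :: "nat \<Rightarrow> times \<Rightarrow> complex"
    and dc v :: "nat \<Rightarrow> nat \<Rightarrow> times \<Rightarrow> complex"
    and lg :: "nat \<Rightarrow> times \<Rightarrow> complex \<Rightarrow> complex"
    and K :: "nat \<Rightarrow> times \<Rightarrow> complex set"
    and U :: "nat \<Rightarrow> times \<Rightarrow> complex set"
    and \<Gamma> :: "nat \<Rightarrow> times \<Rightarrow> real \<Rightarrow> complex"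
    and ld vc :: "nat \<Rightarrow> times \<Rightarrow> complex"
    and S :: "nat \<Rightarrow> times \<Rightarrow> complex \<Rightarrow> complex" +
  fixes I J :: "nat set"
    and k :: "nat \<Rightarrow> nat"  \<comment> \<open>the exponents \<open>n\<^sub>\<alpha>\<close> of the string equations\<close>
    and E1 E2 :: "times \<Rightarrow> complex \<Rightarrow> complex"
  assumes IJ: "I \<union> J = {1..M}" "I \<inter> J = {}"
    and k_pos: "\<And>\<alpha>. \<alpha> \<le> M \<Longrightarrow> 0 < k \<alpha>"
    and E1_rational: "\<And>t. t \<in> T \<Longrightarrow> rational_with_poles_in ((\<lambda>i. q i t) ` {1..M}) (E1 t)"
    and E2_rational: "\<And>t. t \<in> T \<Longrightarrow> rational_with_poles_in ((\<lambda>i. q i t) ` {1..M}) (E2 t)"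
    and E1_eq: "\<And>t p. t \<in> T \<Longrightarrow> p \<in> U 0 t \<Longrightarrow> E1 t p = z 0 t p ^ k 0"
    and E2_eq: "\<And>t p. t \<in> T \<Longrightarrow> p \<in> U 0 t \<Longrightarrow> E2 t p = m 0 t p / z 0 t p ^ (k 0 - 1)"
    and string_I1: "\<And>i t p. i \<in> I \<Longrightarrow> t \<in> T \<Longrightarrow> p \<in> U i t \<Longrightarrow> z i t p ^ k i = E1 t p"
    and string_I2: "\<And>i t p. i \<in> I \<Longrightarrow> t \<in> T \<Longrightarrow> p \<in> U i t \<Longrightarrow>
      1 / of_nat (k i) * (m i t p / z i t p ^ (k i - 1)) = 1 / of_nat (k 0) * E2 t p"
    and string_J1: "\<And>j t p. j \<in> J \<Longrightarrow> t \<in> T \<Longrightarrow> p \<in> U j t \<Longrightarrow>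
      - (of_nat (k 0) / of_nat (k j)) * (m j t p / z j t p ^ (k j - 1)) = E1 t p"
    and string_J2: "\<And>j t p. j \<in> J \<Longrightarrow> t \<in> T \<Longrightarrow> p \<in> U j t \<Longrightarrow>
      1 / of_nat (k 0) * z j t p ^ k j = 1 / of_nat (k 0) * E2 t p"
    \<comment> \<open>the additive constants in \<open>S\<^sub>\<alpha>\<close>\<close>
    and S_normal_I: "\<And>\<alpha> t p. \<alpha> \<in> insert 0 I \<Longrightarrow> t \<in> T \<Longrightarrow>
      p \<in> U \<alpha> t - (\<Union>i\<in>{1..M}. K i t) \<Longrightarrow>
      S \<alpha> t p = (\<Sum>\<beta>\<le>M. R_part M N q z lg \<beta> t p)
        + 1 / of_nat (k 0) * (\<Sum>j\<in>J. plus_part q j t (\<lambda>x. E1 t x * E2 t x) p)"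
    and S_normal_J: "\<And>\<alpha> t p. \<alpha> \<in> J \<Longrightarrow> t \<in> T \<Longrightarrow>
      p \<in> U \<alpha> t - (\<Union>i\<in>{1..M}. K i t) \<Longrightarrow>
      S \<alpha> t p = (\<Sum>\<beta>\<le>M. R_part M N q z lg \<beta> t p)
        - 1 / of_nat (k 0) * plus_part q 0 t (\<lambda>x. E1 t x * E2 t x) p
        - 1 / of_nat (k 0) * (\<Sum>i\<in>I. plus_part q i t (\<lambda>x. E1 t x * E2 t x) p)"

section \<open>The tau-function\<close>

definition log_minus_one ::
    "(nat \<Rightarrow> times \<Rightarrow> complex) \<Rightarrow> (nat \<Rightarrow> times \<Rightarrow> complex \<Rightarrow> complex) \<Rightarrow>
     nat \<Rightarrow> nat \<Rightarrow> times \<Rightarrow> complex" where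
  "log_minus_one q lg j i t = lg j t (q i t - q j t) - lg i t (q j t - q i t)"

definition v_first ::
    "nat \<Rightarrow> (nat \<Rightarrow> times \<Rightarrow> complex) \<Rightarrow> (nat \<Rightarrow> times \<Rightarrow> complex \<Rightarrow> complex) \<Rightarrow>
     (nat \<Rightarrow> times \<Rightarrow> complex) \<Rightarrow> nat \<Rightarrow> times \<Rightarrow> complex" where
  "v_first M q lg vc i t = vc i t - (\<Sum>j\<in>{1..<i}. log_minus_one q lg j i t * time M t j 0)"

definition v_all ::
    "nat \<Rightarrow> (nat \<Rightarrow> times \<Rightarrow> complex) \<Rightarrow> (nat \<Rightarrow> times \<Rightarrow> complex \<Rightarrow> complex) \<Rightarrow>
     (nat \<Rightarrow> times \<Rightarrow> complex) \<Rightarrow> (nat \<Rightarrow> nat \<Rightarrow> times \<Rightarrow> complex) \<Rightarrow>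
     nat \<Rightarrow> nat \<Rightarrow> times \<Rightarrow> complex" where
  "v_all M q lg vc v \<alpha> n t = (if n = 1 then v_first M q lg vc \<alpha> t else v \<alpha> n t)"

text \<open>\<open>m\<^sub>\<alpha>\<close> as a function of the coordinate \<open>z\<^sub>\<alpha>\<close>.\<close>

definition m_of_z ::
    "(nat \<Rightarrow> times \<Rightarrow> complex set) \<Rightarrow> (nat \<Rightarrow> times \<Rightarrow> complex \<Rightarrow> complex) \<Rightarrow>
     (nat \<Rightarrow> times \<Rightarrow> complex \<Rightarrow> complex) \<Rightarrow> nat \<Rightarrow> times \<Rightarrow> complex \<Rightarrow> complex" where
  "m_of_z U z m \<alpha> t \<zeta> = m \<alpha> t (the_inv_into (U \<alpha> t) (z \<alpha> t) \<zeta>)"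

text \<open>
  \<open>F\<close> is a logarithm of \<open>\<tau>\<close> and \<open>dF = (\<Sum>(\<alpha>, n). w\<^sub>\<alpha>\<^sub>,\<^sub>n\<^sub>+\<^sub>1 dt\<^sub>\<alpha>\<^sub>n)\<close> over the independent times.
  Continuity turns the partial derivatives on an open set into the total differential.
\<close>

definition is_tau_function ::
    "(nat \<times> nat) set \<Rightarrow> times set \<Rightarrow> (nat \<Rightarrow> nat \<Rightarrow> times \<Rightarrow> complex) \<Rightarrow>
     (times \<Rightarrow> complex) \<Rightarrow> (times \<Rightarrow> complex) \<Rightarrow> bool" where
  "is_tau_function Ind T w \<tau> F \<longleftrightarrow> (\<forall>t\<in>T. \<tau> t = exp (F t)) \<and> continuous_on T F \<and>
     (\<forall>t\<in>T. \<forall>(\<alpha>, n)\<in>Ind.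
        ((\<lambda>s. F (t((\<alpha>, n) := s))) has_field_derivative w \<alpha> (n + 1) t) (at (t (\<alpha>, n))))"

end

theory Submission
  imports Defs
begin

text \<open>
  In the charts \<open>w = 1/p\<close> at infinity and \<open>w = p\<close> at the finite punctures, \<open>v\<^sub>\<alpha>\<^sub>,\<^sub>n\<^sub>+\<^sub>1\<close> is the residue of
  \<open>z\<^sub>\<alpha>\<^sup>n m\<^sub>\<alpha> dz\<^sub>\<alpha>\<close> and the two expressions for \<open>2 F\<close> agree by comparing coefficients. For the derivative,
  a residue of \<open>f(z, m) dz\<close> changes with the time \<open>t\<^sub>B\<close> by the residue of \<open>(\<partial>f/\<partial>m) d\<Omega>\<^sub>B\<close>, by the Whitham equations.
  Hence \<open>\<partial>(2 F)/\<partial>t\<^sub>B\<close> is \<open>v\<^sub>B\<close>, plus the residues of \<open>\<xi>\<^sub>\<alpha> d\<Omega>\<^sub>B\<close> with \<open>\<xi>\<^sub>\<alpha> = \<Sum>\<^sub>n t\<^sub>\<alpha>\<^sub>n z\<^sub>\<alpha>\<^sup>n\<close>, plus those of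
  \<open>(E\<^sub>1 E\<^sub>2 / n\<^sub>0) d\<Omega>\<^sub>B\<close> at the punctures in \<open>J\<close>, plus the derivatives of the \<open>v\<^sub>i\<^sub>1\<close>. The normalisation of
  the \<open>S\<^sub>\<alpha>\<close> says that \<open>m\<^sub>\<alpha> dz\<^sub>\<alpha>\<close> is one rational form for all \<open>\<alpha>\<close>, up to the exact form \<open>d(E\<^sub>1 E\<^sub>2 / n\<^sub>0)\<close> for
  \<open>\<alpha> \<in> J\<close>. The residue theorem on the sphere for this form times \<open>\<Omega>\<^sub>B\<close> shows that the additional terms
  amount to a second \<open>v\<^sub>B\<close>.

  The constant \<open>v\<^sub>i\<close> is the residue of \<open>(\<xi>\<^sub>i + t\<^sub>i\<^sub>0 log z\<^sub>i - S\<^sub>i) dz\<^sub>i / z\<^sub>i\<close>, and its derivative is read off from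
  \<open>dS\<^sub>i\<close>; the numbers \<open>log\<^sub>j\<^sub>i(-1)\<close> are locally constant and compensate the asymmetry between
  \<open>log\<^sub>j(q\<^sub>i - q\<^sub>j)\<close> and \<open>log\<^sub>i(q\<^sub>j - q\<^sub>i)\<close>.
\<close>

lemma continuous_on_contour_integral_circlepath:
  fixes f :: "'a::topological_space \<Rightarrow> complex \<Rightarrow> complex"
  assumes "continuous_on (X \<times> sphere c r) (\<lambda>(x, w). f x w)" "0 \<le> r"
  shows "continuous_on X (\<lambda>x. contour_integral (circlepath c r) (f x))"
proof -
  have "continuous_on (X \<times> cbox 0 (1::real)) (\<lambda>(x, u). f x (circlepath c r u) *
      (2 * pi * \<i> * r * exp (2 * of_real pi * \<i> * u)))"
  proof -
    have "continuous_on (X \<times> cbox 0 (1::real)) (\<lambda>y. (\<lambda>(x, w). f x w) (fst y, circlepath c r (snd y)))"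
    proof (rule continuous_on_compose2[OF assms(1)])
      show "continuous_on (X \<times> cbox 0 1) (\<lambda>y. (fst y, circlepath c r (snd y)))"
        unfolding circlepath by (intro continuous_intros)
      show "(\<lambda>y. (fst y, circlepath c r (snd y))) ` (X \<times> cbox 0 1) \<subseteq> X \<times> sphere c r"
        using assms(2) path_image_circlepath_nonneg[of r c] by (auto simp: path_image_def)
    qed
    then show ?thesis
      by (auto simp: split_beta intro!: continuous_intros)
  qed
  then have "continuous_on X (\<lambda>x. integral (cbox 0 (1::real)) (\<lambda>u. f x (circlepath c r u) *
      (2 * pi * \<i> * r * exp (2 * of_real pi * \<i> * u))))"
    by (rule integral_continuous_on_param)
  then show ?thesis
    by (simp add: contour_integral_integral vector_derivative_circlepath)
qed

lemma has_field_derivative_contour_integral_circlepath: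
  fixes f f' :: "complex \<Rightarrow> complex \<Rightarrow> complex"
  assumes B: "open B" "s0 \<in> B" and r: "0 \<le> r"
    and f: "\<And>s. s \<in> B \<Longrightarrow> continuous_on (sphere c r) (f s)"
    and der: "\<And>s w. s \<in> B \<Longrightarrow> w \<in> sphere c r \<Longrightarrow> ((\<lambda>s. f s w) has_field_derivative f' s w) (at s)"
    and f': "continuous_on (B \<times> sphere c r) (\<lambda>(s, w). f' s w)"
  shows "((\<lambda>s. contour_integral (circlepath c r) (f s)) has_field_derivative
    contour_integral (circlepath c r) (f' s0)) (at s0)"
proof -
  obtain e where e: "e > 0" "ball s0 e \<subseteq> B"
    using B openE by blast
  let ?v = "\<lambda>u::real. 2 * pi * \<i> * r * exp (2 * of_real pi * \<i> * u)"
  have im: "circlepath c r u \<in> sphere c r" if "u \<in> cbox 0 1" for u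
    using r path_image_circlepath_nonneg[of r c] that by (auto simp: path_image_def)
  have cc: "continuous_on (cbox 0 1) (circlepath c r)"
    unfolding circlepath by (intro continuous_intros)
  have "((\<lambda>s. integral (cbox 0 1) (\<lambda>u. f s (circlepath c r u) * ?v u)) has_field_derivative
      integral (cbox 0 1) (\<lambda>u. f' s0 (circlepath c r u) * ?v u)) (at s0 within ball s0 e)"
  proof (rule leibniz_rule_field_derivative)
    show "((\<lambda>s. f s (circlepath c r u) * ?v u) has_field_derivative f' s (circlepath c r u) * ?v u) (at s within ball s0 e)"
      if "s \<in> ball s0 e" "u \<in> cbox 0 1" for s u
      by (intro DERIV_cmult_right has_field_derivative_at_within[OF der]) (use that e im in auto)
    show "(\<lambda>u. f s (circlepath c r u) * ?v u) integrable_on cbox 0 1" if "s \<in> ball s0 e" for s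
    proof (rule integrable_continuous, intro continuous_intros)
      show "continuous_on (cbox 0 1) (\<lambda>u. f s (circlepath c r u))"
        by (rule continuous_on_compose2[OF f cc]) (use that e im in auto)
    qed
    have "continuous_on (ball s0 e \<times> cbox 0 1) (\<lambda>y. (\<lambda>(s, w). f' s w) (fst y, circlepath c r (snd y)))"
    proof (rule continuous_on_compose2[OF f'])
      show "continuous_on (ball s0 e \<times> cbox 0 1) (\<lambda>y. (fst y, circlepath c r (snd y)))"
        unfolding circlepath by (intro continuous_intros)
    qed (use e im in auto)
    then show "continuous_on (ball s0 e \<times> cbox 0 1) (\<lambda>(s, u). f' s (circlepath c r u) * ?v u)"
      by (auto simp: split_beta intro!: continuous_intros)
  qed (use e in auto)
  moreover have "at s0 within ball s0 e = at s0"
    using e at_within_open[of s0 "ball s0 e"] by auto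
  ultimately show ?thesis
    by (simp add: contour_integral_integral vector_derivative_circlepath)
qed

section \<open>Separately holomorphic functions of two variables\<close>

definition sep_holo :: "complex set \<Rightarrow> complex set \<Rightarrow> (complex \<Rightarrow> complex \<Rightarrow> complex) \<Rightarrow> bool" where
  "sep_holo B A f \<longleftrightarrow> continuous_on (B \<times> A) (\<lambda>(s, w). f s w) \<and>
     (\<forall>s\<in>B. \<forall>w\<in>A. (\<lambda>s. f s w) field_differentiable at s \<and> f s field_differentiable at w)"

abbreviation deriv1 :: "(complex \<Rightarrow> complex \<Rightarrow> complex) \<Rightarrow> complex \<Rightarrow> complex \<Rightarrow> complex" where
  "deriv1 f s w \<equiv> deriv (\<lambda>s. f s w) s"

lemma sep_holo_swap: "sep_holo B A f \<longleftrightarrow> sep_holo A B (\<lambda>w s. f s w)"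
proof -
  have *: "continuous_on (A \<times> B) (\<lambda>(w, s). f s w)" if "continuous_on (B \<times> A) (\<lambda>(s, w). f s w)"
    for A B and f :: "complex \<Rightarrow> complex \<Rightarrow> complex"
  proof -
    have "continuous_on (A \<times> B) (\<lambda>y. (\<lambda>(s, w). f s w) (snd y, fst y))"
      by (rule continuous_on_compose2[OF that]) (auto intro!: continuous_intros)
    then show ?thesis by (simp add: split_beta)
  qed
  from *[where A=A and B=B and f=f] *[where A=B and B=A and f="\<lambda>w s. f s w"] show ?thesis
    unfolding sep_holo_def by blast
qed

lemma sep_holo_cont: "sep_holo B A f \<Longrightarrow> continuous_on (B \<times> A) (\<lambda>(s, w). f s w)"
  and sep_holo_D1: "sep_holo B A f \<Longrightarrow> s \<in> B \<Longrightarrow> w \<in> A \<Longrightarrow> ((\<lambda>s. f s w) has_field_derivative deriv1 f s w) (at s)"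
  and sep_holo_D2: "sep_holo B A f \<Longrightarrow> s \<in> B \<Longrightarrow> w \<in> A \<Longrightarrow> (f s has_field_derivative deriv (f s) w) (at w)"
  by (auto simp: sep_holo_def DERIV_deriv_iff_field_differentiable)

lemma sep_holo_subset: "sep_holo B A f \<Longrightarrow> B' \<subseteq> B \<Longrightarrow> A' \<subseteq> A \<Longrightarrow> sep_holo B' A' f"
  unfolding sep_holo_def by (blast intro: continuous_on_subset)

lemma sep_holo_holomorphic2: "sep_holo B A f \<Longrightarrow> s \<in> B \<Longrightarrow> f s holomorphic_on A"
  unfolding sep_holo_def holomorphic_on_def by (blast intro: field_differentiable_at_within)

lemma sep_holo_holomorphic1: "sep_holo B A f \<Longrightarrow> w \<in> A \<Longrightarrow> (\<lambda>s. f s w) holomorphic_on B"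
  unfolding sep_holo_def holomorphic_on_def by (blast intro: field_differentiable_at_within)

lemma sep_holo_const [intro]: "sep_holo B A (\<lambda>s w. c)"
  unfolding sep_holo_def by auto

lemma sep_holo_first: "f holomorphic_on B \<Longrightarrow> open B \<Longrightarrow> sep_holo B A (\<lambda>s w. f s)"
  unfolding sep_holo_def split_beta
  using continuous_on_compose2[OF holomorphic_on_imp_continuous_on continuous_on_fst[OF continuous_on_id], of f B "B \<times> A"]
  by (auto simp: holomorphic_on_imp_differentiable_at)

lemma sep_holo_add [intro]: "sep_holo B A f \<Longrightarrow> sep_holo B A g \<Longrightarrow> sep_holo B A (\<lambda>s w. f s w + g s w)"
  unfolding sep_holo_def
  by (auto simp: split_beta intro!: continuous_intros field_differentiable_add[unfolded fun_eq_iff] derivative_intros)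

lemma sep_holo_diff [intro]: "sep_holo B A f \<Longrightarrow> sep_holo B A g \<Longrightarrow> sep_holo B A (\<lambda>s w. f s w - g s w)"
  unfolding sep_holo_def
  by (auto simp: split_beta intro!: continuous_intros derivative_intros)

lemma sep_holo_mult [intro]: "sep_holo B A f \<Longrightarrow> sep_holo B A g \<Longrightarrow> sep_holo B A (\<lambda>s w. f s w * g s w)"
  unfolding sep_holo_def
  by (auto simp: split_beta intro!: continuous_intros derivative_intros)

lemma sep_holo_divide [intro]:
  "sep_holo B A f \<Longrightarrow> sep_holo B A g \<Longrightarrow> (\<And>s w. s \<in> B \<Longrightarrow> w \<in> A \<Longrightarrow> g s w \<noteq> 0) \<Longrightarrow> sep_holo B A (\<lambda>s w. f s w / g s w)"
  unfolding sep_holo_def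
  by (auto simp: split_beta intro!: continuous_intros field_differentiable_divide)

lemma sep_holo_power [intro]: "sep_holo B A f \<Longrightarrow> sep_holo B A (\<lambda>s w. f s w ^ n)"
  by (induction n) auto

lemma Cauchy_deriv_contour:
  assumes "f holomorphic_on cball w1 r" "w \<in> ball w1 r"
  shows "deriv f w = 1 / (2 * of_real pi * \<i>) * contour_integral (circlepath w1 r) (\<lambda>u. f u / (u - w)^2)"
  using assms holomorphic_on_subset[OF assms(1) ball_subset_cball]
  by (intro DERIV_imp_deriv Cauchy_derivative_integral_circlepath(2) holomorphic_on_imp_continuous_on)

lemma continuous_on_deriv_param:
  fixes f :: "'a::t2_space \<Rightarrow> complex \<Rightarrow> complex"
  assumes cont: "continuous_on (X \<times> A) (\<lambda>(x, w). f x w)" and A: "open A"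
    and hol: "\<And>x. x \<in> X \<Longrightarrow> f x holomorphic_on A"
  shows "continuous_on (X \<times> A) (\<lambda>(x, w). deriv (f x) w)"
  unfolding continuous_on_eq_continuous_within
proof clarify
  fix x1 w1 assume *: "x1 \<in> X" "w1 \<in> A"
  obtain r where r: "r > 0" "cball w1 r \<subseteq> A"
    using * A open_contains_cball by blast
  let ?Y = "X \<times> ball w1 r"
  have ne: "u \<noteq> w" if "dist w1 u = r" "dist w1 w < r" for u w using that by auto
  have "continuous_on (?Y \<times> sphere w1 r) (\<lambda>y. (\<lambda>(s, w). f s w) (fst (fst y), snd y))"
    by (rule continuous_on_compose2[OF cont]) (use r in \<open>auto intro!: continuous_intros\<close>)
  then have "continuous_on (?Y \<times> sphere w1 r) (\<lambda>(y, u). f (fst y) u / (u - snd y)\<^sup>2)"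
    by (auto simp: split_beta dest: ne intro!: continuous_intros)
  then have "continuous_on ?Y (\<lambda>y. contour_integral (circlepath w1 r) (\<lambda>u. f (fst y) u / (u - snd y)\<^sup>2))"
    by (rule continuous_on_contour_integral_circlepath) (use r in auto)
  then have "continuous_on ?Y (\<lambda>y. 1 / (2 * of_real pi * \<i>) * contour_integral (circlepath w1 r) (\<lambda>u. f (fst y) u / (u - snd y)\<^sup>2))"
    by (intro continuous_intros)
  then have "continuous_on ?Y (\<lambda>(s, w). deriv (f s) w)"
  proof (rule continuous_on_eq, clarsimp)
    fix s w assume s: "s \<in> X" and "dist w1 w < r"
    then show "contour_integral (circlepath w1 r) (\<lambda>u. f s u / (u - w)\<^sup>2) / (2 * complex_of_real pi * \<i>) = deriv (f s) w"
      using Cauchy_deriv_contour[OF holomorphic_on_subset[OF hol[OF s] r(2)], of w] by simp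
  qed
  then have "continuous (at (x1, w1) within ?Y) (\<lambda>(s, w). deriv (f s) w)"
    using * r unfolding continuous_on_eq_continuous_within by auto
  moreover have "at (x1, w1) within ?Y = at (x1, w1) within X \<times> A"
    by (rule at_within_nhd[of _ "UNIV \<times> ball w1 r"]) (use r in \<open>auto intro!: open_Times\<close>)
  ultimately show "continuous (at (x1, w1) within X \<times> A) (\<lambda>(s, w). deriv (f s) w)" by simp
qed

lemma continuous_on_deriv2:
  assumes f: "sep_holo B A f" and op: "open B" "open A"
  shows "continuous_on (B \<times> A) (\<lambda>(s, w). deriv (f s) w)"
  by (rule continuous_on_deriv_param[OF sep_holo_cont[OF f] op(2) sep_holo_holomorphic2[OF f]])

lemma continuous_on_deriv1:
  assumes f: "sep_holo B A f" and op: "open B" "open A"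
  shows "continuous_on (B \<times> A) (\<lambda>(s, w). deriv1 f s w)"
proof -
  have "continuous_on (A \<times> B) (\<lambda>(w, s). deriv1 f s w)"
    using continuous_on_deriv2[of A B "\<lambda>w s. f s w"] f op sep_holo_swap by auto
  then have "continuous_on (B \<times> A) (\<lambda>y. (\<lambda>(w, s). deriv1 f s w) (snd y, fst y))"
    by (rule continuous_on_compose2) (auto intro!: continuous_intros)
  then show ?thesis by (simp add: split_beta)
qed

lemma deriv1_holomorphic2:
  assumes f: "sep_holo B A f" and op: "open B" "open A" and s: "s1 \<in> B"
  shows "deriv1 f s1 holomorphic_on A"
proof -
  obtain r where r: "r > 0" "cball s1 r \<subseteq> B"
    using s op open_contains_cball by blast
  have cont: "continuous_on (A \<times> sphere s1 r) (\<lambda>(w, u). deriv (f u) w / (u - s1)^2)"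
  proof -
    have "continuous_on (A \<times> sphere s1 r) (\<lambda>y. (\<lambda>(s, w). deriv (f s) w) (snd y, fst y))"
      by (rule continuous_on_compose2[OF continuous_on_deriv2[OF f op]]) (use r in \<open>auto intro!: continuous_intros\<close>)
    then show ?thesis
      by (auto simp: split_beta intro!: continuous_intros) (use r in auto)
  qed
  have "((\<lambda>w. contour_integral (circlepath s1 r) (\<lambda>u. f u w / (u - s1)^2)) has_field_derivative
      contour_integral (circlepath s1 r) (\<lambda>u. deriv (f u) w / (u - s1)^2)) (at w)" if "w \<in> A" for w
  proof (rule has_field_derivative_contour_integral_circlepath[OF op(2) that])
    show "continuous_on (sphere s1 r) (\<lambda>u. f u w / (u - s1)\<^sup>2)" if "w \<in> A" for w
      using r that by (auto intro!: continuous_intros continuous_on_subset[OF holomorphic_on_imp_continuous_on[OF sep_holo_holomorphic1[OF f]]])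
    show "((\<lambda>w. f u w / (u - s1)\<^sup>2) has_field_derivative deriv (f u) w / (u - s1)\<^sup>2) (at w)"
      if "w \<in> A" "u \<in> sphere s1 r" for u w
      using sep_holo_D2[OF f, of u w] that r by (intro DERIV_cdivide) (auto simp: subset_iff)
  qed (use r cont in auto)
  then have "(\<lambda>w. 1 / (2 * of_real pi * \<i>) * contour_integral (circlepath s1 r) (\<lambda>u. f u w / (u - s1)^2)) holomorphic_on A"
    using op by (intro holomorphic_intros) (auto simp: holomorphic_on_open)
  then show ?thesis
  proof (rule holomorphic_transform)
    fix w assume "w \<in> A"
    show "1 / (2 * of_real pi * \<i>) * contour_integral (circlepath s1 r) (\<lambda>u. f u w / (u - s1)^2) = deriv1 f s1 w"
      using Cauchy_deriv_contour[OF holomorphic_on_subset[OF sep_holo_holomorphic1[OF f \<open>w \<in> A\<close>] r(2)], of s1] r by simp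
  qed
qed

lemma mixed_derivative:
  assumes f: "sep_holo B A f" and op: "open B" "open A" and s: "s1 \<in> B" "w1 \<in> A"
  shows "((\<lambda>s. deriv (f s) w1) has_field_derivative deriv (deriv1 f s1) w1) (at s1)"
proof -
  obtain r where r: "r > 0" "cball w1 r \<subseteq> A"
    using s op open_contains_cball by blast
  have "((\<lambda>s. contour_integral (circlepath w1 r) (\<lambda>u. f s u / (u - w1)^2)) has_field_derivative
      contour_integral (circlepath w1 r) (\<lambda>u. deriv1 f s1 u / (u - w1)^2)) (at s1)"
  proof (rule has_field_derivative_contour_integral_circlepath[OF op(1) s(1)])
    show "continuous_on (sphere w1 r) (\<lambda>u. f s u / (u - w1)\<^sup>2)" if "s \<in> B" for s
      using r that by (auto intro!: continuous_intros continuous_on_subset[OF holomorphic_on_imp_continuous_on[OF sep_holo_holomorphic2[OF f]]])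
    show "((\<lambda>s. f s u / (u - w1)\<^sup>2) has_field_derivative deriv1 f s u / (u - w1)\<^sup>2) (at s)"
      if "s \<in> B" "u \<in> sphere w1 r" for u s
      using sep_holo_D1[OF f, of s u] that r by (intro DERIV_cdivide) (auto simp: subset_iff)
    have "continuous_on (B \<times> sphere w1 r) (\<lambda>(s, u). deriv1 f s u)"
      by (rule continuous_on_subset[OF continuous_on_deriv1[OF f op]]) (use r in auto)
    then show "continuous_on (B \<times> sphere w1 r) (\<lambda>(s, u). deriv1 f s u / (u - w1)^2)"
      by (auto simp: split_beta intro!: continuous_intros) (use r in auto)
  qed (use r in auto)
  then have "((\<lambda>s. 1 / (2 * of_real pi * \<i>) * contour_integral (circlepath w1 r) (\<lambda>u. f s u / (u - w1)^2)) has_field_derivative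
      1 / (2 * of_real pi * \<i>) * contour_integral (circlepath w1 r) (\<lambda>u. deriv1 f s1 u / (u - w1)^2)) (at s1)"
    by (rule DERIV_cmult)
  also have "1 / (2 * of_real pi * \<i>) * contour_integral (circlepath w1 r) (\<lambda>u. deriv1 f s1 u / (u - w1)^2) = deriv (deriv1 f s1) w1"
    using deriv1_holomorphic2[OF f op s(1)] r
    by (intro Cauchy_deriv_contour[symmetric]) (auto intro: holomorphic_on_subset)
  finally show ?thesis
  proof (rule has_field_derivative_transform_within_open[OF _ op(1) s(1)])
    fix s assume "s \<in> B"
    show "1 / (2 * of_real pi * \<i>) * contour_integral (circlepath w1 r) (\<lambda>u. f s u / (u - w1)^2) = deriv (f s) w1"
      using sep_holo_holomorphic2[OF f \<open>s \<in> B\<close>] r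
      by (intro Cauchy_deriv_contour[symmetric]) (auto intro: holomorphic_on_subset)
  qed
qed

lemma sep_holo_deriv2:
  assumes f: "sep_holo B A f" and op: "open B" "open A"
  shows "sep_holo B A (\<lambda>s. deriv (f s))"
  unfolding sep_holo_def
  using continuous_on_deriv2[OF assms] mixed_derivative[OF assms] holomorphic_deriv[OF sep_holo_holomorphic2[OF f] op(2)]
  by (auto simp: holomorphic_on_imp_differentiable_at[OF _ op(2)] field_differentiable_def[of "\<lambda>s. deriv (f s) w" for w])

lemma sep_holo_deriv1:
  assumes f: "sep_holo B A f" and op: "open B" "open A"
  shows "sep_holo B A (deriv1 f)"
proof -
  have "sep_holo A B (\<lambda>w. deriv (\<lambda>s. f s w))"
    using sep_holo_deriv2[of A B "\<lambda>w s. f s w"] f op sep_holo_swap by auto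
  then show ?thesis by (subst sep_holo_swap)
qed

text \<open>
  Differentiating \<open>\<oint> f dg\<close>: up to the exact form \<open>d(f g\<^sub>s)\<close> the integrand changes by the
  Jacobian of \<open>(f, g)\<close>.
\<close>

lemma has_field_derivative_contour_integral_form:
  assumes f: "sep_holo B A f" and g: "sep_holo B A g" and op: "open B" "open A"
    and s: "s1 \<in> B" and r: "0 < r" "sphere c r \<subseteq> A"
  shows "((\<lambda>s. contour_integral (circlepath c r) (\<lambda>w. f s w * deriv (g s) w)) has_field_derivative
      contour_integral (circlepath c r)
        (\<lambda>w. deriv1 f s1 w * deriv (g s1) w - deriv (f s1) w * deriv1 g s1 w)) (at s1)"
proof -
  note g' = sep_holo_deriv2[OF g op] and gs = sep_holo_deriv1[OF g op] and fs = sep_holo_deriv1[OF f op]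
  have cont: "\<phi> s1 contour_integrable_on circlepath c r" if "sep_holo B A \<phi>" for \<phi>
    using r sep_holo_holomorphic2[OF that s]
    by (intro contour_integrable_continuous_circlepath continuous_on_subset[OF holomorphic_on_imp_continuous_on]) auto
  have der: "((\<lambda>s. contour_integral (circlepath c r) (\<lambda>w. f s w * deriv (g s) w)) has_field_derivative
      contour_integral (circlepath c r)
        (\<lambda>w. deriv1 f s1 w * deriv (g s1) w + f s1 w * deriv (deriv1 g s1) w)) (at s1)"
  proof (rule has_field_derivative_contour_integral_circlepath[OF op(1) s])
    show "continuous_on (sphere c r) (\<lambda>w. f s w * deriv (g s) w)" if "s \<in> B" for s
      using sep_holo_holomorphic2[OF sep_holo_mult[OF f g'] that] r
      by (intro continuous_on_subset[OF holomorphic_on_imp_continuous_on]) auto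
    show "((\<lambda>s. f s w * deriv (g s) w) has_field_derivative
           deriv1 f s w * deriv (g s) w + f s w * deriv (deriv1 g s) w) (at s)"
      if "s \<in> B" "w \<in> sphere c r" for s w
    proof -
      have "w \<in> A" using that r by auto
      from DERIV_mult[OF sep_holo_D1[OF f that(1) this] mixed_derivative[OF g op that(1) this]]
      show ?thesis by (simp add: algebra_simps)
    qed
    have "sep_holo B A (\<lambda>s w. deriv1 f s w * deriv (g s) w + f s w * deriv (deriv1 g s) w)"
      using f fs g' sep_holo_deriv2[OF gs op] by auto
    from sep_holo_cont[OF this]
    show "continuous_on (B \<times> sphere c r) (\<lambda>(s, w). deriv1 f s w * deriv (g s) w + f s w * deriv (deriv1 g s) w)"
      by (rule continuous_on_subset) (use r in auto)
  qed (use r in auto)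
  have prim: "contour_integral (circlepath c r) (\<lambda>w. deriv (f s1) w * deriv1 g s1 w + f s1 w * deriv (deriv1 g s1) w) = 0"
  proof (rule contour_integral_unique, rule Cauchy_theorem_primitive[where S=A and f="\<lambda>w. f s1 w * deriv1 g s1 w"])
    fix w assume "w \<in> A"
    from DERIV_mult[OF sep_holo_D2[OF f s this] sep_holo_D2[OF gs s this]]
    show "((\<lambda>w. f s1 w * deriv1 g s1 w) has_field_derivative deriv (f s1) w * deriv1 g s1 w + f s1 w * deriv (deriv1 g s1) w) (at w within A)"
      by (intro has_field_derivative_at_within[of _ _ _ A]) (simp add: mult.commute add.commute)
  qed (use r in auto)
  have "contour_integral (circlepath c r)
        (\<lambda>w. deriv1 f s1 w * deriv (g s1) w + f s1 w * deriv (deriv1 g s1) w)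
     = contour_integral (circlepath c r)
        (\<lambda>w. (deriv1 f s1 w * deriv (g s1) w - deriv (f s1) w * deriv1 g s1 w) +
          (deriv (f s1) w * deriv1 g s1 w + f s1 w * deriv (deriv1 g s1) w))"
    by (intro arg_cong[of _ _ "contour_integral _"]) (auto simp: fun_eq_iff)
  also have "\<dots> = contour_integral (circlepath c r)
        (\<lambda>w. deriv1 f s1 w * deriv (g s1) w - deriv (f s1) w * deriv1 g s1 w)"
    using cont[OF sep_holo_diff[OF sep_holo_mult[OF fs g'] sep_holo_mult[OF sep_holo_deriv2[OF f op] gs]]]
      cont[OF sep_holo_add[OF sep_holo_mult[OF sep_holo_deriv2[OF f op] gs] sep_holo_mult[OF f sep_holo_deriv2[OF gs op]]]]
    by (subst contour_integral_add) (auto simp: prim)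
  finally show ?thesis using der by simp
qed

text \<open>Only one value of the primitive needs to depend holomorphically on the parameter.\<close>

lemma sep_holo_primitive:
  assumes y: "sep_holo B A y" and op: "open B" "open A" "connected A"
    and f: "\<And>s w. s \<in> B \<Longrightarrow> w \<in> A \<Longrightarrow> (f s has_field_derivative y s w) (at w)"
    and w1: "w1 \<in> A" "(\<lambda>s. f s w1) holomorphic_on B"
  shows "sep_holo B A f"
proof -
  have loc: "sep_holo B (ball a e) f"
    if "a \<in> A" "e > 0" "cball a e \<subseteq> A" "b \<in> ball a e" "(\<lambda>s. f s b) holomorphic_on B" for a b e
  proof -
    let ?v = "\<lambda>w (x::real). y s (linepath b w x) * (w - b)" 
    have conv: "linepath b w x \<in> ball a e" if "w \<in> ball a e" "x \<in> cbox 0 1" for w x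
      using that \<open>b \<in> ball a e\<close> linepath_in_path[of x b w] closed_segment_subset[of b "ball a e" w] by auto
    have eq: "f s w = f s b + integral (cbox 0 1) (\<lambda>x. y s (linepath b w x) * (w - b))" 
      if "s \<in> B" "w \<in> ball a e" for s w
    proof -
      have sub: "ball a e \<subseteq> A" using \<open>cball a e \<subseteq> A\<close> by auto
      have "(y s has_contour_integral (f s (pathfinish (linepath b w)) - f s (pathstart (linepath b w)))) (linepath b w)"
      proof (rule contour_integral_primitive)
        show "(f s has_field_derivative y s x) (at x within ball a e)" if "x \<in> ball a e" for x
          using f that sub \<open>s \<in> B\<close> by (intro has_field_derivative_at_within[of _ _ _ "ball a e"]) auto
        show "path_image (linepath b w) \<subseteq> ball a e"
          using that \<open>b \<in> ball a e\<close> by (auto simp: closed_segment_subset)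
      qed auto
      then have "contour_integral (linepath b w) (y s) = f s w - f s b"
        by (simp add: contour_integral_unique)
      then show ?thesis by (simp add: contour_integral_integral algebra_simps)
    qed
    have cont: "continuous_on (B \<times> ball a e) (\<lambda>p. f (fst p) b + integral (cbox 0 1) (\<lambda>x. y (fst p) (linepath b (snd p) x) * (snd p - b)))"
    proof (intro continuous_intros)
      show "continuous_on (B \<times> ball a e) (\<lambda>p. f (fst p) b)"
        by (rule continuous_on_compose2[OF holomorphic_on_imp_continuous_on[OF \<open>(\<lambda>s. f s b) holomorphic_on B\<close>]])
          (auto intro!: continuous_intros)
      have "continuous_on ((B \<times> ball a e) \<times> cbox 0 1) (\<lambda>p. (\<lambda>(s, w). y s w) (fst (fst p), linepath b (snd (fst p)) (snd p)))"
      proof (rule continuous_on_compose2[OF sep_holo_cont[OF y]])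
        show "continuous_on ((B \<times> ball a e) \<times> cbox 0 1) (\<lambda>p. (fst (fst p), linepath b (snd (fst p)) (snd p)))"
          unfolding linepath_def by (intro continuous_intros)
      qed (use conv \<open>cball a e \<subseteq> A\<close> in force)
      then show "continuous_on (B \<times> ball a e) (\<lambda>p. integral (cbox 0 1) (\<lambda>x. y (fst p) (linepath b (snd p) x) * (snd p - b)))"
        by (intro integral_continuous_on_param) (auto simp: split_beta intro!: continuous_intros)
    qed
    have c: "continuous_on (B \<times> ball a e) (\<lambda>(s, w). f s w)"
      using cont by (rule continuous_on_eq) (auto simp: eq)
    have h: "(\<lambda>s. f s w) field_differentiable at s" if s: "s \<in> B" and w: "w \<in> ball a e" for s w
    proof -
      obtain d where d: "d > 0" "ball s d \<subseteq> B" using s op openE by blast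
      have "((\<lambda>s. integral (cbox 0 1) (\<lambda>x. y s (linepath b w x) * (w - b))) has_field_derivative 
          integral (cbox 0 1) (\<lambda>x. deriv1 y s (linepath b w x) * (w - b))) (at s within ball s d)"
      proof (rule leibniz_rule_field_derivative)
        show "((\<lambda>s. y s (linepath b w x) * (w - b)) has_field_derivative deriv1 y s' (linepath b w x) * (w - b)) (at s' within ball s d)"
          if "s' \<in> ball s d" "x \<in> cbox 0 1" for s' x
        proof -
          have "linepath b w x \<in> A" using conv[OF w that(2)] \<open>cball a e \<subseteq> A\<close> by auto
          then show ?thesis
            using sep_holo_D1[OF y, of s' "linepath b w x"] d that
            by (intro DERIV_cmult_right has_field_derivative_at_within[of _ _ _ "ball s d"]) auto
        qed
        show "(\<lambda>x. y s' (linepath b w x) * (w - b)) integrable_on cbox 0 1" if "s' \<in> ball s d" for s'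
        proof (rule integrable_continuous, intro continuous_intros)
          have "s' \<in> B" using that d by auto
          then show "continuous_on (cbox 0 1) (\<lambda>x. y s' (linepath b w x))"
            by (rule continuous_on_compose2[OF holomorphic_on_imp_continuous_on[OF sep_holo_holomorphic2[OF y]]])
              (use conv[OF w] \<open>cball a e \<subseteq> A\<close> in \<open>force simp: linepath_def intro!: continuous_intros\<close>)+
        qed
        have "continuous_on (ball s d \<times> cbox 0 1) (\<lambda>p. (\<lambda>(s, w). deriv1 y s w) (fst p, linepath b w (snd p)))"
        proof (rule continuous_on_compose2[OF continuous_on_deriv1[OF y op(1,2)]])
          show "continuous_on (ball s d \<times> cbox 0 1) (\<lambda>p. (fst p, linepath b w (snd p)))"
            unfolding linepath_def by (intro continuous_intros)
        qed (use conv[OF w] \<open>cball a e \<subseteq> A\<close> d in force)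
        then show "continuous_on (ball s d \<times> cbox 0 1) (\<lambda>(s, x). deriv1 y s (linepath b w x) * (w - b))"
          by (auto simp: split_beta intro!: continuous_intros)
      qed (use d in auto)
      then have "(\<lambda>s. integral (cbox 0 1) (\<lambda>x. y s (linepath b w x) * (w - b))) field_differentiable at s"
        using at_within_open[of s "ball s d"] d by (auto simp: field_differentiable_def)
      moreover have "(\<lambda>s. f s b) field_differentiable at s"
        using that(1) holomorphic_on_imp_differentiable_at[OF \<open>(\<lambda>s. f s b) holomorphic_on B\<close> op(1)] by auto
      ultimately have "(\<lambda>s. f s b + integral (cbox 0 1) (\<lambda>x. y s (linepath b w x) * (w - b))) field_differentiable at s"
        by (intro derivative_intros)
      then obtain D where "((\<lambda>s. f s b + integral (cbox 0 1) (\<lambda>x. y s (linepath b w x) * (w - b))) has_field_derivative D) (at s)"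
        by (auto simp: field_differentiable_def)
      then have "((\<lambda>s. f s w) has_field_derivative D) (at s)"
        by (rule has_field_derivative_transform_within_open[OF _ op(1) s]) (use eq[OF _ w] in simp)
      then show ?thesis by (auto simp: field_differentiable_def)
    qed
    have g: "f s field_differentiable at w" if "s \<in> B" "w \<in> ball a e" for s w
      using f[of s w] that subsetD[OF \<open>cball a e \<subseteq> A\<close>, of w] by (auto simp: field_differentiable_def)
    show ?thesis using c h g unfolding sep_holo_def by blast
  qed
  have hol: "(\<lambda>s. f s w) holomorphic_on B" if "w \<in> A" for w
  proof -
    have "((\<lambda>s. f s w1) holomorphic_on B) = ((\<lambda>s. f s w) holomorphic_on B)"
    proof (rule connected_equivalence_relation[OF op(3) w1(1) that, of "\<lambda>a b. ((\<lambda>s. f s a) holomorphic_on B) = ((\<lambda>s. f s b) holomorphic_on B)"])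
      fix a assume "a \<in> A"
      then obtain e where e: "e > 0" "cball a e \<subseteq> A" using op open_contains_cball by blast
      show "\<exists>T. openin (top_of_set A) T \<and> a \<in> T \<and> (\<forall>x\<in>T. ((\<lambda>s. f s a) holomorphic_on B) = ((\<lambda>s. f s x) holomorphic_on B))"
      proof (intro exI conjI ballI)
        show "openin (top_of_set A) (ball a e)"
          using e op by (intro open_subset) auto
        fix x assume x: "x \<in> ball a e"
        show "((\<lambda>s. f s a) holomorphic_on B) = ((\<lambda>s. f s x) holomorphic_on B)"
        proof
          assume "(\<lambda>s. f s a) holomorphic_on B"
          then have "sep_holo B (ball a e) f" using loc[OF \<open>a \<in> A\<close> e, of a] e by simp
          then show "(\<lambda>s. f s x) holomorphic_on B" using x by (rule sep_holo_holomorphic1)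
        next
          assume "(\<lambda>s. f s x) holomorphic_on B"
          then have "sep_holo B (ball a e) f" using loc[OF \<open>a \<in> A\<close> e x] by simp
          then show "(\<lambda>s. f s a) holomorphic_on B" using e by (intro sep_holo_holomorphic1) auto
        qed
      qed (use e in auto)
    qed auto
    then show ?thesis using w1 by simp
  qed
  have "sep_holo B (ball a e) f" if "a \<in> A" "e > 0" "cball a e \<subseteq> A" for a e
    using loc[OF that, of a] hol[OF that(1)] that(2) by auto
  then have ex: "\<exists>e>0. ball a e \<subseteq> A \<and> sep_holo B (ball a e) f" if "a \<in> A" for a
    using that op open_contains_cball by (metis ball_subset_cball order_trans)
  have "continuous_on (B \<times> A) (\<lambda>(s, w). f s w)"
  proof (rule continuous_at_imp_continuous_on, clarify)
    fix s a assume "s \<in> B" "a \<in> A"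
    with ex obtain e where "e > 0" "sep_holo B (ball a e) f" by blast
    from sep_holo_cont[OF this(2)] this(1) \<open>s \<in> B\<close> op
    show "isCont (\<lambda>(s, w). f s w) (s, a)"
      by (subst (asm) continuous_on_eq_continuous_at) (auto intro: open_Times)
  qed
  moreover have "(\<lambda>s. f s w) field_differentiable at s \<and> f s field_differentiable at w" if "s \<in> B" "w \<in> A" for s w
    using ex[OF that(2)] that unfolding sep_holo_def by (metis centre_in_ball)
  ultimately show ?thesis unfolding sep_holo_def by blast
qed

section \<open>Residues at a simple pole of the coordinate\<close>

lemma powser_remainder_bigo:
  fixes U g :: "'a \<Rightarrow> complex" and a :: "nat \<Rightarrow> complex"
  assumes sums: "eventually (\<lambda>x. (\<lambda>n. a n * U x ^ n) sums g x) F"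
    and U: "(U \<longlongrightarrow> 0) F" "eventually (\<lambda>x. U x \<noteq> 0) F" and F: "F \<noteq> bot"
  shows "(\<lambda>x. g x - (\<Sum>n<k. a n * U x ^ n)) \<in> O[F](\<lambda>x. U x ^ k)"
proof -
  from eventually_happens'[OF F eventually_conj[OF sums U(2)]]
  obtain x1 where x1: "(\<lambda>n. a n * U x1 ^ n) sums g x1" "U x1 \<noteq> 0" by blast
  define T where "T = (\<lambda>u. \<Sum>n. a (n + k) * u ^ n)"
  have summ: "summable (\<lambda>n. a n * u ^ n)" if "norm u < norm (U x1)" for u
    using powser_inside[OF sums_summable[OF x1(1)] that] .
  have summ': "summable (\<lambda>n. a (n + k) * U x1 ^ n)"
  proof -
    have "summable (\<lambda>n. a (n + k) * U x1 ^ (n + k))"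
      using summable_ignore_initial_segment[OF sums_summable[OF x1(1)]] .
    then have "summable (\<lambda>n. (a (n + k) * U x1 ^ (n + k)) / U x1 ^ k)"
      by (rule summable_divide)
    then show ?thesis using x1(2) by (simp add: power_add)
  qed
  have "isCont T 0"
    unfolding T_def using summ' x1(2) by (intro isCont_powser) auto
  then have "((\<lambda>x. T (U x)) \<longlongrightarrow> T 0) F"
    by (rule isCont_tendsto_compose[OF _ U(1)])
  then have T: "(\<lambda>x. T (U x)) \<in> O[F](\<lambda>_. 1)"
    by (intro bigoI_tendsto[of _ _ "T 0"]) auto
  have "eventually (\<lambda>x. norm (U x) < norm (U x1)) F"
    using tendstoD[OF U(1), of "norm (U x1)"] x1(2) by simp
  then have "eventually (\<lambda>x. g x - (\<Sum>n<k. a n * U x ^ n) = U x ^ k * T (U x)) F"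
    using sums
  proof eventually_elim
    case (elim x)
    have "g x = (\<Sum>n. a (n + k) * U x ^ (n + k)) + (\<Sum>n<k. a n * U x ^ n)"
      using suminf_split_initial_segment[OF summ[OF elim(1)], of k] sums_unique[OF elim(2)] by simp
    also have "(\<Sum>n. a (n + k) * U x ^ (n + k)) = U x ^ k * T (U x)"
    proof -
      have "summable (\<lambda>n. a (n + k) * U x ^ n)"
        using powser_inside[OF summ' elim(1)] .
      from suminf_mult[OF this, of "U x ^ k"] show ?thesis
        by (simp add: T_def power_add mult_ac)
    qed
    finally show ?case by simp
  qed
  then have "(\<lambda>x. g x - (\<Sum>n<k. a n * U x ^ n)) \<in> O[F](\<lambda>x. U x ^ k) \<longleftrightarrow> (\<lambda>x. U x ^ k * T (U x)) \<in> O[F](\<lambda>x. U x ^ k)"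
    by (rule landau_o.big.in_cong)
  also have "\<dots>"
    using landau_o.big.mult[OF landau_o.big_refl T, of "\<lambda>x. U x ^ k"] by simp
  finally show ?thesis .
qed

text \<open>
  \<open>Z = h / (w - c)\<close> is a coordinate with a simple pole at \<open>c\<close>. The circle, about \<open>c0\<close>, does not
  move with \<open>c\<close>; the sign of \<open>res\<close> is that of a positively oriented contour in the \<open>Z\<close>-plane.
\<close>

locale pole_chart =
  fixes c0 c :: complex and r \<rho> :: real and h :: "complex \<Rightarrow> complex"
  assumes rad: "0 < r" "r < \<rho>" "c \<in> ball c0 r"
    and h_hol: "h holomorphic_on ball c0 \<rho>"
    and h_nz: "\<And>w. w \<in> ball c0 \<rho> \<Longrightarrow> h w \<noteq> 0"
begin

definition Z :: "complex \<Rightarrow> complex" where "Z w = h w / (w - c)"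

abbreviation "D \<equiv> ball c0 \<rho> - {c}"

definition res :: "(complex \<Rightarrow> complex) \<Rightarrow> complex" where
  "res \<phi> = - contour_integral (circlepath c0 r) \<phi> / (2 * of_real pi * \<i>)"

lemma c_in: "c \<in> ball c0 \<rho>" "dist c0 c < \<rho>" "dist c0 c < r"
  using rad by auto

lemma open_D [simp]: "open D" by auto

lemma circle_subset: "path_image (circlepath c0 r) \<subseteq> D" "sphere c0 r \<subseteq> D"
  using rad by auto

lemma h_c: "h c \<noteq> 0"
  using h_nz c_in by auto

lemma ev_D: "eventually (\<lambda>w. w \<in> D) (at c)"
  using eventually_at_in_open[of "ball c0 \<rho>" c] c_in by auto

lemma Z_hol: "Z holomorphic_on D"
  unfolding Z_def by (intro holomorphic_intros holomorphic_on_subset[OF h_hol]) auto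

lemma Z'_hol: "deriv Z holomorphic_on D"
  by (rule holomorphic_deriv[OF Z_hol]) auto

lemma Z_nz: "w \<in> D \<Longrightarrow> Z w \<noteq> 0"
  using h_nz by (auto simp: Z_def)

lemma circle_D: "w \<in> sphere c0 r \<Longrightarrow> w \<in> D"
  using circle_subset by blast

lemma Z_nz_circle: "w \<in> sphere c0 r \<Longrightarrow> Z w \<noteq> 0"
  by (intro Z_nz circle_D)

lemma log_deriv_hol: "(\<lambda>w. deriv Z w / Z w) holomorphic_on D"
  by (intro holomorphic_intros Z_hol Z'_hol Z_nz)

lemma has_deriv_Z: "w \<in> D \<Longrightarrow> (Z has_field_derivative deriv Z w) (at w)"
  by (rule holomorphic_derivI[OF Z_hol]) auto

lemma isCont_h: "isCont h c"
  using holomorphic_on_imp_continuous_on[OF h_hol] c_in by (auto simp: continuous_on_eq_continuous_at)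

lemma h_bigo: "h \<in> O[at c](\<lambda>_. 1)"
  using isCont_h by (intro bigoI_tendsto[of _ _ "h c"]) (auto simp: isCont_def)

lemma Z_bigo: "Z \<in> O[at c](\<lambda>w. inverse (w - c))"
  using landau_o.big.mult[OF h_bigo landau_o.big_refl, of "\<lambda>w. inverse (w - c)"]
  by (simp add: Z_def[abs_def] field_simps)

lemma inverse_Z_bigo: "(\<lambda>w. inverse (Z w)) \<in> O[at c](\<lambda>w. w - c)"
proof -
  have "(\<lambda>w. inverse (h w)) \<in> O[at c](\<lambda>_. 1)"
    using isCont_h h_c by (intro bigoI_tendsto[of _ _ "inverse (h c)"]) (auto simp: isCont_def intro!: tendsto_intros)
  from landau_o.big.mult[OF this landau_o.big_refl, of "\<lambda>w. w - c"]
  show ?thesis by (simp add: Z_def[abs_def] field_simps)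
qed

lemma inverse_Z_tendsto: "((\<lambda>w. inverse (Z w)) \<longlongrightarrow> 0) (at c)"
proof -
  have "((\<lambda>w. (w - c) / h w) \<longlongrightarrow> 0 / h c) (at c)"
    using isCont_h h_c by (intro tendsto_intros) (auto simp: isCont_def LIM_zero)
  then show ?thesis by (simp add: Z_def[abs_def] field_simps)
qed

lemma Z_nz_ev: "eventually (\<lambda>w. Z w \<noteq> 0) (at c)"
  using ev_D by eventually_elim (rule Z_nz)

lemma Z'_eq: "w \<in> D \<Longrightarrow> deriv Z w = deriv h w / (w - c) - h w / (w - c)^2"
proof -
  assume w: "w \<in> D"
  then have "((\<lambda>w. h w / (w - c)) has_field_derivative (deriv h w * (w - c) - h w * (1 - 0)) / ((w - c) * (w - c))) (at w)"
    by (intro DERIV_divide DERIV_diff DERIV_ident DERIV_const holomorphic_derivI[OF h_hol open_ball]) auto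
  then have "deriv Z w = (deriv h w * (w - c) - h w * (1 - 0)) / ((w - c) * (w - c))"
    unfolding Z_def[abs_def] by (rule DERIV_imp_deriv)
  then show "deriv Z w = deriv h w / (w - c) - h w / (w - c)^2"
    using w by (simp add: diff_divide_distrib power2_eq_square)
qed

lemma Z'_bigo: "deriv Z \<in> O[at c](\<lambda>w. inverse ((w - c)^2))"
proof -
  have "isCont (deriv h) c"
    using holomorphic_on_imp_continuous_on[OF holomorphic_deriv[OF h_hol open_ball]] c_in
    by (auto simp: continuous_on_eq_continuous_at)
  then have "((\<lambda>w. deriv h w * (w - c) - h w) \<longlongrightarrow> deriv h c * (c - c) - h c) (at c)"
    using isCont_h by (intro tendsto_intros) (auto simp: isCont_def)
  then have 1: "(\<lambda>w. deriv h w * (w - c) - h w) \<in> O[at c](\<lambda>_. 1)"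
    using bigoI_tendsto[of "\<lambda>w. deriv h w * (w - c) - h w" "\<lambda>_. 1"] by simp
  have "eventually (\<lambda>w. deriv Z w = (deriv h w * (w - c) - h w) * inverse ((w - c)^2)) (at c)"
    using ev_D
  proof eventually_elim
    case (elim w)
    have "a / u - b / u^2 = (a * u - b) * inverse (u^2)" if "u \<noteq> 0" for a b u :: complex
      using that by (simp add: field_simps power2_eq_square)
    then show ?case using elim by (simp add: Z'_eq)
  qed
  then have "deriv Z \<in> O[at c](\<lambda>w. inverse ((w - c)^2)) \<longleftrightarrow>
     (\<lambda>w. (deriv h w * (w - c) - h w) * inverse ((w - c)^2)) \<in> O[at c](\<lambda>w. inverse ((w - c)^2))"
    by (rule landau_o.big.in_cong)
  also have \<dots> using landau_o.big.mult[OF 1 landau_o.big_refl, of "\<lambda>w. inverse ((w - c)^2)"] by simp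
  finally show ?thesis .
qed

lemma integrable: "\<phi> holomorphic_on D \<Longrightarrow> \<phi> contour_integrable_on circlepath c0 r"
  using circle_subset rad
  by (intro contour_integrable_continuous_circlepath continuous_on_subset[OF holomorphic_on_imp_continuous_on]) auto

lemma res_cong: "(\<And>w. w \<in> sphere c0 r \<Longrightarrow> \<phi> w = \<psi> w) \<Longrightarrow> res \<phi> = res \<psi>"
  unfolding res_def using rad by (subst contour_integral_cong[of _ _ \<phi> \<psi>]) auto

lemma res_add: "\<phi> holomorphic_on D \<Longrightarrow> \<psi> holomorphic_on D \<Longrightarrow> res (\<lambda>w. \<phi> w + \<psi> w) = res \<phi> + res \<psi>"
  unfolding res_def by (subst contour_integral_add) (auto intro!: integrable simp: field_simps)

lemma res_diff: "\<phi> holomorphic_on D \<Longrightarrow> \<psi> holomorphic_on D \<Longrightarrow> res (\<lambda>w. \<phi> w - \<psi> w) = res \<phi> - res \<psi>"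
  unfolding res_def by (subst contour_integral_diff) (auto intro!: integrable simp: field_simps)

lemma res_cmult: "\<phi> holomorphic_on D \<Longrightarrow> res (\<lambda>w. a * \<phi> w) = a * res \<phi>"
  unfolding res_def by (subst contour_integral_lmul) (auto intro!: integrable simp: field_simps)

lemma res_sum: "finite I \<Longrightarrow> (\<And>i. i \<in> I \<Longrightarrow> \<phi> i holomorphic_on D) \<Longrightarrow> res (\<lambda>w. \<Sum>i\<in>I. \<phi> i w) = (\<Sum>i\<in>I. res (\<phi> i))"
proof (induction I rule: finite_induct)
  case empty
  show ?case by (simp add: res_def)
next
  case (insert i I)
  then show ?case by (simp add: res_add holomorphic_on_sum)
qed

lemma extend:
  assumes "\<phi> holomorphic_on D" "\<phi> \<in> O[at c](\<lambda>_. 1)"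
  obtains \<psi> where "\<psi> holomorphic_on ball c0 \<rho>" "\<And>w. w \<in> D \<Longrightarrow> \<psi> w = \<phi> w"
  using holomorphic_on_extend[of \<phi> "ball c0 \<rho>" c] assms rad by auto

lemma res_bounded:
  assumes "\<phi> holomorphic_on D" "\<phi> \<in> O[at c](\<lambda>_. 1)"
  shows "res \<phi> = 0"
proof -
  obtain \<psi> where \<psi>: "\<psi> holomorphic_on ball c0 \<rho>" "\<And>w. w \<in> D \<Longrightarrow> \<psi> w = \<phi> w"
    using extend[OF assms] by blast
  have "(\<psi> has_contour_integral 0) (circlepath c0 r)"
    by (rule Cauchy_theorem_disc_simple[OF \<psi>(1)]) (use rad in auto)
  then have "contour_integral (circlepath c0 r) \<psi> = 0"
    by (rule contour_integral_unique)
  then have "res \<psi> = 0" by (simp add: res_def)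
  moreover have "res \<phi> = res \<psi>"
    by (intro res_cong \<psi>(2)[symmetric] subsetD[OF circle_subset(2)])
  ultimately show ?thesis by simp
qed

lemma res_deriv:
  assumes "\<psi> holomorphic_on D"
  shows "res (deriv \<psi>) = 0"
proof -
  have "(deriv \<psi> has_contour_integral 0) (circlepath c0 r)"
    by (rule Cauchy_theorem_primitive[of D \<psi>])
      (use circle_subset holomorphic_derivI[OF assms] in \<open>auto intro: has_field_derivative_at_within\<close>)
  then show ?thesis unfolding res_def by (simp add: contour_integral_unique)
qed

lemma res_by_parts:
  assumes "\<phi> holomorphic_on D" "\<psi> holomorphic_on D"
  shows "res (\<lambda>w. \<phi> w * deriv \<psi> w) = - res (\<lambda>w. deriv \<phi> w * \<psi> w)"
proof -
  have "res (deriv (\<lambda>w. \<phi> w * \<psi> w)) = 0"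
    by (rule res_deriv) (intro holomorphic_intros assms)
  also have "res (deriv (\<lambda>w. \<phi> w * \<psi> w)) = res (\<lambda>w. \<phi> w * deriv \<psi> w + deriv \<phi> w * \<psi> w)"
  proof (rule res_cong)
    fix w assume "w \<in> sphere c0 r"
    then have "w \<in> D" using circle_subset by auto
    then show "deriv (\<lambda>w. \<phi> w * \<psi> w) w = \<phi> w * deriv \<psi> w + deriv \<phi> w * \<psi> w"
      using assms by (intro deriv_mult) (auto intro: holomorphic_on_imp_differentiable_at)
  qed
  also have "\<dots> = res (\<lambda>w. \<phi> w * deriv \<psi> w) + res (\<lambda>w. deriv \<phi> w * \<psi> w)"
    by (rule res_add) (intro holomorphic_intros assms; simp)+
  finally show ?thesis by (simp add: eq_neg_iff_add_eq_0)
qed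

lemma res_log_deriv:
  assumes "\<phi> holomorphic_on ball c0 \<rho>"
  shows "res (\<lambda>w. \<phi> w * (deriv Z w / Z w)) = \<phi> c"
proof -
  have 1: "((\<lambda>w. \<phi> w * (deriv h w / h w)) has_contour_integral 0) (circlepath c0 r)"
    by (rule Cauchy_theorem_disc_simple[of _ c0 \<rho>])
      (use rad h_nz in \<open>auto intro!: holomorphic_intros assms h_hol\<close>)
  have 2: "((\<lambda>w. \<phi> w / (w - c)) has_contour_integral (2 * of_real pi * \<i> * \<phi> c)) (circlepath c0 r)"
    by (rule Cauchy_integral_circlepath_simple)
      (use rad in \<open>auto intro!: holomorphic_on_subset[OF assms] simp: dist_norm norm_minus_commute\<close>)
  have "res (\<lambda>w. \<phi> w * (deriv Z w / Z w)) = res (\<lambda>w. \<phi> w * (deriv h w / h w) - \<phi> w / (w - c))"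
  proof (rule res_cong)
    fix w assume "w \<in> sphere c0 r"
    then have "w \<in> D" using circle_subset by auto
    then show "\<phi> w * (deriv Z w / Z w) = \<phi> w * (deriv h w / h w) - \<phi> w / (w - c)"
      using h_nz[of w] unfolding Z'_eq[OF \<open>w \<in> D\<close>] Z_def by (simp add: divide_simps power2_eq_square) (simp add: algebra_simps)
  qed
  also have "\<dots> = \<phi> c"
    using contour_integral_unique[OF has_contour_integral_diff[OF 1 2]] by (simp add: res_def)
  finally show ?thesis .
qed

lemma res_poly: "res (\<lambda>w. poly p (Z w) * deriv Z w) = 0"
proof -
  define P where "P = (\<lambda>x. \<Sum>i\<le>degree p. coeff p i / of_nat (Suc i) * x ^ Suc i)"
  have P: "(P has_field_derivative poly p x) (at x)" for x
    unfolding P_def poly_altdef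
  proof (rule DERIV_sum)
    fix i
    show "((\<lambda>x. coeff p i / of_nat (Suc i) * x ^ Suc i) has_field_derivative coeff p i * x ^ i) (at x)"
    proof -
      have "1 + of_nat i \<noteq> (0::complex)" by (metis of_nat_Suc of_nat_neq_0)
      then have "coeff p i / of_nat (Suc i) * ((1 + of_nat i) * (1 * x ^ i)) = coeff p i * x ^ i"
        by (simp add: of_nat_Suc)
      then show ?thesis
        using DERIV_cmult[OF DERIV_power_Suc[OF DERIV_ident], of "coeff p i / of_nat (Suc i)" i x UNIV] by metis
    qed
  qed
  have "res (\<lambda>w. poly p (Z w) * deriv Z w) = res (deriv (\<lambda>w. P (Z w)))"
  proof (rule res_cong)
    fix w assume "w \<in> sphere c0 r"
    then have "w \<in> D" using circle_subset by auto
    show "poly p (Z w) * deriv Z w = deriv (\<lambda>w. P (Z w)) w"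
      by (rule DERIV_imp_deriv[symmetric]) (rule DERIV_chain2[OF P has_deriv_Z[OF \<open>w \<in> D\<close>]])
  qed
  also have "\<dots> = 0"
    unfolding P_def by (rule res_deriv) (intro holomorphic_intros Z_hol)
  finally show ?thesis .
qed

lemma res_inverse: "res (\<lambda>w. deriv Z w / Z w) = 1"
  using res_log_deriv[of "\<lambda>_. 1"] by simp

end

locale pole_expansion = pole_chart +
  fixes m :: "complex \<Rightarrow> complex" and N :: nat and tt v :: "nat \<Rightarrow> complex"
  assumes m_hol: "m holomorphic_on D"
    and m_exp: "eventually (\<lambda>w. (\<lambda>n. v (n + 2) / Z w ^ (n + 2)) sums
      (m w - (\<Sum>n=1..N. of_nat n * tt n * Z w ^ (n - 1)) - tt 0 / Z w)) (at c)"
begin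

definition Xi :: "complex \<Rightarrow> complex" where "Xi \<zeta> = (\<Sum>n=1..N. of_nat n * tt n * \<zeta> ^ (n - 1)) + tt 0 / \<zeta>"
definition xi :: "complex \<Rightarrow> complex" where "xi \<zeta> = (\<Sum>n=1..N. tt n * \<zeta> ^ n)"
definition rem :: "complex \<Rightarrow> complex" where "rem w = m w - Xi (Z w)"

definition Xp :: "complex poly" where "Xp = (\<Sum>n=1..N. monom (of_nat n * tt n) (n - 1))"

lemma Xi_eq: "Xi \<zeta> = poly Xp \<zeta> + tt 0 / \<zeta>"
  by (simp add: Xi_def Xp_def poly_sum poly_monom)

lemma Xi_hol: "(\<lambda>w. Xi (Z w)) holomorphic_on D"
  unfolding Xi_def by (intro holomorphic_intros Z_hol Z_nz)

lemma xi_hol: "(\<lambda>w. xi (Z w)) holomorphic_on D"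
  unfolding xi_def by (intro holomorphic_intros Z_hol)

lemma rem_hol: "rem holomorphic_on D"
  unfolding rem_def by (intro holomorphic_intros m_hol Xi_hol)

lemma deriv_xi: "w \<in> D \<Longrightarrow> deriv (\<lambda>w. xi (Z w)) w = Xi (Z w) * deriv Z w - tt 0 * (deriv Z w / Z w)"
  unfolding xi_def Xi_def
  by (intro DERIV_imp_deriv)
    (auto intro!: derivative_eq_intros has_deriv_Z sum.cong simp: sum_distrib_left sum_distrib_right algebra_simps)

lemma rem_bigo_inverse_Z:
  "(\<lambda>w. rem w - (\<Sum>n<k. v (n + 2) / Z w ^ (n + 2))) \<in> O[at c](\<lambda>w. inverse (Z w) ^ (k + 2))"
proof -
  have 1: "eventually (\<lambda>w. (\<lambda>n. v (n + 2) * inverse (Z w) ^ n) sums (Z w ^ 2 * rem w)) (at c)"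
    using m_exp ev_D
  proof eventually_elim
    case (elim w)
    have "(\<lambda>n. Z w ^ 2 * (v (n + 2) / Z w ^ (n + 2))) sums (Z w ^ 2 * rem w)"
      using sums_mult[OF elim(1), of "Z w ^ 2"] by (simp add: rem_def Xi_def algebra_simps)
    moreover have "(\<lambda>n. Z w ^ 2 * (v (n + 2) / Z w ^ (n + 2))) = (\<lambda>n. v (n + 2) * inverse (Z w) ^ n)"
      using Z_nz[OF elim(2)] by (simp add: fun_eq_iff power_add power2_eq_square field_simps)
    ultimately show ?case by simp
  qed
  have "(\<lambda>w. Z w ^ 2 * rem w - (\<Sum>n<k. v (n + 2) * inverse (Z w) ^ n)) \<in> O[at c](\<lambda>w. inverse (Z w) ^ k)"
    by (rule powser_remainder_bigo[OF 1 inverse_Z_tendsto]) (use Z_nz_ev in auto)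
  from landau_o.big.mult[OF landau_o.big_refl[of "\<lambda>w. inverse (Z w) ^ 2" "at c"] this]
  have "(\<lambda>w. inverse (Z w) ^ 2 * (Z w ^ 2 * rem w - (\<Sum>n<k. v (n + 2) * inverse (Z w) ^ n))) \<in> O[at c](\<lambda>w. inverse (Z w) ^ (k + 2))"
    by (simp add: power_add power2_eq_square mult_ac)
  also have "?this \<longleftrightarrow> ?thesis"
    by (intro landau_o.big.in_cong eventually_mono[OF Z_nz_ev])
      (simp add: field_simps sum_distrib_left power_add power2_eq_square)
  finally show ?thesis .
qed

lemma rem_bigo: "(\<lambda>w. rem w - (\<Sum>n<k. v (n + 2) / Z w ^ (n + 2))) \<in> O[at c](\<lambda>w. (w - c) ^ (k + 2))"
  using rem_bigo_inverse_Z[of k] landau_o.big_power[OF inverse_Z_bigo, of "k + 2"] by (rule landau_o.big_trans)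

lemma rem_bigo0: "rem \<in> O[at c](\<lambda>w. (w - c) ^ 2)"
  using rem_bigo[of 0] by (simp add: power2_eq_square)

lemma rem_form_bounded: "(\<lambda>w. rem w * deriv Z w) \<in> O[at c](\<lambda>_. 1)"
proof -
  have "(\<lambda>w. rem w * deriv Z w) \<in> O[at c](\<lambda>w. (w - c) ^ 2 * inverse ((w - c)^2))"
    by (intro landau_o.big.mult rem_bigo0 Z'_bigo)
  also have "(\<lambda>w. (w - c) ^ 2 * inverse ((w - c)^2)) \<in> O[at c](\<lambda>_. 1)"
    by (intro bigoI[of _ 1]) (auto simp: eventually_at_filter)
  finally show ?thesis .
qed

lemma res_power_rem:
  assumes "n \<ge> 1"
  shows "res (\<lambda>w. Z w ^ n * rem w * deriv Z w) = v (n + 1)"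
proof -
  define R where "R = (\<lambda>w. rem w - (\<Sum>j<n. v (j + 2) / Z w ^ (j + 2)))"
  have Rh: "R holomorphic_on D"
    unfolding R_def by (intro holomorphic_intros rem_hol Z_hol) (use Z_nz in auto)
  have "(\<lambda>w. Z w ^ n * R w * deriv Z w) \<in> O[at c](\<lambda>w. inverse (w - c) ^ n * (w - c) ^ (n + 2) * inverse ((w - c)^2))"
    unfolding R_def by (intro landau_o.big.mult rem_bigo Z'_bigo landau_o.big_power Z_bigo)
  also have "(\<lambda>w. inverse (w - c) ^ n * (w - c) ^ (n + 2) * inverse ((w - c)^2)) \<in> O[at c](\<lambda>_. 1)"
  proof (intro bigoI[of _ 1])
    have "inverse u ^ n * u ^ (n + 2) * inverse (u^2) = 1" if "u \<noteq> 0" for u :: complex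
      using that by (simp add: field_simps power_add power2_eq_square)
    then show "eventually (\<lambda>w. norm (inverse (w - c) ^ n * (w - c) ^ (n + 2) * inverse ((w - c)^2)) \<le> 1 * norm (1::complex)) (at c)"
      by (auto simp: eventually_at_filter)
  qed
  finally have 0: "res (\<lambda>w. Z w ^ n * R w * deriv Z w) = 0"
    by (intro res_bounded) (intro holomorphic_intros Z_hol Rh Z'_hol)
  have t: "res (\<lambda>w. Z w ^ n * (v (j + 2) / Z w ^ (j + 2)) * deriv Z w) = (if Suc j = n then v (n + 1) else 0)"
    if "j < n" for j
  proof (cases "Suc j = n")
    case True
    have "res (\<lambda>w. Z w ^ n * (v (j + 2) / Z w ^ (j + 2)) * deriv Z w) = res (\<lambda>w. v (n + 1) * (deriv Z w / Z w))"
      by (rule res_cong) (use Z_nz_circle True in \<open>auto simp: field_simps power_add power2_eq_square\<close>)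
    also have "\<dots> = v (n + 1)"
      by (simp only: res_cmult[OF log_deriv_hol] res_inverse mult_1_right)
    finally show ?thesis using True by simp
  next
    case False
    with that obtain i where i: "n = i + (j + 2)" by (metis Suc_lessI add.commute add_2_eq_Suc' less_iff_Suc_add add_Suc_right)
    have "res (\<lambda>w. Z w ^ n * (v (j + 2) / Z w ^ (j + 2)) * deriv Z w) = res (\<lambda>w. poly (monom (v (j + 2)) i) (Z w) * deriv Z w)"
      by (rule res_cong) (use Z_nz_circle in \<open>auto simp: i poly_monom field_simps power_add power2_eq_square\<close>)
    then show ?thesis using False by (simp add: res_poly)
  qed
  have "res (\<lambda>w. Z w ^ n * rem w * deriv Z w) =
      res (\<lambda>w. Z w ^ n * R w * deriv Z w + (\<Sum>j<n. Z w ^ n * (v (j + 2) / Z w ^ (j + 2)) * deriv Z w))"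
    by (rule res_cong) (simp add: R_def algebra_simps sum_distrib_left sum_distrib_right)
  also have "\<dots> = (\<Sum>j<n. if Suc j = n then v (n + 1) else 0)"
  proof -
    have 1: "(\<lambda>w. Z w ^ n * (v (j + 2) / Z w ^ (j + 2)) * deriv Z w) holomorphic_on D" for j
      by (intro holomorphic_intros Z_hol Z'_hol) (use Z_nz in auto)
    have 2: "(\<lambda>w. Z w ^ n * R w * deriv Z w) holomorphic_on D"
      by (intro holomorphic_intros Z_hol Rh Z'_hol)
    have 3: "(\<lambda>w. \<Sum>j<n. Z w ^ n * (v (j + 2) / Z w ^ (j + 2)) * deriv Z w) holomorphic_on D"
      by (intro holomorphic_on_sum 1)
    have "res (\<lambda>w. \<Sum>j<n. Z w ^ n * (v (j + 2) / Z w ^ (j + 2)) * deriv Z w)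
        = (\<Sum>j<n. res (\<lambda>w. Z w ^ n * (v (j + 2) / Z w ^ (j + 2)) * deriv Z w))"
      by (rule res_sum[OF finite_lessThan 1])
    then have "res (\<lambda>w. Z w ^ n * R w * deriv Z w + (\<Sum>j<n. Z w ^ n * (v (j + 2) / Z w ^ (j + 2)) * deriv Z w))
        = (\<Sum>j<n. res (\<lambda>w. Z w ^ n * (v (j + 2) / Z w ^ (j + 2)) * deriv Z w))"
      by (subst res_add[OF 2 3]) (simp only: 0 add_0)
    also have "\<dots> = (\<Sum>j<n. if Suc j = n then v (n + 1) else 0)"
      by (intro sum.cong refl t) simp
    finally show ?thesis .
  qed
  also have "\<dots> = v (n + 1)"
  proof -
    have "(\<Sum>j<n. if Suc j = n then v (n + 1) else 0) = (\<Sum>j<n. if j = n - 1 then v (n + 1) else 0)"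
      using assms by (intro sum.cong) auto
    then show ?thesis using assms by simp
  qed
  finally show ?thesis .
qed

lemma res_power_Xi: "n \<ge> 1 \<Longrightarrow> res (\<lambda>w. Z w ^ n * Xi (Z w) * deriv Z w) = 0"
proof -
  assume n: "n \<ge> 1"
  have "res (\<lambda>w. Z w ^ n * Xi (Z w) * deriv Z w) = res (\<lambda>w. poly (monom 1 n * Xp + monom (tt 0) (n - 1)) (Z w) * deriv Z w)"
    by (rule res_cong) (use Z_nz_circle n in \<open>auto simp: Xi_eq poly_monom algebra_simps power_eq_if\<close>)
  then show ?thesis by (simp only: res_poly)
qed

lemma m_eq: "m w = Xi (Z w) + rem w"
  by (simp add: rem_def)

lemma res_coefficient:
  assumes "n \<ge> 1"
  shows "res (\<lambda>w. Z w ^ n * m w * deriv Z w) = v (n + 1)"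
proof -
  have "res (\<lambda>w. Z w ^ n * m w * deriv Z w) = res (\<lambda>w. Z w ^ n * Xi (Z w) * deriv Z w + Z w ^ n * rem w * deriv Z w)"
    by (rule res_cong) (simp add: rem_def algebra_simps)
  also have "\<dots> = v (n + 1)"
    using assms by (subst res_add) (auto intro!: holomorphic_intros Z_hol Xi_hol rem_hol Z'_hol simp: res_power_Xi res_power_rem)
  finally show ?thesis .
qed

lemma res_square:
  "res (\<lambda>w. Z w * m w ^ 2 * deriv Z w) = 2 * (\<Sum>n=1..N. of_nat n * tt n * v (n + 1)) + tt 0 ^ 2"
proof -
  note hol = Z_hol Xi_hol rem_hol Z'_hol Z_nz
  let ?A = "\<lambda>w. poly (pCons 0 (Xp ^ 2) + smult (2 * tt 0) Xp) (Z w) * deriv Z w"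
  have "res (\<lambda>w. Z w * m w ^ 2 * deriv Z w) = 
     res (\<lambda>w. ?A w + ((tt 0)^2 * (deriv Z w / Z w) + (2 * (\<Sum>n=1..N. of_nat n * tt n * (Z w ^ n * rem w * deriv Z w))
      + (2 * tt 0 * (rem w * deriv Z w) + Z w * rem w ^ 2 * deriv Z w))))"
  proof (rule res_cong)
    fix w assume "w \<in> sphere c0 r"
    then have "Z w \<noteq> 0" by (rule Z_nz_circle)
    have s: "(\<Sum>n=1..N. of_nat n * tt n * (Z w ^ n * rem w * deriv Z w)) = poly Xp (Z w) * Z w * rem w * deriv Z w"
      unfolding Xp_def by (auto simp: poly_sum poly_monom sum_distrib_left sum_distrib_right power_eq_if mult_ac intro!: sum.cong)
    show "Z w * m w ^ 2 * deriv Z w = ?A w + ((tt 0)^2 * (deriv Z w / Z w) + (2 * (\<Sum>n=1..N. of_nat n * tt n * (Z w ^ n * rem w * deriv Z w))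
      + (2 * tt 0 * (rem w * deriv Z w) + Z w * rem w ^ 2 * deriv Z w)))"
    proof -
      have *: "z * (p + t / z + \<rho>)^2 * d = (z * p^2 + 2 * t * p) * d + (t^2 * (d / z) + (2 * (p * z * \<rho> * d) + (2 * t * (\<rho> * d) + z * \<rho>^2 * d)))"
        if "z \<noteq> 0" for z p t \<rho> d :: complex
      proof -
        define y where "y = t / z"
        have t: "t = y * z" using that by (simp add: y_def)
        have 1: "t / z = y" "t^2 * (d / z) = y^2 * z * d"
          using that by (simp_all add: t power2_eq_square)
        show ?thesis
          unfolding 1 unfolding t by (simp add: power2_eq_square algebra_simps)
      qed
      show ?thesis
      proof -
        have A: "poly (pCons 0 (Xp ^ 2) + smult (2 * tt 0) Xp) (Z w) = Z w * poly Xp (Z w) ^ 2 + 2 * tt 0 * poly Xp (Z w)"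
          by (simp only: poly_add poly_pCons poly_smult poly_power add_0)
        show ?thesis
          unfolding s m_eq[of w] Xi_eq A by (rule *[OF \<open>Z w \<noteq> 0\<close>])
      qed
    qed
  qed
  also have "\<dots> = res ?A + ((tt 0)^2 * res (\<lambda>w. deriv Z w / Z w) + (2 * (\<Sum>n=1..N. of_nat n * tt n * res (\<lambda>w. Z w ^ n * rem w * deriv Z w))
      + (2 * tt 0 * res (\<lambda>w. rem w * deriv Z w) + res (\<lambda>w. Z w * rem w ^ 2 * deriv Z w))))"
    by (intro refl trans[OF res_add] trans[OF res_cmult] trans[OF res_sum] arg_cong2[where f="(+)"]
      arg_cong2[where f="(*)"] sum.cong holomorphic_intros hol; simp)
  also have "res ?A = 0" by (rule res_poly)
  also have "res (\<lambda>w. rem w * deriv Z w) = 0"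
    by (rule res_bounded) (intro holomorphic_intros hol rem_form_bounded)+
  also have "res (\<lambda>w. Z w * rem w ^ 2 * deriv Z w) = 0"
  proof (rule res_bounded)
    have "(\<lambda>w. Z w * rem w ^ 2 * deriv Z w) \<in> O[at c](\<lambda>w. inverse (w - c) * ((w - c) ^ 2)^2 * inverse ((w - c)^2))"
      by (intro landau_o.big.mult rem_bigo0 Z'_bigo landau_o.big_power Z_bigo)
    also have "(\<lambda>w. inverse (w - c) * ((w - c) ^ 2)^2 * inverse ((w - c)^2)) \<in> O[at c](\<lambda>w. w - c)"
    proof (intro bigoI[of _ 1])
      have "inverse u * (u^2)^2 * inverse (u^2) = u" if "u \<noteq> 0" for u :: complex
        using that by (simp add: power2_eq_square field_simps)
      then show "eventually (\<lambda>w. norm (inverse (w - c) * ((w - c)^2)^2 * inverse ((w - c)^2)) \<le> 1 * norm (w - c)) (at c)"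
        by (auto simp: eventually_at_filter)
    qed
    also have "(\<lambda>w. w - c) \<in> O[at c](\<lambda>_. 1)"
      by (intro bigoI_tendsto[of _ _ 0]) (auto simp: LIM_zero)
    finally show "(\<lambda>w. Z w * rem w ^ 2 * deriv Z w) \<in> O[at c](\<lambda>_. 1)" .
  qed (intro holomorphic_intros hol)
  finally show ?thesis by (simp add: res_inverse res_power_rem)
qed

lemma res_pairing:
  assumes \<Omega>: "\<Omega> holomorphic_on D" "(\<lambda>w. \<Omega> w - e * Z w ^ n) \<in> O[at c](\<lambda>_. 1)" and n: "n \<ge> 1"
  shows "res (\<lambda>w. \<Omega> w * (m w * deriv Z w)) =
    e * v (n + 1) - res (\<lambda>w. xi (Z w) * deriv \<Omega> w) + tt 0 * res (\<lambda>w. \<Omega> w * (deriv Z w / Z w))"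
proof -
  note hol = Z_hol Xi_hol xi_hol rem_hol m_hol Z'_hol Z_nz \<Omega>(1)
  have "(\<lambda>w. (\<Omega> w - e * Z w ^ n) * (rem w * deriv Z w)) \<in> O[at c](\<lambda>_. 1 * 1)"
    by (intro landau_o.big.mult \<Omega>(2) rem_form_bounded)
  then have "res (\<lambda>w. (\<Omega> w - e * Z w ^ n) * (rem w * deriv Z w)) = 0"
    by (intro res_bounded) (auto intro!: holomorphic_intros hol)
  also have "res (\<lambda>w. (\<Omega> w - e * Z w ^ n) * (rem w * deriv Z w)) =
     res (\<lambda>w. \<Omega> w * (rem w * deriv Z w) - e * (Z w ^ n * rem w * deriv Z w))"
    by (rule res_cong) (simp add: algebra_simps)
  also have "\<dots> = res (\<lambda>w. \<Omega> w * (rem w * deriv Z w)) - e * v (n + 1)"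
    by (simp add: res_diff res_cmult holomorphic_intros hol res_power_rem[OF n, simplified])
  finally have 1: "res (\<lambda>w. \<Omega> w * (rem w * deriv Z w)) = e * v (n + 1)" by simp
  have "res (\<lambda>w. \<Omega> w * (m w * deriv Z w)) = 
    res (\<lambda>w. \<Omega> w * (rem w * deriv Z w) + (\<Omega> w * deriv (\<lambda>w. xi (Z w)) w + tt 0 * (\<Omega> w * (deriv Z w / Z w))))"
  proof (rule res_cong)
    fix w assume "w \<in> sphere c0 r"
    then have "w \<in> D" using circle_subset by auto
    then show "\<Omega> w * (m w * deriv Z w) = \<Omega> w * (rem w * deriv Z w) + (\<Omega> w * deriv (\<lambda>w. xi (Z w)) w + tt 0 * (\<Omega> w * (deriv Z w / Z w)))"
      by (simp add: deriv_xi rem_def algebra_simps)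
  qed
  also have "\<dots> = e * v (n + 1) + (res (\<lambda>w. \<Omega> w * deriv (\<lambda>w. xi (Z w)) w) + tt 0 * res (\<lambda>w. \<Omega> w * (deriv Z w / Z w)))"
    by (intro trans[OF res_add] trans[OF res_cmult] arg_cong2[where f="(+)"]
      arg_cong2[where f="(*)"] 1 refl holomorphic_intros hol; simp)
  also have "res (\<lambda>w. \<Omega> w * deriv (\<lambda>w. xi (Z w)) w) = - res (\<lambda>w. xi (Z w) * deriv \<Omega> w)"
    by (subst res_by_parts) (auto intro!: hol simp: mult.commute)
  finally show ?thesis by simp
qed

end

section \<open>Principal parts\<close>

lemma laurent_remainder_bigo:
  assumes g: "g has_laurent_expansion L"
  shows "(\<lambda>w. g w - poly (fls_prpart L) (inverse w) - (\<Sum>j<k. fls_nth L (int j) * w ^ j)) \<in> O[at 0](\<lambda>w. w ^ k)"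
proof -
  define E where "E = L - (\<Sum>i\<le>degree (fls_prpart L). fls_const (coeff (fls_prpart L) i) * fls_X_inv ^ i)
     - (\<Sum>j<k. fls_const (fls_nth L (int j)) * fls_X ^ j)"
  let ?d = "\<lambda>w. g w - (\<Sum>i\<le>degree (fls_prpart L). coeff (fls_prpart L) i * inverse w ^ i) - (\<Sum>j<k. fls_nth L (int j) * w ^ j)"
  have E: "?d has_laurent_expansion E"
    unfolding E_def by (intro laurent_expansion_intros g)
  have nth: "fls_nth E n = 0" if "n < int k" for n
  proof -
    have 1: "fls_nth (\<Sum>i\<le>degree (fls_prpart L). fls_const (coeff (fls_prpart L) i) * fls_X_inv ^ i) n = (if n < 0 then fls_nth L n else 0)"
    proof (cases "n < 0")
      case True
      have "(\<Sum>i\<le>degree (fls_prpart L). coeff (fls_prpart L) i * (if n = - int i then 1 else 0))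
         = (\<Sum>i\<le>degree (fls_prpart L). if i = nat (-n) then coeff (fls_prpart L) (nat (-n)) else 0)"
        using True by (intro sum.cong) auto
      also have "\<dots> = coeff (fls_prpart L) (nat (-n))"
        by (auto simp: coeff_eq_0 simp del: fls_prpart_coeff degree_fls_prpart)
      finally show ?thesis using True by (simp add: fls_nth_sum del: degree_fls_prpart)
    next
      case False
      then have "(\<Sum>i\<le>degree (fls_prpart L). coeff (fls_prpart L) i * (if n = - int i then 1 else 0)) = 0"
        by (intro sum.neutral) auto
      then show ?thesis using False by (simp add: fls_nth_sum del: degree_fls_prpart)
    qed
    have 2: "fls_nth (\<Sum>j<k. fls_const (fls_nth L (int j)) * fls_X ^ j) n = (if n < 0 then 0 else fls_nth L n)"
    proof (cases "n < 0")
      case True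
      then show ?thesis by (auto simp: fls_nth_sum intro!: sum.neutral)
    next
      case False
      have "(\<Sum>j<k. fls_nth L (int j) * (if n = int j then 1 else 0)) = (\<Sum>j<k. if j = nat n then fls_nth L n else 0)"
        using False by (intro sum.cong) auto
      also have "\<dots> = fls_nth L n" using False that by auto
      finally show ?thesis using False by (simp add: fls_nth_sum)
    qed
    show ?thesis unfolding E_def using 1 2 that by (simp del: fls_prpart_coeff degree_fls_prpart)
  qed
  have "(\<lambda>w. ?d w * w powi (- int k)) has_laurent_expansion fls_shift (int k) E"
    by (rule has_laurent_expansion_shift'[OF E])
  moreover have "fls_subdegree (fls_shift (int k) E) \<ge> 0"
    by (rule fls_subdegree_ge0I) (simp add: nth)
  ultimately have "(\<lambda>w. ?d w * w powi (- int k)) \<midarrow>0\<rightarrow> fls_nth (fls_shift (int k) E) 0"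
    by (rule has_laurent_expansion_imp_tendsto_0)
  then have "(\<lambda>w. ?d w * w powi (- int k)) \<in> O[at 0](\<lambda>_. 1)"
    using bigoI_tendsto[of "\<lambda>w. ?d w * w powi (- int k)" "\<lambda>_. 1"] by simp
  from landau_o.big.mult[OF this landau_o.big_refl[of "\<lambda>w. w ^ k" "at 0"]]
  have "(\<lambda>w. ?d w * w powi (- int k) * w ^ k) \<in> O[at 0](\<lambda>w. w ^ k)" by simp
  also have "?this \<longleftrightarrow> ?d \<in> O[at 0](\<lambda>w. w ^ k)"
    by (intro landau_o.big.in_cong) (auto simp: eventually_at_filter power_int_minus)
  finally show ?thesis by (simp add: poly_altdef)
qed

lemma principal_part_holomorphic: "principal_part a f holomorphic_on - {a}"
  unfolding principal_part_def by (intro holomorphic_intros) auto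

lemma principal_part_bigo:
  assumes "isolated_singularity_at f a" "not_essential f a"
  shows "(\<lambda>p. f p - principal_part a f p) \<in> O[at a](\<lambda>_. 1)"
proof -
  have "(\<lambda>x. f (a + x)) has_laurent_expansion laurent_expansion f a"
    by (rule not_essential_has_laurent_expansion[OF assms])
  from laurent_remainder_bigo[OF this, of 0]
  have "(\<lambda>x. f (a + x) - principal_part a f (a + x)) \<in> O[at 0](\<lambda>_. 1)"
    by (simp add: principal_part_def divide_inverse)
  then show ?thesis
    by (subst at_to_0[of a]) (simp add: landau_o.big.in_filtermap_iff add.commute)
qed

lemma principal_part_at_infinity: "(\<lambda>w. principal_part a f (1 / w)) \<in> O[at 0](\<lambda>w. w)"
proof -
  obtain Q where Q: "fls_prpart (laurent_expansion f a) = pCons 0 Q"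
    by (metis coeff_pCons_0 fls_prpart_coeff pCons_cases)
  have "((\<lambda>w. inverse (1 - a * w)) \<longlongrightarrow> inverse (1 - a * 0)) (at 0)"
    by (intro tendsto_intros) auto
  then have u: "((\<lambda>w. inverse (1 - a * w)) \<longlongrightarrow> 1) (at 0)" by simp
  have "((\<lambda>w. w * inverse (1 - a * w)) \<longlongrightarrow> 0 * 1) (at 0)"
    by (intro tendsto_intros u)
  then have "((\<lambda>w. inverse (1 - a * w) * poly Q (w * inverse (1 - a * w))) \<longlongrightarrow> 1 * poly Q (0 * 1)) (at 0)"
    by (intro tendsto_intros u)
  then have "(\<lambda>w. inverse (1 - a * w) * poly Q (w * inverse (1 - a * w))) \<in> O[at 0](\<lambda>_. 1)"
    using bigoI_tendsto[of "\<lambda>w. inverse (1 - a * w) * poly Q (w * inverse (1 - a * w))" "\<lambda>_. 1"] by simp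
  from landau_o.big.mult[OF landau_o.big_refl[of "\<lambda>w. w" "at 0"] this]
  have "(\<lambda>w. w * (inverse (1 - a * w) * poly Q (w * inverse (1 - a * w)))) \<in> O[at 0](\<lambda>w. w)" by simp
  also have "?this \<longleftrightarrow> ?thesis"
  proof (intro landau_o.big.in_cong)
    have "eventually (\<lambda>w. 1 / (1 / w - a) = w * inverse (1 - a * w)) (at 0)"
      unfolding eventually_at_filter by (auto simp: field_simps)
    then show "eventually (\<lambda>w. w * (inverse (1 - a * w) * poly Q (w * inverse (1 - a * w))) = principal_part a f (1 / w)) (at 0)"
      by eventually_elim (simp add: principal_part_def Q mult_ac)
  qed
  finally show ?thesis .
qed

lemma polynomial_part_holomorphic: "polynomial_part f holomorphic_on A"
  unfolding polynomial_part_def Let_def by (intro holomorphic_intros)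

lemma polynomial_part_bigo:
  assumes "isolated_singularity_at (\<lambda>w. f (1 / w)) 0" "not_essential (\<lambda>w. f (1 / w)) 0"
  shows "(\<lambda>w. f (1 / w) - polynomial_part f (1 / w)) \<in> O[at 0](\<lambda>w. w)"
  using laurent_remainder_bigo[OF not_essential_has_laurent_expansion_0[OF assms], of 1]
  by (simp add: polynomial_part_def Let_def divide_inverse algebra_simps)

section \<open>Cuts\<close>

lemma cut_to_infinity_closed_interior:
  assumes "cut_to_infinity a C"
  shows "closed C" "interior C = {}"
proof -
  obtain g :: "real \<Rightarrow> complex" where g: "continuous_on {0..} g" "inj_on g {0..}" "g 0 = a"
    "filterlim g at_infinity at_top" "C = g ` {0..}"
    using assms unfolding cut_to_infinity_def by blast
  have trunc: "\<exists>n\<ge>0. C \<inter> ball 0 R \<subseteq> g ` {0..n}" for R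
  proof -
    have "eventually (\<lambda>s. R < norm (g s)) at_top"
      using g(4) eventually_at_infinity_pos[of "\<lambda>x. R < norm x"] 
      by (auto simp: filterlim_at_infinity_conv_norm_at_top filterlim_at_top_dense)
    then obtain n where n: "\<And>s. s \<ge> n \<Longrightarrow> R < norm (g s)"
      by (auto simp: eventually_at_top_linorder)
    have "C \<inter> ball 0 R \<subseteq> g ` {0..max 0 n}"
    proof
      fix y assume "y \<in> C \<inter> ball 0 R"
      then obtain s where s: "s \<ge> 0" "y = g s" "norm (g s) < R" using g(5) by auto
      then have "s \<le> n" using n[of s] by (cases "s \<le> n") auto
      then show "y \<in> g ` {0..max 0 n}" using s by auto
    qed
    then show ?thesis by (intro exI[of _ "max 0 n"]) auto
  qed
  have comp: "compact (g ` {0..n})" for n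
    by (intro compact_continuous_image continuous_on_subset[OF g(1)]) auto
  show "closed C"
    unfolding closed_sequential_limits
  proof (intro allI impI, elim conjE)
    fix x l assume x: "\<forall>n. x n \<in> C" "x \<longlonglongrightarrow> l"
    then have "bounded (range x)" by (intro convergent_imp_bounded) (auto simp: convergent_def)
    then obtain R where "\<And>n. x n \<in> ball 0 R"
      by (metis bounded_subset_ballD rangeI subset_iff)
    then obtain k where "\<And>n. x n \<in> g ` {0..k}" "k \<ge> 0" using trunc[of R] x by blast
    then have "l \<in> g ` {0..k}"
      using x comp[of k] by (meson closed_sequentially compact_imp_closed)
    then show "l \<in> C" using g(5) by auto
  qed
  show "interior C = {}"
  proof (rule ccontr)
    assume "interior C \<noteq> {}"
    then obtain x e where e: "e > 0" "ball x e \<subseteq> C" by (meson ex_in_conv mem_interior)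
    have "ball x e \<subseteq> ball 0 (norm x + e)"
    proof
      fix y assume "y \<in> ball x e"
      then show "y \<in> ball 0 (norm x + e)"
        using norm_triangle_ineq2[of y x] by (simp add: dist_norm norm_minus_commute)
    qed
    then obtain n where n: "ball x e \<subseteq> g ` {0..n}" using trunc[of "norm x + e"] e by blast
    define f where "f = the_inv_into {0..n} g"
    have inj: "inj_on g {0..n}" using g(2) by (rule inj_on_subset) auto
    have cf: "continuous_on (ball x e) f"
      unfolding f_def
      by (rule continuous_on_subset[OF continuous_on_inv_into n])
        (use inj in \<open>auto intro: continuous_on_subset[OF g(1)]\<close>)
    have injf: "inj_on f (ball x e)"
      unfolding f_def by (rule inj_on_subset[OF inj_on_the_inv_into[OF inj] n])
    define y where "y = (\<lambda>j::nat. x + of_real (e * j / 4))"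
    have y: "y j \<in> ball x e" if "j < 4" for j
      using that e by (auto simp: y_def dist_norm norm_mult)
    have neq: "f (y i) \<noteq> f (y j)" if "i < 4" "j < 4" "i \<noteq> j" for i j
    proof -
      have "y i \<noteq> y j" using that e by (auto simp: y_def)
      then show ?thesis using inj_onD[OF injf] y that by blast
    qed
    have no: False if "i < 4" "j < 4" "k < 4" "f (y i) < f (y j)" "f (y j) < f (y k)" for i j k
    proof -
      have "connected (f ` (ball x e - {y j}))"
        by (intro connected_continuous_image continuous_on_subset[OF cf] connected_open_diff_countable) auto
      then have "{f (y i)..f (y k)} \<subseteq> f ` (ball x e - {y j})"
        by (rule connected_contains_Icc) (use that y in auto)
      then have "f (y j) \<in> f ` (ball x e - {y j})" using that by auto
      then show False using inj_onD[OF injf] y that by blast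
    qed
    have perm: "a < b \<and> b < c \<or> a < c \<and> c < b \<or> b < a \<and> a < c \<or> b < c \<and> c < a \<or> c < a \<and> a < b \<or> c < b \<and> b < a"
      if "a \<noteq> b" "a \<noteq> c" "b \<noteq> c" for a b c :: real
      using that by linarith
    have "f (y 0) \<noteq> f (y 1)" "f (y 0) \<noteq> f (y 2)" "f (y 1) \<noteq> f (y 2)"
      by (rule neq; simp)+
    from perm[OF this, unfolded One_nat_def] show False
      using no[of 0 1 2, simplified] no[of 0 2 1, simplified] no[of 1 0 2, simplified]
        no[of 1 2 0, simplified] no[of 2 0 1, simplified] no[of 2 1 0, simplified] by blast
  qed
qed

lemma interior_finite_Union_closed:
  assumes "finite I" "\<And>i. i \<in> I \<Longrightarrow> closed (K i)" "\<And>i. i \<in> I \<Longrightarrow> interior (K i) = {}"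
  shows "interior (\<Union>i\<in>I. K i) = {}"
  using assms
proof (induction I rule: finite_induct)
  case (insert i I)
  then have "interior (K i \<union> (\<Union>i\<in>I. K i)) = interior (K i)"
    by (intro interior_closed_Un_empty_interior) auto
  with insert show ?case by simp
qed simp

section \<open>Contour integrals around infinity\<close>

lemma contour_integral_exterior_eq_0:
  assumes V: "open V" "f holomorphic_on V"
    and \<gamma>: "simple_path \<gamma>" "valid_path \<gamma>" "pathfinish \<gamma> = pathstart \<gamma>"
    and wn: "0 \<in> inside (path_image \<gamma>)" "winding_number \<gamma> 0 = 1"
    and sub: "path_image \<gamma> \<subseteq> V" "outside (path_image \<gamma>) \<subseteq> V"
    and f: "(\<lambda>w. f (1 / w)) \<in> O[at 0](\<lambda>w. w ^ 2)"
  shows "contour_integral \<gamma> f = 0"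
proof -
  define W where "W = insert 0 {u. u \<noteq> 0 \<and> inverse u \<in> V}"
  define \<phi> where "\<phi> = (\<lambda>u. f (inverse u) / u^2)"
  let ?\<delta> = "inverse \<circ> \<gamma>"
  have nz: "x \<noteq> 0" if "x \<in> path_image \<gamma>" for x
    using wn(1) that by (auto simp: inside_def)
  have openU: "open {u. u \<noteq> 0 \<and> inverse u \<in> V}"
  proof -
    have "open ((\<lambda>u. inverse u) -` V \<inter> (- {0}))"
      by (intro continuous_open_preimage[of "-{0}" inverse V, simplified Int_commute] continuous_intros V) auto
    also have "(\<lambda>u. inverse u) -` V \<inter> (- {0}) = {u. u \<noteq> 0 \<and> inverse u \<in> V}" by auto
    finally show ?thesis .
  qed
  have "bounded (path_image \<gamma>)" by (intro bounded_valid_path_image \<gamma>)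
  then obtain B where B: "B > 0" "- outside (path_image \<gamma>) \<subseteq> ball 0 B"
    by (meson bounded_subset_ballD cobounded_outside)
  have Wball: "ball 0 (inverse B) \<subseteq> W"
  proof
    fix u :: complex assume u: "u \<in> ball 0 (inverse B)"
    show "u \<in> W"
    proof (cases "u = 0")
      case False
      then have "B < norm (inverse u)"
        using u B by (simp add: norm_inverse norm_divide field_simps)
      then have "inverse u \<in> outside (path_image \<gamma>)" using B by auto
      then show ?thesis using False sub by (auto simp: W_def)
    qed (simp add: W_def)
  qed
  have W0: "W - {0} = {u. u \<noteq> 0 \<and> inverse u \<in> V}" by (auto simp: W_def)
  have W: "open W"
  proof -
    have "W = {u. u \<noteq> 0 \<and> inverse u \<in> V} \<union> ball 0 (inverse B)"
      using Wball B by (auto simp: W_def)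
    then show ?thesis using openU by (simp add: open_Un)
  qed
  have \<phi>h: "\<phi> holomorphic_on W - {0}"
    unfolding \<phi>_def W0
    by (intro holomorphic_intros holomorphic_on_compose_gen[OF _ V(2), unfolded o_def]) auto
  have "(\<lambda>w. f (1 / w) * inverse (w^2)) \<in> O[at 0](\<lambda>w. w ^ 2 * inverse (w^2))"
    by (intro landau_o.big.mult f) auto
  also have "(\<lambda>w::complex. w ^ 2 * inverse (w^2)) \<in> O[at 0](\<lambda>_. 1)"
    by (intro bigoI[of _ 1]) (auto simp: eventually_at_filter)
  finally have "\<phi> \<in> O[at 0](\<lambda>_. 1)"
    by (simp add: \<phi>_def divide_inverse)
  then obtain \<psi> where \<psi>: "\<psi> holomorphic_on W" "\<And>u. u \<in> W - {0} \<Longrightarrow> \<psi> u = \<phi> u"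
    using holomorphic_on_extend[OF \<phi>h] W by (metis W_def insertI1 interior_open)
  have an: "inverse analytic_on (-{0::complex})"
    by (subst analytic_on_open) (auto intro!: holomorphic_intros)
  have d: "deriv inverse w = - (1 / w^2)" if "w \<noteq> 0" for w :: complex
    by (rule DERIV_imp_deriv) (use that in \<open>auto intro!: derivative_eq_intros simp: power2_eq_square field_simps\<close>)
  have pi: "path_image ?\<delta> = inverse ` path_image \<gamma>" by (simp add: path_image_compose)
  have vp: "valid_path ?\<delta>"
    by (rule valid_path_compose_analytic[OF \<gamma>(2) an]) (use nz in auto)
  have comp: "contour_integral ?\<delta> g = contour_integral \<gamma> (\<lambda>w. - (1 / w^2) * g (inverse w))" for g
  proof -
    have "contour_integral ?\<delta> g = contour_integral \<gamma> (\<lambda>w. deriv inverse w * g (inverse w))"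
      by (rule contour_integral_comp_analyticW[OF an \<gamma>(2)]) (use nz in auto)
    also have "\<dots> = contour_integral \<gamma> (\<lambda>w. - (1 / w^2) * g (inverse w))"
      by (rule contour_integral_cong) (auto simp: d nz)
    finally show ?thesis .
  qed
  have wn0: "winding_number ?\<delta> w = 0" if "w \<notin> W" for w
  proof -
    have w: "w \<noteq> 0" "inverse w \<notin> V" using that by (auto simp: W_def)
    have "inverse w \<notin> path_image \<gamma>" "inverse w \<notin> outside (path_image \<gamma>)" using w sub by auto
    then have ins: "inverse w \<in> inside (path_image \<gamma>)" by (metis ComplI UnE inside_Un_outside)
    have wn1: "winding_number \<gamma> (inverse w) = 1"
      using simple_closed_path_winding_number_inside[OF \<gamma>(1)] ins wn by (metis one_neq_neg_one)
    have nin: "w \<notin> path_image ?\<delta>" using \<open>inverse w \<notin> path_image \<gamma>\<close> by (auto simp: pi)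
    have n1: "inverse w \<notin> path_image \<gamma>" "0 \<notin> path_image \<gamma>" using ins nz by (auto simp: inside_def)
    have "contour_integral ?\<delta> (\<lambda>u. 1 / (u - w)) = contour_integral \<gamma> (\<lambda>x. 1 / (x - inverse w) - 1 / (x - 0))"
      unfolding comp
    proof (rule contour_integral_cong)
      fix x assume x: "x \<in> path_image \<gamma>"
      then have "x \<noteq> 0" using nz by auto
      have "x \<noteq> inverse w" using x n1(1) by auto
      then have "x * w \<noteq> 1" using w inverse_unique[of w x] by (auto simp: mult.commute)
      then have "inverse x - w \<noteq> 0" "x - inverse w \<noteq> 0" using w by (auto simp: field_simps)
      then show "- (1 / x^2) * (1 / (inverse x - w)) = 1 / (x - inverse w) - 1 / (x - 0)"
        using \<open>x \<noteq> 0\<close> w \<open>x * w \<noteq> 1\<close> by (simp add: divide_simps power2_eq_square)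
    qed simp
    also have "\<dots> = contour_integral \<gamma> (\<lambda>x. 1 / (x - inverse w)) - contour_integral \<gamma> (\<lambda>x. 1 / (x - 0))"
      by (intro contour_integral_diff contour_integrable_inversediff[OF \<gamma>(2)] n1)
    also have "\<dots> = 0"
      using winding_number_valid_path[OF \<gamma>(2) n1(1)] winding_number_valid_path[OF \<gamma>(2) n1(2)] wn1 wn(2)
      by simp
    finally show ?thesis by (simp add: winding_number_valid_path[OF vp nin])
  qed
  have pW: "path_image ?\<delta> \<subseteq> W" using sub nz by (auto simp: pi W_def)
  have "(\<psi> has_contour_integral 0) ?\<delta>"
    by (rule Cauchy_theorem_global[OF W \<psi>(1) vp _ pW wn0]) (use \<gamma>(3) in \<open>auto simp: pathfinish_def pathstart_def\<close>)
  then have "contour_integral ?\<delta> \<psi> = 0" by (rule contour_integral_unique)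
  moreover have "contour_integral ?\<delta> \<psi> = contour_integral \<gamma> (\<lambda>w. - f w)"
    unfolding comp
  proof (rule contour_integral_cong)
    fix x assume x: "x \<in> path_image \<gamma>"
    then have "inverse x \<in> W - {0}" using pW pi nz by auto
    then show "- (1 / x\<^sup>2) * \<psi> (inverse x) = - f x"
      using \<psi>(2)[of "inverse x"] nz[OF x] by (simp add: \<phi>_def power_inverse)
  qed simp
  ultimately show ?thesis by (simp add: contour_integral_neg)
qed

lemma contour_integral_exterior:
  assumes V: "open V" "f holomorphic_on V"
    and \<gamma>: "simple_path \<gamma>" "valid_path \<gamma>" "pathfinish \<gamma> = pathstart \<gamma>"
    and wn: "0 \<in> inside (path_image \<gamma>)" "winding_number \<gamma> 0 = 1"
    and sub: "path_image \<gamma> \<subseteq> V" "outside (path_image \<gamma>) \<subseteq> V"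
    and f: "(\<lambda>w. f (1 / w) - poly p (1 / w) - a * w) \<in> O[at 0](\<lambda>w. w ^ 2)"
  shows "contour_integral \<gamma> f = 2 * of_real pi * \<i> * a"
proof -
  have nz: "0 \<notin> path_image \<gamma>" using wn(1) by (auto simp: inside_def)
  have out0: "0 \<notin> outside (path_image \<gamma>)"
    using wn(1) inside_Int_outside by blast
  have int: "g contour_integrable_on \<gamma>" if "g holomorphic_on V - {0}" for g
    using that nz sub V \<gamma> by (intro contour_integrable_holomorphic_simple[of _ "V - {0}"]) auto
  have fh: "f holomorphic_on V - {0}" using V by (auto intro: holomorphic_on_subset)
  have "contour_integral \<gamma> (\<lambda>x. f x - poly p x - a * (1 / x)) = 0"
    by (rule contour_integral_exterior_eq_0[of "V - {0}"])
      (use assms nz out0 in \<open>auto intro!: holomorphic_intros fh\<close>)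
  also have "contour_integral \<gamma> (\<lambda>x. f x - poly p x - a * (1 / x)) =
     contour_integral \<gamma> f - contour_integral \<gamma> (poly p) - a * contour_integral \<gamma> (\<lambda>x. 1 / x)"
  proof -
    have 1: "(\<lambda>x. f x - poly p x) contour_integrable_on \<gamma>" "poly p contour_integrable_on \<gamma>" "f contour_integrable_on \<gamma>"
      "(\<lambda>x. a * (1 / x)) contour_integrable_on \<gamma>" "(\<lambda>x. 1 / x) contour_integrable_on \<gamma>"
      by (auto intro!: int holomorphic_intros fh)
    then show ?thesis by (simp only: contour_integral_diff contour_integral_lmul)
  qed
  also have "contour_integral \<gamma> (poly p) = 0"
  proof -
    have "(\<lambda>x. poly p x) holomorphic_on UNIV" by (intro holomorphic_intros)
    then show ?thesis
      using Cauchy_theorem_convex_simple[of "poly p" UNIV \<gamma>] \<gamma> by (intro contour_integral_unique) auto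
  qed
  also have "contour_integral \<gamma> (\<lambda>x. 1 / x) = 2 * of_real pi * \<i>"
    using winding_number_valid_path[OF \<gamma>(2) nz] wn(2) by (simp add: field_simps)
  finally show ?thesis by (simp add: algebra_simps)
qed

lemma res_exterior:
  assumes r: "0 < r" "r < \<rho>"
    and f: "f holomorphic_on {x. norm x > 1 / \<rho>}"
    and exp: "(\<lambda>w. f (1 / w) - poly p (1 / w) - a * w) \<in> O[at 0](\<lambda>w. w ^ 2)"
  shows "pole_chart.res 0 r (\<lambda>w. f (pole_chart.Z 0 (\<lambda>_. 1) w) * deriv (pole_chart.Z 0 (\<lambda>_. 1)) w) = a"
proof -
  interpret pole_chart 0 0 r \<rho> "\<lambda>_. 1"
    by unfold_locales (use r in auto)
  have Z: "Z w = 1 / w" for w by (simp add: Z_def)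
  have fh: "(\<lambda>w. f (Z w)) holomorphic_on D"
    unfolding Z by (intro holomorphic_on_compose_gen[OF _ f, unfolded o_def] holomorphic_intros)
      (use r in \<open>auto simp: norm_divide field_simps\<close>)
  let ?g = "\<lambda>w. (f (Z w) - poly p (Z w) - a / Z w) * deriv Z w"
  have "(\<lambda>w. f (Z w) - poly p (Z w) - a / Z w) \<in> O[at 0](\<lambda>w. w ^ 2)"
    using exp unfolding Z by simp
  from landau_o.big.mult[OF this Z'_bigo]
  have "?g \<in> O[at 0](\<lambda>w. w ^ 2 * inverse (w^2))" by simp
  also have "(\<lambda>w::complex. w ^ 2 * inverse (w^2)) \<in> O[at 0](\<lambda>_. 1)"
    by (intro bigoI[of _ 1]) (auto simp: eventually_at_filter)
  finally have "res ?g = 0"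
    by (intro res_bounded holomorphic_intros fh Z_hol Z'_hol Z_nz)
  moreover have "res (\<lambda>w. f (Z w) * deriv Z w) = res (\<lambda>w. ?g w + (poly p (Z w) * deriv Z w + a * (deriv Z w / Z w)))"
    by (rule res_cong) (simp add: algebra_simps)
  moreover have "\<dots> = res ?g + (res (\<lambda>w. poly p (Z w) * deriv Z w) + a * res (\<lambda>w. deriv Z w / Z w))"
    by (intro refl trans[OF res_add] trans[OF res_cmult] arg_cong2[where f="(+)"]
      arg_cong2[where f="(*)"] holomorphic_intros fh Z_hol Z'_hol Z_nz; simp)
  ultimately show ?thesis by (simp add: res_poly res_inverse)
qed

lemma contour_integral_coefficients:
  fixes M :: "complex \<Rightarrow> complex"
  assumes V: "open V" "M holomorphic_on V"
    and \<gamma>: "simple_path \<gamma>" "valid_path \<gamma>" "pathfinish \<gamma> = pathstart \<gamma>"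
    and wn: "0 \<in> inside (path_image \<gamma>)" "winding_number \<gamma> 0 = 1"
    and sub: "path_image \<gamma> \<subseteq> V" "outside (path_image \<gamma>) \<subseteq> V"
    and exp: "eventually (\<lambda>x. (\<lambda>n. v (n + 2) / x ^ (n + 2)) sums
      (M x - (\<Sum>n=1..N. of_nat n * tt n * x ^ (n - 1)) - tt 0 / x)) at_infinity"
  shows "n \<ge> 1 \<Longrightarrow> contour_integral \<gamma> (\<lambda>x. x ^ n * M x) = 2 * of_real pi * \<i> * v (n + 1)"
    and "contour_integral \<gamma> (\<lambda>x. x * M x ^ 2) = 2 * of_real pi * \<i> *
      (2 * (\<Sum>n=1..N. of_nat n * tt n * v (n + 1)) + tt 0 ^ 2)"
proof -
  have "bounded (path_image \<gamma>)" by (intro bounded_valid_path_image \<gamma>)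
  then obtain B where B: "B > 0" "- outside (path_image \<gamma>) \<subseteq> ball 0 B"
    by (meson bounded_subset_ballD cobounded_outside)
  define \<rho> where "\<rho> = 1 / B"
  have far: "{x. norm x > 1 / \<rho>} \<subseteq> V" using B sub(2) by (auto simp: \<rho>_def)
  interpret P: pole_chart 0 0 "\<rho>/2" \<rho> "\<lambda>_. 1"
    by unfold_locales (use B in \<open>auto simp: \<rho>_def divide_simps\<close>)
  have Z: "P.Z w = 1 / w" for w by (simp add: P.Z_def)
  interpret P: pole_expansion 0 0 "\<rho>/2" \<rho> "\<lambda>_. 1" "\<lambda>w. M (1 / w)" N tt v
  proof unfold_locales
    have "1 / w \<in> V" if "w \<in> ball 0 \<rho> - {0}" for w
    proof -
      have "norm (1 / w) > 1 / \<rho>"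
        using that B by (auto simp: norm_divide divide_simps \<rho>_def mult.commute)
      then show ?thesis using far by auto
    qed
    then have "(\<lambda>w. 1 / w) ` (ball 0 \<rho> - {0}) \<subseteq> V" by blast
    then show "(\<lambda>w. M (1 / w)) holomorphic_on ball 0 \<rho> - {0}"
      by (rule holomorphic_on_compose_gen[OF _ V(2), unfolded o_def, rotated]) (intro holomorphic_intros; simp)
    have "filterlim (\<lambda>w::complex. 1 / w) at_infinity (at 0)"
      using filterlim_inverse_at_infinity by (simp add: inverse_eq_divide[abs_def])
    from eventually_compose_filterlim[OF exp this]
    show "eventually (\<lambda>w. (\<lambda>n. v (n + 2) / P.Z w ^ (n + 2)) sums
      (M (1 / w) - (\<Sum>n=1..N. of_nat n * tt n * P.Z w ^ (n - 1)) - tt 0 / P.Z w)) (at 0)"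
      by (simp add: Z)
  qed
  have ness: "isolated_singularity_at (\<lambda>w. M (1 / w)) 0 \<and> not_essential (\<lambda>w. M (1 / w)) 0"
  proof -
    have "P.rem \<in> O[at 0](\<lambda>_. 1)"
      by (rule landau_o.big_trans[OF P.rem_bigo0], intro bigoI_tendsto[of _ _ 0])
        (auto intro!: tendsto_eq_intros)
    then obtain \<psi> where \<psi>: "\<psi> holomorphic_on ball 0 \<rho>" "\<And>w. w \<in> P.D \<Longrightarrow> \<psi> w = P.rem w"
      using P.extend[OF P.rem_hol] by blast
    have \<rho>: "\<rho> > 0" using B by (simp add: \<rho>_def)
    have ev: "eventually (\<lambda>w. P.Xi (inverse w) + \<psi> w = M (1 / w)) (at 0)"
      using P.ev_D by eventually_elim (simp add: \<psi>(2) P.rem_def Z inverse_eq_divide)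
    have an: "\<psi> analytic_on {0}" using \<psi>(1) \<rho> by (auto simp: analytic_at intro!: exI[of _ "ball 0 \<rho>"])
    have \<psi>L: "\<psi> has_laurent_expansion fps_to_fls (fps_expansion \<psi> 0)"
      by (intro has_laurent_expansion_fps analytic_at_imp_has_fps_expansion_0 an)
    have "(\<lambda>w. poly P.Xp (inverse w) + tt 0 * w + \<psi> w) has_laurent_expansion
      (\<Sum>i\<le>degree P.Xp. fls_const (coeff P.Xp i) * fls_X_inv ^ i) + fls_const (tt 0) * fls_X +
        fps_to_fls (fps_expansion \<psi> 0)"
      unfolding poly_altdef by (intro laurent_expansion_intros \<psi>L)
    then have "isolated_singularity_at (\<lambda>w. poly P.Xp (inverse w) + tt 0 * w + \<psi> w) 0 \<and>
       not_essential (\<lambda>w. poly P.Xp (inverse w) + tt 0 * w + \<psi> w) 0"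
      using has_laurent_expansion_isolated_0 has_laurent_expansion_not_essential_0 by blast
    then show ?thesis
      using isolated_singularity_at_cong[OF ev refl] not_essential_cong[OF ev refl]
      by (simp add: P.Xi_eq inverse_eq_divide)
  qed
  have key: "contour_integral \<gamma> f = 2 * of_real pi * \<i> * P.res (\<lambda>w. f (P.Z w) * deriv P.Z w)"
    if f: "f holomorphic_on V" "isolated_singularity_at (\<lambda>w. f (1 / w)) 0" "not_essential (\<lambda>w. f (1 / w)) 0" for f
  proof -
    let ?L = "laurent_expansion (\<lambda>w. f (1 / w)) 0"
    have "(\<lambda>w. f (1 / w)) has_laurent_expansion ?L"
      by (rule not_essential_has_laurent_expansion_0[OF f(2,3)])
    from laurent_remainder_bigo[OF this, of 2]
    have *: "(\<lambda>w. f (1 / w) - poly (fls_prpart ?L + [:fls_nth ?L 0:]) (1 / w) - fls_nth ?L 1 * w) \<in> O[at 0](\<lambda>w. w^2)"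
      by (simp add: numeral_2_eq_2 inverse_eq_divide algebra_simps)
    have "P.res (\<lambda>w. f (P.Z w) * deriv P.Z w) = fls_nth ?L 1"
      by (rule res_exterior[OF _ _ holomorphic_on_subset[OF f(1) far] *]) (use B in \<open>auto simp: \<rho>_def divide_simps\<close>)
    then show ?thesis
      using contour_integral_exterior[OF V(1) f(1) \<gamma> wn sub *] by simp
  qed
  have inv: "isolated_singularity_at (\<lambda>w. 1 / w :: complex) 0" "not_essential (\<lambda>w. 1 / w :: complex) 0"
    by (auto intro!: singularity_intros)
  have pw: "isolated_singularity_at (\<lambda>w. (1 / w :: complex) ^ n) 0 \<and> not_essential (\<lambda>w. (1 / w :: complex) ^ n) 0" for n
  proof (induction n)
    case (Suc n)
    then show ?case
      unfolding power_Suc by (intro conjI singularity_intros inv) auto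
  qed (auto intro!: singularity_intros)
  show "contour_integral \<gamma> (\<lambda>x. x ^ n * M x) = 2 * of_real pi * \<i> * v (n + 1)" if "n \<ge> 1"
  proof -
    have "contour_integral \<gamma> (\<lambda>x. x ^ n * M x) =
        2 * of_real pi * \<i> * P.res (\<lambda>w. P.Z w ^ n * M (P.Z w) * deriv P.Z w)"
      by (rule key; intro holomorphic_intros singularity_intros V inv ness[THEN conjunct1] ness[THEN conjunct2] pw[THEN conjunct1] pw[THEN conjunct2])
    also have "P.res (\<lambda>w. P.Z w ^ n * M (P.Z w) * deriv P.Z w) = v (n + 1)"
      using P.res_coefficient[OF that] by (simp add: Z)
    finally show ?thesis .
  qed
  show "contour_integral \<gamma> (\<lambda>x. x * M x ^ 2) = 2 * of_real pi * \<i> *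
      (2 * (\<Sum>n=1..N. of_nat n * tt n * v (n + 1)) + tt 0 ^ 2)"
  proof -
    have "contour_integral \<gamma> (\<lambda>x. x * M x ^ 2) =
        2 * of_real pi * \<i> * P.res (\<lambda>w. P.Z w * M (P.Z w) ^ 2 * deriv P.Z w)"
      unfolding power2_eq_square
      by (rule key; intro holomorphic_intros singularity_intros V inv ness[THEN conjunct1] ness[THEN conjunct2])
    also have "P.res (\<lambda>w. P.Z w * M (P.Z w) ^ 2 * deriv P.Z w) =
        2 * (\<Sum>n=1..N. of_nat n * tt n * v (n + 1)) + tt 0 ^ 2"
      using P.res_square by (simp add: Z)
    finally show ?thesis .
  qed
qed

section \<open>Uniform local coordinates\<close>

lemma eventually_tube:
  fixes Y :: "'a::topological_space set"
  assumes X: "openin (top_of_set (Y \<times> UNIV)) X" and A: "compact A" "{t0} \<times> A \<subseteq> X"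
  shows "eventually (\<lambda>t. t \<in> Y \<longrightarrow> {t} \<times> A \<subseteq> X) (nhds t0)"
proof -
  obtain W where W: "open W" "X = (Y \<times> UNIV) \<inter> W" using X by (auto simp: openin_open)
  obtain X0 where X0: "t0 \<in> X0" "open X0" "X0 \<times> A \<subseteq> W"
    using Elementary_Topology.tube_lemma[OF A(1) W(1), of t0] A(2) W(2) by auto
  show ?thesis unfolding eventually_nhds
    by (rule exI[of _ X0]) (use X0 W in auto)
qed

lemma eventually_tube_continuous:
  fixes Y :: "'a::topological_space set" and f :: "'a \<Rightarrow> complex \<Rightarrow> complex"
  assumes X: "openin (top_of_set (Y \<times> UNIV)) X" and A: "compact A" "{t0} \<times> A \<subseteq> X"
    and f: "continuous_on X (\<lambda>(t, w). f t w)" and bd: "\<And>w. w \<in> A \<Longrightarrow> f t0 w = l" and e: "e > 0"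
  shows "eventually (\<lambda>t. t \<in> Y \<longrightarrow> (\<forall>w\<in>A. norm (f t w - l) < e)) (nhds t0)"
proof -
  have "openin (top_of_set X) (X \<inter> (\<lambda>(t, w). f t w) -` ball l e)"
    by (rule continuous_openin_preimage_gen[OF f]) auto
  then have "openin (top_of_set (Y \<times> UNIV)) (X \<inter> (\<lambda>(t, w). f t w) -` ball l e)"
    using X openin_trans by blast
  moreover have "{t0} \<times> A \<subseteq> X \<inter> (\<lambda>(t, w). f t w) -` ball l e"
    using A(2) bd e by auto
  ultimately have "eventually (\<lambda>t. t \<in> Y \<longrightarrow> {t} \<times> A \<subseteq> X \<inter> (\<lambda>(t, w). f t w) -` ball l e) (nhds t0)"
    by (intro eventually_tube A(1))
  then show ?thesis
    by eventually_elim (auto simp: dist_norm norm_minus_commute)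
qed

lemma root_of_unity_isolated:
  assumes "k > 0"
  obtains \<delta> where "\<delta> > 0" "\<And>x :: complex. x ^ k = 1 \<Longrightarrow> norm (x - 1) < \<delta> \<Longrightarrow> x = 1"
proof -
  have "finite {x :: complex. x ^ k = 1}"
    by (rule finite_roots_unity) (use assms in auto)
  from finite_set_avoid[OF this, of 1] obtain \<delta> where "\<delta> > 0" "\<forall>x\<in>{x::complex. x ^ k = 1}. x \<noteq> 1 \<longrightarrow> \<delta> \<le> dist 1 x" by blast
  then show ?thesis
    by (intro that[of \<delta>]) (auto simp: dist_norm norm_minus_commute not_less[symmetric])
qed

text \<open>
  The domain \<open>V t\<close> need not contain the whole punctured disc for \<open>t \<noteq> t0\<close>, and it may be
  disconnected. As \<open>Z t ^ k\<close> continues to the punctured disc, so does \<open>Z t\<close>; continuity of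
  the leading coefficient \<open>d\<close> excludes a change of the branch of the \<open>k\<close>-th root.
\<close>

lemma root_continuation:
  fixes Y T :: "'a::topological_space set" and c d :: "'a \<Rightarrow> complex"
    and Z E :: "'a \<Rightarrow> complex \<Rightarrow> complex" and V :: "'a \<Rightarrow> complex set"
  assumes T: "openin (top_of_set Y) T" "t0 \<in> T"
    and V: "openin (top_of_set (Y \<times> UNIV)) {(t, w). t \<in> T \<and> w \<in> V t}"
    and Z: "continuous_on {(t, w). t \<in> T \<and> w \<in> V t} (\<lambda>(t, w). Z t w)"
    and Z0: "Z t0 holomorphic_on V t0"
    and c: "continuous_on T c" and d: "continuous_on T d" "\<And>t. t \<in> T \<Longrightarrow> d t \<noteq> 0"
    and k: "k > 0" and EZ: "\<And>t w. t \<in> T \<Longrightarrow> w \<in> V t \<Longrightarrow> E t w = Z t w ^ k"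
    and E_hol: "eventually (\<lambda>t. t \<in> T \<longrightarrow> E t holomorphic_on ball (c t0) R - {c t}) (nhds t0)"
    and near: "\<And>t. t \<in> T \<Longrightarrow> eventually (\<lambda>w. w \<in> V t) (at (c t))"
    and lim: "\<And>t. t \<in> T \<Longrightarrow> ((\<lambda>w. (w - c t) * Z t w) \<longlongrightarrow> d t) (at (c t))"
    and rad: "0 < r1" "r1 < r2" "r2 < R"
    and at0: "ball (c t0) R - {c t0} \<subseteq> V t0"
    and close0: "\<And>w. w \<in> ball (c t0) R - {c t0} \<Longrightarrow> norm ((w - c t0) * Z t0 w / d t0 - 1) < 1/4"
  shows "eventually (\<lambda>t. t \<in> T \<longrightarrow> c t \<in> ball (c t0) r1 \<and>
    (\<forall>w. r1 \<le> dist (c t0) w \<longrightarrow> dist (c t0) w \<le> r2 \<longrightarrow> w \<in> V t) \<and>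
    (\<exists>h. h holomorphic_on ball (c t0) r2 \<and> (\<forall>w\<in>ball (c t0) r2. norm (h w / d t - 1) < 1/3) \<and>
      h (c t) = d t \<and> (\<forall>w\<in>ball (c t0) r2. r1 \<le> dist (c t0) w \<longrightarrow> h w = (w - c t) * Z t w) \<and>
      eventually (\<lambda>w. h w = (w - c t) * Z t w) (at (c t)))) (nhds t0)"
proof -
  let ?c0 = "c t0"
  define A where "A = cball ?c0 r2 - ball ?c0 r1"
  have A: "compact A" unfolding A_def by (intro compact_diff) auto
  have A_sub: "A \<subseteq> ball ?c0 R - {?c0}" using rad by (auto simp: A_def)
  define x where "x = (\<lambda>t w. (w - c t) * Z t w / d t)"
  define x0 where "x0 = (\<lambda>w. if w = ?c0 then 1 else x t0 w)"
  have R: "R > 0" using rad by auto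
  have lim1: "((\<lambda>w. x t w) \<longlongrightarrow> 1) (at (c t))" if "t \<in> T" for t
    using tendsto_divide[OF lim[OF that] tendsto_const[of "d t"] d(2)[OF that]] d(2)[OF that] by (simp add: x_def)
  have x0h: "x0 holomorphic_on ball ?c0 R"
    unfolding x0_def
  proof (rule removable_singularity)
    show "x t0 holomorphic_on ball ?c0 R - {?c0}"
      unfolding x_def using d(2)[OF T(2)] by (intro holomorphic_intros holomorphic_on_subset[OF Z0 at0])
  qed (use R lim1 T in auto)
  have x0close: "norm (x0 w - 1) < 1/4" if "w \<in> ball ?c0 R" for w
    using close0[of w] that by (auto simp: x0_def x_def)
  have x0nz: "x0 w \<noteq> 0" if "w \<in> ball ?c0 R" for w
    using x0close[OF that] by auto
  have x0cont: "continuous_on (ball ?c0 R) x0" using x0h by (rule holomorphic_on_imp_continuous_on)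
  obtain \<delta> where \<delta>: "\<delta> > 0" "\<And>x :: complex. x ^ k = 1 \<Longrightarrow> norm (x - 1) < \<delta> \<Longrightarrow> x = 1"
    using root_of_unity_isolated[OF k] by blast
  define \<eta> where "\<eta> = min (1/20) (\<delta>/4)"
  have \<eta>: "\<eta> > 0" "\<eta> \<le> 1/20" "\<eta> \<le> \<delta>/4" using \<delta> by (auto simp: \<eta>_def)
  have "isCont (\<lambda>u::complex. exp (Ln u / of_nat k)) 1"
    using k by (intro continuous_intros) auto
  then have "\<exists>e>0. \<forall>u. dist u 1 < e \<longrightarrow> dist (exp (Ln u / of_nat k)) (exp (Ln (1::complex) / of_nat k)) < \<eta>"
    using \<eta>(1) unfolding continuous_at_eps_delta by blast
  then obtain \<epsilon>0 where \<epsilon>0: "\<epsilon>0 > 0" "\<And>u::complex. dist u 1 < \<epsilon>0 \<Longrightarrow> norm (exp (Ln u / of_nat k) - 1) < \<eta>"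
    by (auto simp: dist_norm)
  define \<epsilon> where "\<epsilon> = min \<epsilon>0 1 / 2"
  have \<epsilon>: "\<epsilon> > 0" "\<epsilon> < \<epsilon>0" "\<epsilon> < 1" using \<epsilon>0 by (auto simp: \<epsilon>_def min_def)
  let ?X = "{(t, w). t \<in> T \<and> w \<in> V t} \<inter> (Y \<times> (ball ?c0 R - {?c0}))"
  have "openin (top_of_set (Y \<times> UNIV)) (Y \<times> (ball ?c0 R - {?c0}))"
    by (rule openin_Times) (simp_all add: open_delete)
  then have Xop: "openin (top_of_set (Y \<times> UNIV)) ?X"
    using V by (rule openin_Int[rotated])
  have TY: "T \<subseteq> Y" using T by (auto dest: openin_imp_subset)
  have X0: "{t0} \<times> A \<subseteq> ?X" using A_sub at0 T TY by auto
  have ratio: "continuous_on ?X (\<lambda>(t, w). x t w / x0 w)"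
  proof -
    have 1: "continuous_on ?X (\<lambda>p. f (fst p))" if "continuous_on T f" for f :: "'a \<Rightarrow> complex"
    proof (rule continuous_on_compose2[OF that continuous_on_fst[OF continuous_on_id]])
      show "fst ` ?X \<subseteq> T" by auto
    qed
    have 2: "continuous_on ?X (\<lambda>p. x0 (snd p))"
    proof (rule continuous_on_compose2[OF x0cont continuous_on_snd[OF continuous_on_id]])
      show "snd ` ?X \<subseteq> ball ?c0 R" by auto
    qed
    have 3: "continuous_on ?X (\<lambda>p. Z (fst p) (snd p))"
      using continuous_on_subset[OF Z, of ?X] by (auto simp: split_beta)
    have "continuous_on ?X (\<lambda>p. ((snd p - c (fst p)) * Z (fst p) (snd p) / d (fst p)) / x0 (snd p))"
      by (intro continuous_intros 1[OF c] 1[OF d(1)] 2 3) (use d x0nz in auto)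
    then show ?thesis by (rule continuous_on_eq) (auto simp: x_def)
  qed
  have r0: "x t0 w / x0 w = 1" if "w \<in> A" for w
    using A_sub x0nz[of w] that by (auto simp: x0_def)
  have ratiok: "continuous_on ?X (\<lambda>(t, w). (x t w / x0 w) ^ k)"
    using continuous_on_power[OF ratio, of k] by (simp add: split_beta)
  have ev1: "eventually (\<lambda>t. t \<in> Y \<longrightarrow> {t} \<times> A \<subseteq> ?X) (nhds t0)"
    by (rule eventually_tube[OF Xop A X0])
  have ev2: "eventually (\<lambda>t. t \<in> Y \<longrightarrow> (\<forall>w\<in>A. norm (x t w / x0 w - 1) < \<eta>)) (nhds t0)"
    by (rule eventually_tube_continuous[OF Xop A X0 ratio r0 \<eta>(1)])
  have ev3: "eventually (\<lambda>t. t \<in> Y \<longrightarrow> (\<forall>w\<in>A. norm ((x t w / x0 w) ^ k - 1) < \<epsilon>)) (nhds t0)"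
    by (rule eventually_tube_continuous[OF Xop A X0 ratiok _ \<epsilon>(1)]) (simp add: r0)
  have ctend: "(c \<longlongrightarrow> ?c0) (at t0 within T)"
    using c T(2) by (simp add: continuous_on_def)
  have ev4: "eventually (\<lambda>t. t \<in> T \<longrightarrow> dist (c t) ?c0 < r1) (nhds t0)"
    using tendstoD[OF ctend rad(1)] rad(1) unfolding eventually_at_filter by (auto elim!: eventually_mono)
  have "isCont x0 ?c0" using x0cont R by (simp add: continuous_on_eq_continuous_at)
  then have "(\<lambda>w. x0 w) \<midarrow>?c0\<rightarrow> 1" by (simp add: isCont_def x0_def)
  then have "eventually (\<lambda>w. dist (x0 w) 1 < \<eta>) (at ?c0)" using tendstoD \<eta>(1) by blast
  then have "eventually (\<lambda>w. dist (x0 w) 1 < \<eta>) (nhds ?c0)"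
    unfolding eventually_nhds_conv_at using \<eta>(1) by (simp add: x0_def)
  then obtain r' where r': "r' > 0" "\<And>w. dist w ?c0 < r' \<Longrightarrow> dist (x0 w) 1 < \<eta>"
    unfolding eventually_nhds_metric by blast
  have ev5: "eventually (\<lambda>t. t \<in> T \<longrightarrow> dist (c t) ?c0 < r') (nhds t0)"
    using tendstoD[OF ctend r'(1)] r'(1) unfolding eventually_at_filter by (auto elim!: eventually_mono)
  show ?thesis
    using ev1 ev2 ev3 ev4 ev5 E_hol
  proof eventually_elim
    case (elim t)
    show ?case
    proof
      assume t: "t \<in> T"
      let ?e = "c t"
      have tY: "t \<in> Y" using t TY by auto
      have cin: "dist ?c0 ?e < r1" using elim(4) t by (metis dist_commute)
      have cR: "?e \<in> ball ?c0 R" using cin rad by simp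
      have dnz: "d t \<noteq> 0" using d t by auto
      have AV: "w \<in> V t" if "w \<in> A" for w using elim(1) tY that by auto
      define Q where "Q = (\<lambda>w. if w = ?e then 1 else (w - ?e) ^ k * E t w / d t ^ k)"
      have Qx: "(w - ?e) ^ k * E t w / d t ^ k = x t w ^ k" if "w \<in> V t" for w
        using EZ[OF t that] by (simp add: x_def power_mult_distrib power_divide)
      have Qh: "Q holomorphic_on ball ?c0 R"
        unfolding Q_def
      proof (rule removable_singularity)
        show "(\<lambda>w. (w - ?e) ^ k * E t w / d t ^ k) holomorphic_on ball ?c0 R - {?e}"
        proof -
          have "E t holomorphic_on ball ?c0 R - {?e}" using elim(6) t by blast
          then show ?thesis using dnz by (intro holomorphic_intros) auto
        qed
        have "((\<lambda>w. x t w ^ k) \<longlongrightarrow> 1 ^ k) (at ?e)"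
          by (intro tendsto_intros lim1 t)
        then have "((\<lambda>w. x t w ^ k) \<longlongrightarrow> 1) (at ?e)" by simp
        moreover have "eventually (\<lambda>w. x t w ^ k = (w - ?e) ^ k * E t w / d t ^ k) (at ?e)"
          using near[OF t] by eventually_elim (simp add: Qx)
        ultimately show "((\<lambda>w. (w - ?e) ^ k * E t w / d t ^ k) \<longlongrightarrow> 1) (at ?e)"
          by (rule Lim_transform_eventually)
      qed (use cR in auto)
      define P where "P = (\<lambda>w. Q w / x0 w ^ k)"
      have Ph: "P holomorphic_on ball ?c0 R"
        unfolding P_def by (intro holomorphic_intros Qh x0h) (use x0nz in auto)
      have PA: "norm (P w - 1) < \<epsilon>" if "w \<in> A" for w
      proof -
        have "w \<noteq> ?e" using that cin by (auto simp: A_def)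
        then have "P w = (x t w / x0 w) ^ k"
          using Qx[OF AV[OF that]] by (simp add: P_def Q_def power_divide)
        then show ?thesis using elim(3) tY that by auto
      qed
      have Pc: "norm (P w - 1) < \<epsilon>0" if "w \<in> cball ?c0 r2" for w
      proof -
        have "norm (P w - 1) \<le> \<epsilon>"
        proof (rule maximum_modulus_frontier[of "\<lambda>w. P w - 1" "cball ?c0 r2"])
          have "(\<lambda>w. P w - 1) holomorphic_on ball ?c0 R" by (intro holomorphic_intros Ph)
          then show "(\<lambda>w. P w - 1) holomorphic_on interior (cball ?c0 r2)"
            by (rule holomorphic_on_subset) (use rad in auto)
          show "continuous_on (closure (cball ?c0 r2)) (\<lambda>w. P w - 1)"
            by (intro continuous_intros continuous_on_subset[OF holomorphic_on_imp_continuous_on[OF Ph]])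
              (use rad in auto)
          show "norm (P w - 1) \<le> \<epsilon>" if "w \<in> frontier (cball ?c0 r2)" for w
            using PA[of w] that rad by (auto simp: A_def)
        qed (use that in auto)
        then show ?thesis using \<epsilon> by simp
      qed
      have P1: "norm (P w - 1) < 1" if "w \<in> cball ?c0 r2" for w
      proof -
        have "norm (P w - 1) \<le> \<epsilon>"
        proof (rule maximum_modulus_frontier[of "\<lambda>w. P w - 1" "cball ?c0 r2"])
          have "(\<lambda>w. P w - 1) holomorphic_on ball ?c0 R" by (intro holomorphic_intros Ph)
          then show "(\<lambda>w. P w - 1) holomorphic_on interior (cball ?c0 r2)"
            by (rule holomorphic_on_subset) (use rad in auto)
          show "continuous_on (closure (cball ?c0 r2)) (\<lambda>w. P w - 1)"
            by (intro continuous_intros continuous_on_subset[OF holomorphic_on_imp_continuous_on[OF Ph]])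
              (use rad in auto)
          show "norm (P w - 1) \<le> \<epsilon>" if "w \<in> frontier (cball ?c0 r2)" for w
            using PA[of w] that rad by (auto simp: A_def)
        qed (use that in auto)
        then show ?thesis using \<epsilon> by simp
      qed
      have Pre: "P w \<notin> \<real>\<^sub>\<le>\<^sub>0" if "w \<in> cball ?c0 r2" for w
      proof
        assume "P w \<in> \<real>\<^sub>\<le>\<^sub>0"
        then have "Re (P w) \<le> 0" by (auto elim!: nonpos_Reals_cases)
        moreover have "\<bar>Re (P w - 1)\<bar> < 1" using P1[OF that] abs_Re_le_cmod le_less_trans by blast
        ultimately show False by simp
      qed
      define y where "y = (\<lambda>w. x0 w * exp (Ln (P w) / of_nat k))"
      have sub: "ball ?c0 r2 \<subseteq> ball ?c0 R" using rad by auto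
      have yh: "y holomorphic_on ball ?c0 r2"
        unfolding y_def using k Pre
        by (intro holomorphic_intros holomorphic_on_subset[OF x0h sub] holomorphic_on_subset[OF Ph sub]) auto
      have yk: "y w ^ k = Q w" if "w \<in> cball ?c0 r2" for w
      proof -
        have "w \<in> ball ?c0 R" using that rad by auto
        moreover have "P w \<noteq> 0" using Pre[OF that] by auto
        ultimately show ?thesis
          using k x0nz by (simp add: y_def power_mult_distrib exp_of_nat_mult[symmetric] P_def)
      qed
      have yr: "norm (y w / x0 w - 1) < \<eta>" if "w \<in> cball ?c0 r2" for w
        using \<epsilon>0(2)[of "P w"] Pc[OF that] x0nz[of w] that rad by (auto simp: y_def dist_norm)
      have ynz: "y w \<noteq> 0" if "w \<in> cball ?c0 r2" for w
        using yr[OF that] \<eta> by (auto simp: y_def) 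
      have y1: "norm (y w - 1) < 1/3" if "w \<in> ball ?c0 r2" for w
      proof -
        have w: "w \<in> ball ?c0 R" "w \<in> cball ?c0 r2" using that rad by auto
        have eq: "y w - 1 = (x0 w - 1) + (y w / x0 w - 1) + (x0 w - 1) * (y w / x0 w - 1)"
          using x0nz[OF w(1)] by (simp add: field_simps)
        have "norm (y w - 1) \<le> norm (x0 w - 1) + norm (y w / x0 w - 1) + norm (x0 w - 1) * norm (y w / x0 w - 1)"
          unfolding eq by (metis (no_types, lifting) norm_add_leD norm_mult order_refl norm_triangle_le add_mono)
        also have "\<dots> < 1/4 + 1/20 + 1/4 * (1/20)"
          using x0close[OF w(1)] yr[OF w(2)] \<eta>(2) by (intro add_strict_mono mult_strict_mono) auto
        finally show ?thesis by simp
      qed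
      have same: "x t w = y w" if w: "w \<in> cball ?c0 r2" "x t w ^ k = y w ^ k" "norm (x t w / y w - 1) < \<delta>" for w
      proof -
        have "(x t w / y w) ^ k = 1" using w ynz[OF w(1)] by (simp add: power_divide)
        then have "x t w / y w = 1" using \<delta>(2) w(3) by blast
        then show ?thesis using ynz[OF w(1)] by (simp add: field_simps)
      qed
      have xyA: "x t w = y w" if "w \<in> A" for w
      proof (rule same)
        show w: "w \<in> cball ?c0 r2" using that by (auto simp: A_def)
        have "w \<noteq> ?e" using that cin by (auto simp: A_def)
        then show "x t w ^ k = y w ^ k"
          using yk[OF w] Qx[OF AV[OF that]] by (simp add: Q_def)
        have wR: "w \<in> ball ?c0 R" using A_sub that by auto
        let ?a = "x t w / x0 w" and ?b = "y w / x0 w"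
        have a: "norm (?a - 1) < \<eta>" using elim(2) tY that by auto
        have b: "norm (?b - 1) < \<eta>" by (rule yr[OF w])
        have b2: "norm ?b > 1/2"
        proof -
          have "1 - norm ?b \<le> norm (?b - 1)" by (metis norm_minus_commute norm_one norm_triangle_ineq2)
          then show ?thesis using b \<eta> by linarith
        qed
        have "x t w / y w - 1 = ((?a - 1) - (?b - 1)) / ?b"
          using x0nz[OF wR] ynz[OF w] by (simp add: field_simps)
        then have "norm (x t w / y w - 1) = norm ((?a - 1) - (?b - 1)) / norm ?b" by (simp only: norm_divide)
        also have "\<dots> \<le> (2 * \<eta>) / norm ?b"
          using a b norm_triangle_ineq4[of "?a - 1" "?b - 1"] by (intro divide_right_mono) auto
        also have "\<dots> < (2 * \<eta>) / (1/2)"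
          using b2 \<eta> by (intro divide_strict_left_mono) auto
        also have "\<dots> \<le> \<delta>" using \<eta> by simp
        finally show "norm (x t w / y w - 1) < \<delta>" .
      qed
      have c2: "?e \<in> cball ?c0 r2" using cin rad by auto
      have yc: "y ?e = 1"
      proof (rule \<delta>(2))
        show "y ?e ^ k = 1" using yk[OF c2] by (simp add: Q_def)
        have a: "norm (x0 ?e - 1) < \<eta>" using r'(2)[of ?e] elim(5) t by (simp add: dist_norm)
        have b: "norm (y ?e / x0 ?e - 1) < \<eta>" by (rule yr[OF c2])
        have eq: "y ?e - 1 = (x0 ?e - 1) + (y ?e / x0 ?e - 1) + (x0 ?e - 1) * (y ?e / x0 ?e - 1)"
          using x0nz[OF cR] by (simp add: field_simps)
        have "norm (y ?e - 1) \<le> norm (x0 ?e - 1) + norm (y ?e / x0 ?e - 1) + norm (x0 ?e - 1) * norm (y ?e / x0 ?e - 1)"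
          unfolding eq by (metis (no_types, lifting) norm_add_leD norm_mult order_refl norm_triangle_le add_mono)
        also have "\<dots> < \<eta> + \<eta> + \<eta> * 1"
          using a b \<eta> by (intro add_strict_mono mult_strict_mono) auto
        finally show "norm (y ?e - 1) < \<delta>" using \<eta> by simp
      qed
      have c3: "?e \<in> ball ?c0 r2" using cin rad by auto
      have ynear: "eventually (\<lambda>w. x t w = y w) (at ?e)"
      proof -
        have "isCont y ?e"
          using holomorphic_on_imp_continuous_on[OF yh] c3 by (simp add: continuous_on_eq_continuous_at)
        then have "(y \<longlongrightarrow> 1) (at ?e)" by (simp add: isCont_def yc)
        then have "((\<lambda>w. x t w / y w) \<longlongrightarrow> 1 / 1) (at ?e)"
          by (intro tendsto_divide lim1 t) auto
        then have "eventually (\<lambda>w. dist (x t w / y w) 1 < \<delta>) (at ?e)"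
          using tendstoD \<delta>(1) by fastforce
        moreover have "eventually (\<lambda>w. w \<in> ball ?c0 r2 - {?e}) (at ?e)"
          by (rule eventually_at_in_open) (use c3 in auto)
        ultimately show ?thesis using near[OF t]
        proof eventually_elim
          case (elim w)
          show ?case
          proof (rule same)
            show w: "w \<in> cball ?c0 r2" using elim by auto
            show "x t w ^ k = y w ^ k" using yk[OF w] Qx[OF elim(3)] elim by (simp add: Q_def)
          qed (use elim in \<open>simp add: dist_norm\<close>)
        qed
      qed
      show "c t \<in> ball ?c0 r1 \<and>
        (\<forall>w. r1 \<le> dist ?c0 w \<longrightarrow> dist ?c0 w \<le> r2 \<longrightarrow> w \<in> V t) \<and>
        (\<exists>h. h holomorphic_on ball ?c0 r2 \<and> (\<forall>w\<in>ball ?c0 r2. norm (h w / d t - 1) < 1/3) \<and>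
          h (c t) = d t \<and> (\<forall>w\<in>ball ?c0 r2. r1 \<le> dist ?c0 w \<longrightarrow> h w = (w - c t) * Z t w) \<and>
          eventually (\<lambda>w. h w = (w - c t) * Z t w) (at (c t)))"
      proof (intro conjI allI impI exI[of _ "\<lambda>w. d t * y w"] ballI)
        show "w \<in> V t" if "r1 \<le> dist ?c0 w" "dist ?c0 w \<le> r2" for w
          by (rule AV) (use that in \<open>auto simp: A_def\<close>)
        show "(\<lambda>w. d t * y w) holomorphic_on ball ?c0 r2" by (intro holomorphic_intros yh)
        show "d t * y w = (w - c t) * Z t w" if "w \<in> ball ?c0 r2" "r1 \<le> dist ?c0 w" for w
          using xyA[of w] that dnz by (auto simp: A_def x_def field_simps)
        show "eventually (\<lambda>w. d t * y w = (w - c t) * Z t w) (at (c t))"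
          using ynear by eventually_elim (use dnz in \<open>auto simp: x_def field_simps\<close>)
      qed (use cin y1 yc dnz in auto)
    qed
  qed
qed

lemma continuous_eq_off_thin:
  fixes f g :: "complex \<Rightarrow> complex"
  assumes "open O'" "continuous_on O' f" "continuous_on O' g" "interior K = {}"
    and "\<And>x. x \<in> O' - K \<Longrightarrow> f x = g x" "x \<in> O'"
  shows "f x = g x"
proof (rule ccontr)
  assume "f x \<noteq> g x"
  have "open (O' \<inter> (\<lambda>x. f x - g x) -` (-{0}))"
    by (intro continuous_open_preimage continuous_intros assms)
  moreover have "O' \<inter> (\<lambda>x. f x - g x) -` (-{0}) \<subseteq> K" using assms by auto
  moreover have "x \<in> O' \<inter> (\<lambda>x. f x - g x) -` (-{0})" using assms \<open>f x \<noteq> g x\<close> by auto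
  ultimately have "x \<in> interior K" by (meson interiorI)
  then show False using assms by simp
qed

lemma residue_circle:
  assumes "f holomorphic_on ball c0 \<rho> - {c}" "c \<in> ball c0 r" "0 < r" "r < \<rho>"
  shows "contour_integral (circlepath c0 r) f = 2 * of_real pi * \<i> * residue f c"
proof -
  have "contour_integral (circlepath c0 r) f = 2 * pi * \<i> * (\<Sum>p\<in>{c}. winding_number (circlepath c0 r) p * residue f p)"
  proof (rule Residue_theorem[of "ball c0 \<rho>"])
    show "path_image (circlepath c0 r) \<subseteq> ball c0 \<rho> - {c}" using assms by auto
    show "\<forall>z. z \<notin> ball c0 \<rho> \<longrightarrow> winding_number (circlepath c0 r) z = 0"
      using assms by (auto intro!: winding_number_zero_outside[of _ "cball c0 r"])
  qed (use assms in auto)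
  moreover have "winding_number (circlepath c0 r) c = 1"
    by (rule winding_number_circlepath) (use assms in \<open>auto simp: dist_norm norm_minus_commute\<close>)
  ultimately show ?thesis by simp
qed

lemma contour_integral_inverse_circle:
  assumes "0 < r" 
  shows "contour_integral (circlepath 0 r) (\<lambda>w. f (1 / w) * (- 1 / w^2)) = - contour_integral (circlepath 0 (1 / r)) f"
proof -
  have an: "inverse analytic_on (-{0::complex})"
    by (subst analytic_on_open) (auto intro!: holomorphic_intros)
  have d: "deriv inverse w = - (1 / w^2)" if "w \<noteq> 0" for w :: complex
    by (rule DERIV_imp_deriv) (use that in \<open>auto intro!: derivative_eq_intros simp: power2_eq_square field_simps\<close>)
  have "inverse \<circ> circlepath 0 r = reversepath (circlepath 0 (1 / r))"
  proof
    fix x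
    have "exp (2 * of_real pi * \<i> * of_real (1 - x)) = exp (2 * of_real pi * \<i> - 2 * of_real pi * \<i> * of_real x)"
      by (simp add: algebra_simps)
    also have "\<dots> = exp (- (2 * of_real pi * \<i> * of_real x)) * exp (2 * of_real pi * \<i>)"
      by (simp add: exp_diff exp_minus divide_inverse)
    finally have "exp (2 * of_real pi * \<i> * of_real (1 - x)) = exp (- (2 * of_real pi * \<i> * of_real x)) * exp (2 * of_real pi * \<i>)" .
    then have E: "exp (2 * of_real pi * \<i> * of_real (1 - x)) = inverse (exp (2 * of_real pi * \<i> * of_real x))"
      by (simp only: exp_two_pi_i exp_minus mult_1_right)
    show "(inverse \<circ> circlepath 0 r) x = reversepath (circlepath 0 (1 / r)) x"
      unfolding o_def circlepath reversepath_def E by (simp add: divide_inverse mult.commute)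
  qed
  then have "contour_integral (inverse \<circ> circlepath 0 r) f = - contour_integral (circlepath 0 (1 / r)) f"
    by (simp add: contour_integral_reversepath)
  moreover have "contour_integral (inverse \<circ> circlepath 0 r) f = contour_integral (circlepath 0 r) (\<lambda>w. deriv inverse w * f (inverse w))"
    by (rule contour_integral_comp_analyticW[OF an]) (use assms in auto)
  moreover have "\<dots> = contour_integral (circlepath 0 r) (\<lambda>w. f (1 / w) * (- 1 / w^2))"
    by (rule contour_integral_cong) (use assms in \<open>auto simp: d inverse_eq_divide\<close>)
  ultimately show ?thesis by simp
qed

section \<open>Local coordinates at the punctures\<close>

lemma bigo_tendsto_zero:
  fixes f g :: "'a \<Rightarrow> complex"
  assumes "f \<in> O[F](g)" "(g \<longlongrightarrow> 0) F"
  shows "(f \<longlongrightarrow> 0) F"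
proof -
  obtain C where C: "eventually (\<lambda>x. norm (f x) \<le> C * norm (g x)) F"
    using assms(1) by (auto elim: landau_o.bigE)
  have "((\<lambda>x. C * norm (g x)) \<longlongrightarrow> C * 0) F"
    by (intro tendsto_intros tendsto_norm_zero assms)
  then show ?thesis using Lim_null_comparison[OF C] by simp
qed

lemma singularity_power:
  fixes f :: "complex \<Rightarrow> complex"
  assumes "isolated_singularity_at f a" "not_essential f a"
  shows "isolated_singularity_at (\<lambda>x. f x ^ n) a" "not_essential (\<lambda>x. f x ^ n) a"
proof -
  have "isolated_singularity_at (\<lambda>x. f x ^ n) a \<and> not_essential (\<lambda>x. f x ^ n) a"
  proof (induction n)
    case (Suc n)
    then show ?case unfolding power_Suc using assms by (intro conjI singularity_intros) auto
  qed (auto intro!: singularity_intros)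
  then show "isolated_singularity_at (\<lambda>x. f x ^ n) a" "not_essential (\<lambda>x. f x ^ n) a" by auto
qed

lemma poly_at_infinity:
  fixes p :: "complex poly"
  shows "isolated_singularity_at (\<lambda>w. poly p (1 / w)) 0" "not_essential (\<lambda>w. poly p (1 / w)) 0"
proof -
  have "(\<lambda>w. poly p (inverse w)) has_laurent_expansion
      (\<Sum>i\<le>degree p. fls_const (coeff p i) * fls_X_inv ^ i)"
    unfolding poly_altdef by (intro laurent_expansion_intros)
  then show "isolated_singularity_at (\<lambda>w. poly p (1 / w)) 0" "not_essential (\<lambda>w. poly p (1 / w)) 0"
    using has_laurent_expansion_isolated_0 has_laurent_expansion_not_essential_0
    by (auto simp: inverse_eq_divide)
qed

lemma poly_singularity:
  fixes p :: "complex poly"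
  shows "isolated_singularity_at (poly p) a" "not_essential (poly p) a"
proof -
  have "(\<lambda>w. poly p w) holomorphic_on UNIV" by (intro holomorphic_intros)
  then have "poly p analytic_on {a}" by (auto simp: analytic_at)
  then show "isolated_singularity_at (poly p) a" "not_essential (poly p) a"
    by (auto intro: isolated_singularity_at_analytic not_essential_analytic)
qed

lemma rational_holomorphic:
  assumes "rational_with_poles_in X f" "finite X"
  shows "f holomorphic_on - X"
proof -
  obtain P Q where PQ: "\<And>p. poly Q p = 0 \<Longrightarrow> p \<in> X" "\<And>p. p \<notin> X \<Longrightarrow> f p = poly P p / poly Q p"
    using assms unfolding rational_with_poles_in_def by blast
  have "(\<lambda>p. poly P p / poly Q p) holomorphic_on - X"
    by (intro holomorphic_intros) (use PQ in auto)
  then show ?thesis by (rule holomorphic_transform) (use PQ in auto)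
qed

lemma rational_singularity:
  assumes "rational_with_poles_in X f" "finite X"
  shows "isolated_singularity_at f a" "not_essential f a"
    "isolated_singularity_at (\<lambda>w. f (1 / w)) 0" "not_essential (\<lambda>w. f (1 / w)) 0"
proof -
  obtain P Q where PQ: "\<And>p. p \<notin> X \<Longrightarrow> f p = poly P p / poly Q p"
    using assms unfolding rational_with_poles_in_def by blast
  have "open (- (X - {a}))" using assms by (intro open_Compl finite_imp_closed) auto
  then have "eventually (\<lambda>x. x \<in> - (X - {a}) - {a}) (at a)" by (intro eventually_at_in_open) auto
  then have ev: "eventually (\<lambda>x. poly P x / poly Q x = f x) (at a)"
    by eventually_elim (auto simp: PQ)
  have "isolated_singularity_at (\<lambda>x. poly P x / poly Q x) a \<and> not_essential (\<lambda>x. poly P x / poly Q x) a"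
    by (intro conjI singularity_intros poly_singularity)
  then show "isolated_singularity_at f a" "not_essential f a"
    using isolated_singularity_at_cong[OF ev refl] not_essential_cong[OF ev refl] by auto
  have "filterlim (\<lambda>w::complex. 1 / w) at_infinity (at 0)"
    using filterlim_inverse_at_infinity by (simp add: inverse_eq_divide[abs_def])
  moreover have "eventually (\<lambda>x. x \<notin> X) at_infinity"
  proof -
    obtain B where B: "\<And>x. x \<in> X \<Longrightarrow> norm x < B"
      using finite_imp_bounded[OF assms(2)] by (meson bounded_iff le_less_trans lt_ex gt_ex)
    show ?thesis unfolding eventually_at_infinity
      by (rule exI[of _ B]) (use B in \<open>auto simp: not_less[symmetric]\<close>)
  qed
  ultimately have "eventually (\<lambda>w. 1 / w \<notin> X) (at 0)"
    by (rule eventually_compose_filterlim[rotated])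
  then have ev: "eventually (\<lambda>w. poly P (1 / w) / poly Q (1 / w) = f (1 / w)) (at 0)"
    by eventually_elim (simp add: PQ)
  have "isolated_singularity_at (\<lambda>w. poly P (1 / w) / poly Q (1 / w)) 0 \<and> not_essential (\<lambda>w. poly P (1 / w) / poly Q (1 / w)) 0"
    by (intro conjI singularity_intros poly_at_infinity)
  then show "isolated_singularity_at (\<lambda>w. f (1 / w)) 0" "not_essential (\<lambda>w. f (1 / w)) 0"
    using isolated_singularity_at_cong[OF ev refl] not_essential_cong[OF ev refl] by auto
qed

context string_solution
begin

abbreviation "Ts \<equiv> time_space M N"
abbreviation "Ind \<equiv> time_indices M N"

text \<open>The chart is \<open>p = 1/w\<close> at \<open>\<infinity>\<close> and \<open>p = w\<close> elsewhere; \<open>cen\<close> is the image of the puncture.\<close>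

definition ch :: "nat \<Rightarrow> complex \<Rightarrow> complex" where "ch \<alpha> w = (if \<alpha> = 0 then 1 / w else w)"
definition ch' :: "nat \<Rightarrow> complex \<Rightarrow> complex" where "ch' \<alpha> w = (if \<alpha> = 0 then - 1 / w^2 else 1)"
definition cen :: "nat \<Rightarrow> times \<Rightarrow> complex" where "cen \<alpha> t = (if \<alpha> = 0 then 0 else q \<alpha> t)"
definition dd :: "nat \<Rightarrow> times \<Rightarrow> complex" where "dd \<alpha> t = (if \<alpha> = 0 then 1 else d \<alpha> t)"
definition V :: "nat \<Rightarrow> times \<Rightarrow> complex set" where "V \<alpha> t = {w. (\<alpha> = 0 \<longrightarrow> w \<noteq> 0) \<and> ch \<alpha> w \<in> U \<alpha> t}"
definition zc :: "nat \<Rightarrow> times \<Rightarrow> complex \<Rightarrow> complex" where "zc \<alpha> t w = z \<alpha> t (ch \<alpha> w)"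
definition mc :: "nat \<Rightarrow> times \<Rightarrow> complex \<Rightarrow> complex" where "mc \<alpha> t w = m \<alpha> t (ch \<alpha> w)"
definition Q :: "times \<Rightarrow> complex set" where "Q t = (\<lambda>i. q i t) ` {1..M}"
text \<open>The string equations make \<open>PP\<close> equal to \<open>- z\<^sub>j m\<^sub>j / k\<^sub>j\<close> near \<open>q\<^sub>j\<close> for \<open>j \<in> J\<close>, and to \<open>z\<^sub>\<alpha> m\<^sub>\<alpha> / k\<^sub>\<alpha>\<close> elsewhere.\<close>

definition PP :: "times \<Rightarrow> complex \<Rightarrow> complex" where "PP t p = 1 / of_nat (k 0) * (E1 t p * E2 t p)"

lemma finite_Q [simp]: "finite (Q t)" by (simp add: Q_def)

lemma T_sub: "T \<subseteq> Ts" using T_open by (auto dest: openin_imp_subset)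

lemma has_deriv_ch: "(\<alpha> = 0 \<Longrightarrow> w \<noteq> 0) \<Longrightarrow> (ch \<alpha> has_field_derivative ch' \<alpha> w) (at w)"
proof (cases "\<alpha> = 0")
  case True
  assume "\<alpha> = 0 \<Longrightarrow> w \<noteq> 0"
  with True have "((\<lambda>w. 1 / w) has_field_derivative - 1 / w^2) (at w)"
    by (auto intro!: derivative_eq_intros simp: power2_eq_square)
  then show ?thesis using True by (simp add: ch_def[abs_def] ch'_def)
next
  case False
  then show ?thesis using DERIV_ident by (simp add: ch_def[abs_def] ch'_def)
qed

lemma slice_open:
  assumes "openin (top_of_set (Ts \<times> UNIV)) {(t, p). t \<in> T \<and> p \<in> X t}" "t \<in> T"
  shows "open (X t :: complex set)"
proof -
  obtain W where W: "open W" "{(t, p). t \<in> T \<and> p \<in> X t} = (Ts \<times> UNIV) \<inter> W"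
    using assms(1) by (auto simp: openin_open)
  have "X t = (\<lambda>p. (t, p)) -` W"
    using W(2) assms(2) T_sub by (auto simp: set_eq_iff)
  moreover have "open ((\<lambda>p. (t, p)) -` W)"
    by (intro open_vimage W continuous_intros)
  ultimately show ?thesis by simp
qed

lemma open_U: "\<alpha> \<le> M \<Longrightarrow> t \<in> T \<Longrightarrow> open (U \<alpha> t)"
  by (rule slice_open[OF U_open])

lemma closed_K: "i \<in> {1..M} \<Longrightarrow> t \<in> T \<Longrightarrow> closed (K i t)"
  and interior_K: "i \<in> {1..M} \<Longrightarrow> t \<in> T \<Longrightarrow> interior (K i t) = {}"
  using cut_to_infinity_closed_interior[OF cut] by auto

lemma interior_cuts: "t \<in> T \<Longrightarrow> interior (\<Union>i\<in>{1..M}. K i t) = {}"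
  by (intro interior_finite_Union_closed closed_K interior_K) auto

lemma closed_cuts: "t \<in> T \<Longrightarrow> closed (\<Union>i\<in>{1..M}. K i t)"
  by (intro closed_UN ballI closed_K) simp_all

lemma q_in_K: "i \<in> {1..M} \<Longrightarrow> t \<in> T \<Longrightarrow> q i t \<in> K i t"
proof -
  assume "i \<in> {1..M}" "t \<in> T"
  then obtain g :: "real \<Rightarrow> complex" where "g 0 = q i t" "K i t = g ` {0..}"
    using cut[of i t] unfolding cut_to_infinity_def by blast
  then show ?thesis by (metis atLeast_iff image_eqI order_refl)
qed

lemma q_notin_K: "i \<in> {1..M} \<Longrightarrow> j \<in> {1..M} \<Longrightarrow> i \<noteq> j \<Longrightarrow> t \<in> T \<Longrightarrow> q i t \<notin> K j t"
  using cuts_disjoint[of i j t] q_in_K[of i t] by auto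

lemma z_hol: "\<alpha> \<le> M \<Longrightarrow> t \<in> T \<Longrightarrow> z \<alpha> t holomorphic_on U \<alpha> t"
  using z_holo[of \<alpha>] by (auto simp: jointly_holomorphic_def holomorphic_on_def intro: field_differentiable_at_within)

lemma m_hol: "\<alpha> \<le> M \<Longrightarrow> t \<in> T \<Longrightarrow> m \<alpha> t holomorphic_on U \<alpha> t"
  using m_holo[of \<alpha>] by (auto simp: jointly_holomorphic_def holomorphic_on_def intro: field_differentiable_at_within)

lemma d_nz: "i \<in> {1..M} \<Longrightarrow> t \<in> T \<Longrightarrow> d i t \<noteq> 0"
  using ld_exp[of i t] by (metis exp_not_eq_zero)

lemma dd_nz: "\<alpha> \<le> M \<Longrightarrow> t \<in> T \<Longrightarrow> dd \<alpha> t \<noteq> 0"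
  using d_nz[of \<alpha> t] by (auto simp: dd_def)

lemma filterlim_ch: "filterlim (ch \<alpha>) (puncture q \<alpha> t) (at (cen \<alpha> t))"
proof (cases "\<alpha> = 0")
  case True
  have "filterlim (\<lambda>w::complex. 1 / w) at_infinity (at 0)"
    using filterlim_inverse_at_infinity by (simp add: inverse_eq_divide[abs_def])
  then show ?thesis using True by (simp add: ch_def[abs_def] puncture_def cen_def)
next
  case False
  then show ?thesis by (simp add: ch_def[abs_def] puncture_def cen_def filterlim_ident)
qed

lemma eventually_ch: "eventually P (puncture q \<alpha> t) \<Longrightarrow> eventually (\<lambda>w. P (ch \<alpha> w)) (at (cen \<alpha> t))"
  using eventually_compose_filterlim[OF _ filterlim_ch] .

lemma zc_limit:
  assumes "\<alpha> \<le> M" "t \<in> T"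
  shows "((\<lambda>w. (w - cen \<alpha> t) * zc \<alpha> t w) \<longlongrightarrow> dd \<alpha> t) (at (cen \<alpha> t))"
proof -
  let ?c = "cen \<alpha> t"
  have U: "((\<lambda>w. w - ?c) \<longlongrightarrow> 0) (at ?c)" by (simp add: LIM_zero)
  have nz: "eventually (\<lambda>w. w - ?c \<noteq> 0) (at ?c)" by (simp add: eventually_at_filter)
  obtain a where "eventually (\<lambda>w. (\<lambda>n. a n * (w - ?c) ^ n) sums (zc \<alpha> t w - dd \<alpha> t / (w - ?c))) (at ?c)"
  proof (cases "\<alpha> = 0")
    case True
    have "eventually (\<lambda>w. (\<lambda>n. dc 0 (n + 1) t / ch \<alpha> w ^ (n + 1)) sums (z 0 t (ch \<alpha> w) - ch \<alpha> w)) (at ?c)"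
      using eventually_ch[of _ \<alpha> t] z0_expansion[OF assms(2)] True by (simp add: puncture_def)
    then have "eventually (\<lambda>w. (\<lambda>n. (if n = 0 then 0 else dc 0 n t) * (w - ?c) ^ n) sums (zc \<alpha> t w - dd \<alpha> t / (w - ?c))) (at ?c)"
    proof eventually_elim
      case (elim w)
      then have "(\<lambda>n. (\<lambda>n. (if n = 0 then 0 else dc 0 n t) * (w - ?c) ^ n) (Suc n)) sums (zc \<alpha> t w - dd \<alpha> t / (w - ?c))"
        using True by (simp add: ch_def cen_def zc_def dd_def power_divide)
      then show ?case by (subst (asm) sums_Suc_iff) simp
    qed
    then show ?thesis by (rule that)
  next
    case False
    then have i: "\<alpha> \<in> {1..M}" using assms by auto
    from zi_expansion[OF i assms(2)] False show ?thesis
      by (intro that[of "\<lambda>n. dc \<alpha> n t"]) (simp add: zc_def ch_def cen_def dd_def)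
  qed
  from powser_remainder_bigo[OF this U nz, of 0]
  have "(\<lambda>w. zc \<alpha> t w - dd \<alpha> t / (w - ?c)) \<in> O[at ?c](\<lambda>_. 1)" by simp
  from landau_o.big.mult[OF landau_o.big_refl[of "\<lambda>w. w - ?c"] this]
  have "(\<lambda>w. (w - ?c) * (zc \<alpha> t w - dd \<alpha> t / (w - ?c))) \<in> O[at ?c](\<lambda>w. w - ?c)" by simp
  then have "((\<lambda>w. (w - ?c) * (zc \<alpha> t w - dd \<alpha> t / (w - ?c))) \<longlongrightarrow> 0) (at ?c)"
    using U by (rule bigo_tendsto_zero)
  then have "((\<lambda>w. (w - ?c) * (zc \<alpha> t w - dd \<alpha> t / (w - ?c)) + dd \<alpha> t) \<longlongrightarrow> 0 + dd \<alpha> t) (at ?c)"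
    by (intro tendsto_intros)
  moreover have "eventually (\<lambda>w. (w - ?c) * (zc \<alpha> t w - dd \<alpha> t / (w - ?c)) + dd \<alpha> t = (w - ?c) * zc \<alpha> t w) (at ?c)"
    using nz by eventually_elim (simp add: field_simps)
  ultimately show ?thesis using Lim_transform_eventually by fastforce
qed

lemma zc_infinity: "\<alpha> \<le> M \<Longrightarrow> t \<in> T \<Longrightarrow> filterlim (zc \<alpha> t) at_infinity (at (cen \<alpha> t))"
proof -
  assume a: "\<alpha> \<le> M" "t \<in> T"
  have "filterlim (\<lambda>w. ((w - cen \<alpha> t) * zc \<alpha> t w) / (w - cen \<alpha> t)) at_infinity (at (cen \<alpha> t))"
    by (rule filterlim_divide_at_infinity[OF zc_limit[OF a] _ dd_nz[OF a]])
      (auto simp: filterlim_at LIM_zero eventually_at_filter)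
  moreover have "eventually (\<lambda>w. ((w - cen \<alpha> t) * zc \<alpha> t w) / (w - cen \<alpha> t) = zc \<alpha> t w) (at (cen \<alpha> t))"
    by (auto simp: eventually_at_filter)
  ultimately show ?thesis using filterlim_cong[OF refl refl] by fastforce
qed

lemma compact_gamma:
  assumes "\<alpha> \<le> M" "t \<in> T"
  shows "compact (gamma_set z U \<Gamma> \<alpha> t)"
proof -
  obtain g where g: "g holomorphic_on (z \<alpha> t ` U \<alpha> t)" "\<And>p. p \<in> U \<alpha> t \<Longrightarrow> g (z \<alpha> t p) = p"
    using holomorphic_has_inverse[OF z_hol[OF assms] open_U[OF assms] z_inj[OF assms]] by metis
  have "gamma_set z U \<Gamma> \<alpha> t = g ` path_image (\<Gamma> \<alpha> t)"
    using Gamma_image[OF assms] g(2) by (force simp: gamma_set_def image_iff)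
  moreover have "compact (path_image (\<Gamma> \<alpha> t))"
    using Gamma_curve[OF assms] by (simp add: compact_valid_path_image)
  ultimately show ?thesis
    using holomorphic_on_imp_continuous_on[OF g(1)] Gamma_image[OF assms]
    by (auto intro!: compact_continuous_image intro: continuous_on_subset)
qed

lemma near_exterior:
  assumes "\<alpha> \<le> M" "t \<in> T"
  shows "eventually (\<lambda>w. (\<alpha> = 0 \<longrightarrow> w \<noteq> 0) \<and> ch \<alpha> w \<in> right_exterior q z U \<Gamma> \<alpha> t) (at (cen \<alpha> t))"
proof (cases "\<alpha> = 0")
  case True
  have "bounded (- outside (gamma_set z U \<Gamma> 0 t))"
    using cobounded_outside compact_imp_bounded compact_gamma[of 0 t] assms by blast
  then obtain B where "- outside (gamma_set z U \<Gamma> 0 t) \<subseteq> ball 0 B"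
    by (meson bounded_subset_ballD)
  then have "eventually (\<lambda>p. p \<in> outside (gamma_set z U \<Gamma> 0 t)) at_infinity"
    unfolding eventually_at_infinity by (intro exI[of _ B]) (auto simp: subset_iff)
  then have "eventually (\<lambda>w. ch \<alpha> w \<in> outside (gamma_set z U \<Gamma> 0 t)) (at (cen \<alpha> t))"
    using eventually_ch[of _ \<alpha> t] True by (simp add: puncture_def)
  then show ?thesis
    using True by (auto simp: right_exterior_def eventually_at_filter cen_def elim: eventually_mono)
next
  case False
  then have i: "\<alpha> \<in> {1..M}" using assms by auto
  have "open (inside (gamma_set z U \<Gamma> \<alpha> t))"
    by (intro open_inside compact_imp_closed compact_gamma assms)
  from eventually_at_in_open[OF this q_inside[OF i assms(2)]] False show ?thesis
    by (simp add: right_exterior_def ch_def cen_def)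
qed

lemma near_V: "\<alpha> \<le> M \<Longrightarrow> t \<in> T \<Longrightarrow> eventually (\<lambda>w. w \<in> V \<alpha> t) (at (cen \<alpha> t))"
  using near_exterior[of \<alpha> t] exterior_subset[of \<alpha> t] by (auto simp: V_def elim!: eventually_mono)

lemma V_openin: 
  assumes "\<alpha> \<le> M"
  shows "openin (top_of_set (Ts \<times> UNIV)) {(t, w). t \<in> T \<and> w \<in> V \<alpha> t}"
proof (cases "\<alpha> = 0")
  case True
  let ?X = "Ts \<times> (-{0::complex})"
  have c: "continuous_on ?X (\<lambda>p. (fst p, 1 / snd p))"
    by (intro continuous_intros) auto
  have "openin (top_of_set ?X) (?X \<inter> (\<lambda>p. (fst p, 1 / snd p)) -` {(t, p). t \<in> T \<and> p \<in> U \<alpha> t})"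
    by (rule continuous_openin_preimage[OF c _ U_open[OF assms]]) auto
  moreover have "openin (top_of_set (Ts \<times> UNIV)) ?X" by (rule openin_Times) auto
  ultimately have "openin (top_of_set (Ts \<times> UNIV)) (?X \<inter> (\<lambda>p. (fst p, 1 / snd p)) -` {(t, p). t \<in> T \<and> p \<in> U \<alpha> t})"
    by (rule openin_trans)
  moreover have "?X \<inter> (\<lambda>p. (fst p, 1 / snd p)) -` {(t, p). t \<in> T \<and> p \<in> U \<alpha> t} = {(t, w). t \<in> T \<and> w \<in> V \<alpha> t}"
    using T_sub True by (auto simp: V_def ch_def)
  ultimately show ?thesis by simp
next
  case False
  then show ?thesis using U_open[OF assms] by (simp add: V_def ch_def)
qed

lemma open_V: "\<alpha> \<le> M \<Longrightarrow> t \<in> T \<Longrightarrow> open (V \<alpha> t)"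
  by (rule slice_open[OF V_openin])

lemma chart_continuous:
  assumes "\<alpha> \<le> M" "continuous_on {(t, p). t \<in> T \<and> p \<in> U \<alpha> t} (\<lambda>(t, p). f t p)"
  shows "continuous_on {(t, w). t \<in> T \<and> w \<in> V \<alpha> t} (\<lambda>(t, w). f t (ch \<alpha> w) :: complex)"
proof -
  have "continuous_on {(t, w). t \<in> T \<and> w \<in> V \<alpha> t} (\<lambda>p. (fst p, ch \<alpha> (snd p)))"
  proof (cases "\<alpha> = 0")
    case True
    have "continuous_on {(t, w). t \<in> T \<and> w \<in> V \<alpha> t} (\<lambda>p. (fst p, 1 / snd p))"
      by (intro continuous_intros) (use True in \<open>auto simp: V_def\<close>)
    then show ?thesis using True by (simp add: ch_def)
  next
    case False
    then show ?thesis by (simp add: ch_def continuous_on_id)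
  qed
  moreover have "(\<lambda>p. (fst p, ch \<alpha> (snd p))) ` {(t, w). t \<in> T \<and> w \<in> V \<alpha> t} \<subseteq> {(t, p). t \<in> T \<and> p \<in> U \<alpha> t}"
    by (auto simp: V_def)
  ultimately have "continuous_on {(t, w). t \<in> T \<and> w \<in> V \<alpha> t} (\<lambda>x. (\<lambda>(t, p). f t p) (fst x, ch \<alpha> (snd x)))"
    by (rule continuous_on_compose2[OF assms(2)])
  then show ?thesis by (rule continuous_on_eq) auto
qed

lemma zc_continuous: "\<alpha> \<le> M \<Longrightarrow> continuous_on {(t, w). t \<in> T \<and> w \<in> V \<alpha> t} (\<lambda>(t, w). zc \<alpha> t w)"
  and mc_continuous: "\<alpha> \<le> M \<Longrightarrow> continuous_on {(t, w). t \<in> T \<and> w \<in> V \<alpha> t} (\<lambda>(t, w). mc \<alpha> t w)"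
  using chart_continuous[of \<alpha> "z \<alpha>"] chart_continuous[of \<alpha> "m \<alpha>"] z_holo[of \<alpha>] m_holo[of \<alpha>]
  by (auto simp: zc_def mc_def jointly_holomorphic_def)

lemma ch_hol: "(\<alpha> = 0 \<Longrightarrow> 0 \<notin> A) \<Longrightarrow> ch \<alpha> holomorphic_on A"
  unfolding ch_def[abs_def] by (cases "\<alpha> = 0") (auto intro!: holomorphic_intros)

lemma zc_hol: "\<alpha> \<le> M \<Longrightarrow> t \<in> T \<Longrightarrow> zc \<alpha> t holomorphic_on V \<alpha> t"
  and mc_hol: "\<alpha> \<le> M \<Longrightarrow> t \<in> T \<Longrightarrow> mc \<alpha> t holomorphic_on V \<alpha> t"
  unfolding zc_def[abs_def] mc_def[abs_def]
  using holomorphic_on_compose_gen[OF ch_hol z_hol, of \<alpha> "V \<alpha> t" \<alpha> t] holomorphic_on_compose_gen[OF ch_hol m_hol, of \<alpha> "V \<alpha> t" \<alpha> t]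
  by (auto simp: o_def V_def)

lemma q_cont: "i \<in> {1..M} \<Longrightarrow> continuous_on T (q i)"
  using q_holo[of i] by (simp add: holomorphic_in_times_def)

lemma d_cont: "i \<in> {1..M} \<Longrightarrow> continuous_on T (d i)"
  using continuous_on_exp[OF ld_cont[of i]] ld_exp[of i] by (auto simp: cong: continuous_on_cong)

lemma cen_cont: "\<alpha> \<le> M \<Longrightarrow> continuous_on T (cen \<alpha>)"
  using q_cont[of \<alpha>] by (cases "\<alpha> = 0") (auto simp: cen_def[abs_def])

lemma dd_cont: "\<alpha> \<le> M \<Longrightarrow> continuous_on T (dd \<alpha>)"
  using d_cont[of \<alpha>] by (cases "\<alpha> = 0") (auto simp: dd_def[abs_def])

lemma E_hol: "t \<in> T \<Longrightarrow> E1 t holomorphic_on - Q t" "t \<in> T \<Longrightarrow> E2 t holomorphic_on - Q t"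
  using rational_holomorphic[OF E1_rational] rational_holomorphic[OF E2_rational] by (auto simp: Q_def)

text \<open>
  The annuli \<open>r1 \<le> |w - c0| \<le> r2\<close> do not depend on \<open>t\<close>, so that residues can be differentiated
  under a fixed contour. \<open>h\<close> continues \<open>(w - c) z\<close> to the whole disc, where \<open>z\<close> itself need not
  be defined.
\<close>

definition good_at :: "(nat \<Rightarrow> complex) \<Rightarrow> (nat \<Rightarrow> real) \<Rightarrow> (nat \<Rightarrow> real) \<Rightarrow> (nat \<Rightarrow> real) \<Rightarrow> nat \<Rightarrow> times \<Rightarrow> (complex \<Rightarrow> complex) \<Rightarrow> bool" where
  "good_at c0 r1 r r2 \<alpha> t h \<longleftrightarrow> cen \<alpha> t \<in> ball (c0 \<alpha>) (r1 \<alpha>) \<and>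
    (\<forall>w. r1 \<alpha> \<le> dist (c0 \<alpha>) w \<longrightarrow> dist (c0 \<alpha>) w \<le> r2 \<alpha> \<longrightarrow> w \<in> V \<alpha> t) \<and>
    h holomorphic_on ball (c0 \<alpha>) (r2 \<alpha>) \<and> (\<forall>w\<in>ball (c0 \<alpha>) (r2 \<alpha>). norm (h w / dd \<alpha> t - 1) < 1/3) \<and>
    h (cen \<alpha> t) = dd \<alpha> t \<and>
    (\<forall>w\<in>ball (c0 \<alpha>) (r2 \<alpha>). r1 \<alpha> \<le> dist (c0 \<alpha>) w \<longrightarrow> h w = (w - cen \<alpha> t) * zc \<alpha> t w) \<and>
    eventually (\<lambda>w. h w = (w - cen \<alpha> t) * zc \<alpha> t w) (at (cen \<alpha> t))"

definition good :: "(nat \<Rightarrow> complex) \<Rightarrow> (nat \<Rightarrow> real) \<Rightarrow> (nat \<Rightarrow> real) \<Rightarrow> (nat \<Rightarrow> real) \<Rightarrow> times \<Rightarrow> bool" where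
  "good c0 r1 r r2 t \<longleftrightarrow> t \<in> T \<and> c0 0 = 0 \<and>
    (\<forall>\<alpha>\<le>M. 0 < r1 \<alpha> \<and> r1 \<alpha> < r \<alpha> \<and> r \<alpha> < r2 \<alpha> \<and> (\<exists>h. good_at c0 r1 r r2 \<alpha> t h)) \<and>
    (\<forall>i\<in>{1..M}. \<forall>j\<in>{1..M}. i \<noteq> j \<longrightarrow> ball (c0 i) (r2 i) \<inter> K j t = {}) \<and>
    (\<forall>j\<in>{1..M}. norm (q j t) * r2 0 < 1)"

lemma good_radius:
  assumes \<alpha>: "\<alpha> \<le> M" and t0: "t0 \<in> T"
  obtains R where "R > 0" "ball (cen \<alpha> t0) R - {cen \<alpha> t0} \<subseteq> V \<alpha> t0"
    "\<And>w. w \<in> ball (cen \<alpha> t0) R - {cen \<alpha> t0} \<Longrightarrow> norm ((w - cen \<alpha> t0) * zc \<alpha> t0 w / dd \<alpha> t0 - 1) < 1/4"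
    "\<And>j. j \<in> {1..M} \<Longrightarrow> \<alpha> \<noteq> 0 \<Longrightarrow> \<alpha> \<noteq> j \<Longrightarrow> ball (cen \<alpha> t0) R \<inter> K j t0 = {}"
    "\<And>j. j \<in> {1..M} \<Longrightarrow> norm (q j t0) * R < 1"
proof -
  let ?c = "cen \<alpha> t0"
  have "((\<lambda>w. (w - ?c) * zc \<alpha> t0 w / dd \<alpha> t0) \<longlongrightarrow> dd \<alpha> t0 / dd \<alpha> t0) (at ?c)"
    by (intro tendsto_intros zc_limit assms dd_nz)
  then have "((\<lambda>w. (w - ?c) * zc \<alpha> t0 w / dd \<alpha> t0) \<longlongrightarrow> 1) (at ?c)" using dd_nz[OF assms] by simp
  then have e1: "eventually (\<lambda>w. dist ((w - ?c) * zc \<alpha> t0 w / dd \<alpha> t0) 1 < 1/4) (at ?c)"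
    by (rule tendstoD) simp
  have op: "open (\<Inter>j\<in>{j\<in>{1..M}. \<alpha> \<noteq> 0 \<and> \<alpha> \<noteq> j}. - K j t0)"
    using closed_K t0 by (intro open_INT) auto
  have "?c \<in> (\<Inter>j\<in>{j\<in>{1..M}. \<alpha> \<noteq> 0 \<and> \<alpha> \<noteq> j}. - K j t0)"
    using q_notin_K[of \<alpha> _ t0] assms by (auto simp: cen_def)
  with op obtain R1 where R1: "R1 > 0" "ball ?c R1 \<subseteq> (\<Inter>j\<in>{j\<in>{1..M}. \<alpha> \<noteq> 0 \<and> \<alpha> \<noteq> j}. - K j t0)"
    using openE by blast
  from eventually_conj[OF near_V[OF assms] e1] obtain R2 where R2: "R2 > 0"
    "\<And>w. w \<noteq> ?c \<Longrightarrow> dist w ?c < R2 \<Longrightarrow> w \<in> V \<alpha> t0 \<and> dist ((w - ?c) * zc \<alpha> t0 w / dd \<alpha> t0) 1 < 1/4"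
    unfolding eventually_at by auto
  define B where "B = 1 + (\<Sum>j=1..M. norm (q j t0))"
  have B: "norm (q j t0) < B" if "j \<in> {1..M}" for j
    using member_le_sum[of j "{1..M}" "\<lambda>j. norm (q j t0)"] that by (auto simp: B_def)
  have B0: "B > 0" unfolding B_def by (intro add_pos_nonneg sum_nonneg) auto
  define R where "R = min (min R1 R2) (1 / B)"
  show ?thesis
  proof
    show "R > 0" using R1 R2 B0 by (simp add: R_def)
    show "ball ?c R - {?c} \<subseteq> V \<alpha> t0"
    proof
      fix w assume "w \<in> ball ?c R - {?c}"
      then have "w \<noteq> ?c" "dist w ?c < R2" by (auto simp: R_def dist_commute)
      then show "w \<in> V \<alpha> t0" using R2(2) by blast
    qed
    show "norm ((w - ?c) * zc \<alpha> t0 w / dd \<alpha> t0 - 1) < 1/4" if "w \<in> ball ?c R - {?c}" for w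
    proof -
      have "w \<noteq> ?c" "dist w ?c < R2" using that by (auto simp: R_def dist_commute)
      then show ?thesis using R2(2)[of w] by (simp add: dist_norm[of _ "1::complex"])
    qed
    show "ball ?c R \<inter> K j t0 = {}" if "j \<in> {1..M}" "\<alpha> \<noteq> 0" "\<alpha> \<noteq> j" for j
      using R1(2) that by (auto simp: R_def)
    show "norm (q j t0) * R < 1" if "j \<in> {1..M}" for j
    proof -
      have "norm (q j t0) * R \<le> norm (q j t0) * (1 / B)"
        by (intro mult_left_mono) (auto simp: R_def)
      also have "\<dots> < 1" using B[OF that] B0 by simp
      finally show ?thesis .
    qed
  qed
qed

lemma good_eventually:
  assumes t0: "t0 \<in> T"
  obtains r1 r r2 where "eventually (\<lambda>t. t \<in> T \<longrightarrow> good (\<lambda>\<alpha>. cen \<alpha> t0) r1 r r2 t) (nhds t0)"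
proof -
  have "\<forall>\<alpha>\<in>{..M}. \<exists>R>0. ball (cen \<alpha> t0) R - {cen \<alpha> t0} \<subseteq> V \<alpha> t0 \<and>
    (\<forall>w \<in> ball (cen \<alpha> t0) R - {cen \<alpha> t0}. norm ((w - cen \<alpha> t0) * zc \<alpha> t0 w / dd \<alpha> t0 - 1) < 1/4) \<and>
    (\<forall>j\<in>{1..M}. \<alpha> \<noteq> 0 \<longrightarrow> \<alpha> \<noteq> j \<longrightarrow> ball (cen \<alpha> t0) R \<inter> K j t0 = {}) \<and>
    (\<forall>j\<in>{1..M}. norm (q j t0) * R < 1)"
    using good_radius[OF _ t0] by (metis atMost_iff)
  from bchoice[OF this] obtain R where R0: "\<forall>\<alpha>\<in>{..M}. R \<alpha> > 0 \<and> ball (cen \<alpha> t0) (R \<alpha>) - {cen \<alpha> t0} \<subseteq> V \<alpha> t0 \<and>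
    (\<forall>w \<in> ball (cen \<alpha> t0) (R \<alpha>) - {cen \<alpha> t0}. norm ((w - cen \<alpha> t0) * zc \<alpha> t0 w / dd \<alpha> t0 - 1) < 1/4) \<and>
    (\<forall>j\<in>{1..M}. \<alpha> \<noteq> 0 \<longrightarrow> \<alpha> \<noteq> j \<longrightarrow> ball (cen \<alpha> t0) (R \<alpha>) \<inter> K j t0 = {}) \<and>
    (\<forall>j\<in>{1..M}. norm (q j t0) * R \<alpha> < 1)" by blast
  have R: "\<And>\<alpha>. \<alpha> \<le> M \<Longrightarrow> R \<alpha> > 0"
    "\<And>\<alpha>. \<alpha> \<le> M \<Longrightarrow> ball (cen \<alpha> t0) (R \<alpha>) - {cen \<alpha> t0} \<subseteq> V \<alpha> t0"
    "\<And>\<alpha> w. \<alpha> \<le> M \<Longrightarrow> w \<in> ball (cen \<alpha> t0) (R \<alpha>) - {cen \<alpha> t0} \<Longrightarrow> norm ((w - cen \<alpha> t0) * zc \<alpha> t0 w / dd \<alpha> t0 - 1) < 1/4"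
    "\<And>\<alpha> j. \<alpha> \<le> M \<Longrightarrow> j \<in> {1..M} \<Longrightarrow> \<alpha> \<noteq> 0 \<Longrightarrow> \<alpha> \<noteq> j \<Longrightarrow> ball (cen \<alpha> t0) (R \<alpha>) \<inter> K j t0 = {}"
    "\<And>\<alpha> j. \<alpha> \<le> M \<Longrightarrow> j \<in> {1..M} \<Longrightarrow> norm (q j t0) * R \<alpha> < 1"
    using R0 unfolding Ball_def atMost_iff by blast+
  define r1 where "r1 = (\<lambda>\<alpha>. R \<alpha> / 4)"
  define r where "r = (\<lambda>\<alpha>. R \<alpha> / 2)"
  define r2 where "r2 = (\<lambda>\<alpha>. 3 * R \<alpha> / 4)"
  define r3 where "r3 = (\<lambda>\<alpha>. 7 * R \<alpha> / 8)"
  have rr: "0 < r1 \<alpha>" "r1 \<alpha> < r \<alpha>" "r1 \<alpha> < r2 \<alpha>" "r \<alpha> < r2 \<alpha>" "r2 \<alpha> < r3 \<alpha>" "r3 \<alpha> < R \<alpha>" if "\<alpha> \<le> M" for \<alpha>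
    using R(1)[OF that] by (auto simp: r1_def r_def r2_def r3_def)
  have evK: "eventually (\<lambda>t. t \<in> T \<longrightarrow> cball (cen i t0) (r3 i) \<inter> K j t = {}) (nhds t0)"
    if ij: "i \<in> {1..M}" "j \<in> {1..M}" "i \<noteq> j" for i j
  proof -
    have "{t0} \<times> cball (cen i t0) (r3 i) \<subseteq> {(t, p). t \<in> T \<and> p \<notin> K j t}"
      using R(4)[of i j] rr(6)[of i] ij t0 by (auto simp: disjoint_iff)
    from eventually_tube[OF cut_open[OF ij(2)] compact_cball this] show ?thesis
      by eventually_elim (use T_sub in auto)
  qed
  have evq: "eventually (\<lambda>t. t \<in> T \<longrightarrow> norm (q j t) * r3 0 < 1) (nhds t0)" if j: "j \<in> {1..M}" for j
  proof -
    have "((\<lambda>t. norm (q j t) * r3 0) \<longlongrightarrow> norm (q j t0) * r3 0) (at t0 within T)"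
      using q_cont[OF j] t0 by (intro tendsto_intros) (auto simp: continuous_on_def)
    moreover have lt: "norm (q j t0) * r3 0 < 1"
      using R(5)[of 0 j] rr(6)[of 0] j by (meson le_less_trans less_imp_le mult_left_mono norm_ge_zero le0)
    ultimately have "eventually (\<lambda>t. norm (q j t) * r3 0 < 1) (at t0 within T)"
      by (rule order_tendstoD(2))
    then show ?thesis using lt unfolding eventually_at_filter by (auto elim!: eventually_mono)
  qed
  have evE: "eventually (\<lambda>t. t \<in> T \<longrightarrow> (\<forall>w \<in> ball (cen \<alpha> t0) (r3 \<alpha>) - {cen \<alpha> t}. (\<alpha> = 0 \<longrightarrow> w \<noteq> 0) \<and> ch \<alpha> w \<notin> Q t)) (nhds t0)"
    if \<alpha>: "\<alpha> \<le> M" for \<alpha>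
  proof (cases "\<alpha> = 0")
    case True
    have "eventually (\<lambda>t. \<forall>j\<in>{1..M}. t \<in> T \<longrightarrow> norm (q j t) * r3 0 < 1) (nhds t0)"
      by (intro eventually_ball_finite ballI evq) auto
    then show ?thesis
    proof eventually_elim
      case (elim t)
      show ?case
      proof (intro impI ballI)
        fix w assume t: "t \<in> T" and w: "w \<in> ball (cen \<alpha> t0) (r3 \<alpha>) - {cen \<alpha> t}"
        have w0: "w \<noteq> 0" "norm w < r3 0" using w True by (auto simp: cen_def)
        have "1 / w \<noteq> q j t" if j: "j \<in> {1..M}" for j
        proof
          assume "1 / w = q j t"
          then have "norm (q j t) * norm w = 1" using w0 by (metis divide_self_if norm_divide norm_one nonzero_eq_divide_eq norm_mult times_divide_eq_left)
          moreover have "norm (q j t) * norm w \<le> norm (q j t) * r3 0" using w0 by (intro mult_left_mono) auto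
          ultimately show False using elim j t by force
        qed
        then have "1 / w \<notin> Q t" unfolding Q_def by blast
        then show "(\<alpha> = 0 \<longrightarrow> w \<noteq> 0) \<and> ch \<alpha> w \<notin> Q t" using w0 True by (simp add: ch_def)
      qed
    qed
  next
    case False
    then have i: "\<alpha> \<in> {1..M}" using \<alpha> by auto
    have "eventually (\<lambda>t. \<forall>j\<in>{1..M}-{\<alpha>}. t \<in> T \<longrightarrow> cball (cen \<alpha> t0) (r3 \<alpha>) \<inter> K j t = {}) (nhds t0)"
      by (intro eventually_ball_finite ballI evK i) auto
    then show ?thesis
    proof eventually_elim
      case (elim t)
      show ?case
      proof (intro impI ballI)
        fix w assume t: "t \<in> T" and w: "w \<in> ball (cen \<alpha> t0) (r3 \<alpha>) - {cen \<alpha> t}"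
        have "w \<noteq> q j t" if j: "j \<in> {1..M}" for j
        proof (cases "j = \<alpha>")
          case False
          then have "cball (cen \<alpha> t0) (r3 \<alpha>) \<inter> K j t = {}" using elim j t by blast
          moreover have "w \<in> cball (cen \<alpha> t0) (r3 \<alpha>)" using w by auto
          ultimately have "w \<notin> K j t" by blast
          then show ?thesis using q_in_K[OF j t] by auto
        qed (use w \<open>\<alpha> \<noteq> 0\<close> in \<open>auto simp: cen_def\<close>)
        then have "w \<notin> Q t" unfolding Q_def by blast
        then show "(\<alpha> = 0 \<longrightarrow> w \<noteq> 0) \<and> ch \<alpha> w \<notin> Q t" using False by (simp add: ch_def)
      qed
    qed
  qed
  have ev: "eventually (\<lambda>t. t \<in> T \<longrightarrow> (\<exists>h. good_at (\<lambda>\<alpha>. cen \<alpha> t0) r1 r r2 \<alpha> t h)) (nhds t0)"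
    if \<alpha>: "\<alpha> \<le> M" for \<alpha>
  proof -
    define E where "E = (\<lambda>t w. (if \<alpha> \<in> J then E2 else E1) t (ch \<alpha> w))"
    have I: "\<alpha> \<in> J \<or> \<alpha> \<in> I \<or> \<alpha> = 0" using IJ \<alpha> by (cases "\<alpha> = 0") auto
    have J0: "0 \<notin> J" using IJ by auto
    have EZ: "E t w = zc \<alpha> t w ^ k \<alpha>" if "t \<in> T" "w \<in> V \<alpha> t" for t w
      using I J0 E1_eq[OF that(1), of "ch \<alpha> w"] string_I1[of \<alpha> t "ch \<alpha> w"] string_J2[of \<alpha> t "ch \<alpha> w"] that k_pos[of 0] IJ
      by (auto simp: E_def zc_def V_def)
    have Eh: "eventually (\<lambda>t. t \<in> T \<longrightarrow> E t holomorphic_on ball (cen \<alpha> t0) (r3 \<alpha>) - {cen \<alpha> t}) (nhds t0)"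
      using evE[OF \<alpha>]
    proof eventually_elim
      case (elim t)
      show ?case
      proof
        assume t: "t \<in> T"
        have 1: "ch \<alpha> holomorphic_on ball (cen \<alpha> t0) (r3 \<alpha>) - {cen \<alpha> t}"
          using elim t by (intro ch_hol) auto
        have 2: "(if \<alpha> \<in> J then E2 else E1) t holomorphic_on - Q t" using E_hol[OF t] by auto
        have 3: "ch \<alpha> ` (ball (cen \<alpha> t0) (r3 \<alpha>) - {cen \<alpha> t}) \<subseteq> - Q t" using elim t by blast
        show "E t holomorphic_on ball (cen \<alpha> t0) (r3 \<alpha>) - {cen \<alpha> t}"
          using holomorphic_on_compose_gen[OF 1 2 3] by (simp add: E_def[abs_def] o_def)
      qed
    qed
    have "eventually (\<lambda>t. t \<in> T \<longrightarrow> cen \<alpha> t \<in> ball (cen \<alpha> t0) (r1 \<alpha>) \<and>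
      (\<forall>w. r1 \<alpha> \<le> dist (cen \<alpha> t0) w \<longrightarrow> dist (cen \<alpha> t0) w \<le> r2 \<alpha> \<longrightarrow> w \<in> V \<alpha> t) \<and>
      (\<exists>h. h holomorphic_on ball (cen \<alpha> t0) (r2 \<alpha>) \<and> (\<forall>w\<in>ball (cen \<alpha> t0) (r2 \<alpha>). norm (h w / dd \<alpha> t - 1) < 1/3) \<and>
        h (cen \<alpha> t) = dd \<alpha> t \<and> (\<forall>w\<in>ball (cen \<alpha> t0) (r2 \<alpha>). r1 \<alpha> \<le> dist (cen \<alpha> t0) w \<longrightarrow> h w = (w - cen \<alpha> t) * zc \<alpha> t w) \<and>
        eventually (\<lambda>w. h w = (w - cen \<alpha> t) * zc \<alpha> t w) (at (cen \<alpha> t)))) (nhds t0)"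
    proof (rule root_continuation[OF T_open t0 V_openin[OF \<alpha>] zc_continuous[OF \<alpha>] zc_hol[OF \<alpha> t0]
          cen_cont[OF \<alpha>] dd_cont[OF \<alpha>] dd_nz[OF \<alpha>] k_pos[OF \<alpha>] EZ Eh near_V[OF \<alpha>] zc_limit[OF \<alpha>] rr(1)[OF \<alpha>] rr(3)[OF \<alpha>] rr(5)[OF \<alpha>]])
      have sub: "ball (cen \<alpha> t0) (r3 \<alpha>) \<subseteq> ball (cen \<alpha> t0) (R \<alpha>)" using rr[OF \<alpha>] by auto
      show "ball (cen \<alpha> t0) (r3 \<alpha>) - {cen \<alpha> t0} \<subseteq> V \<alpha> t0" using R(2)[OF \<alpha>] sub by auto
      show "norm ((w - cen \<alpha> t0) * zc \<alpha> t0 w / dd \<alpha> t0 - 1) < 1/4" if "w \<in> ball (cen \<alpha> t0) (r3 \<alpha>) - {cen \<alpha> t0}" for w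
        using R(3)[OF \<alpha>, of w] sub that by auto
    qed
    then show ?thesis
      by eventually_elim (auto simp: good_at_def)
  qed
  have all1: "eventually (\<lambda>t. \<forall>\<alpha>\<in>{..M}. t \<in> T \<longrightarrow> (\<exists>h. good_at (\<lambda>\<alpha>. cen \<alpha> t0) r1 r r2 \<alpha> t h)) (nhds t0)"
    by (intro eventually_ball_finite ballI ev) auto
  have all2: "eventually (\<lambda>t. \<forall>i\<in>{1..M}. \<forall>j\<in>{1..M}-{i}. t \<in> T \<longrightarrow> cball (cen i t0) (r3 i) \<inter> K j t = {}) (nhds t0)"
    by (intro eventually_ball_finite ballI evK) auto
  have all3: "eventually (\<lambda>t. \<forall>j\<in>{1..M}. t \<in> T \<longrightarrow> norm (q j t) * r3 0 < 1) (nhds t0)"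
    by (intro eventually_ball_finite ballI evq) auto
  have "eventually (\<lambda>t. t \<in> T \<longrightarrow> good (\<lambda>\<alpha>. cen \<alpha> t0) r1 r r2 t) (nhds t0)"
    using all1 all2 all3
  proof eventually_elim
    case (elim t)
    show ?case
    proof
      assume t: "t \<in> T"
      have "ball (cen i t0) (r2 i) \<inter> K j t = {}" if "i \<in> {1..M}" "j \<in> {1..M}" "i \<noteq> j" for i j
      proof -
        have "ball (cen i t0) (r2 i) \<subseteq> cball (cen i t0) (r3 i)" using rr(5)[of i] that by auto
        moreover have "cball (cen i t0) (r3 i) \<inter> K j t = {}" using elim(2) that t by auto
        ultimately show ?thesis by blast
      qed
      moreover have "norm (q j t) * r2 0 < 1" if "j \<in> {1..M}" for j
      proof -
        have "norm (q j t) * r2 0 \<le> norm (q j t) * r3 0" using rr(5)[of 0] by (intro mult_left_mono) auto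
        then show ?thesis using elim(3) that t by fastforce
      qed
      ultimately show "good (\<lambda>\<alpha>. cen \<alpha> t0) r1 r r2 t"
        unfolding good_def using t elim(1) rr by (auto simp: cen_def[of 0])
    qed
  qed
  then show ?thesis by (rule that)
qed

end

section \<open>Residue identities at a fixed time\<close>

lemma (in pole_chart) res_Cauchy:
  assumes "\<phi> holomorphic_on ball c0 \<rho>"
  shows "res (\<lambda>w. \<phi> w / (w - c)) = - \<phi> c"
proof -
  have "((\<lambda>w. \<phi> w / (w - c)) has_contour_integral (2 * of_real pi * \<i> * \<phi> c)) (circlepath c0 r)"
    by (rule Cauchy_integral_circlepath_simple)
      (use rad in \<open>auto intro!: holomorphic_on_subset[OF assms] simp: dist_norm norm_minus_commute\<close>)
  then show ?thesis by (simp add: res_def contour_integral_unique)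
qed

lemma log_branch_derivative:
  fixes L Z :: "complex \<Rightarrow> complex"
  assumes "open B" "continuous_on B L" "\<And>x. x \<in> B \<Longrightarrow> exp (L x) = Z x" "x \<in> B"
    and Z: "(Z has_field_derivative Z') (at x)"
  shows "(L has_field_derivative Z' / Z x) (at x)"
proof -
  have nz: "Z x \<noteq> 0" using assms(3)[OF assms(4)] by (metis exp_not_eq_zero)
  have "isCont L x" using assms by (simp add: continuous_on_eq_continuous_at)
  then have "(L \<longlongrightarrow> L x) (nhds x)" by (simp add: isCont_def tendsto_at_iff_tendsto_nhds)
  then have "eventually (\<lambda>y. dist (L y) (L x) < 1) (nhds x)" by (rule tendstoD) simp
  moreover have "eventually (\<lambda>y. y \<in> B) (nhds x)" using assms by (simp add: eventually_nhds_in_open)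
  ultimately have "eventually (\<lambda>y. Ln (Z y / Z x) + L x = L y) (nhds x)"
  proof eventually_elim
    case (elim y)
    have "\<bar>Im (L y - L x)\<bar> < 1" using elim(1) abs_Im_le_cmod[of "L y - L x"] by (simp add: dist_norm)
    then have "Ln (exp (L y - L x)) = L y - L x" using pi_gt3 by (intro Ln_exp) auto
    then show ?case using assms(3)[OF elim(2)] assms(3)[OF assms(4)] by (simp add: exp_diff)
  qed
  moreover have "((\<lambda>y. Ln (Z y / Z x) + L x) has_field_derivative Z' / Z x) (at x)"
    using nz Z by (auto intro!: derivative_eq_intros)
  ultimately show ?thesis
    using DERIV_cong_ev[OF refl _ refl, of "\<lambda>y. Ln (Z y / Z x) + L x" L x] by blast
qed

locale good_point = string_solution +
  fixes c0 :: "nat \<Rightarrow> complex" and r1 r r2 :: "nat \<Rightarrow> real" and t :: times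
  assumes good: "good c0 r1 r r2 t"
begin

abbreviation c :: "nat \<Rightarrow> complex" where "c \<alpha> \<equiv> cen \<alpha> t"
abbreviation DD :: "nat \<Rightarrow> complex set" where "DD \<alpha> \<equiv> ball (c0 \<alpha>) (r2 \<alpha>) - {c \<alpha>}"
abbreviation res :: "nat \<Rightarrow> (complex \<Rightarrow> complex) \<Rightarrow> complex" where "res \<alpha> \<equiv> pole_chart.res (c0 \<alpha>) (r \<alpha>)"
abbreviation tm :: "nat \<Rightarrow> nat \<Rightarrow> complex" where "tm \<alpha> \<equiv> time M t \<alpha>"

definition hh :: "nat \<Rightarrow> complex \<Rightarrow> complex" where "hh \<alpha> = (SOME h. good_at c0 r1 r r2 \<alpha> t h)"
definition zh :: "nat \<Rightarrow> complex \<Rightarrow> complex" where "zh \<alpha> = pole_chart.Z (c \<alpha>) (hh \<alpha>)"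
definition ann :: "nat \<Rightarrow> complex set" where "ann \<alpha> = ball (c0 \<alpha>) (r2 \<alpha>) - cball (c0 \<alpha>) (r1 \<alpha>)"
definition mh :: "nat \<Rightarrow> complex \<Rightarrow> complex" where
  "mh \<alpha> w = (if \<alpha> \<in> J then - (of_nat (k \<alpha>) / of_nat (k 0)) * zh \<alpha> w ^ (k \<alpha> - 1) * E1 t (ch \<alpha> w)
    else of_nat (k \<alpha>) / of_nat (k 0) * zh \<alpha> w ^ (k \<alpha> - 1) * E2 t (ch \<alpha> w))"

lemma tT: "t \<in> T" and c00: "c0 0 = 0"
  and rad: "\<alpha> \<le> M \<Longrightarrow> 0 < r1 \<alpha>" "\<alpha> \<le> M \<Longrightarrow> r1 \<alpha> < r \<alpha>" "\<alpha> \<le> M \<Longrightarrow> r \<alpha> < r2 \<alpha>"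
  and disc_K: "i \<in> {1..M} \<Longrightarrow> j \<in> {1..M} \<Longrightarrow> i \<noteq> j \<Longrightarrow> ball (c0 i) (r2 i) \<inter> K j t = {}"
  and q_small: "j \<in> {1..M} \<Longrightarrow> norm (q j t) * r2 0 < 1"
  using good unfolding good_def by blast+

lemma hh_good: "\<alpha> \<le> M \<Longrightarrow> good_at c0 r1 r r2 \<alpha> t (hh \<alpha>)"
  unfolding hh_def using good unfolding good_def by (metis someI_ex)

lemma hh: assumes "\<alpha> \<le> M"
  shows c_in: "dist (c0 \<alpha>) (c \<alpha>) < r1 \<alpha>"
    and ann_V: "\<And>w. r1 \<alpha> \<le> dist (c0 \<alpha>) w \<Longrightarrow> dist (c0 \<alpha>) w \<le> r2 \<alpha> \<Longrightarrow> w \<in> V \<alpha> t"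
    and hh_hol: "hh \<alpha> holomorphic_on ball (c0 \<alpha>) (r2 \<alpha>)"
    and hh_close: "\<And>w. w \<in> ball (c0 \<alpha>) (r2 \<alpha>) \<Longrightarrow> norm (hh \<alpha> w / dd \<alpha> t - 1) < 1/3"
    and hh_c: "hh \<alpha> (c \<alpha>) = dd \<alpha> t"
    and hh_ann: "\<And>w. w \<in> ball (c0 \<alpha>) (r2 \<alpha>) \<Longrightarrow> r1 \<alpha> \<le> dist (c0 \<alpha>) w \<Longrightarrow> hh \<alpha> w = (w - c \<alpha>) * zc \<alpha> t w"
    and hh_near: "eventually (\<lambda>w. hh \<alpha> w = (w - c \<alpha>) * zc \<alpha> t w) (at (c \<alpha>))"
  using hh_good[OF assms] unfolding good_at_def by auto

lemma hh_nz: "\<alpha> \<le> M \<Longrightarrow> w \<in> ball (c0 \<alpha>) (r2 \<alpha>) \<Longrightarrow> hh \<alpha> w \<noteq> 0"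
  using hh_close[of \<alpha> w] by auto

lemma chart: "\<alpha> \<le> M \<Longrightarrow> pole_chart (c0 \<alpha>) (c \<alpha>) (r \<alpha>) (r2 \<alpha>) (hh \<alpha>)"
  using rad[of \<alpha>] c_in[of \<alpha>] hh_hol[of \<alpha>] hh_nz[of \<alpha>] by unfold_locales auto

lemma zh_eq: "zh \<alpha> w = hh \<alpha> w / (w - c \<alpha>)" if "\<alpha> \<le> M"
  by (simp add: zh_def pole_chart.Z_def[OF chart[OF that]])

lemma zh_hol: "\<alpha> \<le> M \<Longrightarrow> zh \<alpha> holomorphic_on DD \<alpha>"
  and zh_nz: "\<alpha> \<le> M \<Longrightarrow> w \<in> DD \<alpha> \<Longrightarrow> zh \<alpha> w \<noteq> 0"
  and zh'_hol: "\<alpha> \<le> M \<Longrightarrow> deriv (zh \<alpha>) holomorphic_on DD \<alpha>"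
  unfolding zh_def using pole_chart.Z_hol[OF chart] pole_chart.Z_nz[OF chart] pole_chart.Z'_hol[OF chart] by auto

lemma open_ann: "open (ann \<alpha>)" by (auto simp: ann_def)

lemma ann_D: "\<alpha> \<le> M \<Longrightarrow> ann \<alpha> \<subseteq> DD \<alpha>" using c_in[of \<alpha>] by (auto simp: ann_def)
lemma ann_sub_V: "\<alpha> \<le> M \<Longrightarrow> ann \<alpha> \<subseteq> V \<alpha> t" using ann_V[of \<alpha>] by (auto simp: ann_def)
lemma circle_ann: "\<alpha> \<le> M \<Longrightarrow> sphere (c0 \<alpha>) (r \<alpha>) \<subseteq> ann \<alpha>" using rad[of \<alpha>] by (auto simp: ann_def)

lemma zh_ann: "\<alpha> \<le> M \<Longrightarrow> w \<in> ann \<alpha> \<Longrightarrow> zh \<alpha> w = zc \<alpha> t w"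
  using hh_ann[of \<alpha> w] ann_D[of \<alpha>] by (auto simp: zh_eq ann_def)

lemma zh_near: "\<alpha> \<le> M \<Longrightarrow> eventually (\<lambda>w. zh \<alpha> w = zc \<alpha> t w) (at (c \<alpha>))"
  using hh_near[of \<alpha>] unfolding eventually_at_filter by (auto simp: zh_eq elim!: eventually_mono)

lemma deriv_zh_ann: "\<alpha> \<le> M \<Longrightarrow> w \<in> ann \<alpha> \<Longrightarrow> deriv (zh \<alpha>) w = deriv (zc \<alpha> t) w"
  by (rule deriv_cong_ev[OF _ refl])
    (use eventually_nhds_in_open[OF open_ann, of w \<alpha>] in \<open>auto elim!: eventually_mono simp: zh_ann\<close>)

lemma ch_D: assumes "\<alpha> \<le> M" "w \<in> DD \<alpha>" shows "\<alpha> = 0 \<Longrightarrow> w \<noteq> 0" "ch \<alpha> w \<notin> Q t"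
proof -
  show "\<alpha> = 0 \<Longrightarrow> w \<noteq> 0" using assms by (auto simp: cen_def)
  show "ch \<alpha> w \<notin> Q t"
  proof
    assume "ch \<alpha> w \<in> Q t"
    then obtain j where j: "j \<in> {1..M}" "ch \<alpha> w = q j t" by (auto simp: Q_def)
    show False
    proof (cases "\<alpha> = 0")
      case True
      then have w: "w \<noteq> 0" "norm w < r2 0" using assms c00 by (auto simp: cen_def)
      have "q j t * w = 1" using j(2) True w by (simp add: ch_def divide_eq_eq)
      then have "norm (q j t) * norm w = 1" by (metis norm_mult norm_one)
      moreover have "norm (q j t) * norm w \<le> norm (q j t) * r2 0" using w by (intro mult_left_mono) auto
      ultimately show False using q_small[OF j(1)] by simp
    next
      case False
      then have i: "\<alpha> \<in> {1..M}" using assms by auto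
      have "w = q j t" using j(2) False by (simp add: ch_def)
      moreover have "j \<noteq> \<alpha>" using calculation assms False by (auto simp: cen_def)
      ultimately show False using disc_K[OF i j(1)] q_in_K[OF j(1) tT] assms by auto
    qed
  qed
qed

lemma ch_D_hol: "\<alpha> \<le> M \<Longrightarrow> \<Psi> holomorphic_on - Q t \<Longrightarrow> (\<lambda>w. \<Psi> (ch \<alpha> w)) holomorphic_on DD \<alpha>"
proof -
  assume \<alpha>: "\<alpha> \<le> M" and \<Psi>: "\<Psi> holomorphic_on - Q t"
  have 1: "ch \<alpha> holomorphic_on DD \<alpha>" using ch_D(1)[OF \<alpha>] by (intro ch_hol) blast
  have 2: "ch \<alpha> ` DD \<alpha> \<subseteq> - Q t" using ch_D(2)[OF \<alpha>] by blast
  show ?thesis using holomorphic_on_compose_gen[OF 1 \<Psi> 2] by (simp add: o_def)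
qed

lemma ch'_D_hol: "\<alpha> \<le> M \<Longrightarrow> ch' \<alpha> holomorphic_on DD \<alpha>"
  unfolding ch'_def[abs_def] using ch_D[of \<alpha>] by (cases "\<alpha> = 0") (auto intro!: holomorphic_intros)

lemma deriv_ch:
  assumes "\<alpha> \<le> M" "w \<in> DD \<alpha>" "\<Psi> holomorphic_on - Q t"
  shows "((\<lambda>w. \<Psi> (ch \<alpha> w)) has_field_derivative deriv \<Psi> (ch \<alpha> w) * ch' \<alpha> w) (at w)"
proof -
  have "(\<Psi> has_field_derivative deriv \<Psi> (ch \<alpha> w)) (at (ch \<alpha> w))"
    by (rule holomorphic_derivI[OF assms(3)]) (use ch_D[OF assms(1,2)] finite_imp_closed[of "Q t"] in auto)
  then show ?thesis
    by (rule DERIV_chain2[OF _ has_deriv_ch]) (use ch_D[OF assms(1,2)] in auto)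
qed

lemma PP_hol: "PP t holomorphic_on - Q t"
  unfolding PP_def by (intro holomorphic_intros E_hol tT)

lemma mh_hol: "\<alpha> \<le> M \<Longrightarrow> mh \<alpha> holomorphic_on DD \<alpha>"
  unfolding mh_def[abs_def] using k_pos[of 0]
  by (cases "\<alpha> \<in> J") (auto intro!: holomorphic_intros zh_hol ch_D_hol E_hol tT)

lemma index_cases: "\<alpha> \<le> M \<Longrightarrow> \<alpha> \<in> J \<or> \<alpha> \<in> I \<or> \<alpha> = 0" using IJ by (cases "\<alpha> = 0") auto
lemma J_sub: "j \<in> J \<Longrightarrow> j \<in> {1..M}" and zero_J: "0 \<notin> J"
  and finite_J: "finite J" and finite_I: "finite I"
  using IJ by auto (metis finite_Un finite_atLeastAtMost)+

lemma mh_eq: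
  assumes \<alpha>: "\<alpha> \<le> M" and w: "w \<in> V \<alpha> t" "zh \<alpha> w = zc \<alpha> t w"
  shows "mh \<alpha> w = mc \<alpha> t w"
proof -
  let ?p = "ch \<alpha> w"
  have p: "?p \<in> U \<alpha> t" using w by (simp add: V_def)
  have nz: "z \<alpha> t ?p \<noteq> 0" by (rule z_nonzero[OF \<alpha> tT p])
  have k: "of_nat (k \<alpha>) \<noteq> (0::complex)" "of_nat (k 0) \<noteq> (0::complex)" using k_pos[OF \<alpha>] k_pos[of 0] by auto
  consider "\<alpha> \<in> J" | "\<alpha> \<in> I" "\<alpha> \<notin> J" | "\<alpha> = 0" using index_cases[OF \<alpha>] IJ by auto
  then show ?thesis
  proof cases
    case 1
    have "- (of_nat (k 0) / of_nat (k \<alpha>)) * (m \<alpha> t ?p / z \<alpha> t ?p ^ (k \<alpha> - 1)) = E1 t ?p"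
      by (rule string_J1[OF 1 tT p])
    then show ?thesis unfolding mh_def mc_def w(2) zc_def using 1 k nz by (simp flip: \<open>_ = E1 t ?p\<close>)
  next
    case 2
    have "1 / of_nat (k \<alpha>) * (m \<alpha> t ?p / z \<alpha> t ?p ^ (k \<alpha> - 1)) = 1 / of_nat (k 0) * E2 t ?p"
      by (rule string_I2[OF 2(1) tT p])
    then show ?thesis unfolding mh_def mc_def w(2) zc_def using 2 k nz by (simp add: field_simps)
  next
    case 3
    have "E2 t ?p = m 0 t ?p / z 0 t ?p ^ (k 0 - 1)"
      by (rule E2_eq[OF tT]) (use p 3 in simp)
    then show ?thesis using 3 k nz w zero_J by (simp add: mh_def mc_def zc_def)
  qed
qed

lemma mh_ann: "\<alpha> \<le> M \<Longrightarrow> w \<in> ann \<alpha> \<Longrightarrow> mh \<alpha> w = mc \<alpha> t w"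
  using mh_eq[of \<alpha> w] ann_sub_V[of \<alpha>] zh_ann by auto

lemma mh_near: "\<alpha> \<le> M \<Longrightarrow> eventually (\<lambda>w. mh \<alpha> w = mc \<alpha> t w) (at (c \<alpha>))"
proof -
  assume \<alpha>: "\<alpha> \<le> M"
  show ?thesis
    using zh_near[OF \<alpha>] near_V[OF \<alpha> tT] by eventually_elim (rule mh_eq[OF \<alpha>])
qed

lemma PP_J: "j \<in> J \<Longrightarrow> w \<in> ann j \<Longrightarrow> PP t w = - (zc j t w * mc j t w / of_nat (k j))"
proof -
  assume j: "j \<in> J" and w: "w \<in> ann j"
  have jM: "j \<le> M" "j \<noteq> 0" using J_sub[OF j] by auto
  have p: "w \<in> U j t" using w ann_sub_V[OF jM(1)] jM by (auto simp: V_def ch_def)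
  have nz: "z j t w \<noteq> 0" by (rule z_nonzero[OF jM(1) tT p])
  have k: "of_nat (k j) \<noteq> (0::complex)" "of_nat (k 0) \<noteq> (0::complex)" "k j > 0" using k_pos[OF jM(1)] k_pos[of 0] by auto
  have 1: "- (of_nat (k 0) / of_nat (k j)) * (m j t w / z j t w ^ (k j - 1)) = E1 t w" by (rule string_J1[OF j tT p])
  have 2: "E2 t w = z j t w ^ k j" using string_J2[OF j tT p] k by simp
  have 3: "z j t w ^ k j = z j t w * z j t w ^ (k j - 1)" using k(3) by (metis Suc_diff_1 power_Suc)
  show ?thesis
    unfolding PP_def 1[symmetric] 2 3 zc_def mc_def using nz k jM by (simp add: ch_def)
qed

lemma expn: "\<alpha> \<le> M \<Longrightarrow> pole_expansion (c0 \<alpha>) (c \<alpha>) (r \<alpha>) (r2 \<alpha>) (hh \<alpha>) (mh \<alpha>) (N \<alpha>) (tm \<alpha>) (\<lambda>n. v \<alpha> n t)"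
proof -
  assume \<alpha>: "\<alpha> \<le> M"
  show ?thesis
  proof (intro pole_expansion.intro chart[OF \<alpha>] pole_expansion_axioms.intro)
    show "mh \<alpha> holomorphic_on DD \<alpha>" by (rule mh_hol[OF \<alpha>])
    have "eventually (\<lambda>w. (\<lambda>n. v \<alpha> (n + 2) t / zc \<alpha> t w ^ (n + 2)) sums
        (mc \<alpha> t w - (\<Sum>n=1..N \<alpha>. of_nat n * tm \<alpha> n * zc \<alpha> t w ^ (n - 1)) - tm \<alpha> 0 / zc \<alpha> t w)) (at (c \<alpha>))"
      using eventually_ch[OF m_expansion[OF \<alpha> tT]] by (simp add: zc_def mc_def)
    then show "eventually (\<lambda>w. (\<lambda>n. v \<alpha> (n + 2) t / pole_chart.Z (c \<alpha>) (hh \<alpha>) w ^ (n + 2)) sums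
        (mh \<alpha> w - (\<Sum>n=1..N \<alpha>. of_nat n * tm \<alpha> n * pole_chart.Z (c \<alpha>) (hh \<alpha>) w ^ (n - 1))
          - tm \<alpha> 0 / pole_chart.Z (c \<alpha>) (hh \<alpha>) w)) (at (c \<alpha>))"
      unfolding zh_def[symmetric]
      using zh_near[OF \<alpha>] mh_near[OF \<alpha>] by eventually_elim simp
  qed
qed

lemma res_cong: "\<alpha> \<le> M \<Longrightarrow> (\<And>w. w \<in> ann \<alpha> \<Longrightarrow> \<phi> w = \<psi> w) \<Longrightarrow> res \<alpha> \<phi> = res \<alpha> \<psi>"
  using circle_ann[of \<alpha>] by (intro pole_chart.res_cong[OF chart]) blast+

lemma coefficient:
  assumes "\<alpha> \<le> M" "n \<ge> 1"
  shows "v \<alpha> (n + 1) t = res \<alpha> (\<lambda>w. zc \<alpha> t w ^ n * mc \<alpha> t w * deriv (zc \<alpha> t) w)"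
proof -
  have "v \<alpha> (n + 1) t = res \<alpha> (\<lambda>w. zh \<alpha> w ^ n * mh \<alpha> w * deriv (zh \<alpha>) w)"
    using pole_expansion.res_coefficient[OF expn[OF assms(1)] assms(2)] by (simp add: zh_def)
  also have "\<dots> = res \<alpha> (\<lambda>w. zc \<alpha> t w ^ n * mc \<alpha> t w * deriv (zc \<alpha> t) w)"
    by (rule res_cong[OF assms(1)]) (simp add: zh_ann mh_ann deriv_zh_ann assms)
  finally show ?thesis .
qed

lemma square_coefficient:
  assumes "\<alpha> \<le> M"
  shows "2 * (\<Sum>n=1..N \<alpha>. of_nat n * tm \<alpha> n * v \<alpha> (n + 1) t) + tm \<alpha> 0 ^ 2
    = res \<alpha> (\<lambda>w. zc \<alpha> t w * mc \<alpha> t w ^ 2 * deriv (zc \<alpha> t) w)"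
proof -
  have "2 * (\<Sum>n=1..N \<alpha>. of_nat n * tm \<alpha> n * v \<alpha> (n + 1) t) + tm \<alpha> 0 ^ 2
     = res \<alpha> (\<lambda>w. zh \<alpha> w * mh \<alpha> w ^ 2 * deriv (zh \<alpha>) w)"
    using pole_expansion.res_square[OF expn[OF assms(1)]] by (simp add: zh_def)
  also have "\<dots> = res \<alpha> (\<lambda>w. zc \<alpha> t w * mc \<alpha> t w ^ 2 * deriv (zc \<alpha> t) w)"
    by (rule res_cong[OF assms(1)]) (simp add: zh_ann mh_ann deriv_zh_ann assms)
  finally show ?thesis .
qed

lemma q_inj: "inj_on (\<lambda>i. q i t) {1..M}"
proof (rule inj_onI)
  fix i j assume *: "i \<in> {1..M}" "j \<in> {1..M}" "q i t = q j t"
  show "i = j"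
    using q_notin_K[OF *(1,2) _ tT] q_in_K[OF *(2) tT] *(3) by auto
qed

lemma res_sum_zero:
  assumes \<Psi>: "\<Psi> holomorphic_on - Q t"
  shows "(\<Sum>\<alpha>\<le>M. res \<alpha> (\<lambda>w. \<Psi> (ch \<alpha> w) * ch' \<alpha> w)) = 0"
proof -
  have i: "res i (\<lambda>w. \<Psi> (ch i w) * ch' i w) = - residue \<Psi> (q i t)" if "i \<in> {1..M}" for i
  proof -
    have iM: "i \<le> M" "i \<noteq> 0" using that by auto
    have "contour_integral (circlepath (c0 i) (r i)) \<Psi> = 2 * of_real pi * \<i> * residue \<Psi> (c i)"
    proof (rule residue_circle)
      show "\<Psi> holomorphic_on DD i"
        using ch_D_hol[OF iM(1) \<Psi>] iM by (simp add: ch_def)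
    qed (use rad[OF iM(1)] c_in[OF iM(1)] in auto)
    then show ?thesis using iM by (simp add: ch_def ch'_def pole_chart.res_def[OF chart] cen_def)
  qed
  have "1 / r 0 > 0" using rad[of 0] by simp
  have qr: "norm x < 1 / r 0" if x: "x \<in> Q t" for x
  proof -
    obtain j where j: "j \<in> {1..M}" "x = q j t" using x by (auto simp: Q_def)
    have "norm x * r 0 \<le> norm x * r2 0" using rad[of 0] by (intro mult_left_mono) auto
    then have "norm x * r 0 < 1" using q_small[OF j(1)] j(2) by simp
    then show ?thesis using rad[of 0] by (simp add: field_simps)
  qed
  have "contour_integral (circlepath 0 (1 / r 0)) \<Psi> =
     2 * pi * \<i> * (\<Sum>p\<in>Q t. winding_number (circlepath 0 (1 / r 0)) p * residue \<Psi> p)"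
    by (rule Residue_theorem[of UNIV]) (use \<Psi> rad[of 0] in \<open>auto simp: Compl_eq_Diff_UNIV[symmetric] dest: qr\<close>)
  also have "(\<Sum>p\<in>Q t. winding_number (circlepath 0 (1 / r 0)) p * residue \<Psi> p) = (\<Sum>p\<in>Q t. residue \<Psi> p)"
    by (intro sum.cong refl) (use qr in \<open>auto simp: winding_number_circlepath\<close>)
  also have "\<dots> = (\<Sum>i=1..M. residue \<Psi> (q i t))"
    unfolding Q_def using sum.reindex[OF q_inj, of "residue \<Psi>"] by (simp add: o_def)
  finally have "res 0 (\<lambda>w. \<Psi> (ch 0 w) * ch' 0 w) = (\<Sum>i=1..M. residue \<Psi> (q i t))"
    using contour_integral_inverse_circle[of "r 0" \<Psi>] rad[of 0]
    unfolding pole_chart.res_def[OF chart[OF le0]] by (simp add: ch_def[abs_def] ch'_def[abs_def] c00)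
  moreover have "{..M} = insert 0 {1..M}" by auto
  ultimately show ?thesis using i by (simp add: sum_negf)
qed

definition OmP :: "nat \<Rightarrow> nat \<Rightarrow> complex \<Rightarrow> complex" where "OmP \<mu> n = plus_part q \<mu> t (\<lambda>x. z \<mu> t x ^ n)"

text \<open>
  In the chart \<open>w = 1/p\<close> the functions compared at infinity agree up to \<open>O(1/p)\<close>, because the
  projector at infinity includes the constant term.
\<close>

definition ow :: "nat \<Rightarrow> complex \<Rightarrow> complex" where "ow \<alpha> w = (if \<alpha> = 0 then w else 1)"

lemma ow_bounded: "\<alpha> \<le> M \<Longrightarrow> f \<in> O[at (c \<alpha>)](ow \<alpha>) \<Longrightarrow> f \<in> O[at (c \<alpha>)](\<lambda>_. 1)"
proof (cases "\<alpha> = 0")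
  case True
  assume "f \<in> O[at (c \<alpha>)](ow \<alpha>)"
  then have "f \<in> O[at 0](\<lambda>w. w)" using True by (simp add: ow_def[abs_def] cen_def)
  also have "(\<lambda>w::complex. w) \<in> O[at 0](\<lambda>_. 1)" by (intro bigoI_tendsto[of _ _ 0]) (auto intro!: tendsto_eq_intros)
  finally show ?thesis using True by (simp add: cen_def)
qed (simp add: ow_def[abs_def])

lemma zpow_singularity:
  assumes "\<alpha> \<le> M"
  shows "isolated_singularity_at (\<lambda>w. zc \<alpha> t w ^ n) (c \<alpha>)" "not_essential (\<lambda>w. zc \<alpha> t w ^ n) (c \<alpha>)"
proof -
  have cb: "c \<alpha> \<in> ball (c0 \<alpha>) (r2 \<alpha>)" using c_in[OF assms] rad[OF assms] by auto
  have an: "hh \<alpha> analytic_on {c \<alpha>}"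
    using hh_hol[OF assms] cb by (meson analytic_at open_ball)
  have "isolated_singularity_at (\<lambda>w. hh \<alpha> w / (w - c \<alpha>)) (c \<alpha>) \<and> not_essential (\<lambda>w. hh \<alpha> w / (w - c \<alpha>)) (c \<alpha>)"
    by (intro conjI singularity_intros isolated_singularity_at_analytic not_essential_analytic analytic_intros an)
  moreover have "(\<lambda>w. hh \<alpha> w / (w - c \<alpha>)) = zh \<alpha>" using zh_eq[OF assms] by auto
  ultimately have 1: "isolated_singularity_at (\<lambda>w. zh \<alpha> w ^ n) (c \<alpha>)" "not_essential (\<lambda>w. zh \<alpha> w ^ n) (c \<alpha>)"
    using singularity_power[of "zh \<alpha>" "c \<alpha>" n] by auto
  have ev: "eventually (\<lambda>w. zh \<alpha> w ^ n = zc \<alpha> t w ^ n) (at (c \<alpha>))"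
    using zh_near[OF assms] by eventually_elim simp
  show "isolated_singularity_at (\<lambda>w. zc \<alpha> t w ^ n) (c \<alpha>)" "not_essential (\<lambda>w. zc \<alpha> t w ^ n) (c \<alpha>)"
    using 1 isolated_singularity_at_cong[OF ev refl] not_essential_cong[OF ev refl] by auto
qed

lemma plus_hol: "\<mu> \<le> M \<Longrightarrow> plus_part q \<mu> t f holomorphic_on - Q t"
  using polynomial_part_holomorphic[of f] principal_part_holomorphic[of "q \<mu> t" f]
  by (auto simp: plus_part_def Q_def intro: holomorphic_on_subset)

lemma plus_self:
  assumes "\<alpha> \<le> M" "isolated_singularity_at (\<lambda>w. f (ch \<alpha> w)) (c \<alpha>)" "not_essential (\<lambda>w. f (ch \<alpha> w)) (c \<alpha>)"
  shows "(\<lambda>w. f (ch \<alpha> w) - plus_part q \<alpha> t f (ch \<alpha> w)) \<in> O[at (c \<alpha>)](ow \<alpha>)"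
proof (cases "\<alpha> = 0")
  case True
  then show ?thesis using assms polynomial_part_bigo[of f]
    by (simp add: ch_def[abs_def] cen_def plus_part_def ow_def[abs_def])
next
  case False
  then show ?thesis using assms principal_part_bigo[of f "q \<alpha> t"]
    by (simp add: ch_def[abs_def] cen_def plus_part_def ow_def[abs_def])
qed

lemma plus_other:
  assumes "\<alpha> \<le> M" "\<mu> \<le> M" "\<alpha> \<noteq> \<mu>"
  shows "(\<lambda>w. plus_part q \<mu> t f (ch \<alpha> w)) \<in> O[at (c \<alpha>)](ow \<alpha>)"
proof (cases "\<alpha> = 0")
  case True
  then show ?thesis using assms principal_part_at_infinity[of "q \<mu> t" f]
    by (simp add: ch_def[abs_def] cen_def plus_part_def ow_def[abs_def])
next
  case False
  have "isCont (plus_part q \<mu> t f) (q \<alpha> t)"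
  proof (cases "\<mu> = 0")
    case True
    then show ?thesis
      using holomorphic_on_imp_continuous_on[OF polynomial_part_holomorphic[of f UNIV]]
      by (simp add: plus_part_def continuous_on_eq_continuous_at)
  next
    case mu: False
    have "q \<alpha> t \<noteq> q \<mu> t" using inj_onD[OF q_inj, of \<alpha> \<mu>] assms False mu by auto
    moreover have "open (- {q \<mu> t})" by auto
    ultimately show ?thesis
      using holomorphic_on_imp_continuous_on[OF principal_part_holomorphic[of "q \<mu> t" f]] mu
        continuous_on_eq_continuous_at[of "- {q \<mu> t}" "principal_part (q \<mu> t) f"]
      by (simp add: plus_part_def)
  qed
  then have "(\<lambda>w. plus_part q \<mu> t f w) \<in> O[at (q \<alpha> t)](\<lambda>_. 1)"
    using bigoI_tendsto[of "plus_part q \<mu> t f" "\<lambda>_. 1" _ "at (q \<alpha> t)"] by (simp add: isCont_def)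
  then show ?thesis using False by (simp add: ch_def[abs_def] cen_def ow_def[abs_def])
qed

lemma OmP_hol: "\<mu> \<le> M \<Longrightarrow> OmP \<mu> n holomorphic_on - Q t"
  unfolding OmP_def by (rule plus_hol)

lemma OmP_bigo:
  assumes "\<alpha> \<le> M" "\<mu> \<le> M"
  shows "(\<lambda>w. OmP \<mu> n (ch \<alpha> w) - (if \<alpha> = \<mu> then 1 else 0) * zh \<alpha> w ^ n) \<in> O[at (c \<alpha>)](ow \<alpha>)"
proof (cases "\<alpha> = \<mu>")
  case True
  have "(\<lambda>w. zc \<alpha> t w ^ n - OmP \<mu> n (ch \<alpha> w)) \<in> O[at (c \<alpha>)](ow \<alpha>)"
    using plus_self[OF assms(1), of "\<lambda>x. z \<alpha> t x ^ n"] zpow_singularity[OF assms(1), of n] True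
    by (simp add: OmP_def zc_def)
  then have "(\<lambda>w. - (zc \<alpha> t w ^ n - OmP \<mu> n (ch \<alpha> w))) \<in> O[at (c \<alpha>)](ow \<alpha>)"
    by (subst landau_o.big.uminus_in_iff)
  also have "?this \<longleftrightarrow> ?thesis"
    using zh_near[OF assms(1)] True by (intro landau_o.big.in_cong) (auto elim!: eventually_mono)
  finally show ?thesis .
next
  case False
  then show ?thesis using plus_other[OF assms False] by (simp add: OmP_def)
qed

definition PJ :: "nat \<Rightarrow> complex \<Rightarrow> complex" where
  "PJ \<alpha> p = 1 / of_nat (k 0) * plus_part q \<alpha> t (\<lambda>x. E1 t x * E2 t x) p"

lemma PJ_hol: "\<mu> \<le> M \<Longrightarrow> PJ \<mu> holomorphic_on - Q t"
  unfolding PJ_def by (intro holomorphic_intros plus_hol)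

lemma EE_singularity:
  assumes "\<alpha> \<le> M"
  shows "isolated_singularity_at (\<lambda>w. E1 t (ch \<alpha> w) * E2 t (ch \<alpha> w)) (c \<alpha>)"
    "not_essential (\<lambda>w. E1 t (ch \<alpha> w) * E2 t (ch \<alpha> w)) (c \<alpha>)"
proof -
  note 1 = rational_singularity[OF E1_rational[OF tT]] and 2 = rational_singularity[OF E2_rational[OF tT]]
  have "isolated_singularity_at (\<lambda>w. E1 t (ch \<alpha> w) * E2 t (ch \<alpha> w)) (c \<alpha>) \<and>
    not_essential (\<lambda>w. E1 t (ch \<alpha> w) * E2 t (ch \<alpha> w)) (c \<alpha>)"
  proof (cases "\<alpha> = 0")
    case True
    then show ?thesis unfolding ch_def cen_def by (simp, intro conjI singularity_intros 1 2) auto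
  next
    case False
    then show ?thesis unfolding ch_def cen_def by (simp, intro conjI singularity_intros 1 2) auto
  qed
  then show "isolated_singularity_at (\<lambda>w. E1 t (ch \<alpha> w) * E2 t (ch \<alpha> w)) (c \<alpha>)"
    "not_essential (\<lambda>w. E1 t (ch \<alpha> w) * E2 t (ch \<alpha> w)) (c \<alpha>)" by auto
qed

lemma PJ_bigo:
  assumes "\<alpha> \<le> M" "\<mu> \<le> M"
  shows "(\<lambda>w. PJ \<mu> (ch \<alpha> w) - (if \<alpha> = \<mu> then PP t (ch \<alpha> w) else 0)) \<in> O[at (c \<alpha>)](ow \<alpha>)"
proof (cases "\<alpha> = \<mu>")
  case True
  have "(\<lambda>w. - (1 / of_nat (k 0)) * (E1 t (ch \<alpha> w) * E2 t (ch \<alpha> w) - plus_part q \<alpha> t (\<lambda>x. E1 t x * E2 t x) (ch \<alpha> w)))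
      \<in> O[at (c \<alpha>)](ow \<alpha>)"
    using plus_self[OF assms(1), of "\<lambda>x. E1 t x * E2 t x"] EE_singularity[OF assms(1)] k_pos[of 0]
    by (subst landau_o.big.cmult_in_iff) auto
  also have "(\<lambda>w. - (1 / of_nat (k 0)) * (E1 t (ch \<alpha> w) * E2 t (ch \<alpha> w) - plus_part q \<alpha> t (\<lambda>x. E1 t x * E2 t x) (ch \<alpha> w)))
      = (\<lambda>w. PJ \<mu> (ch \<alpha> w) - (if \<alpha> = \<mu> then PP t (ch \<alpha> w) else 0))"
    using True by (auto simp: PJ_def PP_def fun_eq_iff algebra_simps)
  finally show ?thesis .
next
  case False
  have "(\<lambda>w. 1 / of_nat (k 0) * plus_part q \<mu> t (\<lambda>x. E1 t x * E2 t x) (ch \<alpha> w)) \<in> O[at (c \<alpha>)](ow \<alpha>)"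
    using plus_other[OF assms False, of "\<lambda>x. E1 t x * E2 t x"] k_pos[of 0]
    by (subst landau_o.big.cmult_in_iff) auto
  then show ?thesis using False by (simp add: PJ_def)
qed

lemma bigo_sum: "(\<And>i. i \<in> A \<Longrightarrow> f i \<in> O[F](g)) \<Longrightarrow> (\<lambda>x. \<Sum>i\<in>A. f i x) \<in> O[F](g)"
  for f :: "'i \<Rightarrow> complex \<Rightarrow> complex"
  by (induction A rule: infinite_finite_induct) (auto intro: sum_in_bigo)

text \<open>A rational function is the sum of its principal parts, by Liouville's theorem.\<close>

lemma PP_decomposition:
  assumes "p \<notin> Q t"
  shows "PP t p = (\<Sum>\<mu>\<le>M. PJ \<mu> p)"
proof -
  define \<Delta> where "\<Delta> = (\<lambda>p. PP t p - (\<Sum>\<mu>\<le>M. PJ \<mu> p))"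
  have h: "\<Delta> holomorphic_on - Q t"
    unfolding \<Delta>_def by (intro holomorphic_intros PP_hol PJ_hol) auto
  have b: "(\<lambda>w. \<Delta> (ch \<alpha> w)) \<in> O[at (c \<alpha>)](ow \<alpha>)" if \<alpha>: "\<alpha> \<le> M" for \<alpha>
  proof -
    have "(\<lambda>w. - (\<Sum>\<mu>\<le>M. PJ \<mu> (ch \<alpha> w) - (if \<alpha> = \<mu> then PP t (ch \<alpha> w) else 0))) \<in> O[at (c \<alpha>)](ow \<alpha>)"
      unfolding landau_o.big.uminus_in_iff by (rule bigo_sum) (use PJ_bigo[OF \<alpha>] in auto)
    also have "(\<lambda>w. - (\<Sum>\<mu>\<le>M. PJ \<mu> (ch \<alpha> w) - (if \<alpha> = \<mu> then PP t (ch \<alpha> w) else 0))) = (\<lambda>w. \<Delta> (ch \<alpha> w))"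
      using \<alpha> by (auto simp: \<Delta>_def fun_eq_iff sum_subtractf)
    finally show ?thesis .
  qed
  have "\<exists>g. g holomorphic_on UNIV \<and> (\<forall>x\<in>UNIV - Q t. g x = \<Delta> x)"
  proof (rule removable_singularities)
    show "\<Delta> \<in> O[at x](\<lambda>_. 1)" if "x \<in> Q t" for x
    proof -
      obtain i where i: "i \<in> {1..M}" "x = q i t" using \<open>x \<in> Q t\<close> by (auto simp: Q_def)
      then show ?thesis using b[of i] by (simp add: ch_def cen_def ow_def[abs_def])
    qed
  qed (use h in \<open>auto simp: Compl_eq_Diff_UNIV\<close>)
  then obtain g where g: "g holomorphic_on UNIV" "\<And>x. x \<notin> Q t \<Longrightarrow> g x = \<Delta> x" by auto
  have "((\<lambda>w. \<Delta> (1 / w)) \<longlongrightarrow> 0) (at 0)"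
    using bigo_tendsto_zero[of "\<lambda>w. \<Delta> (1 / w)" "at 0" "\<lambda>w. w"] b[of 0]
    by (simp add: ch_def[abs_def] cen_def ow_def[abs_def])
  then have "(\<Delta> \<longlongrightarrow> 0) at_infinity"
    by (subst lim_at_infinity_0) (simp add: o_def inverse_eq_divide)
  moreover have "eventually (\<lambda>x. \<Delta> x = g x) at_infinity"
  proof -
    obtain B where B: "\<And>x. x \<in> Q t \<Longrightarrow> norm x < B"
      using finite_imp_bounded[OF finite_Q] by (meson bounded_iff le_less_trans gt_ex)
    show ?thesis unfolding eventually_at_infinity
      by (rule exI[of _ B]) (use B g in \<open>force simp: not_less[symmetric]\<close>)
  qed
  ultimately have "(g \<longlongrightarrow> 0) at_infinity" by (rule Lim_transform_eventually)
  then have "g p = 0" by (rule Liouville_weak_0[OF g(1)])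
  then show ?thesis using g(2)[OF assms] by (simp add: \<Delta>_def)
qed

definition G0 :: "complex \<Rightarrow> complex" where
  "G0 p = (\<Sum>\<beta>\<le>M. \<Sum>n=1..N \<beta>. OmP \<beta> n p * tm \<beta> n) + (\<Sum>j\<in>J. PJ j p)"

definition PPJ :: "nat \<Rightarrow> complex \<Rightarrow> complex" where "PPJ \<alpha> p = (if \<alpha> \<in> J then PP t p else 0)"

lemma PPJ_hol: "PPJ \<alpha> holomorphic_on - Q t"
  unfolding PPJ_def[abs_def] by (cases "\<alpha> \<in> J") (auto intro: PP_hol)

lemma G0_hol: "G0 holomorphic_on - Q t"
  unfolding G0_def by (intro holomorphic_intros OmP_hol PJ_hol) (use J_sub in auto)

definition xi :: "nat \<Rightarrow> complex \<Rightarrow> complex" where "xi \<alpha> = pole_expansion.xi (N \<alpha>) (tm \<alpha>)"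

lemma xi_eq: "xi \<alpha> \<zeta> = (\<Sum>n=1..N \<alpha>. tm \<alpha> n * \<zeta> ^ n)" if "\<alpha> \<le> M"
  by (simp add: xi_def pole_expansion.xi_def[OF expn[OF that]])

lemma xi_hol: "\<alpha> \<le> M \<Longrightarrow> (\<lambda>w. xi \<alpha> (zh \<alpha> w)) holomorphic_on DD \<alpha>"
  by (simp add: xi_eq) (intro holomorphic_intros zh_hol)

lemma G0_bigo:
  assumes \<alpha>: "\<alpha> \<le> M"
  shows "(\<lambda>w. G0 (ch \<alpha> w) - xi \<alpha> (zh \<alpha> w) - PPJ \<alpha> (ch \<alpha> w)) \<in> O[at (c \<alpha>)](ow \<alpha>)"
proof -
  let ?\<delta> = "\<lambda>\<mu>. if \<alpha> = \<mu> then 1 else (0::complex)"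
  have "(\<lambda>w. (\<Sum>\<beta>\<le>M. \<Sum>n=1..N \<beta>. tm \<beta> n * (OmP \<beta> n (ch \<alpha> w) - ?\<delta> \<beta> * zh \<alpha> w ^ n)) +
     (\<Sum>j\<in>J. PJ j (ch \<alpha> w) - (if \<alpha> = j then PP t (ch \<alpha> w) else 0))) \<in> O[at (c \<alpha>)](ow \<alpha>)"
  proof (rule sum_in_bigo(1))
    have "(\<lambda>w. tm \<beta> n * (OmP \<beta> n (ch \<alpha> w) - ?\<delta> \<beta> * zh \<alpha> w ^ n)) \<in> O[at (c \<alpha>)](ow \<alpha>)" if "\<beta> \<le> M" for \<beta> n
      using OmP_bigo[OF \<alpha> that, of n] by (cases "tm \<beta> n = 0") auto
    then show "(\<lambda>w. \<Sum>\<beta>\<le>M. \<Sum>n=1..N \<beta>. tm \<beta> n * (OmP \<beta> n (ch \<alpha> w) - ?\<delta> \<beta> * zh \<alpha> w ^ n)) \<in> O[at (c \<alpha>)](ow \<alpha>)"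
      by (intro bigo_sum) auto
    have "(\<lambda>w. PJ j (ch \<alpha> w) - (if \<alpha> = j then PP t (ch \<alpha> w) else 0)) \<in> O[at (c \<alpha>)](ow \<alpha>)" if "j \<in> J" for j
      using PJ_bigo[OF \<alpha>, of j] J_sub[OF that] by auto
    then show "(\<lambda>w. \<Sum>j\<in>J. PJ j (ch \<alpha> w) - (if \<alpha> = j then PP t (ch \<alpha> w) else 0)) \<in> O[at (c \<alpha>)](ow \<alpha>)"
      by (rule bigo_sum)
  qed
  also have "(\<lambda>w. (\<Sum>\<beta>\<le>M. \<Sum>n=1..N \<beta>. tm \<beta> n * (OmP \<beta> n (ch \<alpha> w) - ?\<delta> \<beta> * zh \<alpha> w ^ n)) +
     (\<Sum>j\<in>J. PJ j (ch \<alpha> w) - (if \<alpha> = j then PP t (ch \<alpha> w) else 0))) =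
     (\<lambda>w. G0 (ch \<alpha> w) - xi \<alpha> (zh \<alpha> w) - PPJ \<alpha> (ch \<alpha> w))"
  proof
    fix w
    have "(\<Sum>\<beta>\<le>M. \<Sum>n=1..N \<beta>. tm \<beta> n * (?\<delta> \<beta> * zh \<alpha> w ^ n)) = (\<Sum>\<beta>\<le>M. if \<alpha> = \<beta> then (\<Sum>n=1..N \<beta>. tm \<beta> n * zh \<alpha> w ^ n) else 0)"
      by (intro sum.cong) auto
    also have "\<dots> = xi \<alpha> (zh \<alpha> w)" using \<alpha> by (simp add: xi_eq)
    finally have 1: "(\<Sum>\<beta>\<le>M. \<Sum>n=1..N \<beta>. tm \<beta> n * (?\<delta> \<beta> * zh \<alpha> w ^ n)) = xi \<alpha> (zh \<alpha> w)" .
    have 2: "(\<Sum>j\<in>J. if \<alpha> = j then PP t (ch \<alpha> w) else 0) = PPJ \<alpha> (ch \<alpha> w)"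
      using finite_J by (simp add: PPJ_def)
    show "(\<Sum>\<beta>\<le>M. \<Sum>n=1..N \<beta>. tm \<beta> n * (OmP \<beta> n (ch \<alpha> w) - ?\<delta> \<beta> * zh \<alpha> w ^ n)) +
     (\<Sum>j\<in>J. PJ j (ch \<alpha> w) - (if \<alpha> = j then PP t (ch \<alpha> w) else 0)) = G0 (ch \<alpha> w) - xi \<alpha> (zh \<alpha> w) - PPJ \<alpha> (ch \<alpha> w)"
      unfolding right_diff_distrib sum_subtractf 1 2 by (simp add: G0_def mult.commute)
  qed
  finally show ?thesis .
qed

abbreviation cuts :: "complex set" where "cuts \<equiv> \<Union>i\<in>{1..M}. K i t"

lemma Q_cuts: "Q t \<subseteq> cuts" using q_in_K[OF _ tT] by (auto simp: Q_def)

lemma S_formula: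
  assumes \<alpha>: "\<alpha> \<le> M" and p: "p \<in> U \<alpha> t - cuts"
  shows "S \<alpha> t p = G0 p - (\<Sum>i=1..M. tm i 0 * lg i t (p - q i t)) - PPJ \<alpha> p"
proof -
  have R: "(\<Sum>\<beta>\<le>M. R_part M N q z lg \<beta> t p) = (\<Sum>\<beta>\<le>M. \<Sum>n=1..N \<beta>. OmP \<beta> n p * tm \<beta> n) - (\<Sum>i=1..M. tm i 0 * lg i t (p - q i t))"
  proof -
    have "(\<Sum>\<beta>\<le>M. if \<beta> = 0 then 0 else tm \<beta> 0 * lg \<beta> t (p - q \<beta> t)) = (\<Sum>i=1..M. tm i 0 * lg i t (p - q i t))"
    proof -
      have "{..M} = insert 0 {1..M}" by auto
      then show ?thesis by simp
    qed
    then show ?thesis by (simp add: R_part_def sum_subtractf OmP_def)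
  qed
  have pQ: "p \<notin> Q t" using p Q_cuts by auto
  show ?thesis
  proof (cases "\<alpha> \<in> J")
    case False
    then have "\<alpha> \<in> insert 0 I" using index_cases[OF \<alpha>] by auto
    from S_normal_I[OF this tT p] False show ?thesis
      by (simp add: R G0_def PPJ_def PJ_def sum_distrib_left)
  next
    case True
    have "{..M} = insert 0 (I \<union> J)" using IJ by auto
    moreover have "0 \<notin> I \<union> J" using IJ by auto
    ultimately have "(\<Sum>\<mu>\<le>M. PJ \<mu> p) = PJ 0 p + (\<Sum>\<mu>\<in>I \<union> J. PJ \<mu> p)"
      using finite_I finite_J by simp
    then have "PP t p = PJ 0 p + ((\<Sum>i\<in>I. PJ i p) + (\<Sum>j\<in>J. PJ j p))"
      unfolding PP_decomposition[OF pQ] using sum.union_disjoint[OF finite_I finite_J IJ(2)] by simp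
    then show ?thesis
      using S_normal_J[OF True tT p] True
      by (simp add: R G0_def PPJ_def PJ_def sum_distrib_left)
  qed
qed

lemma lg_deriv: "i \<in> {1..M} \<Longrightarrow> p \<notin> K i t \<Longrightarrow> ((\<lambda>p. lg i t (p - q i t)) has_field_derivative 1 / (p - q i t)) (at p)"
proof -
  assume i: "i \<in> {1..M}" and p: "p \<notin> K i t"
  have op: "open (- K i t)" using closed_K[OF i tT] by auto
  have cont: "continuous_on (- K i t) (\<lambda>p. lg i t (p - q i t))"
  proof -
    have "continuous_on (- K i t) (\<lambda>p. (\<lambda>(t, p). lg i t (p - q i t)) (t, p))"
      by (rule continuous_on_compose2[OF lg_cont[OF i]]) (use tT in \<open>auto intro!: continuous_intros\<close>)
    then show ?thesis by simp
  qed
  have nz: "p - q i t \<noteq> 0" using q_in_K[OF i tT] p by auto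
  have "((\<lambda>p. lg i t (p - q i t)) has_field_derivative 1 / (p - q i t)) (at p)"
  proof (rule log_branch_derivative[OF op cont, of "\<lambda>p. p - q i t"])
    show "((\<lambda>p. p - q i t) has_field_derivative 1) (at p)" by (auto intro!: derivative_eq_intros)
  qed (use p lg_exp[OF i tT] in auto)
  then show ?thesis .
qed

end

context pole_chart
begin

lemma extend_limit:
  assumes "\<phi> holomorphic_on D" "(\<phi> \<longlongrightarrow> l) (at c)"
  shows "(\<lambda>w. if w = c then l else \<phi> w) holomorphic_on ball c0 \<rho>"
  by (rule removable_singularity) (use assms in auto)

lemma res_log_deriv_limit:
  assumes "\<phi> holomorphic_on D" "(\<phi> \<longlongrightarrow> l) (at c)"
  shows "res (\<lambda>w. \<phi> w * (deriv Z w / Z w)) = l"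
proof -
  have "res (\<lambda>w. (if w = c then l else \<phi> w) * (deriv Z w / Z w)) = l"
    using res_log_deriv[OF extend_limit[OF assms]] by simp
  moreover have "res (\<lambda>w. (if w = c then l else \<phi> w) * (deriv Z w / Z w)) = res (\<lambda>w. \<phi> w * (deriv Z w / Z w))"
    by (rule res_cong) (use circle_D in auto)
  ultimately show ?thesis by simp
qed

lemma res_Cauchy_limit:
  assumes "\<phi> holomorphic_on D" "(\<phi> \<longlongrightarrow> l) (at c)"
  shows "res (\<lambda>w. \<phi> w / (w - c)) = - l"
proof -
  have "res (\<lambda>w. (if w = c then l else \<phi> w) / (w - c)) = - l"
    using res_Cauchy[OF extend_limit[OF assms]] by simp
  moreover have "res (\<lambda>w. (if w = c then l else \<phi> w) / (w - c)) = res (\<lambda>w. \<phi> w / (w - c))"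
    by (rule res_cong) (use circle_D in auto)
  ultimately show ?thesis by simp
qed

end

lemma Ln_near_1: "norm (x - 1) < 1 \<Longrightarrow> x \<notin> \<real>\<^sub>\<le>\<^sub>0" for x :: complex
proof
  assume *: "norm (x - 1) < 1" "x \<in> \<real>\<^sub>\<le>\<^sub>0"
  then have "Re x \<le> 0" by (auto elim!: nonpos_Reals_cases)
  moreover have "\<bar>Re (x - 1)\<bar> < 1" using *(1) abs_Re_le_cmod le_less_trans by blast
  ultimately show False by simp
qed

context good_point
begin

definition gg0 :: "complex \<Rightarrow> complex" where
  "gg0 p = deriv G0 p - (\<Sum>i=1..M. tm i 0 / (p - q i t))"

lemma open_mQ: "open (- Q t)" using finite_imp_closed[OF finite_Q] by auto

lemma gg0_hol: "gg0 holomorphic_on - Q t"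
  unfolding gg0_def by (intro holomorphic_intros holomorphic_deriv[OF G0_hol open_mQ]) (auto simp: Q_def)

lemma m_formula:
  assumes \<alpha>: "\<alpha> \<le> M" and p: "p \<in> U \<alpha> t - Q t"
  shows "m \<alpha> t p * deriv (z \<alpha> t) p = gg0 p - deriv (PPJ \<alpha>) p"
proof (rule continuous_eq_off_thin[of "U \<alpha> t - Q t" "\<lambda>p. m \<alpha> t p * deriv (z \<alpha> t) p" "\<lambda>p. gg0 p - deriv (PPJ \<alpha>) p" cuts p])
  have op: "open (U \<alpha> t - Q t)" using open_U[OF \<alpha> tT] finite_imp_closed[OF finite_Q] by auto
  show "open (U \<alpha> t - Q t)" by fact
  have "(\<lambda>p. m \<alpha> t p * deriv (z \<alpha> t) p) holomorphic_on U \<alpha> t"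
    by (intro holomorphic_intros m_hol holomorphic_deriv[OF z_hol] open_U \<alpha> tT)
  then show "continuous_on (U \<alpha> t - Q t) (\<lambda>p. m \<alpha> t p * deriv (z \<alpha> t) p)"
    by (intro holomorphic_on_imp_continuous_on) (auto intro: holomorphic_on_subset)
  have "(\<lambda>p. gg0 p - deriv (PPJ \<alpha>) p) holomorphic_on - Q t"
    by (intro holomorphic_intros gg0_hol holomorphic_deriv[OF PPJ_hol open_mQ])
  then show "continuous_on (U \<alpha> t - Q t) (\<lambda>p. gg0 p - deriv (PPJ \<alpha>) p)"
    by (intro holomorphic_on_imp_continuous_on) (auto intro: holomorphic_on_subset)
  show "interior cuts = {}" by (rule interior_cuts[OF tT])
  show "p \<in> U \<alpha> t - Q t" by fact
  fix x assume x: "x \<in> U \<alpha> t - Q t - cuts"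
  have opc: "open (U \<alpha> t - cuts)" using open_U[OF \<alpha> tT] closed_cuts[OF tT] by auto
  have xU: "x \<in> U \<alpha> t - cuts" using x by auto
  have xQ: "x \<in> - Q t" using x by auto
  have "((\<lambda>p. G0 p - (\<Sum>i=1..M. tm i 0 * lg i t (p - q i t)) - PPJ \<alpha> p) has_field_derivative
      deriv G0 x - (\<Sum>i=1..M. tm i 0 * (1 / (x - q i t))) - deriv (PPJ \<alpha>) x) (at x)"
    by (intro DERIV_diff DERIV_sum DERIV_cmult lg_deriv holomorphic_derivI[OF G0_hol open_mQ xQ]
        holomorphic_derivI[OF PPJ_hol open_mQ xQ]) (use x in auto)
  then have "(S \<alpha> t has_field_derivative
      deriv G0 x - (\<Sum>i=1..M. tm i 0 * (1 / (x - q i t))) - deriv (PPJ \<alpha>) x) (at x)"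
    by (rule has_field_derivative_transform_within_open[OF _ opc xU]) (simp add: S_formula[OF \<alpha>])
  then show "m \<alpha> t x * deriv (z \<alpha> t) x = gg0 x - deriv (PPJ \<alpha>) x"
    using DERIV_unique[OF S_p[OF \<alpha> tT xU]] by (simp add: gg0_def)
qed

lemma deriv_zc: 
  assumes "\<alpha> \<le> M" "w \<in> V \<alpha> t"
  shows "deriv (zc \<alpha> t) w = deriv (z \<alpha> t) (ch \<alpha> w) * ch' \<alpha> w"
proof -
  have "(z \<alpha> t has_field_derivative deriv (z \<alpha> t) (ch \<alpha> w)) (at (ch \<alpha> w))"
    by (rule holomorphic_derivI[OF z_hol open_U]) (use assms tT in \<open>auto simp: V_def\<close>)
  from DERIV_chain2[OF this has_deriv_ch] assms show ?thesis
    unfolding zc_def[abs_def] by (intro DERIV_imp_deriv) (auto simp: V_def)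
qed

lemma m_form:
  assumes \<alpha>: "\<alpha> \<le> M" and w: "w \<in> ann \<alpha>"
  shows "mh \<alpha> w * deriv (zh \<alpha>) w = gg0 (ch \<alpha> w) * ch' \<alpha> w - deriv (\<lambda>w. PPJ \<alpha> (ch \<alpha> w)) w"
proof -
  have V: "w \<in> V \<alpha> t" using w ann_sub_V[OF \<alpha>] by auto
  have D: "w \<in> DD \<alpha>" using w ann_D[OF \<alpha>] by auto
  have U: "ch \<alpha> w \<in> U \<alpha> t - Q t" using V ch_D[OF \<alpha> D] by (auto simp: V_def)
  have "mh \<alpha> w * deriv (zh \<alpha>) w = m \<alpha> t (ch \<alpha> w) * deriv (z \<alpha> t) (ch \<alpha> w) * ch' \<alpha> w"
    by (simp add: mh_ann[OF \<alpha> w] deriv_zh_ann[OF \<alpha> w] deriv_zc[OF \<alpha> V] mc_def)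
  also have "\<dots> = (gg0 (ch \<alpha> w) - deriv (PPJ \<alpha>) (ch \<alpha> w)) * ch' \<alpha> w"
    by (simp add: m_formula[OF \<alpha> U])
  finally have "mh \<alpha> w * deriv (zh \<alpha>) w = (gg0 (ch \<alpha> w) - deriv (PPJ \<alpha>) (ch \<alpha> w)) * ch' \<alpha> w" .
  moreover have "deriv (PPJ \<alpha>) (ch \<alpha> w) * ch' \<alpha> w = deriv (\<lambda>w. PPJ \<alpha> (ch \<alpha> w)) w"
    by (rule DERIV_imp_deriv[symmetric]) (rule deriv_ch[OF \<alpha> D PPJ_hol])
  ultimately show ?thesis by (simp add: left_diff_distrib)
qed

lemma res_PPJ:
  assumes "\<And>\<alpha>. \<alpha> \<le> M \<Longrightarrow> \<alpha> \<notin> J \<Longrightarrow> f \<alpha> = (\<lambda>w. 0)"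
  shows "(\<Sum>\<alpha>\<le>M. res \<alpha> (f \<alpha>)) = (\<Sum>j\<in>J. res j (f j))"
proof -
  have "(\<Sum>\<alpha>\<le>M. res \<alpha> (f \<alpha>)) = (\<Sum>\<alpha>\<in>J. res \<alpha> (f \<alpha>))"
  proof (rule sum.mono_neutral_right)
    show "J \<subseteq> {..M}" using J_sub by auto
    show "\<forall>i\<in>{..M} - J. res i (f i) = 0"
      using assms by (auto simp: pole_chart.res_def[OF chart])
  qed auto
  then show ?thesis .
qed

lemma pairing:
  assumes \<mu>: "\<mu> \<le> M" and n: "n \<ge> 1"
  shows "(\<Sum>\<alpha>\<le>M. res \<alpha> (\<lambda>w. xi \<alpha> (zc \<alpha> t w) * deriv (\<lambda>w. OmP \<mu> n (ch \<alpha> w)) w))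
      + (\<Sum>j\<in>J. res j (\<lambda>w. PP t w * deriv (\<lambda>w. OmP \<mu> n (ch j w)) w))
    = v \<mu> (n + 1) t + (\<Sum>\<alpha>\<le>M. tm \<alpha> 0 * res \<alpha> (\<lambda>w. OmP \<mu> n (ch \<alpha> w) * (deriv (zc \<alpha> t) w / zc \<alpha> t w)))"
proof -
  define \<Omega> where "\<Omega> = (\<lambda>\<alpha> w. OmP \<mu> n (ch \<alpha> w))"
  have \<Omega>h: "\<Omega> \<alpha> holomorphic_on DD \<alpha>" if "\<alpha> \<le> M" for \<alpha>
    unfolding \<Omega>_def by (rule ch_D_hol[OF that OmP_hol[OF \<mu>]])
  have 1: "res \<alpha> (\<lambda>w. (OmP \<mu> n (ch \<alpha> w) * gg0 (ch \<alpha> w)) * ch' \<alpha> w) + res \<alpha> (\<lambda>w. deriv (\<Omega> \<alpha>) w * PPJ \<alpha> (ch \<alpha> w))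
      = (if \<alpha> = \<mu> then v \<mu> (n + 1) t else 0) - res \<alpha> (\<lambda>w. xi \<alpha> (zc \<alpha> t w) * deriv (\<Omega> \<alpha>) w)
        + tm \<alpha> 0 * res \<alpha> (\<lambda>w. \<Omega> \<alpha> w * (deriv (zc \<alpha> t) w / zc \<alpha> t w))" if \<alpha>: "\<alpha> \<le> M" for \<alpha>
  proof -
    interpret P: pole_expansion "c0 \<alpha>" "c \<alpha>" "r \<alpha>" "r2 \<alpha>" "hh \<alpha>" "mh \<alpha>" "N \<alpha>" "tm \<alpha>" "\<lambda>n. v \<alpha> n t"
      by (rule expn[OF \<alpha>])
    have Z: "P.Z = zh \<alpha>" by (simp add: zh_def)
    have x: "P.xi = xi \<alpha>" by (simp add: xi_def)
    have "(\<lambda>w. \<Omega> \<alpha> w - (if \<alpha> = \<mu> then 1 else 0) * P.Z w ^ n) \<in> O[at (c \<alpha>)](\<lambda>_. 1)"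
      using ow_bounded[OF \<alpha> OmP_bigo[OF \<alpha> \<mu>, of n]] by (simp add: \<Omega>_def Z)
    from P.res_pairing[OF \<Omega>h[OF \<alpha>] this n]
    have A: "res \<alpha> (\<lambda>w. \<Omega> \<alpha> w * (mh \<alpha> w * deriv (zh \<alpha>) w)) =
      (if \<alpha> = \<mu> then 1 else 0) * v \<alpha> (n + 1) t - res \<alpha> (\<lambda>w. xi \<alpha> (zh \<alpha> w) * deriv (\<Omega> \<alpha>) w)
        + tm \<alpha> 0 * res \<alpha> (\<lambda>w. \<Omega> \<alpha> w * (deriv (zh \<alpha>) w / zh \<alpha> w))"
      unfolding Z x by simp
    have B: "res \<alpha> (\<lambda>w. xi \<alpha> (zh \<alpha> w) * deriv (\<Omega> \<alpha>) w) = res \<alpha> (\<lambda>w. xi \<alpha> (zc \<alpha> t w) * deriv (\<Omega> \<alpha>) w)"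
      "res \<alpha> (\<lambda>w. \<Omega> \<alpha> w * (deriv (zh \<alpha>) w / zh \<alpha> w)) = res \<alpha> (\<lambda>w. \<Omega> \<alpha> w * (deriv (zc \<alpha> t) w / zc \<alpha> t w))"
      by (rule res_cong[OF \<alpha>]; simp add: zh_ann[OF \<alpha>] deriv_zh_ann[OF \<alpha>])+
    have "res \<alpha> (\<lambda>w. \<Omega> \<alpha> w * (mh \<alpha> w * deriv (zh \<alpha>) w)) =
      res \<alpha> (\<lambda>w. (OmP \<mu> n (ch \<alpha> w) * gg0 (ch \<alpha> w)) * ch' \<alpha> w - \<Omega> \<alpha> w * deriv (\<lambda>w. PPJ \<alpha> (ch \<alpha> w)) w)"
      by (rule res_cong[OF \<alpha>]) (simp only: m_form[OF \<alpha>] \<Omega>_def right_diff_distrib mult.assoc)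
    also have "\<dots> = res \<alpha> (\<lambda>w. (OmP \<mu> n (ch \<alpha> w) * gg0 (ch \<alpha> w)) * ch' \<alpha> w)
        - res \<alpha> (\<lambda>w. \<Omega> \<alpha> w * deriv (\<lambda>w. PPJ \<alpha> (ch \<alpha> w)) w)"
      by (rule P.res_diff)
        (intro holomorphic_intros ch_D_hol[OF \<alpha>] OmP_hol gg0_hol ch'_D_hol \<Omega>h \<mu> \<alpha> holomorphic_deriv[OF ch_D_hol[OF \<alpha> PPJ_hol]] P.open_D)+
    also have "res \<alpha> (\<lambda>w. \<Omega> \<alpha> w * deriv (\<lambda>w. PPJ \<alpha> (ch \<alpha> w)) w) = - res \<alpha> (\<lambda>w. deriv (\<Omega> \<alpha>) w * PPJ \<alpha> (ch \<alpha> w))"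
      by (rule P.res_by_parts) (intro \<Omega>h \<alpha> ch_D_hol[OF \<alpha>] PPJ_hol)+
    finally show ?thesis using A unfolding B by auto
  qed
  have "(\<Sum>\<alpha>\<le>M. res \<alpha> (\<lambda>w. (OmP \<mu> n (ch \<alpha> w) * gg0 (ch \<alpha> w)) * ch' \<alpha> w)) = 0"
    by (rule res_sum_zero) (intro holomorphic_intros OmP_hol gg0_hol \<mu>)
  moreover have "(\<Sum>\<alpha>\<le>M. res \<alpha> (\<lambda>w. deriv (\<Omega> \<alpha>) w * PPJ \<alpha> (ch \<alpha> w))) = (\<Sum>j\<in>J. res j (\<lambda>w. PP t w * deriv (\<Omega> j) w))"
  proof -
    have "(\<Sum>\<alpha>\<le>M. res \<alpha> (\<lambda>w. deriv (\<Omega> \<alpha>) w * PPJ \<alpha> (ch \<alpha> w))) = (\<Sum>j\<in>J. res j (\<lambda>w. deriv (\<Omega> j) w * PPJ j (ch j w)))"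
      by (rule res_PPJ) (simp add: PPJ_def)
    also have "\<dots> = (\<Sum>j\<in>J. res j (\<lambda>w. PP t w * deriv (\<Omega> j) w))"
    proof (rule sum.cong[OF refl])
      fix j assume "j \<in> J"
      moreover have "j \<noteq> 0" using J_sub[OF \<open>j \<in> J\<close>] by auto
      ultimately show "res j (\<lambda>w. deriv (\<Omega> j) w * PPJ j (ch j w)) = res j (\<lambda>w. PP t w * deriv (\<Omega> j) w)"
        by (simp add: PPJ_def ch_def mult.commute)
    qed
    finally show ?thesis .
  qed
  moreover have "(\<Sum>\<alpha>\<le>M. res \<alpha> (\<lambda>w. (OmP \<mu> n (ch \<alpha> w) * gg0 (ch \<alpha> w)) * ch' \<alpha> w)) + (\<Sum>\<alpha>\<le>M. res \<alpha> (\<lambda>w. deriv (\<Omega> \<alpha>) w * PPJ \<alpha> (ch \<alpha> w)))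
     = (\<Sum>\<alpha>\<le>M. if \<alpha> = \<mu> then v \<mu> (n + 1) t else 0) - (\<Sum>\<alpha>\<le>M. res \<alpha> (\<lambda>w. xi \<alpha> (zc \<alpha> t w) * deriv (\<Omega> \<alpha>) w))
        + (\<Sum>\<alpha>\<le>M. tm \<alpha> 0 * res \<alpha> (\<lambda>w. \<Omega> \<alpha> w * (deriv (zc \<alpha> t) w / zc \<alpha> t w)))"
    unfolding sum.distrib[symmetric] sum_subtractf[symmetric] by (intro sum.cong refl 1) auto
  ultimately show ?thesis using \<mu> by (simp add: \<Omega>_def)
qed

lemma res_infinity:
  assumes \<mu>: "\<mu> \<le> M" and n: "n \<ge> 1"
  shows "res 0 (\<lambda>w. OmP \<mu> n (ch 0 w) * (deriv (zc 0 t) w / zc 0 t w)) = 0"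
proof -
  interpret P: pole_chart "c0 0" "c 0" "r 0" "r2 0" "hh 0" by (rule chart) simp
  have Z: "P.Z = zh 0" by (simp add: zh_def)
  let ?e = "if 0 = \<mu> then 1 else (0::complex)"
  let ?f = "\<lambda>w. OmP \<mu> n (ch 0 w) - ?e * zh 0 w ^ n"
  have fh: "?f holomorphic_on DD 0"
    by (intro holomorphic_intros ch_D_hol OmP_hol zh_hol \<mu>) auto
  have "(?f \<longlongrightarrow> 0) (at (c 0))"
    using OmP_bigo[OF le0 \<mu>, of n] by (rule bigo_tendsto_zero) (simp add: ow_def[abs_def] cen_def)
  from P.res_log_deriv_limit[OF fh this]
  have 1: "res 0 (\<lambda>w. ?f w * (deriv (zh 0) w / zh 0 w)) = 0" by (simp add: Z)
  have 2: "res 0 (\<lambda>w. poly (monom ?e (n - 1)) (zh 0 w) * deriv (zh 0) w) = 0"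
    using P.res_poly[of "monom ?e (n - 1)"] unfolding Z .
  have "res 0 (\<lambda>w. OmP \<mu> n (ch 0 w) * (deriv (zc 0 t) w / zc 0 t w)) =
    res 0 (\<lambda>w. ?f w * (deriv (zh 0) w / zh 0 w) + poly (monom ?e (n - 1)) (zh 0 w) * deriv (zh 0) w)"
  proof (rule res_cong[OF le0])
    fix w assume w: "w \<in> ann 0"
    then have "zh 0 w \<noteq> 0" by (intro zh_nz subsetD[OF ann_D]) auto
    then show "OmP \<mu> n (ch 0 w) * (deriv (zc 0 t) w / zc 0 t w) =
      ?f w * (deriv (zh 0) w / zh 0 w) + poly (monom ?e (n - 1)) (zh 0 w) * deriv (zh 0) w"
      unfolding zh_ann[OF le0 w, symmetric] deriv_zh_ann[OF le0 w, symmetric] poly_monom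
      using n by (simp add: field_simps power_eq_if)
  qed
  also have "\<dots> = res 0 (\<lambda>w. ?f w * (deriv (zh 0) w / zh 0 w)) + res 0 (\<lambda>w. poly (monom ?e (n - 1)) (zh 0 w) * deriv (zh 0) w)"
    by (rule P.res_add) (intro holomorphic_intros fh zh_hol zh'_hol zh_nz; simp)+
  finally show ?thesis by (simp only: 1 2 add_0)
qed

lemma ld_d: "b \<in> {1..M} \<Longrightarrow> dd b t = d b t" by (auto simp: dd_def)
lemma c_q: "b \<in> {1..M} \<Longrightarrow> c b = q b t" by (auto simp: cen_def)

text \<open>
  Off the cuts \<open>fh b\<close> is \<open>\<Sum>\<^sub>n t\<^sub>b\<^sub>n z\<^sub>b\<^sup>n + t\<^sub>b\<^sub>0 log z\<^sub>b - S\<^sub>b\<close>, whose limit at \<open>q\<^sub>b\<close> is \<open>v\<^sub>b\<close>. Written in this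
  form it has no cuts.
\<close>

definition fh :: "nat \<Rightarrow> complex \<Rightarrow> complex" where
  "fh b p = xi b (zh b p) + tm b 0 * (ld b t + Ln (hh b p / d b t)) + (\<Sum>j\<in>{1..M} - {b}. tm j 0 * lg j t (p - q j t))
    - G0 p + PPJ b p"

lemma lg_hol: "b \<in> {1..M} \<Longrightarrow> j \<in> {1..M} - {b} \<Longrightarrow> (\<lambda>p. lg j t (p - q j t)) holomorphic_on ball (c0 b) (r2 b)"
proof -
  assume b: "b \<in> {1..M}" and j: "j \<in> {1..M} - {b}"
  have "((\<lambda>p. lg j t (p - q j t)) has_field_derivative 1 / (p - q j t)) (at p)" if "p \<in> ball (c0 b) (r2 b)" for p
    using disc_K[of b j] b j that by (intro lg_deriv) blast+
  then show ?thesis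
    unfolding holomorphic_on_open[OF open_ball] by blast
qed

lemma lnh_hol: "b \<in> {1..M} \<Longrightarrow> (\<lambda>p. Ln (hh b p / d b t)) holomorphic_on ball (c0 b) (r2 b)"
proof -
  assume b: "b \<in> {1..M}"
  then have bM: "b \<le> M" by auto
  have "hh b p / d b t \<notin> \<real>\<^sub>\<le>\<^sub>0" if "p \<in> ball (c0 b) (r2 b)" for p
    using hh_close[OF bM that] ld_d[OF b] by (intro Ln_near_1) auto
  then show ?thesis
    using d_nz[OF b tT] by (intro holomorphic_intros hh_hol bM) auto
qed

lemma reg_hol: "b \<in> {1..M} \<Longrightarrow> (\<lambda>p. tm b 0 * (ld b t + Ln (hh b p / d b t)) + (\<Sum>j\<in>{1..M} - {b}. tm j 0 * lg j t (p - q j t))) holomorphic_on ball (c0 b) (r2 b)"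
  by (intro holomorphic_intros lnh_hol lg_hol)

lemma sub_hol: "b \<in> {1..M} \<Longrightarrow> f holomorphic_on - Q t \<Longrightarrow> f holomorphic_on DD b"
  using ch_D_hol[of b f] by (simp add: ch_def)

lemma fh_hol: "b \<in> {1..M} \<Longrightarrow> fh b holomorphic_on DD b"
proof -
  assume b: "b \<in> {1..M}"
  then have bM: "b \<le> M" by auto
  have "(\<lambda>p. xi b (zh b p) + (tm b 0 * (ld b t + Ln (hh b p / d b t)) + (\<Sum>j\<in>{1..M} - {b}. tm j 0 * lg j t (p - q j t)))
    - G0 p + PPJ b p) holomorphic_on DD b"
    by (intro holomorphic_intros holomorphic_on_subset[OF reg_hol[OF b]] xi_hol[OF bM] sub_hol[OF b] G0_hol PPJ_hol) auto
  then show ?thesis by (simp add: fh_def[abs_def] add.assoc)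
qed

lemma fh_extends:
  assumes b: "b \<in> {1..M}"
  obtains l where "(fh b \<longlongrightarrow> l) (at (c b))"
proof -
  have bM: "b \<le> M" "b \<noteq> 0" using b by auto
  have cb: "c b \<in> ball (c0 b) (r2 b)" using c_in[OF bM(1)] rad[OF bM(1)] by auto
  let ?g = "\<lambda>p. tm b 0 * (ld b t + Ln (hh b p / d b t)) + (\<Sum>j\<in>{1..M} - {b}. tm j 0 * lg j t (p - q j t))"
  have "isCont ?g (c b)"
    using holomorphic_on_imp_continuous_on[OF reg_hol[OF b]] cb by (simp add: continuous_on_eq_continuous_at)
  then have g: "?g \<in> O[at (c b)](\<lambda>_. 1)"
    using bigoI_tendsto[of ?g "\<lambda>_. 1" _ "at (c b)"] by (simp add: isCont_def)
  have "(\<lambda>w. G0 (ch b w) - xi b (zh b w) - PPJ b (ch b w)) \<in> O[at (c b)](\<lambda>_. 1)"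
    by (rule ow_bounded[OF bM(1) G0_bigo[OF bM(1)]])
  then have "(\<lambda>w. ?g w - (G0 w - xi b (zh b w) - PPJ b w)) \<in> O[at (c b)](\<lambda>_. 1)"
    using bM by (intro sum_in_bigo(2)[OF g]) (simp add: ch_def)
  moreover have "(\<lambda>w. ?g w - (G0 w - xi b (zh b w) - PPJ b w)) = fh b"
    by (simp add: fh_def fun_eq_iff algebra_simps)
  ultimately have "fh b \<in> O[at (c b)](\<lambda>_. 1)" by simp
  then obtain \<psi> where \<psi>: "\<psi> holomorphic_on ball (c0 b) (r2 b)" "\<And>w. w \<in> DD b \<Longrightarrow> \<psi> w = fh b w"
    using pole_chart.extend[OF chart[OF bM(1)] fh_hol[OF b]] by blast
  have "isCont \<psi> (c b)"
    using holomorphic_on_imp_continuous_on[OF \<psi>(1)] cb by (simp add: continuous_on_eq_continuous_at)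
  then have "(\<psi> \<longlongrightarrow> \<psi> (c b)) (at (c b))" by (simp add: isCont_def)
  moreover have "eventually (\<lambda>w. \<psi> w = fh b w) (at (c b))"
    using pole_chart.ev_D[OF chart[OF bM(1)]] by eventually_elim (rule \<psi>)
  ultimately show ?thesis using Lim_transform_eventually that by blast
qed

lemma sum_remove: "b \<in> {1..M} \<Longrightarrow> (\<Sum>i=1..M. f i) = f b + (\<Sum>j\<in>{1..M} - {b}. f j)" for f :: "nat \<Rightarrow> complex"
  by (rule sum.remove) auto

lemma fh_limit:
  assumes b: "b \<in> {1..M}"
  shows "(fh b \<longlongrightarrow> vc b t) (at (c b))"
proof -
  have bM: "b \<le> M" "b \<noteq> 0" using b by auto
  obtain l where l: "(fh b \<longlongrightarrow> l) (at (c b))" using fh_extends[OF b] by blast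
  let ?F = "at (c b) within - cuts"
  have F: "?F \<noteq> bot"
  proof -
    have "c b islimpt - cuts"
      unfolding islimpt_def
    proof (intro allI impI)
      fix X assume X: "c b \<in> X" "open X"
      have "\<not> X \<subseteq> cuts"
        using interior_cuts[OF tT] interiorI[of X "c b" cuts] X by auto
      then obtain y where "y \<in> X" "y \<notin> cuts" by auto
      moreover have "c b \<in> cuts" using q_in_K[OF b tT] b bM by (auto simp: cen_def)
      ultimately show "\<exists>y\<in>- cuts. y \<in> X \<and> y \<noteq> c b" by auto
    qed
    then show ?thesis using trivial_limit_within by blast
  qed
  have le: "?F \<le> at (c b)" by (simp add: at_le)
  have nz: "eventually (\<lambda>w. zh b w \<noteq> 0) (at (c b))"
    using pole_chart.ev_D[OF chart[OF bM(1)]] by eventually_elim (rule zh_nz[OF bM(1)])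
  have cM: "eventually (\<lambda>p. p \<in> V b t \<and> hh b p = (p - c b) * zc b t p \<and> zh b p = zc b t p) (at (c b))"
    using near_V[OF bM(1) tT] hh_near[OF bM(1)] zh_near[OF bM(1)] by eventually_elim auto
  have S: "eventually (\<lambda>p. p \<notin> cuts \<longrightarrow>
      (\<lambda>n. v b (n + 2) t / of_nat (n + 1) / z b t p ^ (n + 1)) sums
        ((\<Sum>n=1..N b. z b t p ^ n * tm b n) + time_log_z M q z lg d ld b t p - vc b t - S b t p)) (at (c b))"
    using S_expansion[OF bM(1) tT] bM by (simp add: puncture_def cen_def)
  define a where "a = (\<lambda>n. if n = 0 then 0 else v b (n + 1) t / of_nat n)"
  have "eventually (\<lambda>p. p \<notin> cuts \<longrightarrow> (\<lambda>n. a n * inverse (zh b p) ^ n) sums (fh b p - vc b t)) (at (c b))"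
    using S cM nz
  proof eventually_elim
    case (elim p)
    show ?case
    proof
      assume p: "p \<notin> cuts"
      have zz: "z b t p = zh b p" using elim bM by (simp add: zc_def ch_def)
      have pU: "p \<in> U b t - cuts" using elim p bM by (auto simp: V_def ch_def)
      have hz: "hh b p = zh b p * (p - q b t)" using elim bM by (simp add: cen_def mult.commute)
      have tl: "time_log_z M q z lg d ld b t p = tm b 0 * (ld b t - lg b t (p - q b t) + Ln (hh b p / d b t))"
        using bM by (simp add: time_log_z_def zz hz)
      have E: "(\<Sum>n=1..N b. z b t p ^ n * tm b n) + time_log_z M q z lg d ld b t p - vc b t - S b t p = fh b p - vc b t"
        unfolding tl S_formula[OF bM(1) pU] sum_remove[OF b] fh_def xi_eq[OF bM(1)] zz
        by (simp add: algebra_simps)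
      have "(\<lambda>n. v b (n + 2) t / of_nat (n + 1) / z b t p ^ (n + 1)) sums
        ((\<Sum>n=1..N b. z b t p ^ n * tm b n) + time_log_z M q z lg d ld b t p - vc b t - S b t p)"
        using elim(1) p by blast
      from this[unfolded E] have "(\<lambda>n. v b (n + 2) t / of_nat (n + 1) / zh b p ^ (n + 1)) sums (fh b p - vc b t)"
        unfolding zz .
      moreover have "(\<lambda>n. v b (n + 2) t / of_nat (n + 1) / zh b p ^ (n + 1)) = (\<lambda>n. (\<lambda>n. a n * inverse (zh b p) ^ n) (Suc n))"
        by (simp add: a_def fun_eq_iff divide_inverse power_inverse)
      ultimately have "(\<lambda>n. (\<lambda>n. a n * inverse (zh b p) ^ n) (Suc n)) sums (fh b p - vc b t)" by metis
      then show "(\<lambda>n. a n * inverse (zh b p) ^ n) sums (fh b p - vc b t)"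
        using sums_Suc_iff[of "\<lambda>n. a n * inverse (zh b p) ^ n" "fh b p - vc b t"] by (simp add: a_def)
    qed
  qed
  then have 1: "eventually (\<lambda>p. (\<lambda>n. a n * inverse (zh b p) ^ n) sums (fh b p - vc b t)) ?F"
    by (auto simp: eventually_at_filter elim!: eventually_mono)
  have 2: "((\<lambda>p. inverse (zh b p)) \<longlongrightarrow> 0) ?F"
    using pole_chart.inverse_Z_tendsto[OF chart[OF bM(1)]] tendsto_mono[OF le] by (simp add: zh_def)
  have 3: "eventually (\<lambda>p. inverse (zh b p) \<noteq> 0) ?F"
    using nz filter_leD[OF le] by (auto elim!: eventually_mono)
  have "(\<lambda>p. fh b p - vc b t) \<in> O[?F](\<lambda>p. inverse (zh b p))"
    using powser_remainder_bigo[OF 1 2 3 F, of 1] by (simp add: a_def)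
  then have "((\<lambda>p. fh b p - vc b t) \<longlongrightarrow> 0) ?F" using 2 by (rule bigo_tendsto_zero)
  then have "(fh b \<longlongrightarrow> vc b t) ?F" by (simp add: LIM_zero_iff)
  moreover have "(fh b \<longlongrightarrow> l) ?F" using l le tendsto_mono by blast
  ultimately have "l = vc b t" using tendsto_unique[OF F] by blast
  then show ?thesis using l by simp
qed

definition fb :: "nat \<Rightarrow> complex \<Rightarrow> complex" where
  "fb b p = xi b (zc b t p) + tm b 0 * (ld b t + Ln ((p - q b t) * zc b t p / d b t)) + (\<Sum>j\<in>{1..M} - {b}. tm j 0 * lg j t (p - q j t))
    - G0 p + PPJ b p"

lemma fb_fh: "b \<in> {1..M} \<Longrightarrow> w \<in> ann b \<Longrightarrow> fb b w = fh b w"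
  using hh_ann[of b w] zh_ann[of b w] c_q[of b] by (auto simp: fb_def fh_def ann_def)

lemma vc_residue:
  assumes b: "b \<in> {1..M}"
  shows "vc b t = res b (\<lambda>w. fb b w * (deriv (zc b t) w / zc b t w))"
proof -
  have bM: "b \<le> M" using b by auto
  have "vc b t = res b (\<lambda>w. fh b w * (deriv (zh b) w / zh b w))"
    using pole_chart.res_log_deriv_limit[OF chart[OF bM] fh_hol[OF b] fh_limit[OF b]] by (simp add: zh_def)
  also have "\<dots> = res b (\<lambda>w. fb b w * (deriv (zc b t) w / zc b t w))"
    by (rule res_cong[OF bM]) (simp add: fb_fh[OF b] zh_ann[OF bM] deriv_zh_ann[OF bM])
  finally show ?thesis .
qed

lemma fb_S:
  assumes b: "b \<in> {1..M}" and p: "p \<in> ann b" "p \<notin> cuts"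
  shows "fb b p = xi b (zc b t p) + tm b 0 * (ld b t - lg b t (p - q b t) + Ln ((p - q b t) * zc b t p / d b t)) - S b t p"
proof -
  have bM: "b \<le> M" "b \<noteq> 0" using b by auto
  have pU: "p \<in> U b t - cuts" using ann_sub_V[OF bM(1)] p bM by (auto simp: V_def ch_def)
  show ?thesis
    unfolding S_formula[OF bM(1) pU] sum_remove[OF b] fb_def by (simp add: algebra_simps)
qed

lemma fb_deriv:
  assumes b: "b \<in> {1..M}" and p: "p \<in> ann b"
  shows "(fb b has_field_derivative (pole_expansion.Xi (N b) (tm b) (zc b t p) - mc b t p) * deriv (zc b t) p) (at p)"
proof -
  have bM: "b \<le> M" "b \<noteq> 0" using b by auto
  interpret P: pole_expansion "c0 b" "c b" "r b" "r2 b" "hh b" "mh b" "N b" "tm b" "\<lambda>n. v b n t"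
    by (rule expn[OF bM(1)])
  have Z: "P.Z = zh b" by (simp add: zh_def)
  have x: "P.xi = xi b" by (simp add: xi_def)
  have D: "p \<in> DD b" and pb: "p \<in> ball (c0 b) (r2 b)" using p ann_D[OF bM(1)] by (auto simp: ann_def)
  have pQ: "p \<in> - Q t" using ch_D(2)[OF bM(1) D] bM by (simp add: ch_def)
  have hn: "hh b p \<noteq> 0" by (rule hh_nz[OF bM(1) pb])
  have pc: "p \<noteq> c b" using D by auto
  have hd: "hh b p / d b t \<notin> \<real>\<^sub>\<le>\<^sub>0"
    using hh_close[OF bM(1) pb] ld_d[OF b] by (intro Ln_near_1) auto
  have dn: "d b t \<noteq> 0" by (rule d_nz[OF b tT])
  have zn: "zh b p \<noteq> 0" by (rule zh_nz[OF bM(1) D])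
  have 1: "((\<lambda>w. xi b (zh b w)) has_field_derivative P.Xi (zh b p) * deriv (zh b) p - tm b 0 * (deriv (zh b) p / zh b p)) (at p)"
    using holomorphic_derivI[OF xi_hol[OF bM(1)] P.open_D D] P.deriv_xi[OF D] by (simp add: Z x)
  have "((\<lambda>w. hh b w / d b t) has_field_derivative deriv (hh b) p / d b t) (at p)"
    by (intro DERIV_cdivide holomorphic_derivI[OF hh_hol[OF bM(1)] open_ball pb])
  from DERIV_chain2[OF has_field_derivative_Ln[OF hd] this]
  have 2: "((\<lambda>w. Ln (hh b w / d b t)) has_field_derivative deriv (hh b) p / hh b p) (at p)"
    using dn hn by (simp add: field_simps)
  have 3: "deriv (hh b) p / hh b p = 1 / (p - q b t) + deriv (zh b) p / zh b p"
  proof -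
    have zd: "deriv (zh b) p = deriv (hh b) p / (p - c b) - hh b p / (p - c b)^2"
      using P.Z'_eq[OF D] by (simp add: Z)
    have aux: "a / h = 1 / u + (a / u - h / u^2) / (h / u)" if "h \<noteq> 0" "u \<noteq> 0" for a h u :: complex
      using that by (simp add: field_simps power2_eq_square)
    show ?thesis unfolding zd zh_eq[OF bM(1)] c_q[OF b, symmetric] by (rule aux) (use hn pc in auto)
  qed
  have A: "(fh b has_field_derivative (P.Xi (zh b p) * deriv (zh b) p - tm b 0 * (deriv (zh b) p / zh b p))
     + tm b 0 * (0 + deriv (hh b) p / hh b p) + (\<Sum>j\<in>{1..M} - {b}. tm j 0 * (1 / (p - q j t))) - deriv G0 p + deriv (PPJ b) p) (at p)"
    unfolding fh_def[abs_def]
  proof (intro DERIV_add DERIV_diff DERIV_cmult DERIV_sum DERIV_const 1 2)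
    show "(G0 has_field_derivative deriv G0 p) (at p)" by (rule holomorphic_derivI[OF G0_hol open_mQ pQ])
    show "(PPJ b has_field_derivative deriv (PPJ b) p) (at p)" by (rule holomorphic_derivI[OF PPJ_hol open_mQ pQ])
    fix j assume j: "j \<in> {1..M} - {b}"
    then show "((\<lambda>p. lg j t (p - q j t)) has_field_derivative 1 / (p - q j t)) (at p)"
      using disc_K[of b j] b pb by (intro lg_deriv) auto
  qed
  have C: "gg0 p - deriv (PPJ b) p = mh b p * deriv (zh b) p"
    using m_formula[OF bM(1), of p] mh_ann[OF bM(1) p] deriv_zh_ann[OF bM(1) p] pQ ann_sub_V[OF bM(1)] p bM
      deriv_zc[OF bM(1), of p]
    by (auto simp: V_def ch_def ch'_def mc_def)
  have B: "(P.Xi (zh b p) * deriv (zh b) p - tm b 0 * (deriv (zh b) p / zh b p))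
     + tm b 0 * (0 + deriv (hh b) p / hh b p) + (\<Sum>j\<in>{1..M} - {b}. tm j 0 * (1 / (p - q j t))) - deriv G0 p + deriv (PPJ b) p
     = P.Xi (zh b p) * deriv (zh b) p - (gg0 p - deriv (PPJ b) p)"
    unfolding gg0_def sum_remove[OF b] 3 by (simp add: algebra_simps)
  have "(fh b has_field_derivative (P.Xi (zh b p) - mh b p) * deriv (zh b) p) (at p)"
    by (rule DERIV_cong[OF A]) (simp only: B C left_diff_distrib)
  then have "(fh b has_field_derivative (P.Xi (zc b t p) - mc b t p) * deriv (zc b t) p) (at p)"
    by (simp add: zh_ann[OF bM(1) p] mh_ann[OF bM(1) p] deriv_zh_ann[OF bM(1) p])
  then show ?thesis
    by (rule has_field_derivative_transform_within_open[OF _ open_ann p]) (simp add: fb_fh[OF b])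
qed

lemma kappa_bigo:
  assumes \<alpha>: "\<alpha> \<le> M" and b: "b \<in> {1..M}" "\<alpha> \<noteq> b" and f: "f \<in> O[at (c \<alpha>)](ow \<alpha>)"
  shows "(\<lambda>w. f w * (ch' \<alpha> w / (ch \<alpha> w - q b t))) \<in> O[at (c \<alpha>)](\<lambda>_. 1)"
proof (cases "\<alpha> = 0")
  case True
  have "((\<lambda>w. - inverse (1 - q b t * w)) \<longlongrightarrow> - inverse (1 - q b t * 0)) (at 0)"
    by (intro tendsto_intros) auto
  then have u: "(\<lambda>w. - inverse (1 - q b t * w)) \<in> O[at 0](\<lambda>_. 1)"
    using bigoI_tendsto[of "\<lambda>w. - inverse (1 - q b t * w)" "\<lambda>_. 1"] by simp
  have f0: "f \<in> O[at 0](\<lambda>w. w)" using f True by (simp add: ow_def[abs_def] cen_def)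
  have "(\<lambda>w. f w * (inverse w * (- inverse (1 - q b t * w)))) \<in> O[at 0](\<lambda>w. w * (inverse w * 1))"
    by (intro landau_o.big.mult f0 u landau_o.big_refl)
  also have "(\<lambda>w::complex. w * (inverse w * 1)) \<in> O[at 0](\<lambda>_. 1)"
    by (intro bigoI[of _ 1]) (auto simp: eventually_at_filter)
  finally have "(\<lambda>w. f w * (inverse w * (- inverse (1 - q b t * w)))) \<in> O[at 0](\<lambda>_. 1)" .
  also have "?this \<longleftrightarrow> (\<lambda>w. f w * ((- 1 / w^2) / (1 / w - q b t))) \<in> O[at 0](\<lambda>_. 1)"
  proof (intro landau_o.big.in_cong)
    show "eventually (\<lambda>w. f w * (inverse w * (- inverse (1 - q b t * w))) = f w * ((- 1 / w^2) / (1 / w - q b t))) (at 0)"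
      unfolding eventually_at_filter
    proof (intro always_eventually allI impI)
      fix x :: complex assume x: "x \<noteq> 0"
      have aux: "inverse x * (- inverse a) = (- 1 / x^2) / (a * inverse x)" for a
        using x by (cases "a = 0") (auto simp: field_simps power2_eq_square)
      have e: "1 / x - q b t = (1 - q b t * x) * inverse x" using x by (simp add: field_simps)
      show "f x * (inverse x * (- inverse (1 - q b t * x))) = f x * ((- 1 / x^2) / (1 / x - q b t))"
        unfolding e aux ..
    qed
  qed
  finally show ?thesis using True by (simp add: ch_def ch'_def cen_def)
next
  case False
  have "q \<alpha> t \<noteq> q b t" using inj_onD[OF q_inj, of \<alpha> b] \<alpha> b False by auto
  then have "((\<lambda>w. 1 / (w - q b t)) \<longlongrightarrow> 1 / (q \<alpha> t - q b t)) (at (q \<alpha> t))"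
    by (intro tendsto_intros) auto
  then have "(\<lambda>w. 1 / (w - q b t)) \<in> O[at (q \<alpha> t)](\<lambda>_. 1)"
    using bigoI_tendsto[of "\<lambda>w. 1 / (w - q b t)" "\<lambda>_. 1"] by simp
  from landau_o.big.mult[OF _ this, of f "\<lambda>_. 1"] f False show ?thesis
    by (simp add: ch_def ch'_def cen_def ow_def[abs_def])
qed

lemma vc_formula:
  assumes b: "b \<in> {1..M}"
  shows "vc b t = tm b 0 * ld b t + (\<Sum>j\<in>{1..M} - {b}. tm j 0 * lg j t (q b t - q j t))
    - (\<Sum>\<alpha>\<le>M. res \<alpha> (\<lambda>w. xi \<alpha> (zc \<alpha> t w) * (ch' \<alpha> w / (ch \<alpha> w - q b t))))
    - (\<Sum>j\<in>J. res j (\<lambda>w. PP t w / (w - q b t)))"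
proof -
  have bM: "b \<le> M" "b \<noteq> 0" using b by auto
  define \<kappa> where "\<kappa> = (\<lambda>\<alpha> w. ch' \<alpha> w / (ch \<alpha> w - q b t))"
  have \<kappa>h: "\<kappa> \<alpha> holomorphic_on DD \<alpha>" if "\<alpha> \<le> M" for \<alpha>
  proof -
    have "(\<lambda>w. (\<lambda>p. 1 / (p - q b t)) (ch \<alpha> w)) holomorphic_on DD \<alpha>"
      by (rule ch_D_hol[OF that]) (intro holomorphic_intros, use b in \<open>auto simp: Q_def\<close>)
    then have "(\<lambda>w. ch' \<alpha> w * (1 / (ch \<alpha> w - q b t))) holomorphic_on DD \<alpha>"
      by (rule holomorphic_on_mult[OF ch'_D_hol[OF that]])
    then show ?thesis by (simp add: \<kappa>_def[abs_def])
  qed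
  have \<kappa>b: "\<kappa> b w = 1 / (w - c b)" for w using bM c_q[OF b] by (simp add: \<kappa>_def ch_def ch'_def)
  have Xh: "(\<lambda>w. xi \<alpha> (zh \<alpha> w)) holomorphic_on DD \<alpha>" "(\<lambda>w. PPJ \<alpha> (ch \<alpha> w)) holomorphic_on DD \<alpha>"
    "(\<lambda>w. G0 (ch \<alpha> w)) holomorphic_on DD \<alpha>" if "\<alpha> \<le> M" for \<alpha>
    using that by (auto intro: xi_hol ch_D_hol PPJ_hol G0_hol)
  have other: "res \<alpha> (\<lambda>w. G0 (ch \<alpha> w) * \<kappa> \<alpha> w) = res \<alpha> (\<lambda>w. xi \<alpha> (zh \<alpha> w) * \<kappa> \<alpha> w) + res \<alpha> (\<lambda>w. PPJ \<alpha> (ch \<alpha> w) * \<kappa> \<alpha> w)"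
    if \<alpha>: "\<alpha> \<le> M" "\<alpha> \<noteq> b" for \<alpha>
  proof -
    interpret P: pole_chart "c0 \<alpha>" "c \<alpha>" "r \<alpha>" "r2 \<alpha>" "hh \<alpha>" by (rule chart[OF \<alpha>(1)])
    note h = Xh[OF \<alpha>(1)] \<kappa>h[OF \<alpha>(1)]
    have "res \<alpha> (\<lambda>w. (G0 (ch \<alpha> w) - xi \<alpha> (zh \<alpha> w) - PPJ \<alpha> (ch \<alpha> w)) * \<kappa> \<alpha> w) = 0"
    proof (rule P.res_bounded)
      show "(\<lambda>w. (G0 (ch \<alpha> w) - xi \<alpha> (zh \<alpha> w) - PPJ \<alpha> (ch \<alpha> w)) * \<kappa> \<alpha> w) \<in> O[at (c \<alpha>)](\<lambda>_. 1)"
        unfolding \<kappa>_def by (rule kappa_bigo[OF \<alpha>(1) b \<alpha>(2) G0_bigo[OF \<alpha>(1)]])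
    qed (intro holomorphic_intros h)
    also have "(\<lambda>w. (G0 (ch \<alpha> w) - xi \<alpha> (zh \<alpha> w) - PPJ \<alpha> (ch \<alpha> w)) * \<kappa> \<alpha> w) =
      (\<lambda>w. (G0 (ch \<alpha> w) * \<kappa> \<alpha> w - xi \<alpha> (zh \<alpha> w) * \<kappa> \<alpha> w) - PPJ \<alpha> (ch \<alpha> w) * \<kappa> \<alpha> w)"
      by (simp add: algebra_simps)
    also have "res \<alpha> \<dots> = res \<alpha> (\<lambda>w. G0 (ch \<alpha> w) * \<kappa> \<alpha> w) - res \<alpha> (\<lambda>w. xi \<alpha> (zh \<alpha> w) * \<kappa> \<alpha> w) - res \<alpha> (\<lambda>w. PPJ \<alpha> (ch \<alpha> w) * \<kappa> \<alpha> w)"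
      by (intro trans[OF P.res_diff] arg_cong2[where f="(-)"] refl holomorphic_intros h)
    finally show ?thesis by (simp add: algebra_simps)
  qed
  let ?reg = "\<lambda>p. tm b 0 * (ld b t + Ln (hh b p / d b t)) + (\<Sum>j\<in>{1..M} - {b}. tm j 0 * lg j t (p - q j t))"
  let ?A = "tm b 0 * ld b t + (\<Sum>j\<in>{1..M} - {b}. tm j 0 * lg j t (q b t - q j t))"
  interpret P: pole_chart "c0 b" "c b" "r b" "r2 b" "hh b" by (rule chart[OF bM(1)])
  have reg: "res b (\<lambda>w. ?reg w * \<kappa> b w) = - ?A"
    using P.res_Cauchy[OF reg_hol[OF b]] hh_c[OF bM(1)] ld_d[OF b] d_nz[OF b tT] c_q[OF b]
    by (simp add: \<kappa>b)
  have regh: "?reg holomorphic_on DD b" by (rule holomorphic_on_subset[OF reg_hol[OF b]]) auto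
  have self: "- vc b t = res b (\<lambda>w. xi b (zh b w) * \<kappa> b w) - ?A - res b (\<lambda>w. G0 (ch b w) * \<kappa> b w) + res b (\<lambda>w. PPJ b (ch b w) * \<kappa> b w)"
  proof -
    note h = Xh[OF bM(1)] \<kappa>h[OF bM(1)] regh
    have "- vc b t = res b (\<lambda>w. fh b w * \<kappa> b w)"
      using P.res_Cauchy_limit[OF fh_hol[OF b] fh_limit[OF b]] by (simp add: \<kappa>b)
    also have "(\<lambda>w. fh b w * \<kappa> b w) = (\<lambda>w. ((xi b (zh b w) * \<kappa> b w + ?reg w * \<kappa> b w) - G0 (ch b w) * \<kappa> b w) + PPJ b (ch b w) * \<kappa> b w)"
      using bM by (simp add: fh_def ch_def fun_eq_iff algebra_simps)
    also have "res b \<dots> = res b (\<lambda>w. xi b (zh b w) * \<kappa> b w) + res b (\<lambda>w. ?reg w * \<kappa> b w) - res b (\<lambda>w. G0 (ch b w) * \<kappa> b w) + res b (\<lambda>w. PPJ b (ch b w) * \<kappa> b w)"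
      by (intro trans[OF P.res_add] trans[OF P.res_diff] arg_cong2[where f="(+)"] arg_cong2[where f="(-)"] refl holomorphic_intros h)
    finally show ?thesis unfolding reg by simp
  qed
  have rem: "(\<Sum>\<alpha>\<le>M. f \<alpha>) = f b + (\<Sum>\<alpha>\<in>{..M} - {b}. f \<alpha>)" for f :: "nat \<Rightarrow> complex"
    using bM by (intro sum.remove) auto
  have "(\<Sum>\<alpha>\<le>M. res \<alpha> (\<lambda>w. (\<lambda>p. G0 p * (1 / (p - q b t))) (ch \<alpha> w) * ch' \<alpha> w)) = 0"
    by (rule res_sum_zero) (intro holomorphic_intros G0_hol, use b in \<open>auto simp: Q_def\<close>)
  then have "(\<Sum>\<alpha>\<le>M. res \<alpha> (\<lambda>w. G0 (ch \<alpha> w) * \<kappa> \<alpha> w)) = 0"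
    by (simp add: \<kappa>_def)
  then have "res b (\<lambda>w. G0 (ch b w) * \<kappa> b w) = - (\<Sum>\<alpha>\<in>{..M} - {b}. res \<alpha> (\<lambda>w. xi \<alpha> (zh \<alpha> w) * \<kappa> \<alpha> w) + res \<alpha> (\<lambda>w. PPJ \<alpha> (ch \<alpha> w) * \<kappa> \<alpha> w))"
    unfolding rem using other by (simp add: eq_neg_iff_add_eq_0)
  then have "- vc b t = (\<Sum>\<alpha>\<le>M. res \<alpha> (\<lambda>w. xi \<alpha> (zh \<alpha> w) * \<kappa> \<alpha> w)) + (\<Sum>\<alpha>\<le>M. res \<alpha> (\<lambda>w. PPJ \<alpha> (ch \<alpha> w) * \<kappa> \<alpha> w)) - ?A"
    using self unfolding rem[of "\<lambda>\<alpha>. res \<alpha> (\<lambda>w. xi \<alpha> (zh \<alpha> w) * \<kappa> \<alpha> w)"] rem[of "\<lambda>\<alpha>. res \<alpha> (\<lambda>w. PPJ \<alpha> (ch \<alpha> w) * \<kappa> \<alpha> w)"]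
    by (simp add: sum.distrib)
  moreover have "(\<Sum>\<alpha>\<le>M. res \<alpha> (\<lambda>w. PPJ \<alpha> (ch \<alpha> w) * \<kappa> \<alpha> w)) = (\<Sum>j\<in>J. res j (\<lambda>w. PP t w / (w - q b t)))"
  proof -
    have "(\<Sum>\<alpha>\<le>M. res \<alpha> (\<lambda>w. PPJ \<alpha> (ch \<alpha> w) * \<kappa> \<alpha> w)) = (\<Sum>j\<in>J. res j (\<lambda>w. PPJ j (ch j w) * \<kappa> j w))"
      by (rule res_PPJ) (simp add: PPJ_def)
    also have "\<dots> = (\<Sum>j\<in>J. res j (\<lambda>w. PP t w / (w - q b t)))"
    proof (rule sum.cong[OF refl])
      fix j assume "j \<in> J"
      moreover have "j \<noteq> 0" using J_sub[OF \<open>j \<in> J\<close>] by auto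
      ultimately show "res j (\<lambda>w. PPJ j (ch j w) * \<kappa> j w) = res j (\<lambda>w. PP t w / (w - q b t))"
        by (simp add: PPJ_def ch_def \<kappa>_def ch'_def)
    qed
    finally show ?thesis .
  qed
  moreover have "(\<Sum>\<alpha>\<le>M. res \<alpha> (\<lambda>w. xi \<alpha> (zh \<alpha> w) * \<kappa> \<alpha> w)) = (\<Sum>\<alpha>\<le>M. res \<alpha> (\<lambda>w. xi \<alpha> (zc \<alpha> t w) * (ch' \<alpha> w / (ch \<alpha> w - q b t))))"
    by (intro sum.cong refl res_cong) (auto simp: zh_ann \<kappa>_def)
  ultimately show ?thesis by (simp add: algebra_simps)
qed

end

lemma continuous_on_locally:
  fixes f :: "'a::t2_space \<Rightarrow> complex"
  assumes "\<And>x. x \<in> X \<Longrightarrow> \<exists>N. open N \<and> x \<in> N \<and> continuous_on (X \<inter> N) f"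
  shows "continuous_on X f"
  unfolding continuous_on_eq_continuous_within
proof
  fix x assume x: "x \<in> X"
  then obtain N where N: "open N" "x \<in> N" "continuous_on (X \<inter> N) f" using assms by blast
  have "at x within X \<inter> N = at x within X"
    by (rule at_within_nhd[of _ N]) (use N in auto)
  then show "continuous (at x within X) f"
    using N(3) x N(2) unfolding continuous_on_eq_continuous_within by (metis IntI)
qed

context string_solution
begin

lemma zc_surjective:
  assumes \<alpha>: "\<alpha> \<le> M" and t: "t \<in> T" and P: "eventually (\<lambda>w. P (zc \<alpha> t w)) (at (cen \<alpha> t))"
  shows "eventually P at_infinity"
proof -
  let ?c = "cen \<alpha> t"
  from eventually_conj[OF P near_V[OF \<alpha> t]] obtain R where R: "R > 0"
    "\<And>w. w \<noteq> ?c \<Longrightarrow> dist w ?c < R \<Longrightarrow> P (zc \<alpha> t w) \<and> w \<in> V \<alpha> t"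
    unfolding eventually_at by auto
  define u where "u = (\<lambda>w. if w = ?c then 0 else inverse (zc \<alpha> t w))"
  have V: "ball ?c R - {?c} \<subseteq> V \<alpha> t"
  proof
    fix w assume "w \<in> ball ?c R - {?c}"
    then show "w \<in> V \<alpha> t" using R(2)[of w] by (simp add: dist_commute)
  qed
  have nz: "zc \<alpha> t w \<noteq> 0" if "w \<in> V \<alpha> t" for w
    using z_nonzero[OF \<alpha> t] that by (auto simp: V_def zc_def)
  have uh: "u holomorphic_on ball ?c R"
    unfolding u_def
  proof (rule removable_singularity)
    show "(\<lambda>w. inverse (zc \<alpha> t w)) holomorphic_on ball ?c R - {?c}"
      by (intro holomorphic_intros holomorphic_on_subset[OF zc_hol[OF \<alpha> t] V]) (use V nz in auto)
    show "((\<lambda>w. inverse (zc \<alpha> t w)) \<longlongrightarrow> 0) (at ?c)"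
      by (rule filterlim_compose[OF tendsto_inverse_0 zc_infinity[OF \<alpha> t]])
  qed auto
  have "\<not> u constant_on ball ?c R"
  proof
    assume "u constant_on ball ?c R"
    then obtain y where y: "\<And>w. w \<in> ball ?c R \<Longrightarrow> u w = y" by (auto simp: constant_on_def)
    define w where "w = ?c + of_real (R / 2)"
    have w: "w \<in> ball ?c R" "w \<noteq> ?c" using R(1) by (auto simp: w_def dist_norm)
    then have "u w \<noteq> 0" using V nz by (auto simp: u_def)
    moreover have "u w = u ?c" using y[OF w(1)] y[of ?c] R(1) by simp
    ultimately show False by (simp add: u_def)
  qed
  then have "open (u ` ball ?c R)"
    by (intro open_mapping_thm[OF uh]) auto
  moreover have "0 \<in> u ` ball ?c R" using R(1) by (auto simp: u_def intro!: image_eqI[of _ _ ?c])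
  ultimately obtain \<delta> where \<delta>: "\<delta> > 0" "ball 0 \<delta> \<subseteq> u ` ball ?c R" using openE by blast
  show ?thesis unfolding eventually_at_infinity
  proof (intro exI[of _ "2 / \<delta>"] allI impI)
    fix \<zeta> :: complex assume \<zeta>: "2 / \<delta> \<le> norm \<zeta>"
    then have nz\<zeta>: "\<zeta> \<noteq> 0" using \<delta>(1) by auto
    have "norm (inverse \<zeta>) \<le> \<delta> / 2" using le_imp_inverse_le[OF \<zeta>] \<delta>(1) by (simp add: norm_inverse)
    then have "inverse \<zeta> \<in> ball 0 \<delta>" using \<delta>(1) by simp
    then obtain w where w: "w \<in> ball ?c R" "inverse \<zeta> = u w" using \<delta>(2) by blast
    then have "w \<noteq> ?c" using nz\<zeta> by (auto simp: u_def)
    then have "zc \<alpha> t w = \<zeta>" using w(2) by (simp add: u_def)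
    moreover have "P (zc \<alpha> t w)" using R(2)[OF \<open>w \<noteq> ?c\<close>] w(1) by (simp add: dist_commute)
    ultimately show "P \<zeta>" by simp
  qed
qed

lemma Gamma_coefficients:
  assumes \<alpha>: "\<alpha> \<le> M" and t: "t \<in> T"
  shows "n \<ge> 1 \<Longrightarrow> contour_integral (\<Gamma> \<alpha> t) (\<lambda>\<zeta>. \<zeta> ^ n * m_of_z U z m \<alpha> t \<zeta>) = 2 * of_real pi * \<i> * v \<alpha> (n + 1) t"
    and "contour_integral (\<Gamma> \<alpha> t) (\<lambda>\<zeta>. \<zeta> * m_of_z U z m \<alpha> t \<zeta> ^ 2) = 2 * of_real pi * \<i> *
      (2 * (\<Sum>n=1..N \<alpha>. of_nat n * time M t \<alpha> n * v \<alpha> (n + 1) t) + time M t \<alpha> 0 ^ 2)"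
    and "m_of_z U z m \<alpha> t holomorphic_on z \<alpha> t ` U \<alpha> t"
proof -
  let ?V = "z \<alpha> t ` U \<alpha> t" and ?M = "m_of_z U z m \<alpha> t"
  note inj = z_inj[OF \<alpha> t]
  obtain g where g: "g holomorphic_on ?V" "\<And>p. p \<in> U \<alpha> t \<Longrightarrow> g (z \<alpha> t p) = p"
    using holomorphic_has_inverse[OF z_hol[OF \<alpha> t] open_U[OF \<alpha> t] inj] by metis
  have gM: "?M \<zeta> = m \<alpha> t (g \<zeta>)" if "\<zeta> \<in> ?V" for \<zeta>
    using that g(2) by (auto simp: m_of_z_def the_inv_into_f_f[OF inj])
  have "(\<lambda>\<zeta>. m \<alpha> t (g \<zeta>)) holomorphic_on ?V"
  proof -
    have "g ` ?V \<subseteq> U \<alpha> t" using g(2) by auto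
    from holomorphic_on_compose_gen[OF g(1) m_hol[OF \<alpha> t] this] show ?thesis by (simp only: o_def)
  qed
  then show Mh: "?M holomorphic_on ?V"
    by (rule holomorphic_transform) (simp add: gM)
  have V: "open ?V" by (rule open_mapping_thm3[OF z_hol[OF \<alpha> t] open_U[OF \<alpha> t] inj])
  have out: "outside (path_image (\<Gamma> \<alpha> t)) \<subseteq> ?V"
    using exterior_image[OF \<alpha> t] exterior_subset[OF \<alpha> t] by blast
  have "eventually (\<lambda>w. (\<lambda>n. v \<alpha> (n + 2) t / zc \<alpha> t w ^ (n + 2)) sums
      (?M (zc \<alpha> t w) - (\<Sum>n=1..N \<alpha>. of_nat n * time M t \<alpha> n * zc \<alpha> t w ^ (n - 1)) - time M t \<alpha> 0 / zc \<alpha> t w)) (at (cen \<alpha> t))"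
    using eventually_ch[OF m_expansion[OF \<alpha> t]] near_V[OF \<alpha> t]
  proof eventually_elim
    case (elim w)
    then have "?M (zc \<alpha> t w) = m \<alpha> t (ch \<alpha> w)" using gM g(2) by (auto simp: V_def zc_def)
    then show ?case using elim(1) by (simp add: zc_def)
  qed
  from zc_surjective[OF \<alpha> t this]
  have ex: "eventually (\<lambda>x. (\<lambda>n. v \<alpha> (n + 2) t / x ^ (n + 2)) sums
      (?M x - (\<Sum>n=1..N \<alpha>. of_nat n * time M t \<alpha> n * x ^ (n - 1)) - time M t \<alpha> 0 / x)) at_infinity" .
  have c: "simple_path (\<Gamma> \<alpha> t)" "valid_path (\<Gamma> \<alpha> t)" "pathfinish (\<Gamma> \<alpha> t) = pathstart (\<Gamma> \<alpha> t)"
    "0 \<in> inside (path_image (\<Gamma> \<alpha> t))" "winding_number (\<Gamma> \<alpha> t) 0 = 1" "path_image (\<Gamma> \<alpha> t) \<subseteq> ?V"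
    using Gamma_curve[OF \<alpha> t] Gamma_winding[OF \<alpha> t] Gamma_image[OF \<alpha> t] by auto
  note * = contour_integral_coefficients[OF V Mh c(1-6) out, where v="\<lambda>n. v \<alpha> n t" and N="N \<alpha>" and tt="time M t \<alpha>"]
  show "contour_integral (\<Gamma> \<alpha> t) (\<lambda>\<zeta>. \<zeta> ^ n * ?M \<zeta>) = 2 * of_real pi * \<i> * v \<alpha> (n + 1) t" if "n \<ge> 1"
    by (rule *(1)[OF ex that])
  show "contour_integral (\<Gamma> \<alpha> t) (\<lambda>\<zeta>. \<zeta> * ?M \<zeta> ^ 2) = 2 * of_real pi * \<i> *
      (2 * (\<Sum>n=1..N \<alpha>. of_nat n * time M t \<alpha> n * v \<alpha> (n + 1) t) + time M t \<alpha> 0 ^ 2)"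
    by (rule *(2)[OF ex])
qed

lemma Gamma_sum:
  assumes \<alpha>: "\<alpha> \<le> M" and t: "t \<in> T"
  shows "1 / (2 * pi * \<i>) * contour_integral (\<Gamma> \<alpha> t)
         (\<lambda>\<zeta>. (\<Sum>n=1..N \<alpha>. \<zeta> ^ n * time M t \<alpha> n) * m_of_z U z m \<alpha> t \<zeta>) = (\<Sum>n=1..N \<alpha>. time M t \<alpha> n * v \<alpha> (n + 1) t)"
proof -
  have V: "open (z \<alpha> t ` U \<alpha> t)" by (rule open_mapping_thm3[OF z_hol[OF \<alpha> t] open_U[OF \<alpha> t] z_inj[OF \<alpha> t]])
  have int: "(\<lambda>\<zeta>. time M t \<alpha> n * (\<zeta> ^ n * m_of_z U z m \<alpha> t \<zeta>)) contour_integrable_on \<Gamma> \<alpha> t" for n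
    using Gamma_curve[OF \<alpha> t] Gamma_image[OF \<alpha> t]
    by (intro contour_integrable_holomorphic_simple[OF _ V] holomorphic_intros Gamma_coefficients(3)[OF \<alpha> t]) auto
  have int': "(\<lambda>\<zeta>. (\<zeta> ^ n * m_of_z U z m \<alpha> t \<zeta>)) contour_integrable_on \<Gamma> \<alpha> t" for n
    using Gamma_curve[OF \<alpha> t] Gamma_image[OF \<alpha> t]
    by (intro contour_integrable_holomorphic_simple[OF _ V] holomorphic_intros Gamma_coefficients(3)[OF \<alpha> t]) auto
  have "contour_integral (\<Gamma> \<alpha> t) (\<lambda>\<zeta>. (\<Sum>n=1..N \<alpha>. \<zeta> ^ n * time M t \<alpha> n) * m_of_z U z m \<alpha> t \<zeta>) =
    contour_integral (\<Gamma> \<alpha> t) (\<lambda>\<zeta>. \<Sum>n=1..N \<alpha>. time M t \<alpha> n * (\<zeta> ^ n * m_of_z U z m \<alpha> t \<zeta>))"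
  proof -
    have "(\<lambda>\<zeta>. (\<Sum>n=1..N \<alpha>. \<zeta> ^ n * time M t \<alpha> n) * m_of_z U z m \<alpha> t \<zeta>) =
      (\<lambda>\<zeta>. \<Sum>n=1..N \<alpha>. time M t \<alpha> n * (\<zeta> ^ n * m_of_z U z m \<alpha> t \<zeta>))"
      unfolding sum_distrib_right by (intro ext sum.cong refl) (simp only: mult_ac)
    then show ?thesis by (rule arg_cong)
  qed
  also have "\<dots> = (\<Sum>n=1..N \<alpha>. contour_integral (\<Gamma> \<alpha> t) (\<lambda>\<zeta>. time M t \<alpha> n * (\<zeta> ^ n * m_of_z U z m \<alpha> t \<zeta>)))"
    by (rule contour_integral_sum) (auto intro: int)
  also have "\<dots> = (\<Sum>n=1..N \<alpha>. time M t \<alpha> n * (2 * of_real pi * \<i> * v \<alpha> (n + 1) t))"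
    by (intro sum.cong refl) (simp add: contour_integral_lmul[OF int'] Gamma_coefficients(1)[OF \<alpha> t, simplified])
  finally show ?thesis
    by (simp add: sum_distrib_left sum_divide_distrib field_simps)
qed

definition twice_F :: "times \<Rightarrow> complex" where
  "twice_F t = (\<Sum>\<alpha>\<le>M. \<Sum>n=1..N \<alpha>. time M t \<alpha> n * v \<alpha> (n + 1) t)
    - (\<Sum>j\<in>J. 1 / (2 * of_nat (k j)) * (2 * (\<Sum>n=1..N j. of_nat n * time M t j n * v j (n + 1) t) + time M t j 0 ^ 2))
    + (\<Sum>i=1..M. time M t i 0 * v_first M q lg vc i t)"

lemma contour_formula:
  assumes t: "t \<in> T"
  shows "(\<Sum>\<alpha>\<le>M. 1 / (2 * pi * \<i>) * contour_integral (\<Gamma> \<alpha> t)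
         (\<lambda>\<zeta>. (\<Sum>n=1..N \<alpha>. \<zeta> ^ n * time M t \<alpha> n) * m_of_z U z m \<alpha> t \<zeta>))
      - (\<Sum>j\<in>J. 1 / (4 * pi * \<i> * of_nat (k j)) * contour_integral (\<Gamma> j t)
           (\<lambda>\<zeta>. \<zeta> * (m_of_z U z m j t \<zeta>)\<^sup>2))
      + (\<Sum>i=1..M. time M t i 0 * v_all M q lg vc v i 1 t) = twice_F t"
proof -
  have "1 / (4 * pi * \<i> * of_nat (k j)) * contour_integral (\<Gamma> j t) (\<lambda>\<zeta>. \<zeta> * (m_of_z U z m j t \<zeta>)\<^sup>2) =
    1 / (2 * of_nat (k j)) * (2 * (\<Sum>n=1..N j. of_nat n * time M t j n * v j (n + 1) t) + time M t j 0 ^ 2)"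
    if "j \<in> J" for j
  proof -
    have j: "j \<le> M" using that IJ by auto
    have "1 / (4 * pi * \<i> * of_nat (k j)) * (2 * of_real pi * \<i> * x) = 1 / (2 * of_nat (k j)) * x" for x :: complex
      using k_pos[OF j] by (simp add: field_simps)
    then show ?thesis unfolding Gamma_coefficients(2)[OF j t] .
  qed
  then show ?thesis
    unfolding twice_F_def v_all_def using Gamma_sum[OF _ t] by simp
qed

lemma coefficient_formula:
  assumes t: "t \<in> T"
  shows "(\<Sum>(\<alpha>, n)\<in>time_indices M N. time M t \<alpha> n * v_all M q lg vc v \<alpha> (n + 1) t)
      - (\<Sum>j\<in>J. 1 / of_nat (k j) *
           (\<Sum>n=1..N j. of_nat n * time M t j n * v_all M q lg vc v j (n + 1) t))
      - (\<Sum>j\<in>J. (time M t j 0)\<^sup>2 / (2 * of_nat (k j))) = twice_F t"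
proof -
  let ?g = "\<lambda>(\<alpha>, n). time M t \<alpha> n * v_all M q lg vc v \<alpha> (n + 1) t"
  have "time_indices M N = (SIGMA \<alpha>:{..M}. {1..N \<alpha>}) \<union> (\<lambda>i. (i, 0)) ` {1..M}"
    by (auto simp: time_indices_def)
  then have "sum ?g (time_indices M N) = sum ?g (SIGMA \<alpha>:{..M}. {1..N \<alpha>}) + sum ?g ((\<lambda>i. (i, 0)) ` {1..M})"
    by (simp only:) (rule sum.union_disjoint; auto)
  also have "sum ?g (SIGMA \<alpha>:{..M}. {1..N \<alpha>}) = (\<Sum>\<alpha>\<le>M. \<Sum>n=1..N \<alpha>. time M t \<alpha> n * v \<alpha> (n + 1) t)"
    by (subst sum.Sigma[symmetric]) (auto intro!: sum.cong simp: v_all_def)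
  also have "sum ?g ((\<lambda>i. (i, 0)) ` {1..M}) = (\<Sum>i=1..M. time M t i 0 * v_first M q lg vc i t)"
    by (subst sum.reindex) (auto simp: inj_on_def v_all_def)
  finally have 1: "sum ?g (time_indices M N) = (\<Sum>\<alpha>\<le>M. \<Sum>n=1..N \<alpha>. time M t \<alpha> n * v \<alpha> (n + 1) t)
     + (\<Sum>i=1..M. time M t i 0 * v_first M q lg vc i t)" .
  have 2: "(\<Sum>n=1..N j. of_nat n * time M t j n * v_all M q lg vc v j (n + 1) t) = (\<Sum>n=1..N j. of_nat n * time M t j n * v j (n + 1) t)" for j
    by (intro sum.cong) (auto simp: v_all_def)
  have 3: "1 / (2 * of_nat (k j)) * (2 * x + y) = 1 / of_nat (k j) * x + y / (2 * of_nat (k j))" if "j \<in> J" for j and x y :: complex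
    using k_pos[of j] IJ that by (auto simp: field_simps)
  have "(\<Sum>j\<in>J. 1 / (2 * of_nat (k j)) * (2 * (\<Sum>n=1..N j. of_nat n * time M t j n * v j (n + 1) t) + time M t j 0 ^ 2)) =
    (\<Sum>j\<in>J. 1 / of_nat (k j) * (\<Sum>n=1..N j. of_nat n * time M t j n * v j (n + 1) t)) + (\<Sum>j\<in>J. (time M t j 0)\<^sup>2 / (2 * of_nat (k j)))"
    unfolding sum.distrib[symmetric] by (intro sum.cong refl 3)
  then show ?thesis unfolding twice_F_def 1 2 by (simp add: algebra_simps)
qed

end

context good_point
begin

definition gb :: "nat \<Rightarrow> complex \<Rightarrow> complex" where "gb b p = fb b p - xi b (zc b t p)"

lemma vc_residue_gb:
  assumes b: "b \<in> {1..M}"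
  shows "vc b t = res b (\<lambda>w. gb b w / zc b t w * deriv (zc b t) w)"
proof -
  have bM: "b \<le> M" using b by auto
  interpret P: pole_chart "c0 b" "c b" "r b" "r2 b" "hh b" by (rule chart[OF bM])
  have Z: "P.Z = zh b" by (simp add: zh_def)
  let ?p = "\<Sum>n=1..N b. monom (tm b n) (n - 1)"
  have zz: "zh b w \<noteq> 0" if "w \<in> DD b" for w using zh_nz[OF bM that] .
  have "vc b t = res b (\<lambda>w. fb b w * (deriv (zc b t) w / zc b t w))" by (rule vc_residue[OF b])
  also have "\<dots> = res b (\<lambda>w. (fh b w - xi b (zh b w)) / zh b w * deriv (zh b) w + poly ?p (zh b w) * deriv (zh b) w)"
  proof (rule res_cong[OF bM])
    fix w assume w: "w \<in> ann b"
    then have nz: "zh b w \<noteq> 0" by (intro zz subsetD[OF ann_D[OF bM]])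
    have "poly ?p (zh b w) = xi b (zh b w) / zh b w"
      unfolding xi_eq[OF bM] poly_sum sum_divide_distrib poly_monom
      using nz by (intro sum.cong refl) (auto simp: power_eq_if)
    then show "fb b w * (deriv (zc b t) w / zc b t w) = (fh b w - xi b (zh b w)) / zh b w * deriv (zh b) w + poly ?p (zh b w) * deriv (zh b) w"
      using nz unfolding fb_fh[OF b w] zh_ann[OF bM w, symmetric] deriv_zh_ann[OF bM w, symmetric]
      by (simp add: field_simps)
  qed
  also have "\<dots> = res b (\<lambda>w. (fh b w - xi b (zh b w)) / zh b w * deriv (zh b) w) + res b (\<lambda>w. poly ?p (zh b w) * deriv (zh b) w)"
    by (rule P.res_add) (intro holomorphic_intros fh_hol b xi_hol zh_hol zh'_hol bM zz; assumption?)+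
  also have "res b (\<lambda>w. poly ?p (zh b w) * deriv (zh b) w) = 0" using P.res_poly[of ?p] unfolding Z .
  also have "res b (\<lambda>w. (fh b w - xi b (zh b w)) / zh b w * deriv (zh b) w) = res b (\<lambda>w. gb b w / zc b t w * deriv (zc b t) w)"
    by (rule res_cong[OF bM]) (simp add: gb_def fb_fh[OF b] zh_ann[OF bM] deriv_zh_ann[OF bM])
  finally show ?thesis by simp
qed

lemma zc_nz_ann: "\<alpha> \<le> M \<Longrightarrow> p \<in> ann \<alpha> \<Longrightarrow> zc \<alpha> t p \<noteq> 0"
  using zh_nz[of \<alpha> p, OF _ subsetD[OF ann_D[of \<alpha>]]] zh_ann[of \<alpha> p] by metis

lemma gb_deriv:
  assumes b: "b \<in> {1..M}" and p: "p \<in> ann b"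
  shows "(gb b has_field_derivative (tm b 0 / zc b t p - mc b t p) * deriv (zc b t) p) (at p)"
proof -
  have bM: "b \<le> M" using b by auto
  have zd: "(zc b t has_field_derivative deriv (zc b t) p) (at p)"
    by (rule holomorphic_derivI[OF zc_hol[OF bM tT] open_V[OF bM tT]]) (use p ann_sub_V[OF bM] in auto)
  have "((\<lambda>p. xi b (zc b t p)) has_field_derivative (\<Sum>n=1..N b. of_nat n * tm b n * zc b t p ^ (n - 1)) * deriv (zc b t) p) (at p)"
    unfolding xi_eq[OF bM] sum_distrib_right
    by (auto intro!: derivative_eq_intros zd sum.cong simp: mult_ac)
  from DERIV_diff[OF fb_deriv[OF b p] this] show ?thesis
    unfolding gb_def[abs_def] pole_expansion.Xi_def[OF expn[OF bM]]
    by (rule DERIV_cong) (simp add: algebra_simps)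
qed

lemma gb_S:
  assumes b: "b \<in> {1..M}" and p: "p \<in> ann b" "p \<notin> cuts"
  shows "gb b p = tm b 0 * (ld b t - lg b t (p - q b t) + Ln ((p - q b t) * zc b t p / d b t)) - S b t p"
  using fb_S[OF b p] by (simp add: gb_def)

lemma log_close: "b \<in> {1..M} \<Longrightarrow> p \<in> ann b \<Longrightarrow> (p - q b t) * zc b t p / d b t \<notin> \<real>\<^sub>\<le>\<^sub>0"
  using hh_close[of b p] hh_ann[of b p] c_q[of b] ld_d[of b] by (intro Ln_near_1) (auto simp: ann_def)

lemma res_log_terms:
  assumes b: "b \<in> {1..M}"
  shows "\<mu> \<in> {1..M} \<Longrightarrow> \<mu> \<noteq> b \<Longrightarrow> res b (\<lambda>w. lg \<mu> t (w - q \<mu> t) / zc b t w * deriv (zc b t) w) = lg \<mu> t (q b t - q \<mu> t)"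
    and "res b (\<lambda>w. (ld b t + Ln ((w - q b t) * zc b t w / d b t)) / zc b t w * deriv (zc b t) w) = ld b t"
proof -
  have bM: "b \<le> M" using b by auto
  interpret P: pole_chart "c0 b" "c b" "r b" "r2 b" "hh b" by (rule chart[OF bM])
  have Z: "P.Z = zh b" by (simp add: zh_def)
  show "res b (\<lambda>w. lg \<mu> t (w - q \<mu> t) / zc b t w * deriv (zc b t) w) = lg \<mu> t (q b t - q \<mu> t)" if "\<mu> \<in> {1..M}" "\<mu> \<noteq> b"
  proof -
    have "res b (\<lambda>w. lg \<mu> t (w - q \<mu> t) * (deriv (zh b) w / zh b w)) = lg \<mu> t (q b t - q \<mu> t)"
      using P.res_log_deriv[OF lg_hol[OF b, of \<mu>]] that c_q[OF b] unfolding Z by simp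
    moreover have "res b (\<lambda>w. lg \<mu> t (w - q \<mu> t) * (deriv (zh b) w / zh b w)) = res b (\<lambda>w. lg \<mu> t (w - q \<mu> t) / zc b t w * deriv (zc b t) w)"
      by (rule res_cong[OF bM]) (simp add: zh_ann[OF bM] deriv_zh_ann[OF bM])
    ultimately show ?thesis by simp
  qed
  have "(\<lambda>w. ld b t + Ln (hh b w / d b t)) holomorphic_on ball (c0 b) (r2 b)"
    by (intro holomorphic_intros lnh_hol b)
  from P.res_log_deriv[OF this]
  have "res b (\<lambda>w. (ld b t + Ln (hh b w / d b t)) * (deriv (zh b) w / zh b w)) = ld b t"
    unfolding Z using hh_c[OF bM] ld_d[OF b] d_nz[OF b tT] by simp
  moreover have "res b (\<lambda>w. (ld b t + Ln (hh b w / d b t)) * (deriv (zh b) w / zh b w)) =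
     res b (\<lambda>w. (ld b t + Ln ((w - q b t) * zc b t w / d b t)) / zc b t w * deriv (zc b t) w)"
    by (rule res_cong[OF bM]) (use hh_ann[OF bM] c_q[OF b] in \<open>auto simp: zh_ann[OF bM] deriv_zh_ann[OF bM] ann_def\<close>)
  ultimately show "res b (\<lambda>w. (ld b t + Ln ((w - q b t) * zc b t w / d b t)) / zc b t w * deriv (zc b t) w) = ld b t" by simp
qed

end

section \<open>Derivatives with respect to the times\<close>

locale time_slice = good_point +
  fixes B :: "nat \<times> nat" and Bs :: "complex set"
  assumes B: "B \<in> time_indices M N" and Bs: "open Bs" "t B \<in> Bs"
    and good_slice: "\<And>s. s \<in> Bs \<Longrightarrow> good c0 r1 r r2 (t(B := s))"
begin

abbreviation L :: "complex \<Rightarrow> times" where "L s \<equiv> t(B := s)"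
abbreviation s0 :: complex where "s0 \<equiv> t B"
abbreviation Zf :: "nat \<Rightarrow> complex \<Rightarrow> complex \<Rightarrow> complex" where "Zf \<alpha> \<equiv> \<lambda>s. zc \<alpha> (L s)"
abbreviation Mf :: "nat \<Rightarrow> complex \<Rightarrow> complex \<Rightarrow> complex" where "Mf \<alpha> \<equiv> \<lambda>s. mc \<alpha> (L s)"
abbreviation gbs :: "complex \<Rightarrow> nat \<Rightarrow> complex \<Rightarrow> complex" where
  "gbs s \<equiv> good_point.gb M N q z d lg ld J k E1 E2 (L s)"

lemma good_pointL: "s \<in> Bs \<Longrightarrow> good_point M N T q z m d dc v lg K U \<Gamma> ld vc S I J k E1 E2 c0 r1 r r2 (L s)"
  by unfold_locales (rule good_slice)

lemma LT: "s \<in> Bs \<Longrightarrow> L s \<in> T" using good_slice by (auto simp: good_def)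

lemma L_Ts: "L s \<in> Ts" using T_sub tT B by (auto simp: time_space_def)

lemma L_cont: "continuous_on X L"
proof (rule continuous_on_coordinatewise_then_product)
  fix A show "continuous_on X (\<lambda>s. L s A)"
    by (cases "A = B") (auto intro: continuous_intros)
qed

lemma sliceL_open:
  assumes "openin (top_of_set (Ts \<times> UNIV)) X" "(t, p) \<in> X"
  shows "eventually (\<lambda>s. (L s, p) \<in> X) (nhds s0)"
proof -
  obtain O' where O: "open O'" "X = (Ts \<times> UNIV) \<inter> O'" using assms(1) by (auto simp: openin_open)
  have "continuous_on UNIV (\<lambda>s. (L s, p))" by (intro continuous_intros L_cont)
  then have "open ((\<lambda>s. (L s, p)) -` O')" using O(1) by (metis continuous_on_open_vimage open_UNIV Int_UNIV_right)
  moreover have "s0 \<in> (\<lambda>s. (L s, p)) -` O'" using assms(2) O(2) by simp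
  ultimately show ?thesis using L_Ts O(2) unfolding eventually_nhds by blast
qed

lemma sep_chart:
  assumes \<alpha>: "\<alpha> \<le> M" and f: "jointly_holomorphic Ind {(t, p). t \<in> T \<and> p \<in> U \<alpha> t} f"
  shows "sep_holo Bs (ann \<alpha>) (\<lambda>s w. f (L s) (ch \<alpha> w))"
  unfolding sep_holo_def
proof (intro conjI ballI)
  have V: "w \<in> V \<alpha> (L s)" if "s \<in> Bs" "w \<in> ann \<alpha>" for s w
    using good_point.ann_sub_V[OF good_pointL[OF that(1)] \<alpha>] that(2) by blast
  have "continuous_on (Bs \<times> ann \<alpha>) (\<lambda>x. (\<lambda>(t, w). f t (ch \<alpha> w)) (L (fst x), snd x))"
  proof (rule continuous_on_compose2[OF chart_continuous[OF \<alpha>]])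
    show "continuous_on {(t, p). t \<in> T \<and> p \<in> U \<alpha> t} (\<lambda>(t, p). f t p)"
      using f by (simp add: jointly_holomorphic_def)
    show "continuous_on (Bs \<times> ann \<alpha>) (\<lambda>x. (L (fst x), snd x))"
      by (intro continuous_intros continuous_on_compose2[OF L_cont[of UNIV]]) auto
    show "(\<lambda>x. (L (fst x), snd x)) ` (Bs \<times> ann \<alpha>) \<subseteq> {(t, w). t \<in> T \<and> w \<in> V \<alpha> t}"
      using LT V by auto
  qed
  then show "continuous_on (Bs \<times> ann \<alpha>) (\<lambda>(s, w). f (L s) (ch \<alpha> w))" by (simp add: split_beta)
  fix s w assume s: "s \<in> Bs" and w: "w \<in> ann \<alpha>"
  have p: "ch \<alpha> w \<in> U \<alpha> (L s)" "\<alpha> = 0 \<Longrightarrow> w \<noteq> 0" using V[OF s w] by (auto simp: V_def)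
  have *: "f (L s) field_differentiable at (ch \<alpha> w)"
    "(\<lambda>s'. f ((L s)(B := s')) (ch \<alpha> w)) field_differentiable at (L s B)"
  proof -
    have "(L s, ch \<alpha> w) \<in> {(t, p). t \<in> T \<and> p \<in> U \<alpha> t}" using LT[OF s] p(1) by simp
    then have "f (L s) field_differentiable at (ch \<alpha> w) \<and>
      (\<forall>A\<in>Ind. (\<lambda>s'. f ((L s)(A := s')) (ch \<alpha> w)) field_differentiable at (L s A))"
      using f unfolding jointly_holomorphic_def by blast
    then show "f (L s) field_differentiable at (ch \<alpha> w)"
      "(\<lambda>s'. f ((L s)(B := s')) (ch \<alpha> w)) field_differentiable at (L s B)"
      using B by blast+
  qed
  show "(\<lambda>s. f (L s) (ch \<alpha> w)) field_differentiable at s" using *(2) by simp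
  have "ch \<alpha> field_differentiable at w" using has_deriv_ch[of \<alpha> w] p(2) by (auto simp: field_differentiable_def)
  from field_differentiable_compose[OF this *(1)]
  show "(\<lambda>w. f (L s) (ch \<alpha> w)) field_differentiable at w" by (simp add: o_def)
qed

lemma sep_holo_Zf: "\<alpha> \<le> M \<Longrightarrow> sep_holo Bs (ann \<alpha>) (Zf \<alpha>)"
  using sep_chart[OF _ z_holo] by (simp add: zc_def[abs_def])

lemma sep_holo_Mf: "\<alpha> \<le> M \<Longrightarrow> sep_holo Bs (ann \<alpha>) (Mf \<alpha>)"
  using sep_chart[OF _ m_holo] by (simp add: mc_def[abs_def])

lemma L_s0: "L s0 = t" by simp

definition OmD :: "complex \<Rightarrow> complex" where
  "OmD p = (if snd B = 0 then - 1 / (p - q (fst B) t) else deriv (OmP (fst B) (snd B)) p)"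

definition Om' :: "nat \<Rightarrow> complex \<Rightarrow> complex" where "Om' \<alpha> w = OmD (ch \<alpha> w) * ch' \<alpha> w"

lemma B_cases:
  obtains (log) b where "B = (b, 0)" "b \<in> {1..M}" | (power) \<mu> n where "B = (\<mu>, n)" "\<mu> \<le> M" "n \<ge> 1"
proof -
  obtain \<mu> n where e: "B = (\<mu>, n)" by fastforce
  then have "\<mu> \<le> M" "(\<mu>, n) \<noteq> (0, 0)" using B by (auto simp: time_indices_def)
  then show ?thesis using e log power by (cases "n = 0") auto
qed

lemma OmD_Omega:
  assumes "p \<notin> cuts"
  shows "deriv (Omega q z lg B t) p = OmD p"
proof (cases rule: B_cases)
  case (log b)
  have "((\<lambda>p. - lg b t (p - q b t)) has_field_derivative - (1 / (p - q b t))) (at p)"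
    using assms log by (intro DERIV_minus lg_deriv) auto
  then have "deriv (\<lambda>p. - lg b t (p - q b t)) p = - 1 / (p - q b t)" by (simp add: DERIV_imp_deriv)
  moreover have "Omega q z lg B t = (\<lambda>p. - lg b t (p - q b t))" by (simp add: Omega_def fun_eq_iff log)
  ultimately show ?thesis unfolding OmD_def unfolding log(1) by simp
next
  case (power \<mu> n)
  then have "Omega q z lg B t = OmP \<mu> n" by (auto simp: Omega_def OmP_def)
  then show ?thesis unfolding OmD_def using power by simp
qed

lemma OmD_hol: "OmD holomorphic_on - Q t"
proof (cases rule: B_cases)
  case (log b)
  then show ?thesis unfolding OmD_def by (auto intro!: holomorphic_intros simp: Q_def)
next
  case (power \<mu> n)
  then show ?thesis unfolding OmD_def using holomorphic_deriv[OF OmP_hol open_mQ] by simp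
qed

lemma Om'_hol: "\<alpha> \<le> M \<Longrightarrow> Om' \<alpha> holomorphic_on DD \<alpha>"
  unfolding Om'_def[abs_def] by (intro holomorphic_intros ch_D_hol OmD_hol ch'_D_hol)

lemma deriv_mc:
  assumes "\<alpha> \<le> M" "w \<in> V \<alpha> t"
  shows "deriv (mc \<alpha> t) w = deriv (m \<alpha> t) (ch \<alpha> w) * ch' \<alpha> w"
proof -
  have 1: "(m \<alpha> t has_field_derivative deriv (m \<alpha> t) (ch \<alpha> w)) (at (ch \<alpha> w))"
      by (rule holomorphic_derivI[OF m_hol[OF assms(1) tT] open_U[OF assms(1) tT]]) (use assms(2) in \<open>auto simp: V_def\<close>)
  have 2: "(ch \<alpha> has_field_derivative ch' \<alpha> w) (at w)"
    by (rule has_deriv_ch) (use assms(2) in \<open>auto simp: V_def\<close>)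
  from DERIV_chain2[OF 1 2] show ?thesis unfolding mc_def[abs_def] by (rule DERIV_imp_deriv)
qed

lemma interior_cuts_chart: "\<alpha> \<le> M \<Longrightarrow> interior {w \<in> ann \<alpha>. ch \<alpha> w \<in> cuts} = {}"
proof -
  assume \<alpha>: "\<alpha> \<le> M"
  define X where "X = {w \<in> ann \<alpha>. ch \<alpha> w \<in> cuts}"
  let ?O = "interior X"
  have sub: "?O \<subseteq> X" by (rule interior_subset)
  have z: "\<alpha> = 0 \<Longrightarrow> 0 \<notin> ?O" using sub ann_sub_V[OF \<alpha>] by (auto simp: V_def X_def)
  have "inj_on (ch \<alpha>) ?O" by (auto simp: inj_on_def ch_def)
  from open_mapping_thm3[OF ch_hol[OF z] open_interior this] have "open (ch \<alpha> ` ?O)" .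
  moreover have "ch \<alpha> ` ?O \<subseteq> cuts"
  proof
    fix p assume "p \<in> ch \<alpha> ` ?O"
    then obtain w where w: "p = ch \<alpha> w" "w \<in> X" using sub by blast
    then show "p \<in> cuts" unfolding X_def by blast
  qed
  ultimately have "ch \<alpha> ` ?O \<subseteq> interior cuts" by (intro interior_maximal)
  then have "ch \<alpha> ` ?O = {}" unfolding interior_cuts[OF tT] by (rule equalityI) (rule empty_subsetI)
  then have "?O = {}" by (rule image_is_empty[THEN iffD1])
  then show ?thesis unfolding X_def .
qed

lemma whitham_chart:
  assumes \<alpha>: "\<alpha> \<le> M" and w: "w \<in> ann \<alpha>"
  shows "deriv (zc \<alpha> t) w * deriv1 (Mf \<alpha>) s0 w - deriv1 (Zf \<alpha>) s0 w * deriv (mc \<alpha> t) w = Om' \<alpha> w"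
proof (rule continuous_eq_off_thin[OF open_ann _ _ interior_cuts_chart[OF \<alpha>] _ w])
  note zs = sep_holo_Zf[OF \<alpha>] and ms = sep_holo_Mf[OF \<alpha>]
  have "(\<lambda>w. deriv (Zf \<alpha> s0) w * deriv1 (Mf \<alpha>) s0 w - deriv1 (Zf \<alpha>) s0 w * deriv (Mf \<alpha> s0) w) holomorphic_on ann \<alpha>"
    by (intro holomorphic_intros deriv1_holomorphic2[OF zs Bs(1) open_ann Bs(2)] deriv1_holomorphic2[OF ms Bs(1) open_ann Bs(2)]
        holomorphic_deriv[OF sep_holo_holomorphic2[OF zs Bs(2)] open_ann] holomorphic_deriv[OF sep_holo_holomorphic2[OF ms Bs(2)] open_ann])
  then show "continuous_on (ann \<alpha>) (\<lambda>w. deriv (zc \<alpha> t) w * deriv1 (Mf \<alpha>) s0 w - deriv1 (Zf \<alpha>) s0 w * deriv (mc \<alpha> t) w)"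
    unfolding L_s0 by (rule holomorphic_on_imp_continuous_on)
  show "continuous_on (ann \<alpha>) (Om' \<alpha>)"
    by (rule holomorphic_on_imp_continuous_on[OF holomorphic_on_subset[OF Om'_hol[OF \<alpha>] ann_D[OF \<alpha>]]])
  fix w assume w: "w \<in> ann \<alpha> - {w \<in> ann \<alpha>. ch \<alpha> w \<in> cuts}"
  then have V: "w \<in> V \<alpha> t" using ann_sub_V[OF \<alpha>] by auto
  let ?p = "ch \<alpha> w"
  have p: "?p \<in> U \<alpha> t - cuts" using V w by (auto simp: V_def)
  have "deriv (z \<alpha> t) ?p * deriv1 (Mf \<alpha>) s0 w - deriv1 (Zf \<alpha>) s0 w * deriv (m \<alpha> t) ?p = OmD ?p"
    using whitham_p[OF \<alpha> tT p B] OmD_Omega[of ?p] p by (simp add: tderiv_def zc_def mc_def)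
  moreover have "a * e * b - x * (y * e) = (a * b - x * y) * e" for a b e x y :: complex by algebra
  ultimately show "deriv (zc \<alpha> t) w * deriv1 (Mf \<alpha>) s0 w - deriv1 (Zf \<alpha>) s0 w * deriv (mc \<alpha> t) w = Om' \<alpha> w"
    unfolding Om'_def deriv_zc[OF \<alpha> V] deriv_mc[OF \<alpha> V] by simp
qed

lemma res_form_derivative:
  assumes \<alpha>: "\<alpha> \<le> M" and f: "sep_holo Bs' (ann \<alpha>) f" and Bs': "open Bs'" "s0 \<in> Bs'" "Bs' \<subseteq> Bs"
  shows "((\<lambda>s. res \<alpha> (\<lambda>w. f s w * deriv (Zf \<alpha> s) w)) has_field_derivative
    res \<alpha> (\<lambda>w. deriv1 f s0 w * deriv (zc \<alpha> t) w - deriv (f s0) w * deriv1 (Zf \<alpha>) s0 w)) (at s0)"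
proof -
  have P: "pole_chart (c0 \<alpha>) (c \<alpha>) (r \<alpha>) (r2 \<alpha>) (hh \<alpha>)" by (rule chart[OF \<alpha>])
  have r: "0 < r \<alpha>" using rad[OF \<alpha>] by auto
  show ?thesis unfolding pole_chart.res_def[OF P]
    using has_field_derivative_contour_integral_form[OF f sep_holo_subset[OF sep_holo_Zf[OF \<alpha>] Bs'(3) subset_refl] Bs'(1) open_ann Bs'(2) r circle_ann[OF \<alpha>]]
    unfolding L_s0 by (intro DERIV_cdivide DERIV_minus)
qed

lemma moment_derivative:
  assumes \<alpha>: "\<alpha> \<le> M"
  shows "((\<lambda>s. res \<alpha> (\<lambda>w. Zf \<alpha> s w ^ n * Mf \<alpha> s w ^ j * deriv (Zf \<alpha> s) w)) has_field_derivative
    res \<alpha> (\<lambda>w. of_nat j * zc \<alpha> t w ^ n * mc \<alpha> t w ^ (j - 1) * Om' \<alpha> w)) (at s0)"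
proof -
  note zs = sep_holo_Zf[OF \<alpha>] and ms = sep_holo_Mf[OF \<alpha>]
  have f: "sep_holo Bs (ann \<alpha>) (\<lambda>s w. Zf \<alpha> s w ^ n * Mf \<alpha> s w ^ j)"
    by (intro sep_holo_mult sep_holo_power zs ms)
  have *: "res \<alpha> (\<lambda>w. deriv1 (\<lambda>s w. Zf \<alpha> s w ^ n * Mf \<alpha> s w ^ j) s0 w * deriv (zc \<alpha> t) w
      - deriv ((\<lambda>s w. Zf \<alpha> s w ^ n * Mf \<alpha> s w ^ j) s0) w * deriv1 (Zf \<alpha>) s0 w)
    = res \<alpha> (\<lambda>w. of_nat j * zc \<alpha> t w ^ n * mc \<alpha> t w ^ (j - 1) * Om' \<alpha> w)"
  proof (rule res_cong[OF \<alpha>])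
    fix w assume w: "w \<in> ann \<alpha>"
    note z1 = sep_holo_D1[OF zs Bs(2) w] and m1 = sep_holo_D1[OF ms Bs(2) w]
      and z2 = sep_holo_D2[OF zs Bs(2) w, unfolded L_s0] and m2 = sep_holo_D2[OF ms Bs(2) w, unfolded L_s0]
    have 1: "deriv1 (\<lambda>s w. Zf \<alpha> s w ^ n * Mf \<alpha> s w ^ j) s0 w
      = of_nat n * zc \<alpha> t w ^ (n - 1) * deriv1 (Zf \<alpha>) s0 w * mc \<alpha> t w ^ j + of_nat j * mc \<alpha> t w ^ (j - 1) * deriv1 (Mf \<alpha>) s0 w * zc \<alpha> t w ^ n"
      by (rule DERIV_imp_deriv, rule DERIV_cong[OF DERIV_mult[OF DERIV_power[OF z1] DERIV_power[OF m1]]]) (simp add: L_s0 mult_ac)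
    have 2: "deriv (\<lambda>w. zc \<alpha> t w ^ n * mc \<alpha> t w ^ j) w
      = of_nat n * zc \<alpha> t w ^ (n - 1) * deriv (zc \<alpha> t) w * mc \<alpha> t w ^ j + of_nat j * mc \<alpha> t w ^ (j - 1) * deriv (mc \<alpha> t) w * zc \<alpha> t w ^ n"
      by (rule DERIV_imp_deriv, rule DERIV_cong[OF DERIV_mult[OF DERIV_power[OF z2] DERIV_power[OF m2]]]) (simp add: mult_ac)
    show "deriv1 (\<lambda>s w. Zf \<alpha> s w ^ n * Mf \<alpha> s w ^ j) s0 w * deriv (zc \<alpha> t) w
      - deriv ((\<lambda>s w. Zf \<alpha> s w ^ n * Mf \<alpha> s w ^ j) s0) w * deriv1 (Zf \<alpha>) s0 w
      = of_nat j * zc \<alpha> t w ^ n * mc \<alpha> t w ^ (j - 1) * Om' \<alpha> w"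
      unfolding L_s0 1 2 whitham_chart[OF \<alpha> w, symmetric] by (simp add: algebra_simps)
  qed
  show ?thesis using res_form_derivative[OF \<alpha> f Bs subset_refl] unfolding * .
qed

lemma has_derivative_slice:
  assumes "(f has_field_derivative D) (at s0)" "\<And>s. s \<in> Bs \<Longrightarrow> f s = g s"
  shows "(g has_field_derivative D) (at s0)"
  by (rule has_field_derivative_transform_within_open[OF assms(1) Bs assms(2)])

lemma v_derivative:
  assumes \<alpha>: "\<alpha> \<le> M" and n: "n \<ge> 1"
  shows "((\<lambda>s. v \<alpha> (n + 1) (L s)) has_field_derivative res \<alpha> (\<lambda>w. zc \<alpha> t w ^ n * Om' \<alpha> w)) (at s0)"
  using has_derivative_slice[OF moment_derivative[OF \<alpha>, of n 1]]
    good_point.coefficient[OF good_pointL \<alpha> n] by simp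

lemma square_derivative:
  assumes \<alpha>: "\<alpha> \<le> M"
  shows "((\<lambda>s. 2 * (\<Sum>n=1..N \<alpha>. of_nat n * time M (L s) \<alpha> n * v \<alpha> (n + 1) (L s)) + time M (L s) \<alpha> 0 ^ 2) has_field_derivative
    res \<alpha> (\<lambda>w. 2 * zc \<alpha> t w * mc \<alpha> t w * Om' \<alpha> w)) (at s0)"
proof (rule has_derivative_slice)
  show "((\<lambda>s. res \<alpha> (\<lambda>w. Zf \<alpha> s w * Mf \<alpha> s w ^ 2 * deriv (Zf \<alpha> s) w)) has_field_derivative
    res \<alpha> (\<lambda>w. 2 * zc \<alpha> t w * mc \<alpha> t w * Om' \<alpha> w)) (at s0)"
    using moment_derivative[OF \<alpha>, of 1 2] by simp
qed (rule good_point.square_coefficient[OF good_pointL \<alpha>, symmetric])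

end

context time_slice
begin

definition tdot :: "nat \<Rightarrow> nat \<Rightarrow> complex" where "tdot \<alpha> n = (if (\<alpha>, n) = B then 1 else 0)"

lemma time_derivative: "(\<alpha>, n) \<noteq> (0, 0) \<Longrightarrow> ((\<lambda>s. time M (L s) \<alpha> n) has_field_derivative tdot \<alpha> n) (at s)"
  by (cases "(\<alpha>, n) = B") (auto simp: time_def tdot_def intro!: derivative_eq_intros)

text \<open>
  \<open>H b\<close> is the time derivative of \<open>t\<^sub>b\<^sub>0 log z\<^sub>b - S\<^sub>b\<close> at constant \<open>z\<^sub>b\<close>, in a form without cuts.
\<close>

definition H :: "nat \<Rightarrow> complex \<Rightarrow> complex" where
  "H b p = (if snd B = 0 then
      (if fst B = b then ld b t + Ln ((p - q b t) * zc b t p / d b t) else lg (fst B) t (p - q (fst B) t))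
    else - OmP (fst B) (snd B) p)"

lemma H_deriv:
  assumes b: "b \<in> {1..M}" and p: "p \<in> ann b"
  shows "(H b has_field_derivative tdot b 0 * deriv (zc b t) p / zc b t p - Om' b p) (at p)"
proof -
  have bM: "b \<le> M" and bn: "b \<noteq> 0" using b by auto
  have pQ: "p \<notin> Q t" using ch_D(2)[OF bM subsetD[OF ann_D[OF bM] p]] bn by (simp add: ch_def)
  have chb: "ch b w = w" "ch' b w = 1" for w using bn by (auto simp: ch_def ch'_def)
  show ?thesis
  proof (cases rule: B_cases)
    case (log \<mu>)
    show ?thesis
    proof (cases "\<mu> = b")
      case True
      have zd: "(zc b t has_field_derivative deriv (zc b t) p) (at p)"
        by (rule holomorphic_derivI[OF zc_hol[OF bM tT] open_V[OF bM tT]]) (use p ann_sub_V[OF bM] in auto)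
      have nz: "p - q b t \<noteq> 0" "zc b t p \<noteq> 0" "d b t \<noteq> 0"
        using pQ b zc_nz_ann[OF bM p] d_nz[OF b tT] by (auto simp: Q_def)
      have g: "((\<lambda>p. (p - q b t) * zc b t p / d b t) has_field_derivative (zc b t p + (p - q b t) * deriv (zc b t) p) / d b t) (at p)"
        by (rule DERIV_cong[OF DERIV_cdivide[OF DERIV_mult[OF DERIV_diff[OF DERIV_ident DERIV_const] zd]]]) simp
      have "((\<lambda>p. ld b t + Ln ((p - q b t) * zc b t p / d b t)) has_field_derivative
        0 + inverse ((p - q b t) * zc b t p / d b t) * ((zc b t p + (p - q b t) * deriv (zc b t) p) / d b t)) (at p)"
        by (rule DERIV_add[OF DERIV_const DERIV_chain2[OF has_field_derivative_Ln[OF log_close[OF b p]] g]])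
      moreover have "0 + inverse ((p - q b t) * zc b t p / d b t) * ((zc b t p + (p - q b t) * deriv (zc b t) p) / d b t)
        = tdot b 0 * deriv (zc b t) p / zc b t p - Om' b p"
        unfolding tdot_def Om'_def OmD_def unfolding chb log(1) True using nz by (simp add: field_simps)
      moreover have "H b = (\<lambda>p. ld b t + Ln ((p - q b t) * zc b t p / d b t))"
        unfolding H_def[abs_def] unfolding log(1) True by simp
      ultimately show ?thesis by simp
    next
      case False
      have "ball (c0 b) (r2 b) \<inter> K \<mu> t = {}" by (rule disc_K) (use b log False in auto)
      then have "p \<notin> K \<mu> t" using p by (auto simp: ann_def)
      from lg_deriv[OF log(2) this]
      moreover have "H b = (\<lambda>p. lg \<mu> t (p - q \<mu> t))"
        unfolding H_def[abs_def] unfolding log(1) using False by simp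
      moreover have "1 / (p - q \<mu> t) = tdot b 0 * deriv (zc b t) p / zc b t p - Om' b p"
        unfolding tdot_def Om'_def OmD_def unfolding chb log(1) using False by simp
      ultimately show ?thesis by simp
    qed
  next
    case (power \<mu> n)
    have "((\<lambda>p. - OmP \<mu> n p) has_field_derivative - deriv (OmP \<mu> n) p) (at p)"
      by (rule DERIV_minus[OF holomorphic_derivI[OF OmP_hol[OF power(2)] open_mQ]]) (use pQ in simp)
    moreover have "H b = (\<lambda>p. - OmP \<mu> n p)"
      unfolding H_def[abs_def] unfolding power(1) using power(3) by simp
    moreover have "- deriv (OmP \<mu> n) p = tdot b 0 * deriv (zc b t) p / zc b t p - Om' b p"
      unfolding tdot_def Om'_def OmD_def unfolding chb power(1) using power(3) by simp
    ultimately show ?thesis by simp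
  qed
qed

lemma H_Omega:
  assumes b: "b \<in> {1..M}" and p: "p \<in> ann b" "p \<notin> cuts"
  shows "H b p = tdot b 0 * (ld b t - lg b t (p - q b t) + Ln ((p - q b t) * zc b t p / d b t)) - Omega q z lg B t p"
proof (cases rule: B_cases)
  case (log \<mu>)
  then show ?thesis unfolding H_def tdot_def Omega_def unfolding log(1) by auto
next
  case (power \<mu> n)
  then show ?thesis unfolding H_def tdot_def Omega_def OmP_def unfolding power(1) by auto
qed

lemma connected_ann: "connected (ann \<alpha>)"
proof -
  have "ann \<alpha> = {w. r1 \<alpha> < norm (w - c0 \<alpha>) \<and> norm (w - c0 \<alpha>) < r2 \<alpha>}"
    by (auto simp: ann_def dist_norm norm_minus_commute)
  then show ?thesis by (simp only:) (rule connected_annulus(1), simp)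
qed

definition gbd :: "nat \<Rightarrow> complex \<Rightarrow> complex \<Rightarrow> complex" where
  "gbd b s p = (time M (L s) b 0 / Zf b s p - Mf b s p) * deriv (Zf b s) p"

lemma Zf_nz: "\<alpha> \<le> M \<Longrightarrow> s \<in> Bs \<Longrightarrow> p \<in> ann \<alpha> \<Longrightarrow> Zf \<alpha> s p \<noteq> 0"
  using good_point.zc_nz_ann[OF good_pointL] by blast

lemma time_sep: "b \<in> {1..M} \<Longrightarrow> Bs' \<subseteq> Bs \<Longrightarrow> open Bs' \<Longrightarrow> sep_holo Bs' A (\<lambda>s w. time M (L s) b 0)"
  by (rule sep_holo_first) (use time_derivative[of b 0] in \<open>auto simp: holomorphic_on_open\<close>)

lemma gbd_sep:
  assumes b: "b \<in> {1..M}" and Bs': "open Bs'" "Bs' \<subseteq> Bs"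
  shows "sep_holo Bs' (ann b) (gbd b)"
proof -
  have bM: "b \<le> M" using b by auto
  note zs = sep_holo_subset[OF sep_holo_Zf[OF bM] Bs'(2) subset_refl] and ms = sep_holo_subset[OF sep_holo_Mf[OF bM] Bs'(2) subset_refl]
  have "sep_holo Bs' (ann b) (\<lambda>s p. (time M (L s) b 0 / Zf b s p - Mf b s p) * deriv (Zf b s) p)"
    by (intro sep_holo_mult sep_holo_diff sep_holo_divide time_sep[OF b Bs'(2) Bs'(1)] zs ms sep_holo_deriv2[OF zs Bs'(1) open_ann])
      (use Zf_nz[OF bM] Bs'(2) in blast)
  then show ?thesis by (simp add: gbd_def[abs_def])
qed

text \<open>Off the cuts the derivative in the time direction is known from \<open>dS\<close>.\<close>

lemma gbs_point:
  assumes b: "b \<in> {1..M}" and p: "p \<in> ann b" and Bs': "open Bs'" "Bs' \<subseteq> Bs"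
    and off': "\<forall>s\<in>Bs'. \<forall>i\<in>{1..M}. p \<notin> K i (L s)" and s: "s \<in> Bs'"
  shows "((\<lambda>s. gbs s b p) has_field_derivative
      tdot b 0 * (ld b (L s) - lg b (L s) (p - q b (L s)) + Ln ((p - q b (L s)) * Zf b s p / d b (L s)))
      + time M (L s) b 0 * (deriv1 (Zf b) s p / Zf b s p)
      - (Mf b s p * deriv1 (Zf b) s p + Omega q z lg B (L s) p)) (at s)"
proof -
  have bM: "b \<le> M" and bn: "b \<noteq> 0" using b by auto
  have chb: "ch b w = w" for w using bn by (simp add: ch_def)
  have off: "p \<notin> K i (L s)" if "s \<in> Bs'" "i \<in> {1..M}" for s i using off' that by blast
  define lam where "lam s = ld b (L s) - lg b (L s) (p - q b (L s)) + Ln ((p - q b (L s)) * Zf b s p / d b (L s))" for s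
  have inT: "L s \<in> T" if "s \<in> Bs'" for s using that Bs'(2) LT by blast
  have co: "continuous_on Bs' (\<lambda>s. f (L s))" if "continuous_on T f" for f :: "times \<Rightarrow> complex"
    by (rule continuous_on_compose2[OF that L_cont]) (use inT in auto)
  have zh: "(\<lambda>s. Zf b s p) holomorphic_on Bs"
    by (rule sep_holo_holomorphic1[OF sep_holo_Zf[OF bM] p])
  have close: "(p - q b (L s)) * Zf b s p / d b (L s) \<notin> \<real>\<^sub>\<le>\<^sub>0" if "s \<in> Bs'" for s
    using good_point.log_close[OF good_pointL b p] that Bs'(2) by blast
  have "continuous_on Bs' (\<lambda>s. (\<lambda>(t, p). lg b t (p - q b t)) (L s, p))"
    by (rule continuous_on_compose2[OF lg_cont[OF b]]) (use inT off[OF _ b] in \<open>auto intro!: continuous_intros L_cont\<close>)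
  then have lgc: "continuous_on Bs' (\<lambda>s. lg b (L s) (p - q b (L s)))" by simp
  have lc: "continuous_on Bs' lam"
    unfolding lam_def[abs_def]
    by (intro continuous_intros co ld_cont[OF b] q_cont[OF b] d_cont[OF b] lgc
        continuous_on_subset[OF holomorphic_on_imp_continuous_on[OF zh] Bs'(2)])
      (use close d_nz[OF b inT] in auto)
  have le: "exp (lam s) = Zf b s p" if s: "s \<in> Bs'" for s
  proof -
    have n: "d b (L s) \<noteq> 0" "p - q b (L s) \<noteq> 0"
      using d_nz[OF b inT[OF s]] q_in_K[OF b inT[OF s]] off[OF s b] by auto
    have "(p - q b (L s)) * Zf b s p / d b (L s) \<noteq> 0" using close[OF s] by force
    then show ?thesis
      unfolding lam_def exp_add exp_diff ld_exp[OF b inT[OF s]] lg_exp[OF b inT[OF s] off[OF s b]] using n by simp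
  qed
  have sB: "s \<in> Bs" using s Bs'(2) by blast
  have l': "(lam has_field_derivative deriv1 (Zf b) s p / Zf b s p) (at s)"
    by (rule log_branch_derivative[OF Bs'(1) lc le s sep_holo_D1[OF sep_holo_Zf[OF bM] sB p]])
  have eq: "gbs s b p = time M (L s) b 0 * lam s - S b (L s) p" if s: "s \<in> Bs'" for s
    unfolding lam_def by (rule good_point.gb_S[OF good_pointL b p]) (use s Bs'(2) off in auto)
  have U: "p \<in> U b (L s) - (\<Union>i\<in>{1..M}. K i (L s))"
    using good_point.ann_sub_V[OF good_pointL[OF sB] bM] p off[OF s] bn by (auto simp: V_def ch_def)
  have S': "((\<lambda>s. S b (L s) p) has_field_derivative Mf b s p * deriv1 (Zf b) s p + Omega q z lg B (L s) p) (at s)"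
    using S_t[OF bM inT[OF s] U B] by (simp add: mc_def zc_def chb tderiv_def)
  have "((\<lambda>s. time M (L s) b 0 * lam s - S b (L s) p) has_field_derivative
     (tdot b 0 * lam s + deriv1 (Zf b) s p / Zf b s p * time M (L s) b 0) - (Mf b s p * deriv1 (Zf b) s p + Omega q z lg B (L s) p)) (at s)"
    by (rule DERIV_diff[OF DERIV_mult[OF time_derivative l'] S']) (use bn in simp)
  then have "((\<lambda>s. gbs s b p) has_field_derivative
     (tdot b 0 * lam s + deriv1 (Zf b) s p / Zf b s p * time M (L s) b 0) - (Mf b s p * deriv1 (Zf b) s p + Omega q z lg B (L s) p)) (at s)"
    by (rule has_field_derivative_transform_within_open[OF _ Bs'(1) s]) (simp add: eq)
  then show ?thesis unfolding lam_def by (simp only: mult.commute)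
qed

lemma gbs_derivative:
  assumes b: "b \<in> {1..M}"
  obtains Bs' where "open Bs'" "s0 \<in> Bs'" "Bs' \<subseteq> Bs" "sep_holo Bs' (ann b) (\<lambda>s. gbs s b)"
    "\<And>p. p \<in> ann b \<Longrightarrow> deriv1 (\<lambda>s. gbs s b) s0 p =
      (tm b 0 / zc b t p - mc b t p) * deriv1 (Zf b) s0 p + H b p"
proof -
  have bM: "b \<le> M" using b by auto
  have "sphere (c0 b) (r b) \<noteq> {}" using rad[OF bM] by auto
  then have "ann b \<noteq> {}" using circle_ann[OF bM] by blast
  then have "\<not> ann b \<subseteq> cuts"
    using interior_maximal[OF _ open_ann, of b cuts] interior_cuts[OF tT] by blast
  then obtain p1 where p1: "p1 \<in> ann b" "p1 \<notin> cuts" by blast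
  have "eventually (\<lambda>s. p1 \<notin> K i (L s)) (nhds s0)" if i: "i \<in> {1..M}" for i
    using sliceL_open[OF cut_open[OF i], of p1] p1(2) i tT by (auto elim: eventually_mono)
  then have "eventually (\<lambda>s. \<forall>i\<in>{1..M}. p1 \<notin> K i (L s)) (nhds s0)"
    by (intro eventually_ball_finite) auto
  then obtain X where X: "open X" "s0 \<in> X" "\<And>s i. s \<in> X \<Longrightarrow> i \<in> {1..M} \<Longrightarrow> p1 \<notin> K i (L s)"
    unfolding eventually_nhds by blast
  define Bs' where "Bs' = Bs \<inter> X"
  have Bs': "open Bs'" "s0 \<in> Bs'" "Bs' \<subseteq> Bs" using Bs X by (auto simp: Bs'_def)
  have off: "\<forall>s\<in>Bs'. \<forall>i\<in>{1..M}. p1 \<notin> K i (L s)" using X(3) by (auto simp: Bs'_def)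
  note gp = gbs_point[OF b p1(1) Bs'(1) Bs'(3) off]
  note ys = gbd_sep[OF b Bs'(1) Bs'(3)]
  note zs = sep_holo_subset[OF sep_holo_Zf[OF bM] Bs'(3) subset_refl] and ms = sep_holo_subset[OF sep_holo_Mf[OF bM] Bs'(3) subset_refl]
  have gd: "(gbs s b has_field_derivative gbd b s p) (at p)" if "s \<in> Bs'" "p \<in> ann b" for s p
    unfolding gbd_def by (rule good_point.gb_deriv[OF good_pointL b that(2)]) (use that(1) Bs'(3) in blast)
  have gs: "sep_holo Bs' (ann b) (\<lambda>s. gbs s b)"
  proof (rule sep_holo_primitive[OF ys Bs'(1) open_ann connected_ann gd p1(1)])
    show "(\<lambda>s. gbs s b p1) holomorphic_on Bs'"
      unfolding holomorphic_on_open[OF Bs'(1)] using gp by blast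
  qed
  define X1 where "X1 p = deriv1 (\<lambda>s. gbs s b) s0 p" for p
  define Y1 where "Y1 p = (tm b 0 / zc b t p - mc b t p) * deriv1 (Zf b) s0 p + H b p" for p
  have d0: "((\<lambda>p. X1 p - Y1 p) has_field_derivative 0) (at p)" if p: "p \<in> ann b" for p
  proof -
    have nz: "zc b t p \<noteq> 0" by (rule zc_nz_ann[OF bM p])
    note z1 = sep_holo_D1[OF zs Bs'(2) p] and m1 = sep_holo_D1[OF ms Bs'(2) p]
    have z2: "(zc b t has_field_derivative deriv (zc b t) p) (at p)"
      and m2: "(mc b t has_field_derivative deriv (mc b t) p) (at p)"
      using sep_holo_D2[OF zs Bs'(2) p] sep_holo_D2[OF ms Bs'(2) p] unfolding L_s0 by auto
    have z12: "(deriv1 (Zf b) s0 has_field_derivative deriv (deriv1 (Zf b) s0) p) (at p)"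
      by (rule holomorphic_derivI[OF deriv1_holomorphic2[OF zs Bs'(1) open_ann Bs'(2)] open_ann p])
    have z21: "((\<lambda>s. deriv (Zf b s) p) has_field_derivative deriv (deriv1 (Zf b) s0) p) (at s0)"
      by (rule mixed_derivative[OF zs Bs'(1) open_ann Bs'(2) p])
    have t1: "((\<lambda>s. time M (L s) b 0) has_field_derivative tdot b 0) (at s0)"
      by (rule time_derivative) (use b in auto)
    have x: "(X1 has_field_derivative deriv X1 p) (at p)"
      unfolding X1_def[abs_def]
      by (rule holomorphic_derivI[OF deriv1_holomorphic2[OF gs Bs'(1) open_ann Bs'(2)] open_ann p])
    have "((\<lambda>s. deriv (gbs s b) p) has_field_derivative deriv X1 p) (at s0)"
      unfolding X1_def[abs_def] by (rule mixed_derivative[OF gs Bs'(1) open_ann Bs'(2) p])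
    then have "(( \<lambda>s. gbd b s p) has_field_derivative deriv X1 p) (at s0)"
      by (rule has_field_derivative_transform_within_open[OF _ Bs'(1,2)]) (rule DERIV_imp_deriv[OF gd[OF _ p]])
    moreover have "((\<lambda>s. gbd b s p) has_field_derivative
        ((tdot b 0 * zc b t p - tm b 0 * deriv1 (Zf b) s0 p) / (zc b t p * zc b t p) - deriv1 (Mf b) s0 p) * deriv (zc b t) p
        + deriv (deriv1 (Zf b) s0) p * (tm b 0 / zc b t p - mc b t p)) (at s0)"
      using DERIV_mult[OF DERIV_diff[OF DERIV_divide[OF t1 z1] m1] z21] nz unfolding gbd_def[abs_def] L_s0 by blast
    ultimately have x2: "deriv X1 p = ((tdot b 0 * zc b t p - tm b 0 * deriv1 (Zf b) s0 p) / (zc b t p * zc b t p) - deriv1 (Mf b) s0 p) * deriv (zc b t) p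
        + deriv (deriv1 (Zf b) s0) p * (tm b 0 / zc b t p - mc b t p)"
      by (rule DERIV_unique)
    have y: "(Y1 has_field_derivative ((0 * zc b t p - tm b 0 * deriv (zc b t) p) / (zc b t p * zc b t p) - deriv (mc b t) p) * deriv1 (Zf b) s0 p
        + deriv (deriv1 (Zf b) s0) p * (tm b 0 / zc b t p - mc b t p) + (tdot b 0 * deriv (zc b t) p / zc b t p - Om' b p)) (at p)"
      unfolding Y1_def[abs_def]
      by (rule DERIV_add[OF DERIV_mult[OF DERIV_diff[OF DERIV_divide[OF DERIV_const z2 nz] m2] z12] H_deriv[OF b p]])
    show ?thesis
      by (rule DERIV_cong[OF DERIV_diff[OF x y]])
        (use nz in \<open>simp add: x2 whitham_chart[OF bM p, symmetric] divide_simps; simp add: algebra_simps\<close>)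
  qed
  have e1: "X1 p1 - Y1 p1 = 0"
    unfolding X1_def Y1_def DERIV_imp_deriv[OF gp[OF Bs'(2)]] L_s0 H_Omega[OF b p1]
    by (simp add: algebra_simps)
  have "(\<lambda>p. X1 p - Y1 p) constant_on ann b"
    by (rule has_field_derivative_0_imp_constant_on[OF d0 connected_ann open_ann])
  then have "X1 p - Y1 p = 0" if "p \<in> ann b" for p
    using e1 p1(1) that unfolding constant_on_def by metis
  with that[OF Bs' gs] show ?thesis unfolding X1_def Y1_def by auto
qed

lemma vc_derivative:
  assumes b: "b \<in> {1..M}"
  shows "((\<lambda>s. vc b (L s)) has_field_derivative res b (\<lambda>p. H b p / zc b t p * deriv (zc b t) p)) (at s0)"
proof -
  have bM: "b \<le> M" using b by auto
  obtain Bs' where Bs': "open Bs'" "s0 \<in> Bs'" "Bs' \<subseteq> Bs" and gs: "sep_holo Bs' (ann b) (\<lambda>s. gbs s b)"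
    and g': "\<And>p. p \<in> ann b \<Longrightarrow> deriv1 (\<lambda>s. gbs s b) s0 p =
      (tm b 0 / zc b t p - mc b t p) * deriv1 (Zf b) s0 p + H b p"
    using gbs_derivative[OF b] by metis
  note zs = sep_holo_subset[OF sep_holo_Zf[OF bM] Bs'(3) subset_refl]
  have f: "sep_holo Bs' (ann b) (\<lambda>s p. gbs s b p / Zf b s p)"
    by (rule sep_holo_divide[OF gs zs]) (use Zf_nz[OF bM] Bs'(3) in blast)
  have "res b (\<lambda>w. deriv1 (\<lambda>s p. gbs s b p / Zf b s p) s0 w * deriv (zc b t) w
      - deriv (\<lambda>p. gbs s0 b p / Zf b s0 p) w * deriv1 (Zf b) s0 w) = res b (\<lambda>p. H b p / zc b t p * deriv (zc b t) p)"
  proof (rule res_cong[OF bM])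
    fix p assume p: "p \<in> ann b"
    have nz: "zc b t p \<noteq> 0" by (rule zc_nz_ann[OF bM p])
    note z1 = sep_holo_D1[OF zs Bs'(2) p] and g1 = sep_holo_D1[OF gs Bs'(2) p, unfolded g'[OF p]]
    have z2: "(zc b t has_field_derivative deriv (zc b t) p) (at p)"
      using sep_holo_D2[OF zs Bs'(2) p] unfolding L_s0 by auto
    note g2 = gb_deriv[OF b p]
    have 1: "deriv1 (\<lambda>s p. gbs s b p / Zf b s p) s0 p = (((tm b 0 / zc b t p - mc b t p) * deriv1 (Zf b) s0 p + H b p) * zc b t p
      - gb b p * deriv1 (Zf b) s0 p) / (zc b t p * zc b t p)"
      using DERIV_imp_deriv[OF DERIV_divide[OF g1 z1]] nz unfolding L_s0 by simp
    have 2: "deriv (\<lambda>p. gb b p / zc b t p) p = ((tm b 0 / zc b t p - mc b t p) * deriv (zc b t) p * zc b t p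
      - gb b p * deriv (zc b t) p) / (zc b t p * zc b t p)"
      by (rule DERIV_imp_deriv[OF DERIV_divide[OF g2 z2 nz]])
    show "deriv1 (\<lambda>s p. gbs s b p / Zf b s p) s0 p * deriv (zc b t) p
      - deriv (\<lambda>p. gbs s0 b p / Zf b s0 p) p * deriv1 (Zf b) s0 p = H b p / zc b t p * deriv (zc b t) p"
      unfolding 1 unfolding L_s0 2 using nz by (simp add: divide_simps) (simp add: algebra_simps)
  qed
  with res_form_derivative[OF bM f Bs']
  have "((\<lambda>s. res b (\<lambda>w. gbs s b w / Zf b s w * deriv (Zf b s) w)) has_field_derivative
    res b (\<lambda>p. H b p / zc b t p * deriv (zc b t) p)) (at s0)" by simp
  then show ?thesis
    by (rule has_derivative_slice) (rule good_point.vc_residue_gb[OF good_pointL b, symmetric])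
qed

end

lemma contour_integral_uminus: "contour_integral g (\<lambda>w. - f w) = - contour_integral g f"
  by (simp add: contour_integral_integral)

context time_slice
begin

lemma log_minus_one_derivative:
  assumes i: "i \<in> {1..M}" and j: "j \<in> {1..M}" "j \<noteq> i"
  shows "((\<lambda>s. log_minus_one q lg j i (L s)) has_field_derivative 0) (at s0)"
proof -
  have co: "continuous_on Bs (\<lambda>s. f (L s))" if "continuous_on T f" for f :: "times \<Rightarrow> complex"
    by (rule continuous_on_compose2[OF that L_cont]) (use LT in auto)
  have lc: "continuous_on Bs (\<lambda>s. lg a (L s) (q b (L s) - q a (L s)))" if "a \<in> {1..M}" "b \<in> {1..M}" "b \<noteq> a" for a b
  proof -
    have "continuous_on Bs (\<lambda>s. (\<lambda>(t, p). lg a t (p - q a t)) (L s, q b (L s)))"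
      by (rule continuous_on_compose2[OF lg_cont[OF that(1)]])
        (use LT q_notin_K[OF that(2,1,3)] in \<open>auto intro!: continuous_intros L_cont co q_cont[OF that(2)]\<close>)
    then show ?thesis by simp
  qed
  have "continuous_on Bs (\<lambda>s. log_minus_one q lg j i (L s))"
    unfolding log_minus_one_def using i j by (intro continuous_intros lc) auto
  moreover have "exp (log_minus_one q lg j i (L s)) = -1" if s: "s \<in> Bs" for s
  proof -
    note T = LT[OF s]
    have "q j (L s) \<noteq> q i (L s)" using q_notin_K[OF i j(1) _ T] q_in_K[OF j(1) T] j(2) by metis
    then show ?thesis
      unfolding log_minus_one_def exp_diff lg_exp[OF j(1) T q_notin_K[OF i j(1) j(2)[symmetric] T]]
        lg_exp[OF i T q_notin_K[OF j(1) i j(2) T]]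
      by (simp add: divide_simps)
  qed
  ultimately show ?thesis
    using log_branch_derivative[OF Bs(1) _ _ Bs(2), of "\<lambda>s. log_minus_one q lg j i (L s)" "\<lambda>_. -1" 0] by simp
qed

definition vdot :: "nat \<Rightarrow> complex" where
  "vdot b = res b (\<lambda>p. H b p / zc b t p * deriv (zc b t) p) - (\<Sum>j\<in>{1..<b}. log_minus_one q lg j b t * tdot j 0)"

lemma v_first_derivative:
  assumes b: "b \<in> {1..M}"
  shows "((\<lambda>s. v_first M q lg vc b (L s)) has_field_derivative vdot b) (at s0)"
proof -
  have "((\<lambda>s. log_minus_one q lg j b (L s) * time M (L s) j 0) has_field_derivative log_minus_one q lg j b t * tdot j 0) (at s0)"
    if "j \<in> {1..<b}" for j
    by (rule DERIV_cong[OF DERIV_mult[OF log_minus_one_derivative time_derivative]])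
      (use that b in \<open>auto simp: L_s0\<close>)
  then show ?thesis unfolding v_first_def vdot_def
    by (intro DERIV_diff vc_derivative b DERIV_sum)
qed

lemma vdot_log:
  assumes Bb: "B = (b, 0)" and b: "b \<in> {1..M}" and i: "i \<in> {1..M}"
  shows "vdot i = (if i = b then ld b t else if i < b then lg i t (q b t - q i t) - log_minus_one q lg i b t
     else lg i t (q b t - q i t))"
proof -
  have t: "tdot j 0 = (if j = b then 1 else 0)" for j unfolding tdot_def unfolding Bb by simp
  have s: "(\<Sum>j\<in>{1..<i}. log_minus_one q lg j i t * tdot j 0) = (if b < i then log_minus_one q lg b i t else 0)"
    unfolding t using b by (simp add: if_distrib[of "\<lambda>x. _ * x"] cong: if_cong)
  have "res i (\<lambda>p. H i p / zc i t p * deriv (zc i t) p) = (if b = i then ld b t else lg b t (q i t - q b t))"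
    unfolding H_def unfolding Bb using res_log_terms(1)[OF i, of b] res_log_terms(2)[OF i] b by (auto simp del: One_nat_def)
  then show ?thesis unfolding vdot_def s by (auto simp: log_minus_one_def)
qed

lemma vdot_power:
  assumes Bb: "B = (\<mu>, n)" and n: "n \<ge> 1" and i: "i \<in> {1..M}" and \<mu>: "\<mu> \<le> M"
  shows "vdot i = - res i (\<lambda>w. OmP \<mu> n (ch i w) * (deriv (zc i t) w / zc i t w))"
proof -
  have iM: "i \<le> M" and i0: "i \<noteq> 0" using i by auto
  interpret P: pole_chart "c0 i" "c i" "r i" "r2 i" "hh i" by (rule chart[OF iM])
  have t: "tdot j 0 = 0" for j unfolding tdot_def unfolding Bb using n by simp
  have "res i (\<lambda>p. H i p / zc i t p * deriv (zc i t) p) = P.res (\<lambda>w. - (OmP \<mu> n (ch i w) * (deriv (zc i t) w / zc i t w)))"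
    by (rule res_cong[OF iM]) (unfold H_def, unfold Bb, use n i0 in \<open>simp add: ch_def\<close>)
  also have "\<dots> = - P.res (\<lambda>w. OmP \<mu> n (ch i w) * (deriv (zc i t) w / zc i t w))"
    by (simp only: P.res_def contour_integral_uminus) simp
  finally show ?thesis unfolding vdot_def t by simp
qed

definition twice_F_dot :: complex where
  "twice_F_dot = (\<Sum>\<alpha>\<le>M. \<Sum>n=1..N \<alpha>. tdot \<alpha> n * v \<alpha> (n + 1) t + res \<alpha> (\<lambda>w. zc \<alpha> t w ^ n * Om' \<alpha> w) * tm \<alpha> n)
    - (\<Sum>j\<in>J. 1 / (2 * of_nat (k j)) * res j (\<lambda>w. 2 * zc j t w * mc j t w * Om' j w))
    + (\<Sum>i=1..M. tdot i 0 * v_first M q lg vc i t + vdot i * tm i 0)"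

lemma twice_F_derivative_raw: "((\<lambda>s. twice_F (L s)) has_field_derivative twice_F_dot) (at s0)"
  unfolding twice_F_def twice_F_dot_def
proof (intro DERIV_add DERIV_diff DERIV_sum)
  fix \<alpha> n assume "\<alpha> \<in> {..M}" "n \<in> {1..N \<alpha>}"
  then show "((\<lambda>s. time M (L s) \<alpha> n * v \<alpha> (n + 1) (L s)) has_field_derivative
      tdot \<alpha> n * v \<alpha> (n + 1) t + res \<alpha> (\<lambda>w. zc \<alpha> t w ^ n * Om' \<alpha> w) * tm \<alpha> n) (at s0)"
    using DERIV_mult[OF time_derivative v_derivative, of \<alpha> n \<alpha> n] unfolding L_s0 by auto
next
  fix j assume "j \<in> J"
  then show "((\<lambda>s. 1 / (2 * of_nat (k j)) * (2 * (\<Sum>n=1..N j. of_nat n * time M (L s) j n * v j (n + 1) (L s)) + (time M (L s) j 0)\<^sup>2))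
      has_field_derivative 1 / (2 * of_nat (k j)) * res j (\<lambda>w. 2 * zc j t w * mc j t w * Om' j w)) (at s0)"
    using J_sub[of j] by (intro DERIV_cmult square_derivative) auto
next
  fix i assume "i \<in> {1..M}"
  then show "((\<lambda>s. time M (L s) i 0 * v_first M q lg vc i (L s)) has_field_derivative
      tdot i 0 * v_first M q lg vc i t + vdot i * tm i 0) (at s0)"
    using DERIV_mult[OF time_derivative v_first_derivative, of i 0 i] unfolding L_s0 by auto
qed

lemma tdot_sum:
  "(\<Sum>\<alpha>\<le>M. \<Sum>n=1..N \<alpha>. tdot \<alpha> n * v \<alpha> (n + 1) t) + (\<Sum>i=1..M. tdot i 0 * v_first M q lg vc i t)
    = v_all M q lg vc v (fst B) (snd B + 1) t"
proof (cases rule: B_cases)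
  case (log b)
  have 1: "tdot \<alpha> n = 0" if "n \<ge> 1" for \<alpha> n unfolding tdot_def unfolding log using that by simp
  have 2: "tdot i 0 = (if i = b then 1 else 0)" for i unfolding tdot_def unfolding log by simp
  have "(\<Sum>\<alpha>\<le>M. \<Sum>n=1..N \<alpha>. tdot \<alpha> n * v \<alpha> (n + 1) t) = 0"
    by (intro sum.neutral ballI) (simp add: 1)
  moreover have "(\<Sum>i=1..M. tdot i 0 * v_first M q lg vc i t) = v_first M q lg vc b t"
    unfolding 2 using log(2) by (simp add: if_distrib[of "\<lambda>x. x * _"] cong: if_cong)
  ultimately show ?thesis using log by (simp add: v_all_def)
next
  case (power \<mu> n)
  have 2: "tdot i 0 = 0" for i unfolding tdot_def unfolding power(1) using power(3) by simp
  have n: "n \<in> {1..N \<mu>}" using B power by (auto simp: time_indices_def)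
  have "(\<Sum>l=1..N \<alpha>. tdot \<alpha> l * v \<alpha> (l + 1) t) = (if \<alpha> = \<mu> then v \<mu> (n + 1) t else 0)" for \<alpha>
  proof (cases "\<alpha> = \<mu>")
    case True
    have "tdot \<alpha> l = (if l = n then 1 else 0)" for l unfolding tdot_def unfolding power(1) True by simp
    then show ?thesis using n True by (simp add: if_distrib[of "\<lambda>x. x * _"] cong: if_cong)
  next
    case False
    have "tdot \<alpha> l = 0" for l unfolding tdot_def unfolding power(1) using False by simp
    then show ?thesis using False by simp
  qed
  then have "(\<Sum>\<alpha>\<le>M. \<Sum>n=1..N \<alpha>. tdot \<alpha> n * v \<alpha> (n + 1) t) = v \<mu> (n + 1) t"
    using power(2) by simp
  moreover have "(\<Sum>i=1..M. tdot i 0 * v_first M q lg vc i t) = 0" by (simp only: 2) simp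
  ultimately show ?thesis using power by (simp add: v_all_def)
qed

definition residue_terms :: complex where
  "residue_terms = (\<Sum>\<alpha>\<le>M. res \<alpha> (\<lambda>w. xi \<alpha> (zc \<alpha> t w) * Om' \<alpha> w)) + (\<Sum>j\<in>J. res j (\<lambda>w. PP t w * Om' j w))"

lemma zc_holA: "\<alpha> \<le> M \<Longrightarrow> zc \<alpha> t holomorphic_on ann \<alpha>"
  by (rule holomorphic_on_subset[OF zc_hol[OF _ tT] ann_sub_V])

lemma Om'_holA: "\<alpha> \<le> M \<Longrightarrow> Om' \<alpha> holomorphic_on ann \<alpha>"
  by (rule holomorphic_on_subset[OF Om'_hol ann_D])

lemma res_circle_sum:
  assumes \<alpha>: "\<alpha> \<le> M" and A: "finite A" "\<And>i. i \<in> A \<Longrightarrow> f i holomorphic_on ann \<alpha>"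
  shows "res \<alpha> (\<lambda>w. \<Sum>i\<in>A. a i * f i w) = (\<Sum>i\<in>A. a i * res \<alpha> (f i))"
proof -
  have P: "pole_chart (c0 \<alpha>) (c \<alpha>) (r \<alpha>) (r2 \<alpha>) (hh \<alpha>)" by (rule chart[OF \<alpha>])
  have int: "f i contour_integrable_on circlepath (c0 \<alpha>) (r \<alpha>)" if "i \<in> A" for i
    using continuous_on_subset[OF holomorphic_on_imp_continuous_on[OF A(2)[OF that]] circle_ann[OF \<alpha>]] rad[OF \<alpha>]
    by (intro contour_integrable_continuous_circlepath) auto
  have "contour_integral (circlepath (c0 \<alpha>) (r \<alpha>)) (\<lambda>w. \<Sum>i\<in>A. a i * f i w)
    = (\<Sum>i\<in>A. contour_integral (circlepath (c0 \<alpha>) (r \<alpha>)) (\<lambda>w. a i * f i w))"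
    by (rule contour_integral_sum) (auto intro: A int contour_integrable_lmul)
  also have "\<dots> = (\<Sum>i\<in>A. a i * contour_integral (circlepath (c0 \<alpha>) (r \<alpha>)) (f i))"
    by (intro sum.cong refl contour_integral_lmul int)
  finally show ?thesis
    unfolding pole_chart.res_def[OF P] by (simp add: sum_divide_distrib sum_negf)
qed

lemma twice_F_dot_residues: "twice_F_dot = v_all M q lg vc v (fst B) (snd B + 1) t + residue_terms + (\<Sum>i=1..M. tm i 0 * vdot i)"
proof -
  have 1: "(\<Sum>n=1..N \<alpha>. res \<alpha> (\<lambda>w. zc \<alpha> t w ^ n * Om' \<alpha> w) * tm \<alpha> n) = res \<alpha> (\<lambda>w. xi \<alpha> (zc \<alpha> t w) * Om' \<alpha> w)"
    if \<alpha>: "\<alpha> \<le> M" for \<alpha>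
  proof -
    have "res \<alpha> (\<lambda>w. \<Sum>n=1..N \<alpha>. tm \<alpha> n * (zc \<alpha> t w ^ n * Om' \<alpha> w)) = (\<Sum>n=1..N \<alpha>. tm \<alpha> n * res \<alpha> (\<lambda>w. zc \<alpha> t w ^ n * Om' \<alpha> w))"
      by (rule res_circle_sum[OF \<alpha>]) (auto intro!: holomorphic_intros zc_holA Om'_holA \<alpha>)
    moreover have "(\<Sum>n=1..N \<alpha>. tm \<alpha> n * (zc \<alpha> t w ^ n * Om' \<alpha> w)) = xi \<alpha> (zc \<alpha> t w) * Om' \<alpha> w" for w
      unfolding xi_eq[OF \<alpha>] sum_distrib_right by (simp only: mult.assoc)
    ultimately show ?thesis by (simp add: mult.commute)
  qed
  have 2: "- (1 / (2 * of_nat (k j)) * res j (\<lambda>w. 2 * zc j t w * mc j t w * Om' j w)) = res j (\<lambda>w. PP t w * Om' j w)"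
    if j: "j \<in> J" for j
  proof -
    have jM: "j \<le> M" using J_sub[OF j] by auto
    have k: "of_nat (k j) \<noteq> (0::complex)" using k_pos[OF jM] by simp
    have mh: "mc j t holomorphic_on ann j" by (rule holomorphic_on_subset[OF mc_hol[OF jM tT] ann_sub_V[OF jM]])
    have "res j (\<lambda>w. \<Sum>i\<in>{0::nat}. - (1 / (2 * of_nat (k j))) * (2 * zc j t w * mc j t w * Om' j w))
      = (\<Sum>i\<in>{0::nat}. - (1 / (2 * of_nat (k j))) * res j (\<lambda>w. 2 * zc j t w * mc j t w * Om' j w))"
      by (rule res_circle_sum[OF jM]) (auto intro!: holomorphic_intros zc_holA Om'_holA jM mh)
    moreover have "res j (\<lambda>w. \<Sum>i\<in>{0::nat}. - (1 / (2 * of_nat (k j))) * (2 * zc j t w * mc j t w * Om' j w))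
      = res j (\<lambda>w. PP t w * Om' j w)"
      by (rule res_cong[OF jM]) (use k in \<open>simp add: PP_J[OF j]\<close>)
    ultimately show ?thesis by simp
  qed
  have "twice_F_dot = ((\<Sum>\<alpha>\<le>M. \<Sum>n=1..N \<alpha>. tdot \<alpha> n * v \<alpha> (n + 1) t) + (\<Sum>i=1..M. tdot i 0 * v_first M q lg vc i t))
     + ((\<Sum>\<alpha>\<le>M. \<Sum>n=1..N \<alpha>. res \<alpha> (\<lambda>w. zc \<alpha> t w ^ n * Om' \<alpha> w) * tm \<alpha> n)
       + (\<Sum>j\<in>J. - (1 / (2 * of_nat (k j)) * res j (\<lambda>w. 2 * zc j t w * mc j t w * Om' j w))))
     + (\<Sum>i=1..M. tm i 0 * vdot i)"
    unfolding twice_F_dot_def sum.distrib sum_negf by (simp add: mult.commute)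
  then show ?thesis unfolding tdot_sum residue_terms_def using 1 2 by simp
qed

lemma twice_F_derivative: "((\<lambda>s. twice_F (L s)) has_field_derivative 2 * v_all M q lg vc v (fst B) (snd B + 1) t) (at s0)"
proof -
  have "residue_terms + (\<Sum>i=1..M. tm i 0 * vdot i) = v_all M q lg vc v (fst B) (snd B + 1) t"
  proof (cases rule: B_cases)
    case (log b)
    note b = log(2)
    have Om: "Om' \<alpha> w = - (ch' \<alpha> w / (ch \<alpha> w - q b t))" for \<alpha> w
      unfolding Om'_def OmD_def unfolding log(1) by simp
    have neg: "res \<alpha> (\<lambda>w. f w * Om' \<alpha> w) = - res \<alpha> (\<lambda>w. f w * (ch' \<alpha> w / (ch \<alpha> w - q b t)))" if "\<alpha> \<le> M" for \<alpha> f
      unfolding Om pole_chart.res_def[OF chart[OF that]] mult_minus_right contour_integral_uminus by simp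
    have J: "res j (\<lambda>w. PP t w * Om' j w) = - res j (\<lambda>w. PP t w / (w - q b t))" if "j \<in> J" for j
      using neg[of j] J_sub[OF that] by (simp add: ch_def ch'_def)
    have br: "residue_terms = vc b t - tm b 0 * ld b t - (\<Sum>j\<in>{1..M} - {b}. tm j 0 * lg j t (q b t - q j t))"
      unfolding vc_formula[OF b] residue_terms_def using neg J by (simp add: sum_negf)
    have "(\<Sum>i=1..M. tm i 0 * vdot i) = tm b 0 * vdot b + (\<Sum>j\<in>{1..M} - {b}. tm j 0 * vdot j)"
      by (rule sum_remove[OF b])
    also have "\<dots> = tm b 0 * ld b t + (\<Sum>j\<in>{1..M} - {b}. tm j 0 * lg j t (q b t - q j t)
       - (if j < b then log_minus_one q lg j b t * tm j 0 else 0))"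
      using b by (intro arg_cong2[where f="(+)"] sum.cong) (auto simp: vdot_log[OF log] algebra_simps)
    also have "\<dots> = tm b 0 * ld b t + (\<Sum>j\<in>{1..M} - {b}. tm j 0 * lg j t (q b t - q j t))
       - (\<Sum>j\<in>{1..M} - {b}. if j < b then log_minus_one q lg j b t * tm j 0 else 0)"
      by (simp add: sum_subtractf)
    also have "(\<Sum>j\<in>{1..M} - {b}. if j < b then log_minus_one q lg j b t * tm j 0 else 0) = (\<Sum>j\<in>{1..<b}. log_minus_one q lg j b t * tm j 0)"
      using b by (intro sum.mono_neutral_cong_right) auto
    finally show ?thesis using br log by (simp add: v_all_def v_first_def)
  next
    case (power \<mu> n)
    have Om: "Om' \<alpha> w = deriv (\<lambda>w. OmP \<mu> n (ch \<alpha> w)) w" if "\<alpha> \<le> M" "w \<in> ann \<alpha>" for \<alpha> w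
      unfolding Om'_def OmD_def unfolding power(1) using power(3)
      by (simp add: DERIV_imp_deriv[OF deriv_ch[OF that(1) subsetD[OF ann_D[OF that(1)] that(2)] OmP_hol[OF power(2)]]])
    have OmJ: "Om' j w = deriv (\<lambda>w. OmP \<mu> n (ch j w)) w" if "j \<in> J" "w \<in> ann j" for j w
      using Om[OF _ that(2)] J_sub[OF that(1)] by simp
    have "residue_terms = (\<Sum>\<alpha>\<le>M. res \<alpha> (\<lambda>w. xi \<alpha> (zc \<alpha> t w) * deriv (\<lambda>w. OmP \<mu> n (ch \<alpha> w)) w))
      + (\<Sum>j\<in>J. res j (\<lambda>w. PP t w * deriv (\<lambda>w. OmP \<mu> n (ch j w)) w))"
      unfolding residue_terms_def
    proof (intro arg_cong2[where f="(+)"] sum.cong refl res_cong)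
      show "j \<in> J \<Longrightarrow> j \<le> M" for j using J_sub[of j] by simp
    qed (auto simp: Om OmJ)
    also have "\<dots> = v \<mu> (n + 1) t + (\<Sum>\<alpha>\<le>M. tm \<alpha> 0 * res \<alpha> (\<lambda>w. OmP \<mu> n (ch \<alpha> w) * (deriv (zc \<alpha> t) w / zc \<alpha> t w)))"
      by (rule pairing[OF power(2,3)])
    also have "(\<Sum>\<alpha>\<le>M. tm \<alpha> 0 * res \<alpha> (\<lambda>w. OmP \<mu> n (ch \<alpha> w) * (deriv (zc \<alpha> t) w / zc \<alpha> t w)))
      = (\<Sum>\<alpha>=1..M. tm \<alpha> 0 * res \<alpha> (\<lambda>w. OmP \<mu> n (ch \<alpha> w) * (deriv (zc \<alpha> t) w / zc \<alpha> t w)))"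
    proof (rule sum.mono_neutral_right)
      show "\<forall>i\<in>{..M} - {1..M}. tm i 0 * res i (\<lambda>w. OmP \<mu> n (ch i w) * (deriv (zc i t) w / zc i t w)) = 0"
      proof
        fix i assume "i \<in> {..M} - {1..M}"
        then have i: "i = 0" by auto
        show "tm i 0 * res i (\<lambda>w. OmP \<mu> n (ch i w) * (deriv (zc i t) w / zc i t w)) = 0"
          unfolding i res_infinity[OF power(2,3)] by simp
      qed
    qed auto
    also have "\<dots> = (\<Sum>i=1..M. - (tm i 0 * vdot i))"
      using vdot_power[OF power(1,3) _ power(2)] by (intro sum.cong) auto
    finally show ?thesis unfolding power(1) using power(3) by (simp add: v_all_def sum_negf)
  qed
  then show ?thesis using twice_F_derivative_raw unfolding twice_F_dot_residues by (simp add: add.assoc)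
qed

end

context good_point
begin

lemma continuous_on_res:
  assumes "continuous_on (X \<times> ann \<alpha>) (\<lambda>(x, w). f x w)" "\<alpha> \<le> M"
  shows "continuous_on X (\<lambda>x. res \<alpha> (f x))"
proof -
  have "continuous_on (X \<times> sphere (c0 \<alpha>) (r \<alpha>)) (\<lambda>(x, w). f x w)"
    by (rule continuous_on_subset[OF assms(1)]) (use circle_ann[OF assms(2)] in auto)
  from continuous_on_contour_integral_circlepath[OF this] show ?thesis
    unfolding pole_chart.res_def[OF chart[OF assms(2)]] using rad[OF assms(2)]
    by (intro continuous_intros) auto
qed

lemma twice_F_continuous_good:
  assumes X: "X \<subseteq> T" "\<And>x. x \<in> X \<Longrightarrow> good c0 r1 r r2 x"
  shows "continuous_on X twice_F"
proof -
  have gp: "good_point M N T q z m d dc v lg K U \<Gamma> ld vc S I J k E1 E2 c0 r1 r r2 x" if "x \<in> X" for x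
    by unfold_locales (rule X(2)[OF that])
  note sub = continuous_on_subset[OF _ X(1)]
  have V: "w \<in> V \<alpha> x" if "\<alpha> \<le> M" "x \<in> X" "w \<in> ann \<alpha>" for \<alpha> x w
    using good_point.ann_sub_V[OF gp[OF that(2)] that(1)] that(3) by blast
  have XV: "X \<times> ann \<alpha> \<subseteq> {(t, w). t \<in> T \<and> w \<in> V \<alpha> t}" if "\<alpha> \<le> M" for \<alpha>
    using V[OF that] X(1) by auto
  have zcc: "continuous_on (X \<times> ann \<alpha>) (\<lambda>y. zc \<alpha> (fst y) (snd y))" if "\<alpha> \<le> M" for \<alpha>
    using continuous_on_subset[OF zc_continuous[OF that] XV[OF that]] by (simp add: split_beta)
  have mcc: "continuous_on (X \<times> ann \<alpha>) (\<lambda>y. mc \<alpha> (fst y) (snd y))" if "\<alpha> \<le> M" for \<alpha>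
    using continuous_on_subset[OF mc_continuous[OF that] XV[OF that]] by (simp add: split_beta)
  have dzc: "continuous_on (X \<times> ann \<alpha>) (\<lambda>y. deriv (zc \<alpha> (fst y)) (snd y))" if \<alpha>: "\<alpha> \<le> M" for \<alpha>
  proof -
    have "continuous_on (X \<times> ann \<alpha>) (\<lambda>(x, w). deriv (zc \<alpha> x) w)"
    proof (rule continuous_on_deriv_param[OF _ open_ann])
      show "continuous_on (X \<times> ann \<alpha>) (\<lambda>(x, w). zc \<alpha> x w)" using zcc[OF \<alpha>] by (simp add: split_beta)
      fix x assume x: "x \<in> X"
      show "zc \<alpha> x holomorphic_on ann \<alpha>"
        by (rule holomorphic_on_subset[OF zc_hol[OF \<alpha>]]) (use x X(1) V[OF \<alpha> x] in auto)
    qed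
    then show ?thesis by (simp add: split_beta)
  qed
  have coord: "continuous_on X (\<lambda>t. t A)" for A :: "nat \<times> nat"
    by (rule continuous_on_subset[OF _ subset_UNIV]) (rule continuous_on_product_coordinates)
  have tc: "continuous_on X (\<lambda>t. time M t \<alpha> n)" for \<alpha> n
    unfolding time_def by (cases "(\<alpha>, n) = (0, 0)") (auto intro!: continuous_intros coord)
  have fst_time: "continuous_on (X \<times> A) (\<lambda>y. time M (fst y) \<alpha> n)" for A :: "complex set" and \<alpha> n
    by (rule continuous_on_compose2[OF tc]) (auto intro: continuous_intros)
  have vc': "continuous_on X (v \<alpha> (n + 1))" if "\<alpha> \<le> M" "n \<ge> 1" for \<alpha> n
  proof -
    have "continuous_on X (\<lambda>x. res \<alpha> (\<lambda>w. zc \<alpha> x w ^ n * mc \<alpha> x w * deriv (zc \<alpha> x) w))"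
      by (rule continuous_on_res[OF _ that(1)], unfold split_beta)
        (intro continuous_intros zcc mcc dzc that)
    then show ?thesis
      by (rule continuous_on_eq) (simp only: good_point.coefficient[OF gp that])
  qed
  have lgc: "continuous_on X (\<lambda>t. lg j t (q b t - q j t))" if "j \<in> {1..M}" "b \<in> {1..M}" "b \<noteq> j" for b j
  proof -
    have "continuous_on X (\<lambda>t. (\<lambda>(t, p). lg j t (p - q j t)) (t, q b t))"
    proof (rule continuous_on_compose2[OF lg_cont[OF that(1)]])
      show "continuous_on X (\<lambda>t. (t, q b t))" by (intro continuous_intros sub q_cont that)
      show "(\<lambda>t. (t, q b t)) ` X \<subseteq> {(t, p). t \<in> T \<and> p \<notin> K j t}"
        using X(1) q_notin_K[OF that(2,1,3)] by auto
    qed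
    then show ?thesis by simp
  qed
  have vcc: "continuous_on X (vc b)" if b: "b \<in> {1..M}" for b
  proof -
    have qc: "continuous_on (X \<times> A) (\<lambda>y. q b (fst y))" for A :: "complex set"
      by (rule continuous_on_compose2[OF sub[OF q_cont[OF b]]]) (auto intro: continuous_intros)
    have 1: "continuous_on X (\<lambda>x. res \<alpha> (\<lambda>w. (\<Sum>n=1..N \<alpha>. time M x \<alpha> n * zc \<alpha> x w ^ n) * (ch' \<alpha> w / (ch \<alpha> w - q b x))))"
      if \<alpha>: "\<alpha> \<le> M" for \<alpha>
    proof (rule continuous_on_res[OF _ \<alpha>])
      have "0 \<notin> ann \<alpha>" if "\<alpha> = 0"
        using ann_sub_V[OF \<alpha>] that unfolding V_def by blast
      then have c1: "continuous_on (ann \<alpha>) (ch \<alpha>)"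
        by (intro holomorphic_on_imp_continuous_on ch_hol)
      have c2: "continuous_on (ann \<alpha>) (ch' \<alpha>)"
        by (rule holomorphic_on_imp_continuous_on[OF holomorphic_on_subset[OF ch'_D_hol[OF \<alpha>] ann_D[OF \<alpha>]]])
      have c: "continuous_on (X \<times> ann \<alpha>) (\<lambda>y. ch \<alpha> (snd y))" "continuous_on (X \<times> ann \<alpha>) (\<lambda>y. ch' \<alpha> (snd y))"
        by (rule continuous_on_compose2[OF c1] continuous_on_compose2[OF c2]; force intro: continuous_on_snd continuous_on_id)+
      have ne: "ch \<alpha> w - q b x \<noteq> 0" if "x \<in> X" "w \<in> ann \<alpha>" for x w
      proof -
        have "ch \<alpha> w \<notin> Q x"
          by (rule good_point.ch_D(2)[OF gp[OF that(1)] \<alpha> subsetD[OF good_point.ann_D[OF gp[OF that(1)] \<alpha>] that(2)]])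
        then show ?thesis using b by (auto simp: Q_def)
      qed
      show "continuous_on (X \<times> ann \<alpha>) (\<lambda>(x, w). (\<Sum>n=1..N \<alpha>. time M x \<alpha> n * zc \<alpha> x w ^ n) * (ch' \<alpha> w / (ch \<alpha> w - q b x)))"
        unfolding split_beta by (intro continuous_intros fst_time zcc \<alpha> c qc) (use ne in auto)
    qed
    have 2: "continuous_on X (\<lambda>x. res j (\<lambda>w. - (zc j x w * mc j x w / of_nat (k j)) / (w - q b x)))"
      if j: "j \<in> J" for j
    proof (rule continuous_on_res)
      show jM: "j \<le> M" using J_sub[OF j] by simp
      have j0: "j \<noteq> 0" using J_sub[OF j] by simp
      have kz: "k j \<noteq> 0" using k_pos[OF jM] by simp
      have ne: "w - q b x \<noteq> 0" if "x \<in> X" "w \<in> ann j" for x w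
      proof -
        have "ch j w \<notin> Q x"
          by (rule good_point.ch_D(2)[OF gp[OF that(1)] jM subsetD[OF good_point.ann_D[OF gp[OF that(1)] jM] that(2)]])
        then show ?thesis using b j0 by (auto simp: Q_def ch_def)
      qed
      show "continuous_on (X \<times> ann j) (\<lambda>(x, w). - (zc j x w * mc j x w / of_nat (k j)) / (w - q b x))"
        unfolding split_beta by (intro continuous_intros zcc mcc qc jM) (use ne kz in auto)
    qed
    have "continuous_on X (\<lambda>x. time M x b 0 * ld b x + (\<Sum>j\<in>{1..M} - {b}. time M x j 0 * lg j x (q b x - q j x))
      - (\<Sum>\<alpha>\<le>M. res \<alpha> (\<lambda>w. (\<Sum>n=1..N \<alpha>. time M x \<alpha> n * zc \<alpha> x w ^ n) * (ch' \<alpha> w / (ch \<alpha> w - q b x))))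
      - (\<Sum>j\<in>J. res j (\<lambda>w. - (zc j x w * mc j x w / of_nat (k j)) / (w - q b x))))"
      by (intro continuous_intros tc sub[OF ld_cont[OF b]] lgc 1 2) (use b in auto)
    then show ?thesis
    proof (rule continuous_on_eq)
      fix x assume x: "x \<in> X"
      have "res j (\<lambda>w. - (zc j x w * mc j x w / of_nat (k j)) / (w - q b x)) = res j (\<lambda>w. PP x w / (w - q b x))"
        if "j \<in> J" for j
        by (rule res_cong) (use J_sub[OF that] good_point.PP_J[OF gp[OF x] that] in auto)
      moreover have "(\<Sum>\<alpha>\<le>M. res \<alpha> (\<lambda>w. (\<Sum>n=1..N \<alpha>. time M x \<alpha> n * zc \<alpha> x w ^ n) * (ch' \<alpha> w / (ch \<alpha> w - q b x))))
        = (\<Sum>\<alpha>\<le>M. res \<alpha> (\<lambda>w. good_point.xi M N x \<alpha> (zc \<alpha> x w) * (ch' \<alpha> w / (ch \<alpha> w - q b x))))"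
        using good_point.xi_eq[OF gp[OF x]] by (intro sum.cong refl) simp
      ultimately show "time M x b 0 * ld b x + (\<Sum>j\<in>{1..M} - {b}. time M x j 0 * lg j x (q b x - q j x))
        - (\<Sum>\<alpha>\<le>M. res \<alpha> (\<lambda>w. (\<Sum>n=1..N \<alpha>. time M x \<alpha> n * zc \<alpha> x w ^ n) * (ch' \<alpha> w / (ch \<alpha> w - q b x))))
        - (\<Sum>j\<in>J. res j (\<lambda>w. - (zc j x w * mc j x w / of_nat (k j)) / (w - q b x))) = vc b x"
        unfolding good_point.vc_formula[OF gp[OF x] b] by simp
    qed
  qed
  have vf: "continuous_on X (v_first M q lg vc b)" if b: "b \<in> {1..M}" for b
    unfolding v_first_def[abs_def] log_minus_one_def
    by (intro continuous_intros vcc[OF b] lgc tc) (use b in auto)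
  show ?thesis unfolding twice_F_def[abs_def]
    by (intro continuous_intros tc vc' vf) (use J_sub k_pos in \<open>auto simp: less_imp_neq[symmetric]\<close>)
qed

end

context string_solution
begin

lemma twice_F_continuous: "continuous_on T twice_F"
proof (rule continuous_on_locally)
  fix t assume t: "t \<in> T"
  obtain r1 r r2 where ev: "eventually (\<lambda>x. x \<in> T \<longrightarrow> good (\<lambda>\<alpha>. cen \<alpha> t) r1 r r2 x) (nhds t)"
    using good_eventually[OF t] by metis
  then obtain X where X: "open X" "t \<in> X" "\<And>x. x \<in> X \<Longrightarrow> x \<in> T \<Longrightarrow> good (\<lambda>\<alpha>. cen \<alpha> t) r1 r r2 x"
    unfolding eventually_nhds by blast
  interpret good_point M N T q z m d dc v lg K U \<Gamma> ld vc S I J k E1 E2 "\<lambda>\<alpha>. cen \<alpha> t" r1 r r2 t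
    by unfold_locales (rule X(3)[OF X(2) t])
  have "continuous_on (T \<inter> X) twice_F" by (rule twice_F_continuous_good) (use X(3) in auto)
  then show "\<exists>X. open X \<and> t \<in> X \<and> continuous_on (T \<inter> X) twice_F" using X(1,2) by blast
qed

lemma time_slice_exists:
  assumes t: "t \<in> T" and B: "B \<in> Ind"
  obtains r1 r r2 Bs where
    "time_slice M N T q z m d dc v lg K U \<Gamma> ld vc S I J k E1 E2 (\<lambda>\<alpha>. cen \<alpha> t) r1 r r2 t B Bs"
proof -
  obtain r1 r r2 where ev: "eventually (\<lambda>x. x \<in> T \<longrightarrow> good (\<lambda>\<alpha>. cen \<alpha> t) r1 r r2 x) (nhds t)"
    using good_eventually[OF t] by metis
  obtain O' where O': "open O'" "T = Ts \<inter> O'" using T_open by (auto simp: openin_open)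
  have "eventually (\<lambda>x. x \<in> O') (nhds t)" using O' t by (auto simp: eventually_nhds)
  obtain X where X: "open X" "t \<in> X" "\<And>x. x \<in> X \<Longrightarrow> x \<in> Ts \<Longrightarrow> good (\<lambda>\<alpha>. cen \<alpha> t) r1 r r2 x"
  proof -
    from eventually_conj[OF ev \<open>eventually (\<lambda>x. x \<in> O') (nhds t)\<close>] obtain X where
      X: "open X" "t \<in> X" "\<forall>x\<in>X. (x \<in> T \<longrightarrow> good (\<lambda>\<alpha>. cen \<alpha> t) r1 r r2 x) \<and> x \<in> O'"
      unfolding eventually_nhds by (elim exE conjE)
    show ?thesis by (rule that[OF X(1,2)]) (use X(3) O'(2) in simp)
  qed
  have "continuous_on UNIV (\<lambda>s. t(B := s))"
  proof (rule continuous_on_coordinatewise_then_product)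
    fix A show "continuous_on UNIV (\<lambda>s. (t(B := s)) A)"
      by (cases "A = B") (auto intro: continuous_intros)
  qed
  then have o: "open ((\<lambda>s. t(B := s)) -` X)" using X(1) by (metis continuous_on_open_vimage open_UNIV Int_UNIV_right)
  have Ts: "t(B := s) \<in> Ts" for s using T_sub t B by (auto simp: time_space_def)
  have "time_slice M N T q z m d dc v lg K U \<Gamma> ld vc S I J k E1 E2 (\<lambda>\<alpha>. cen \<alpha> t) r1 r r2 t B ((\<lambda>s. t(B := s)) -` X)"
    using X(2,3) T_sub t B Ts o by unfold_locales auto
  then show ?thesis by (rule that)
qed

lemma tau_derivative:
  assumes t: "t \<in> T" and B: "(\<alpha>, n) \<in> Ind" and F: "\<And>t. t \<in> T \<Longrightarrow> 2 * F t = twice_F t"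
  shows "((\<lambda>s. F (t((\<alpha>, n) := s))) has_field_derivative v_all M q lg vc v \<alpha> (n + 1) t) (at (t (\<alpha>, n)))"
proof -
  obtain r1 r r2 Bs where
    "time_slice M N T q z m d dc v lg K U \<Gamma> ld vc S I J k E1 E2 (\<lambda>\<alpha>. cen \<alpha> t) r1 r r2 t (\<alpha>, n) Bs"
    using time_slice_exists[OF t B] by metis
  then interpret time_slice M N T q z m d dc v lg K U \<Gamma> ld vc S I J k E1 E2 "\<lambda>\<alpha>. cen \<alpha> t" r1 r r2 t "(\<alpha>, n)" Bs .
  have "((\<lambda>s. twice_F (L s) / 2) has_field_derivative 2 * v_all M q lg vc v \<alpha> (n + 1) t / 2) (at s0)"
    using DERIV_cdivide[OF twice_F_derivative, of 2] by simp
  then have "((\<lambda>s. F (L s)) has_field_derivative 2 * v_all M q lg vc v \<alpha> (n + 1) t / 2) (at s0)"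
  proof (rule has_derivative_slice)
    fix s assume "s \<in> Bs"
    from F[OF LT[OF this]] show "twice_F (L s) / 2 = F (L s)" by (metis nonzero_mult_div_cancel_left zero_neq_numeral)
  qed
  then show ?thesis by simp
qed

end

theorem theorem3:
  fixes M :: nat
    and N k :: "nat \<Rightarrow> nat"
    and I J :: "nat set"
    and T :: "times set"
    and q d ld vc :: "nat \<Rightarrow> times \<Rightarrow> complex"
    and z m lg S :: "nat \<Rightarrow> times \<Rightarrow> complex \<Rightarrow> complex"
    and dc v :: "nat \<Rightarrow> nat \<Rightarrow> times \<Rightarrow> complex"
    and K U :: "nat \<Rightarrow> times \<Rightarrow> complex set"
    and \<Gamma> :: "nat \<Rightarrow> times \<Rightarrow> real \<Rightarrow> complex"
    and E1 E2 :: "times \<Rightarrow> complex \<Rightarrow> complex"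
    and \<tau> F :: "times \<Rightarrow> complex"
  assumes solution:
      "string_solution M N T q z m d dc v lg K U \<Gamma> ld vc S I J k E1 E2"
    and tau: "\<And>t. t \<in> T \<Longrightarrow> \<tau> t = exp (F t)"
    and F: "\<And>t. t \<in> T \<Longrightarrow> 2 * F t =
      (\<Sum>\<alpha>\<le>M. 1 / (2 * pi * \<i>) * contour_integral (\<Gamma> \<alpha> t)
         (\<lambda>\<zeta>. (\<Sum>n=1..N \<alpha>. \<zeta> ^ n * time M t \<alpha> n) * m_of_z U z m \<alpha> t \<zeta>))
      - (\<Sum>j\<in>J. 1 / (4 * pi * \<i> * of_nat (k j)) * contour_integral (\<Gamma> j t)
           (\<lambda>\<zeta>. \<zeta> * (m_of_z U z m j t \<zeta>)\<^sup>2))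
      + (\<Sum>i=1..M. time M t i 0 * v_all M q lg vc v i 1 t)"
  shows "(\<forall>t\<in>T. 2 * F t =
      (\<Sum>(\<alpha>, n)\<in>time_indices M N. time M t \<alpha> n * v_all M q lg vc v \<alpha> (n + 1) t)
      - (\<Sum>j\<in>J. 1 / of_nat (k j) *
           (\<Sum>n=1..N j. of_nat n * time M t j n * v_all M q lg vc v j (n + 1) t))
      - (\<Sum>j\<in>J. (time M t j 0)\<^sup>2 / (2 * of_nat (k j))))
    \<and> is_tau_function (time_indices M N) T (v_all M q lg vc v) \<tau> F"
proof -
  interpret string_solution M N T q z m d dc v lg K U \<Gamma> ld vc S I J k E1 E2 by (rule solution)
  have twice_F: "2 * F t = twice_F t" if "t \<in> T" for t
    unfolding F[OF that] by (rule contour_formula[OF that])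
  have "continuous_on T (\<lambda>t. twice_F t / 2)" by (intro continuous_intros twice_F_continuous) simp
  then have "continuous_on T F"
    by (rule continuous_on_eq) (simp add: twice_F[symmetric])
  then have "is_tau_function Ind T (v_all M q lg vc v) \<tau> F"
    unfolding is_tau_function_def using tau tau_derivative[OF _ _ twice_F] by blast
  then show ?thesis using twice_F coefficient_formula by simp
qed

end
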